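(* Every associated vector bundle to the bundle $\mathbf{C}_q[S^{2N-1}]\hookleftarrow\mathbf{C}_q[\mathbf{C}P^{N-1}]$ (with fibre $\mathbf{C}[U_1]$) is also an associated vector bundle to the bundle $\mathbf{C}_q[SU_N]\hookleftarrow\mathbf{C}_q[\mathbf{C}P^{N-1}]$ (with fibre $\mathbf{C}_q[U_{N-1}]$). That is, for every right $\mathbf{C}[U_1]$-comodule $V$, the left $\mathbf{C}_q[\mathbf{C}P^{N-1}]$-module $(\mathbf{C}_q[S^{2N-1}]\otimes V)^{U_1}$ is of the form $(\mathbf{C}_q[SU_N]\otimes W)^{U_{N-1}}$ for some right $\mathbf{C}_q[U_{N-1}]$-comodule $W$.
   Context: Algebras are unital over $\mathbf{C}$. Fix $N\ge2$, $q\in(0,1]$, $\nu=q-q^{-1}$. Let $H(x)=1$ for $x>0$ and $H(x)=0$ for $x\le0$, and $R^{ik}_{jl}=q^{\delta_{ik}}\delta_{il}\delta_{kj}+\nu H(k-i)\delta_{ij}\delta_{kl}$. For $n\ge1$, $\mathbf{C}_q[M_n]$ is the bialgebra generated by $u^i_j$ ($1\le i,j\le n$) with relations $\sum_{w,x}R^{ac}_{wx}u^w_bu^x_d=\sum_{y,z}R^{yz}_{bd}u^a_yu^c_z$, $\Delta(u^i_j)=\sum_k u^i_k\otimes u^k_j$, $\varepsilon(u^i_j)=\delta_{ij}$. The element $\det_n=\sum_{\pi\in S_n}(-q)^{\ell(\pi)}u^1_{\pi(1)}\cdots u^n_{\pi(n)}$ is central and grouplike. $\mathbf{C}_q[U_n]$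 is the Hopf algebra obtained by adjoining $\det_n^{-1}$; $\mathbf{C}_q[SU_n]=\mathbf{C}_q[M_n]/\langle\det_n-1\rangle$; $\mathbf{C}[U_1]=\mathbf{C}[t,t^{-1}]$ with $t$ grouplike. Hopf algebra maps on $\mathbf{C}_q[SU_N]$: $\alpha_N$ to $\mathbf{C}_q[U_{N-1}]$, $\alpha_N(u^1_1)=\det_{N-1}^{-1}$, $\alpha_N(u^1_i)=\alpha_N(u^i_1)=0$ ($i\ne1$), $\alpha_N(u^i_j)=u^{i-1}_{j-1}$ ($i,j\ge2$); $\beta_N$ to $\mathbf{C}_q[SU_{N-1}]$, $\beta_N(u^1_1)=1$, $\beta_N(u^1_i)=\beta_N(u^i_1)=0$ ($i\ne1$), $\beta_N(u^i_j)=u^{i-1}_{j-1}$ ($i,j\ge2$); $\gamma_N$ to $\mathbf{C}[U_1]$, $\gamma_N(u^1_1)=t^{-1}$, $\gamma_N(u^k_k)=1$ ($2\le k\le N-1$), $\gamma_N(u^N_N)=t$, $\gamma_N(u^i_j)=0$ ($i\ne j$). $\mathbf{C}_q[\mathbf{C}P^{N-1}]$, resp. $\mathbf{C}_q[S^{2N-1}]$, is the algebra of coinvariants in $\mathbf{C}_q[SU_N]$ of $(\mathrm{id}\otimes\alpha_N)\Delta$, resp. $(\mathrm{id}\otimes\beta_N)\Delta$. $\mathbf{C}_q[S^{2N-1}]$ is a right $\mathbf{C}[U_1]$-comodule algebra via $(\mathrm{id}\otimes\gamma_N)\Delta$, with coinvariant subalgebra $\mathbf{C}_q[\mathbf{C}P^{N-1}]$.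 For a bundle with total space $P$ (a right $H$-comodule algebra), fibre $H$ and base $M=P^H$, an associated (vector) bundle is a left $M$-module of the form $(P\otimes V)^H$, the coinvariants of the tensor product coaction on $P\otimes V$, for a right $H$-comodule $V$. *)

theory Defs
  imports
    "HOL-Algebra.Algebra"
    "HOL-Library.Poly_Mapping"
    "HOL-Combinatorics.Permutations"
begin

section \<open>Complex vector spaces and algebras\<close>

text \<open>
  Vector spaces and (not necessarily commutative) algebras over the complex numbers are records of
  type \<open>(complex, 'a) module\<close>; for a mere vector space the fields \<open>mult\<close> and \<open>one\<close> carry no meaning.
\<close>

definition complex_algebra :: "(complex, complex) module" where
  "complex_algebra = \<lparr>carrier = UNIV, monoid.mult = (*), one = 1, ring.zero = 0, ring.add = (+), smult = (*)\<rparr>"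

abbreviation complex_vector_space :: "(complex, 'a, 'm) module_scheme \<Rightarrow> bool" where
  "complex_vector_space V \<equiv> module complex_algebra V"

definition linear_map ::
    "(complex, 'a, 'm) module_scheme \<Rightarrow> (complex, 'b, 'n) module_scheme \<Rightarrow> ('a \<Rightarrow> 'b) \<Rightarrow> bool" where
  "linear_map V W f \<longleftrightarrow>
     f \<in> carrier V \<rightarrow> carrier W \<and>
     (\<forall>x\<in>carrier V. \<forall>y\<in>carrier V. f (x \<oplus>\<^bsub>V\<^esub> y) = f x \<oplus>\<^bsub>W\<^esub> f y) \<and>
     (\<forall>c. \<forall>x\<in>carrier V. f (c \<odot>\<^bsub>V\<^esub> x) = c \<odot>\<^bsub>W\<^esub> f x)"

definition scale :: "complex \<Rightarrow> ('b \<Rightarrow>\<^sub>0 complex) \<Rightarrow> ('b \<Rightarrow>\<^sub>0 complex)" where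
  "scale c f = Poly_Mapping.map ((*) c) f"

text \<open>
  The quotient of \<open>F\<close> by \<open>I\<close>. It is a vector space if \<open>I\<close> is a subspace, and the algebra
  \<open>F Quot I\<close> with its scalar multiplication if \<open>I\<close> is a two-sided ideal.
\<close>

definition quot :: "(complex, 'a, 'm) module_scheme \<Rightarrow> 'a set \<Rightarrow> (complex, 'a set) module" where
  "quot F I = \<lparr>carrier = carrier (F Quot I), monoid.mult = monoid.mult (F Quot I), one = one (F Quot I),
     ring.zero = ring.zero (F Quot I), ring.add = ring.add (F Quot I),
     smult = (\<lambda>c Y. \<Union>x\<in>Y. I +>\<^bsub>F\<^esub> (c \<odot>\<^bsub>F\<^esub> x))\<rparr>"

definition subspace :: "(complex, 'a, 'm) module_scheme \<Rightarrow> 'a set \<Rightarrow> (complex, 'a) module" where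
  "subspace A S = (module.truncate A)\<lparr>carrier := S\<rparr>"


section \<open>Algebras given by generators and relations\<close>

datatype 'g word = Word (letters: "'g list")

instantiation word :: (type) monoid_add
begin

definition zero_word :: "'a word" where "0 = Word []"

definition plus_word :: "'a word \<Rightarrow> 'a word \<Rightarrow> 'a word" where
  "v + w = Word (letters v @ letters w)"

instance by standard (simp_all add: zero_word_def plus_word_def)

end

text \<open>
  Concatenation of words is written additively, so the convolution product of
  \<^theory>\<open>HOL-Library.Poly_Mapping\<close> makes \<open>'g word \<Rightarrow>\<^sub>0 complex\<close> the free algebra on \<open>'g\<close>.
\<close>

type_synonym 'g free = "'g word \<Rightarrow>\<^sub>0 complex"

definition free_algebra :: "'g set \<Rightarrow> (complex, 'g free) module" where
  "free_algebra G = \<lparr>carrier = {f. \<forall>w\<in>Poly_Mapping.keys f. set (letters w) \<subseteq> G},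
     monoid.mult = (*), one = 1, ring.zero = 0, ring.add = (+), smult = scale\<rparr>"

definition gen :: "'g \<Rightarrow> 'g free" where
  "gen g = Poly_Mapping.single (Word [g]) 1"

definition presented_algebra :: "'g set \<Rightarrow> 'g free set \<Rightarrow> (complex, 'g free set) module" where
  "presented_algebra G R = quot (free_algebra G) (Idl\<^bsub>free_algebra G\<^esub> R)"

definition presented_gen :: "'g set \<Rightarrow> 'g free set \<Rightarrow> 'g \<Rightarrow> 'g free set" where
  "presented_gen G R g = (Idl\<^bsub>free_algebra G\<^esub> R) +>\<^bsub>free_algebra G\<^esub> gen g"

definition free_eval ::
    "(complex, 'b, 'm) module_scheme \<Rightarrow> ('g \<Rightarrow> 'b) \<Rightarrow> 'g free \<Rightarrow> 'b" where
  "free_eval B \<phi> f =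
     (\<Oplus>\<^bsub>B\<^esub>w\<in>Poly_Mapping.keys f. Poly_Mapping.lookup f w \<odot>\<^bsub>B\<^esub> foldr (\<lambda>g b. \<phi> g \<otimes>\<^bsub>B\<^esub> b) (letters w) \<one>\<^bsub>B\<^esub>)"

text \<open>
  The algebra map to \<open>B\<close> out of a presented algebra with values \<open>\<phi>\<close> on the generators (provided
  that \<open>\<phi>\<close> respects the relations); elements of a presented algebra are sets of representatives.
\<close>

definition presented_hom ::
    "(complex, 'b, 'm) module_scheme \<Rightarrow> ('g \<Rightarrow> 'b) \<Rightarrow> 'g free set \<Rightarrow> 'b" where
  "presented_hom B \<phi> Y = the_elem (free_eval B \<phi> ` Y)"


section \<open>Tensor products\<close>

type_synonym ('a, 'b) tensor = "('a \<times> 'b \<Rightarrow>\<^sub>0 complex) set"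

text \<open>
  The vector space with basis \<open>carrier V \<times> carrier W\<close>. If \<open>V\<close> and \<open>W\<close> are algebras it is an algebra
  with the componentwise product on the basis.
\<close>

definition pair_space ::
    "(complex, 'a, 'm) module_scheme \<Rightarrow> (complex, 'b, 'n) module_scheme \<Rightarrow>
     (complex, 'a \<times> 'b \<Rightarrow>\<^sub>0 complex) module" where
  "pair_space V W = \<lparr>carrier = {f. Poly_Mapping.keys f \<subseteq> carrier V \<times> carrier W},
     monoid.mult = (\<lambda>f g. \<Sum>(a, b)\<in>Poly_Mapping.keys f. \<Sum>(c, d)\<in>Poly_Mapping.keys g.
       Poly_Mapping.single (a \<otimes>\<^bsub>V\<^esub> c, b \<otimes>\<^bsub>W\<^esub> d) (Poly_Mapping.lookup f (a, b) * Poly_Mapping.lookup g (c, d))),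
     one = Poly_Mapping.single (\<one>\<^bsub>V\<^esub>, \<one>\<^bsub>W\<^esub>) 1,
     ring.zero = 0, ring.add = (+), smult = scale\<rparr>"

definition bilinear_relators ::
    "(complex, 'a, 'm) module_scheme \<Rightarrow> (complex, 'b, 'n) module_scheme \<Rightarrow>
     ('a \<times> 'b \<Rightarrow>\<^sub>0 complex) set" where
  "bilinear_relators V W = (let s = (\<lambda>p. Poly_Mapping.single p (1 :: complex)) in
     {s (x \<oplus>\<^bsub>V\<^esub> y, z) - s (x, z) - s (y, z) | x y z.
        x \<in> carrier V \<and> y \<in> carrier V \<and> z \<in> carrier W} \<union>
     {s (x, y \<oplus>\<^bsub>W\<^esub> z) - s (x, y) - s (x, z) | x y z.
        x \<in> carrier V \<and> y \<in> carrier W \<and> z \<in> carrier W} \<union>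
     {s (c \<odot>\<^bsub>V\<^esub> x, y) - scale c (s (x, y)) | c x y. x \<in> carrier V \<and> y \<in> carrier W} \<union>
     {s (x, c \<odot>\<^bsub>W\<^esub> y) - scale c (s (x, y)) | c x y. x \<in> carrier V \<and> y \<in> carrier W})"

definition bilinear_kernel ::
    "(complex, 'a, 'm) module_scheme \<Rightarrow> (complex, 'b, 'n) module_scheme \<Rightarrow>
     ('a \<times> 'b \<Rightarrow>\<^sub>0 complex) set" where
  "bilinear_kernel V W =
     \<Inter>{K. submodule K complex_algebra (pair_space V W) \<and>
        bilinear_relators V W \<subseteq> K}"

definition tensor ::
    "(complex, 'a, 'm) module_scheme \<Rightarrow> (complex, 'b, 'n) module_scheme \<Rightarrow>
     (complex, ('a, 'b) tensor) module" where
  "tensor V W = quot (pair_space V W) (bilinear_kernel V W)"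

definition tens ::
    "(complex, 'a, 'm) module_scheme \<Rightarrow> (complex, 'b, 'n) module_scheme \<Rightarrow>
     'a \<Rightarrow> 'b \<Rightarrow> ('a, 'b) tensor" where
  "tens V W v w = bilinear_kernel V W +>\<^bsub>pair_space V W\<^esub> Poly_Mapping.single (v, w) 1"

text \<open>The linear map to \<open>Z\<close> out of a tensor product induced by a bilinear \<open>h\<close>.\<close>

definition tensor_lift ::
    "(complex, 'c, 'm) module_scheme \<Rightarrow> ('a \<Rightarrow> 'b \<Rightarrow> 'c) \<Rightarrow> ('a, 'b) tensor \<Rightarrow> 'c" where
  "tensor_lift Z h Y =
     the_elem ((\<lambda>f. \<Oplus>\<^bsub>Z\<^esub>p\<in>Poly_Mapping.keys f. Poly_Mapping.lookup f p \<odot>\<^bsub>Z\<^esub> h (fst p) (snd p)) ` Y)"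

text \<open>The map \<open>f \<otimes> g\<close>, where \<open>V\<close> and \<open>W\<close> are the codomains of \<open>f\<close> and \<open>g\<close>.\<close>

definition tensor_map ::
    "(complex, 'c, 'm) module_scheme \<Rightarrow> (complex, 'd, 'n) module_scheme \<Rightarrow>
     ('a \<Rightarrow> 'c) \<Rightarrow> ('b \<Rightarrow> 'd) \<Rightarrow> ('a, 'b) tensor \<Rightarrow> ('c, 'd) tensor" where
  "tensor_map V W f g = tensor_lift (tensor V W) (\<lambda>a b. tens V W (f a) (g b))"

definition tensor_assoc ::
    "(complex, 'a, 'l) module_scheme \<Rightarrow> (complex, 'b, 'm) module_scheme \<Rightarrow>
     (complex, 'c, 'n) module_scheme \<Rightarrow>
     (('a, 'b) tensor, 'c) tensor \<Rightarrow> ('a, ('b, 'c) tensor) tensor" where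
  "tensor_assoc U V W =
     tensor_lift (tensor U (tensor V W))
       (\<lambda>x w. tensor_lift (tensor U (tensor V W)) (\<lambda>u v. tens U (tensor V W) u (tens V W v w)) x)"


section \<open>Comodules, coinvariants and associated bundles\<close>

text \<open>
  The Hopf algebras below are records with a coproduct and a counit. The antipode is determined by
  these and plays no role in the notions of comodule and coinvariant.
\<close>

record 'a bialgebra = "(complex, 'a) module" +
  comult :: "'a \<Rightarrow> ('a, 'a) tensor"
  counit :: "'a \<Rightarrow> complex"

definition right_comodule ::
    "'h bialgebra \<Rightarrow> (complex, 'v) module \<Rightarrow> ('v \<Rightarrow> ('v, 'h) tensor) \<Rightarrow> bool" where
  "right_comodule H V \<rho> \<longleftrightarrow>
     complex_vector_space V \<and>
     linear_map V (tensor V H) \<rho> \<and>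
     (\<forall>v\<in>carrier V.
        tensor_assoc V H H (tensor_map (tensor V H) H \<rho> id (\<rho> v)) =
        tensor_map V (tensor H H) id (comult H) (\<rho> v)) \<and>
     (\<forall>v\<in>carrier V. tensor_lift V (\<lambda>w h. counit H h \<odot>\<^bsub>V\<^esub> w) (\<rho> v) = v)"

definition coinvariants ::
    "'h bialgebra \<Rightarrow> (complex, 'v) module \<Rightarrow> ('v \<Rightarrow> ('v, 'h) tensor) \<Rightarrow> 'v set" where
  "coinvariants H V \<rho> = {x \<in> carrier V. \<rho> x = tens V H x \<one>\<^bsub>H\<^esub>}"

text \<open>
  In Sweedler notation, the tensor product coaction sends \<open>p \<otimes> v\<close> to
  \<open>(p\<^sub>0 \<otimes> v\<^sub>0) \<otimes> p\<^sub>1 v\<^sub>1\<close>.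
\<close>

definition tensor_coaction ::
    "'h bialgebra \<Rightarrow> (complex, 'p) module \<Rightarrow> ('p \<Rightarrow> ('p, 'h) tensor) \<Rightarrow>
     (complex, 'v) module \<Rightarrow> ('v \<Rightarrow> ('v, 'h) tensor) \<Rightarrow>
     ('p, 'v) tensor \<Rightarrow> (('p, 'v) tensor, 'h) tensor" where
  "tensor_coaction H P \<rho>P V \<rho>V = (let Z = tensor (tensor P V) H in
     tensor_lift Z (\<lambda>p v.
       tensor_lift Z (\<lambda>p0 p1.
         tensor_lift Z (\<lambda>v0 v1. tens (tensor P V) H (tens P V p0 v0) (p1 \<otimes>\<^bsub>H\<^esub> v1)) (\<rho>V v)) (\<rho>P p)))"

text \<open>
  The left module \<open>(P \<otimes> V)\<^sup>H\<close> over the coinvariants of \<open>P\<close>, acting by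
  \<open>m (p \<otimes> v) = (m p) \<otimes> v\<close>. The scalar multiplication of the record is this action.
\<close>

definition associated_bundle ::
    "'h bialgebra \<Rightarrow> (complex, 'p) module \<Rightarrow> ('p \<Rightarrow> ('p, 'h) tensor) \<Rightarrow>
     (complex, 'v) module \<Rightarrow> ('v \<Rightarrow> ('v, 'h) tensor) \<Rightarrow> ('p, ('p, 'v) tensor) module" where
  "associated_bundle H P \<rho>P V \<rho>V = (let T = tensor P V in
     \<lparr>carrier = coinvariants H T (tensor_coaction H P \<rho>P V \<rho>V),
      monoid.mult = undefined, one = undefined, ring.zero = \<zero>\<^bsub>T\<^esub>, ring.add = ring.add T,
      smult = (\<lambda>m. tensor_lift T (\<lambda>p v. tens P V (m \<otimes>\<^bsub>P\<^esub> p) v))\<rparr>)"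

text \<open>
  The base algebra \<open>M\<close> need not be commutative, so the library's \<open>module M E\<close> does not apply to
  these modules. Complex linearity is included, as \<open>M\<close> contains the scalars.
\<close>

definition left_module_iso ::
    "('m, 'k) monoid_scheme \<Rightarrow> ('m, 'a) module \<Rightarrow> ('m, 'b) module \<Rightarrow> bool" where
  "left_module_iso M E F \<longleftrightarrow> (\<exists>h.
     bij_betw h (carrier E) (carrier F) \<and>
     (\<forall>x\<in>carrier E. \<forall>y\<in>carrier E. h (x \<oplus>\<^bsub>E\<^esub> y) = h x \<oplus>\<^bsub>F\<^esub> h y) \<and>
     (\<forall>m\<in>carrier M. \<forall>x\<in>carrier E. h (m \<odot>\<^bsub>E\<^esub> x) = m \<odot>\<^bsub>F\<^esub> h x))"


section \<open>The quantum groups\<close>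

text \<open>\<open>U i j\<close> stands for $u^i_j$ and \<open>DetInv\<close> for the inverse of the quantum determinant.\<close>

datatype qgen = U nat nat | DetInv

text \<open>\<open>Rmat q i k j l\<close> is $R^{ik}_{jl}$.\<close>

definition Rmat :: "real \<Rightarrow> nat \<Rightarrow> nat \<Rightarrow> nat \<Rightarrow> nat \<Rightarrow> complex" where
  "Rmat q i k j l = of_real (
     (if i = k then q else 1) * of_bool (i = l) * of_bool (k = j) +
     (q - inverse q) * of_bool (k > i) * of_bool (i = j) * of_bool (k = l))"

definition matrix_relators :: "real \<Rightarrow> nat \<Rightarrow> qgen free set" where
  "matrix_relators q n =
     {(\<Sum>w\<in>{1..n}. \<Sum>x\<in>{1..n}. scale (Rmat q a c w x) (gen (U w b) * gen (U x d))) -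
      (\<Sum>y\<in>{1..n}. \<Sum>z\<in>{1..n}. scale (Rmat q y z b d) (gen (U a y) * gen (U c z)))
      | a b c d. a \<in> {1..n} \<and> b \<in> {1..n} \<and> c \<in> {1..n} \<and> d \<in> {1..n}}"

definition perm_length :: "nat \<Rightarrow> (nat \<Rightarrow> nat) \<Rightarrow> nat" where
  "perm_length n \<pi> = card {(i, j). 1 \<le> i \<and> i < j \<and> j \<le> n \<and> \<pi> i > \<pi> j}"

definition qdet :: "real \<Rightarrow> nat \<Rightarrow> qgen free" where
  "qdet q n = (\<Sum>\<pi> | \<pi> permutes {1..n}. scale (of_real ((- q) ^ perm_length n \<pi>))
     (prod_list (map (\<lambda>i. gen (U i (\<pi> i))) [1..<Suc n])))"

definition matrix_gens :: "nat \<Rightarrow> qgen set" where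
  "matrix_gens n = {U i j | i j. i \<in> {1..n} \<and> j \<in> {1..n}}"

definition SU_relators :: "real \<Rightarrow> nat \<Rightarrow> qgen free set" where
  "SU_relators q n = matrix_relators q n \<union> {qdet q n - 1}"

definition U_relators :: "real \<Rightarrow> nat \<Rightarrow> qgen free set" where
  "U_relators q n =
     matrix_relators q n \<union> {gen DetInv * qdet q n - 1, qdet q n * gen DetInv - 1}"

definition matrix_bialgebra ::
    "qgen set \<Rightarrow> qgen free set \<Rightarrow> nat \<Rightarrow> qgen free set bialgebra" where
  "matrix_bialgebra G R n = (let A = presented_algebra G R; u = presented_gen G R in
     module.extend A (bialgebra.fields
       (presented_hom (tensor A A) (\<lambda>g. case g of
          U i j \<Rightarrow> (\<Oplus>\<^bsub>tensor A A\<^esub>k\<in>{1..n}. tens A A (u (U i k)) (u (U k j)))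
        | DetInv \<Rightarrow> tens A A (u DetInv) (u DetInv)))
       (presented_hom complex_algebra (\<lambda>g. case g of U i j \<Rightarrow> of_bool (i = j) | DetInv \<Rightarrow> 1))))"

definition CqSU :: "real \<Rightarrow> nat \<Rightarrow> qgen free set bialgebra" where
  "CqSU q n = matrix_bialgebra (matrix_gens n) (SU_relators q n) n"

definition u_SU :: "real \<Rightarrow> nat \<Rightarrow> nat \<Rightarrow> nat \<Rightarrow> qgen free set" where
  "u_SU q n i j = presented_gen (matrix_gens n) (SU_relators q n) (U i j)"

definition CqU :: "real \<Rightarrow> nat \<Rightarrow> qgen free set bialgebra" where
  "CqU q n = matrix_bialgebra (insert DetInv (matrix_gens n)) (U_relators q n) n"

definition u_U :: "real \<Rightarrow> nat \<Rightarrow> nat \<Rightarrow> nat \<Rightarrow> qgen free set" where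
  "u_U q n i j = presented_gen (insert DetInv (matrix_gens n)) (U_relators q n) (U i j)"

definition detinv_U :: "real \<Rightarrow> nat \<Rightarrow> qgen free set" where
  "detinv_U q n = presented_gen (insert DetInv (matrix_gens n)) (U_relators q n) DetInv"

text \<open>Laurent polynomials: \<open>Poly_Mapping.single k 1\<close> is $t^k$.\<close>

type_synonym laurent = "int \<Rightarrow>\<^sub>0 complex"

definition laurent_algebra :: "(complex, laurent) module" where
  "laurent_algebra = \<lparr>carrier = UNIV, monoid.mult = (*), one = 1, ring.zero = 0, ring.add = (+), smult = scale\<rparr>"

definition tpow :: "int \<Rightarrow> laurent" where
  "tpow k = Poly_Mapping.single k 1"

definition CU1 :: "laurent bialgebra" where
  "CU1 = (let A = laurent_algebra in
     module.extend A (bialgebra.fields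
       (\<lambda>f. \<Oplus>\<^bsub>tensor A A\<^esub>k\<in>Poly_Mapping.keys f. Poly_Mapping.lookup f k \<odot>\<^bsub>tensor A A\<^esub> tens A A (tpow k) (tpow k))
       (\<lambda>f. \<Sum>k\<in>Poly_Mapping.keys f. Poly_Mapping.lookup f k)))"


section \<open>The quantum spheres and projective spaces\<close>

text \<open>The maps $\alpha_N$, $\beta_N$ and $\gamma_N$ on \<open>CqSU q N\<close>; \<open>DetInv\<close> does not occur there.\<close>

definition alpha :: "real \<Rightarrow> nat \<Rightarrow> qgen free set \<Rightarrow> qgen free set" where
  "alpha q N = presented_hom (CqU q (N - 1)) (\<lambda>g. case g of
     U i j \<Rightarrow> if i = 1 \<and> j = 1 then detinv_U q (N - 1)
       else if i = 1 \<or> j = 1 then \<zero>\<^bsub>CqU q (N - 1)\<^esub>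
       else u_U q (N - 1) (i - 1) (j - 1)
   | DetInv \<Rightarrow> undefined)"

definition beta :: "real \<Rightarrow> nat \<Rightarrow> qgen free set \<Rightarrow> qgen free set" where
  "beta q N = presented_hom (CqSU q (N - 1)) (\<lambda>g. case g of
     U i j \<Rightarrow> if i = 1 \<and> j = 1 then \<one>\<^bsub>CqSU q (N - 1)\<^esub>
       else if i = 1 \<or> j = 1 then \<zero>\<^bsub>CqSU q (N - 1)\<^esub>
       else u_SU q (N - 1) (i - 1) (j - 1)
   | DetInv \<Rightarrow> undefined)"

definition gamma :: "real \<Rightarrow> nat \<Rightarrow> qgen free set \<Rightarrow> laurent" where
  "gamma q N = presented_hom CU1 (\<lambda>g. case g of
     U i j \<Rightarrow> if i \<noteq> j then 0 else if i = 1 then tpow (- 1) else if i = N then tpow 1 else 1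
   | DetInv \<Rightarrow> undefined)"

definition SU_algebra :: "real \<Rightarrow> nat \<Rightarrow> (complex, qgen free set) module" where
  "SU_algebra q N = module.truncate (CqSU q N)"

text \<open>The right coaction $(\mathrm{id}\otimes f)\Delta$ of \<open>H\<close> on \<open>CqSU q N\<close>.\<close>

definition coaction_via ::
    "real \<Rightarrow> nat \<Rightarrow> 'h bialgebra \<Rightarrow> (qgen free set \<Rightarrow> 'h) \<Rightarrow>
     qgen free set \<Rightarrow> (qgen free set, 'h) tensor" where
  "coaction_via q N H f x = tensor_map (SU_algebra q N) H id f (comult (CqSU q N) x)"

definition CqCP :: "real \<Rightarrow> nat \<Rightarrow> (complex, qgen free set) module" where
  "CqCP q N = subspace (SU_algebra q N)
     (coinvariants (CqU q (N - 1)) (SU_algebra q N) (coaction_via q N (CqU q (N - 1)) (alpha q N)))"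

definition CqS :: "real \<Rightarrow> nat \<Rightarrow> (complex, qgen free set) module" where
  "CqS q N = subspace (SU_algebra q N)
     (coinvariants (CqSU q (N - 1)) (SU_algebra q N) (coaction_via q N (CqSU q (N - 1)) (beta q N)))"

text \<open>
  The coaction $(\mathrm{id}\otimes\gamma_N)\Delta$ has to be read as a map into \<open>tensor (CqS q N) CU1\<close>.
  As a set of cosets this is not contained in \<open>tensor (SU_algebra q N) CU1\<close>, so the values are
  pulled back along the canonical injection between the two.
\<close>

definition sphere_coaction ::
    "real \<Rightarrow> nat \<Rightarrow> qgen free set \<Rightarrow> (qgen free set, laurent) tensor" where
  "sphere_coaction q N x =
     the_inv_into (carrier (tensor (CqS q N) CU1)) (tensor_map (SU_algebra q N) CU1 id id)
       (coaction_via q N CU1 (gamma q N) x)"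

end

theory Submission
  imports Defs "HOL-Combinatorics.Multiset_Permutations"
begin

text \<open>
  Write \<open>n = N - 1\<close>, \<open>P = CqSU q N\<close> and \<open>S = CqS q N\<close>. Reading $t$ as the central grouplike determinant embeds
  $\mathbf{C}[U_1]$ into \<open>CqU q n\<close> (\<open>det_map\<close>), and along this embedding every comodule \<open>V\<close> of the circle becomes
  the required comodule \<open>W\<close>. The map $\alpha$ is the convolution product of $\gamma$ and $\beta$, the latter lifted along a
  section of \<open>CqU q n \<rightarrow> CqSU q n\<close>; hence the coaction through $\alpha$ restricts on \<open>S\<close> to the one through $\gamma$, and
  \<open>S \<otimes> V\<close> sits inside \<open>P \<otimes> V\<close> compatibly with both coactions. Conversely an element of \<open>P \<otimes> V\<close> that is coinvariant
  under \<open>CqU q n\<close> is coinvariant under \<open>CqSU q n\<close>, which acts trivially on \<open>W\<close>, and therefore lies in \<open>S \<otimes> V\<close>,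
  since all linear maps split.
\<close>

section \<open>Linear algebra over the complex numbers\<close>

text \<open>That the determinant is central and grouplike, and that \<alpha>, \<beta>, \<gamma> and
  the coproducts are well defined, is not contained in the definitions; all of it is derived from
  the R-matrix relations. The algebras are records with carriers, so this calculus runs in free
  algebras modulo the kernel of an evaluation, where sums and products are type class operations.
  That the \<gamma>-coaction preserves \<open>S\<close> also needs proof. Coassociativity expresses
  \<rho>\<beta> after \<rho>\<gamma> through \<rho>\<alpha>, and on \<open>S\<close> the last leg of
  \<rho>\<alpha> consists of powers of the determinant, which are trivial in
  \<open>CqSU q n\<close>. Tensors are cosets that depend on the carrier, so S \<otimes> V is not a
  subset of P \<otimes> V. The isomorphism is the map induced by the inclusion; complements of
  subspaces take the place of flatness, both for its injectivity and for reaching every coinvariant.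
  Comodule identities are reduced to vectors \<open>x\<close> coacted on by x \<otimes> t^k, since
  every circle comodule is a sum of such weight vectors.\<close>

lemma complex_algebra_simps [simp]:
  "carrier complex_algebra = UNIV" "a \<otimes>\<^bsub>complex_algebra\<^esub> b = a * b" "\<one>\<^bsub>complex_algebra\<^esub> = 1"
  "\<zero>\<^bsub>complex_algebra\<^esub> = 0" "a \<oplus>\<^bsub>complex_algebra\<^esub> b = a + b" "a \<odot>\<^bsub>complex_algebra\<^esub> b = a * b"
  by (simp_all add: complex_algebra_def)

lemma complex_algebra_cring: "cring complex_algebra"
proof (rule cringI)
  show "abelian_group complex_algebra"
  proof (rule abelian_groupI)
    show "\<exists>y\<in>carrier complex_algebra. y \<oplus>\<^bsub>complex_algebra\<^esub> x = \<zero>\<^bsub>complex_algebra\<^esub>" for x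
      by (rule bexI[of _ "- x"]) simp_all
  qed simp_all
  show "comm_monoid complex_algebra"
    by (rule comm_monoidI) simp_all
qed (simp_all add: distrib_right)

lemma complex_vector_spaceI:
  assumes "abelian_group V"
    and "\<And>a x. x \<in> carrier V \<Longrightarrow> a \<odot>\<^bsub>V\<^esub> x \<in> carrier V"
    and "\<And>a b x. x \<in> carrier V \<Longrightarrow> (a + b) \<odot>\<^bsub>V\<^esub> x = (a \<odot>\<^bsub>V\<^esub> x) \<oplus>\<^bsub>V\<^esub> (b \<odot>\<^bsub>V\<^esub> x)"
    and "\<And>a x y. x \<in> carrier V \<Longrightarrow> y \<in> carrier V \<Longrightarrow>
      a \<odot>\<^bsub>V\<^esub> (x \<oplus>\<^bsub>V\<^esub> y) = (a \<odot>\<^bsub>V\<^esub> x) \<oplus>\<^bsub>V\<^esub> (a \<odot>\<^bsub>V\<^esub> y)"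
    and "\<And>a b x. x \<in> carrier V \<Longrightarrow> (a * b) \<odot>\<^bsub>V\<^esub> x = a \<odot>\<^bsub>V\<^esub> (b \<odot>\<^bsub>V\<^esub> x)"
    and "\<And>x. x \<in> carrier V \<Longrightarrow> 1 \<odot>\<^bsub>V\<^esub> x = x"
  shows "complex_vector_space V"
  by (rule moduleI) (use assms complex_algebra_cring in auto)

section \<open>Vector space laws in ordinary complex arithmetic\<close>

context
  fixes V :: "(complex, 'a, 'm) module_scheme"
  assumes V: "complex_vector_space V"
begin

interpretation module complex_algebra V by (rule V)

lemma vs_abelian_group: "abelian_group V" by unfold_locales
lemma vs_add_closed: "x \<in> carrier V \<Longrightarrow> y \<in> carrier V \<Longrightarrow> x \<oplus>\<^bsub>V\<^esub> y \<in> carrier V" by simp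
lemma vs_zero_closed: "\<zero>\<^bsub>V\<^esub> \<in> carrier V" by simp
lemma vs_smult_closed: "x \<in> carrier V \<Longrightarrow> c \<odot>\<^bsub>V\<^esub> x \<in> carrier V" by simp
lemma vs_minus_closed: "x \<in> carrier V \<Longrightarrow> y \<in> carrier V \<Longrightarrow> x \<ominus>\<^bsub>V\<^esub> y \<in> carrier V" by simp
lemma vs_smult_add: "x \<in> carrier V \<Longrightarrow> (a + b) \<odot>\<^bsub>V\<^esub> x = a \<odot>\<^bsub>V\<^esub> x \<oplus>\<^bsub>V\<^esub> b \<odot>\<^bsub>V\<^esub> x"
  using smult_l_distr[of a b x] by simp
lemma vs_smult_add_right: "x \<in> carrier V \<Longrightarrow> y \<in> carrier V \<Longrightarrow>
    a \<odot>\<^bsub>V\<^esub> (x \<oplus>\<^bsub>V\<^esub> y) = a \<odot>\<^bsub>V\<^esub> x \<oplus>\<^bsub>V\<^esub> a \<odot>\<^bsub>V\<^esub> y"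
  using smult_r_distr[of a x y] by simp
lemma vs_smult_smult: "x \<in> carrier V \<Longrightarrow> a \<odot>\<^bsub>V\<^esub> (b \<odot>\<^bsub>V\<^esub> x) = (a * b) \<odot>\<^bsub>V\<^esub> x"
  using smult_assoc1[of a b x] by simp
lemma vs_smult_one: "x \<in> carrier V \<Longrightarrow> 1 \<odot>\<^bsub>V\<^esub> x = x"
  using smult_one[of x] by simp
lemma vs_smult_zero: "x \<in> carrier V \<Longrightarrow> 0 \<odot>\<^bsub>V\<^esub> x = \<zero>\<^bsub>V\<^esub>"
  using smult_l_null[of x] by simp
lemma vs_smult_zero_right: "c \<odot>\<^bsub>V\<^esub> \<zero>\<^bsub>V\<^esub> = \<zero>\<^bsub>V\<^esub>"
  using smult_r_null[of c] by simp
lemma vs_minus_eq: "x \<in> carrier V \<Longrightarrow> y \<in> carrier V \<Longrightarrow> x \<ominus>\<^bsub>V\<^esub> y = x \<oplus>\<^bsub>V\<^esub> (- 1) \<odot>\<^bsub>V\<^esub> y"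
proof -
  assume x: "x \<in> carrier V" and y: "y \<in> carrier V"
  have "(- 1) \<odot>\<^bsub>V\<^esub> y \<oplus>\<^bsub>V\<^esub> y = \<zero>\<^bsub>V\<^esub>"
    using vs_smult_add[OF y, of "- 1" 1] y by (simp add: vs_smult_one vs_smult_zero)
  hence "(- 1) \<odot>\<^bsub>V\<^esub> y = \<ominus>\<^bsub>V\<^esub> y" using y by (simp add: vs_smult_closed M.minus_equality)
  thus ?thesis by (simp add: a_minus_def)
qed
lemma vs_minus_eq_zero_iff: "x \<in> carrier V \<Longrightarrow> y \<in> carrier V \<Longrightarrow> x \<ominus>\<^bsub>V\<^esub> y = \<zero>\<^bsub>V\<^esub> \<longleftrightarrow> x = y"
proof -
  assume x: "x \<in> carrier V" and y: "y \<in> carrier V"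
  have "x \<ominus>\<^bsub>V\<^esub> y = \<zero>\<^bsub>V\<^esub> \<longleftrightarrow> x = \<zero>\<^bsub>V\<^esub> \<oplus>\<^bsub>V\<^esub> y"
    unfolding a_minus_def using M.add.inv_solve_right'[of "\<zero>\<^bsub>V\<^esub>" x y] x y by auto
  thus ?thesis using y by simp
qed
lemma vs_finsum_closed: "(\<And>i. i \<in> A \<Longrightarrow> f i \<in> carrier V) \<Longrightarrow> (\<Oplus>\<^bsub>V\<^esub>i\<in>A. f i) \<in> carrier V"
  by (simp add: Pi_def)
lemma vs_finsum_add: "(\<And>i. i \<in> A \<Longrightarrow> f i \<in> carrier V) \<Longrightarrow> (\<And>i. i \<in> A \<Longrightarrow> g i \<in> carrier V) \<Longrightarrow>
    (\<Oplus>\<^bsub>V\<^esub>i\<in>A. f i \<oplus>\<^bsub>V\<^esub> g i) = (\<Oplus>\<^bsub>V\<^esub>i\<in>A. f i) \<oplus>\<^bsub>V\<^esub> (\<Oplus>\<^bsub>V\<^esub>i\<in>A. g i)"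
  by (simp add: Pi_def)
lemma vs_finsum_smult: "finite A \<Longrightarrow> (\<And>i. i \<in> A \<Longrightarrow> f i \<in> carrier V) \<Longrightarrow>
    (\<Oplus>\<^bsub>V\<^esub>i\<in>A. c \<odot>\<^bsub>V\<^esub> f i) = c \<odot>\<^bsub>V\<^esub> (\<Oplus>\<^bsub>V\<^esub>i\<in>A. f i)"
  using finsum_smult_ldistr[of A c f] by (simp add: Pi_def)
lemma vs_finsum_insert: "finite A \<Longrightarrow> a \<notin> A \<Longrightarrow> f a \<in> carrier V \<Longrightarrow> (\<And>i. i \<in> A \<Longrightarrow> f i \<in> carrier V) \<Longrightarrow>
    (\<Oplus>\<^bsub>V\<^esub>i\<in>insert a A. f i) = f a \<oplus>\<^bsub>V\<^esub> (\<Oplus>\<^bsub>V\<^esub>i\<in>A. f i)"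
  by (simp add: Pi_def)
lemma vs_finsum_mono_neutral: "finite B \<Longrightarrow> A \<subseteq> B \<Longrightarrow> (\<And>i. i \<in> B \<Longrightarrow> f i \<in> carrier V) \<Longrightarrow>
    (\<And>i. i \<in> B - A \<Longrightarrow> f i = \<zero>\<^bsub>V\<^esub>) \<Longrightarrow> (\<Oplus>\<^bsub>V\<^esub>i\<in>A. f i) = (\<Oplus>\<^bsub>V\<^esub>i\<in>B. f i)"
  by (rule M.add.finprod_mono_neutral_cong_left) auto
lemma vs_finsum_single: "finite A \<Longrightarrow> a \<in> A \<Longrightarrow> f a \<in> carrier V \<Longrightarrow> (\<And>i. i \<in> A \<Longrightarrow> i \<noteq> a \<Longrightarrow> f i = \<zero>\<^bsub>V\<^esub>) \<Longrightarrow>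
    (\<Oplus>\<^bsub>V\<^esub>i\<in>A. f i) = f a"
proof -
  assume *: "finite A" "a \<in> A" "f a \<in> carrier V" "\<And>i. i \<in> A \<Longrightarrow> i \<noteq> a \<Longrightarrow> f i = \<zero>\<^bsub>V\<^esub>"
  have "f i \<in> carrier V" if "i \<in> A" for i
    using that * vs_zero_closed by (cases "i = a") auto
  thus ?thesis using vs_finsum_mono_neutral[of A "{a}" f] * by (auto simp: Pi_def)
qed
lemma vs_finsum_empty: "(\<Oplus>\<^bsub>V\<^esub>i\<in>{}. f i) = \<zero>\<^bsub>V\<^esub>" by simp
lemma vs_l_zero: "x \<in> carrier V \<Longrightarrow> \<zero>\<^bsub>V\<^esub> \<oplus>\<^bsub>V\<^esub> x = x" by simp
lemma vs_r_zero: "x \<in> carrier V \<Longrightarrow> x \<oplus>\<^bsub>V\<^esub> \<zero>\<^bsub>V\<^esub> = x" by simp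

end

lemmas vs_closed [simp, intro] = vs_add_closed vs_zero_closed vs_smult_closed vs_minus_closed
lemmas vs_simps [simp] = vs_smult_one vs_smult_zero vs_smult_zero_right vs_l_zero vs_r_zero
  vs_minus_eq_zero_iff vs_finsum_empty

lemma vs_finsum_cong: "complex_vector_space V \<Longrightarrow> (\<And>i. i \<in> A \<Longrightarrow> g i \<in> carrier V) \<Longrightarrow>
    (\<And>i. i \<in> A \<Longrightarrow> f i = g i) \<Longrightarrow> (\<Oplus>\<^bsub>V\<^esub>i\<in>A. f i) = (\<Oplus>\<^bsub>V\<^esub>i\<in>A. g i)"
  by (rule abelian_monoid.finsum_cong')
    (auto dest!: vs_abelian_group simp: abelian_group_def)

text \<open>The axioms see only the carrier, the sum, zero and the scalar action, so they pass
  between records that differ in product, unit or further fields, such as subspaces and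
  bialgebras.\<close>

lemma vs_cong:
  fixes V :: "(complex, 'a, 'm) module_scheme" and W :: "(complex, 'a, 'n) module_scheme"
  assumes "complex_vector_space V" and "carrier W = carrier V" and "ring.add W = ring.add V"
    and "\<zero>\<^bsub>W\<^esub> = \<zero>\<^bsub>V\<^esub>" and "smult W = smult V"
  shows "complex_vector_space W"
proof (rule complex_vector_spaceI)
  interpret module complex_algebra V by (rule assms(1))
  show "abelian_group W"
  proof (rule abelian_groupI)
    fix x assume "x \<in> carrier W"
    thus "\<exists>y\<in>carrier W. y \<oplus>\<^bsub>W\<^esub> x = \<zero>\<^bsub>W\<^esub>"
      using M.add.inv_closed[of x] M.l_neg[of x] by (auto simp: assms intro!: bexI[of _ "\<ominus>\<^bsub>V\<^esub> x"])
  qed (auto simp: assms M.a_ac)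
qed (use assms(1) in \<open>auto simp: assms(2-) vs_smult_add vs_smult_add_right vs_smult_smult\<close>)

section \<open>Linear maps\<close>

lemma linear_mapI:
  assumes "\<And>x. x \<in> carrier V \<Longrightarrow> f x \<in> carrier W"
    and "\<And>x y. x \<in> carrier V \<Longrightarrow> y \<in> carrier V \<Longrightarrow> f (x \<oplus>\<^bsub>V\<^esub> y) = f x \<oplus>\<^bsub>W\<^esub> f y"
    and "\<And>c x. x \<in> carrier V \<Longrightarrow> f (c \<odot>\<^bsub>V\<^esub> x) = c \<odot>\<^bsub>W\<^esub> f x"
  shows "linear_map V W f"
  using assms unfolding linear_map_def by auto

lemma linear_map_closed: "linear_map V W f \<Longrightarrow> x \<in> carrier V \<Longrightarrow> f x \<in> carrier W"
  and linear_map_add: "linear_map V W f \<Longrightarrow> x \<in> carrier V \<Longrightarrow> y \<in> carrier V \<Longrightarrow> f (x \<oplus>\<^bsub>V\<^esub> y) = f x \<oplus>\<^bsub>W\<^esub> f y"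
  and linear_map_smult: "linear_map V W f \<Longrightarrow> x \<in> carrier V \<Longrightarrow> f (c \<odot>\<^bsub>V\<^esub> x) = c \<odot>\<^bsub>W\<^esub> f x"
  unfolding linear_map_def by auto

lemma linear_map_zero:
  assumes "complex_vector_space V" "complex_vector_space W" "linear_map V W f"
  shows "f \<zero>\<^bsub>V\<^esub> = \<zero>\<^bsub>W\<^esub>"
  using linear_map_smult[OF assms(3) vs_zero_closed[OF assms(1)], of 0]
    linear_map_closed[OF assms(3) vs_zero_closed[OF assms(1)]] assms(1,2) by simp

lemma linear_map_minus:
  assumes "complex_vector_space V" "complex_vector_space W" "linear_map V W f" "x \<in> carrier V" "y \<in> carrier V"
  shows "f (x \<ominus>\<^bsub>V\<^esub> y) = f x \<ominus>\<^bsub>W\<^esub> f y"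
  using assms by (simp add: vs_minus_eq linear_map_closed linear_map_add linear_map_smult)

lemma linear_map_finsum:
  assumes "complex_vector_space V" "complex_vector_space W" "linear_map V W f"
    and "finite A" "\<And>i. i \<in> A \<Longrightarrow> g i \<in> carrier V"
  shows "f (\<Oplus>\<^bsub>V\<^esub>i\<in>A. g i) = (\<Oplus>\<^bsub>W\<^esub>i\<in>A. f (g i))"
  using assms(4,5)
proof (induction A rule: finite_induct)
  case empty thus ?case using assms(1-3) by (simp add: linear_map_zero)
next
  case (insert a A)
  thus ?case using assms(1-3)
    by (simp add: vs_finsum_insert linear_map_add linear_map_closed vs_finsum_closed)
qed

lemma linear_map_comp:
  "linear_map V W g \<Longrightarrow> linear_map W Z f \<Longrightarrow> linear_map V Z (\<lambda>x. f (g x))"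
  unfolding linear_map_def by (auto simp: Pi_iff)

lemma linear_map_id: "linear_map V V (\<lambda>x. x)" "linear_map V V id"
  unfolding linear_map_def by auto

lemma linear_map_cong_fun:
  "complex_vector_space V \<Longrightarrow> linear_map V W f \<Longrightarrow> (\<And>x. x \<in> carrier V \<Longrightarrow> g x = f x) \<Longrightarrow> linear_map V W g"
  unfolding linear_map_def by auto

lemma linear_map_const_zero: "complex_vector_space W \<Longrightarrow> linear_map V W (\<lambda>x. \<zero>\<^bsub>W\<^esub>)"
  by (rule linear_mapI) auto

lemma linear_map_smult_const:
  "complex_vector_space W \<Longrightarrow> linear_map V W f \<Longrightarrow> linear_map V W (\<lambda>x. c \<odot>\<^bsub>W\<^esub> f x)"
  by (rule linear_mapI)
    (auto simp: linear_map_closed linear_map_add linear_map_smult vs_smult_add_right vs_smult_smult mult.commute)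

lemma linear_map_add_maps:
  assumes "complex_vector_space W" "linear_map V W f" "linear_map V W g"
  shows "linear_map V W (\<lambda>x. f x \<oplus>\<^bsub>W\<^esub> g x)"
proof (rule linear_mapI)
  interpret module complex_algebra W by (rule assms(1))
  fix x y assume "x \<in> carrier V" "y \<in> carrier V"
  thus "f (x \<oplus>\<^bsub>V\<^esub> y) \<oplus>\<^bsub>W\<^esub> g (x \<oplus>\<^bsub>V\<^esub> y) = f x \<oplus>\<^bsub>W\<^esub> g x \<oplus>\<^bsub>W\<^esub> (f y \<oplus>\<^bsub>W\<^esub> g y)"
    using assms by (simp add: linear_map_add linear_map_closed M.a_ac)
qed (use assms in \<open>auto simp: linear_map_closed linear_map_smult vs_smult_add_right\<close>)

lemma linear_map_minus_maps:
  assumes "complex_vector_space W" "linear_map V W f" "linear_map V W g"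
  shows "linear_map V W (\<lambda>x. f x \<ominus>\<^bsub>W\<^esub> g x)"
proof -
  have "linear_map V W (\<lambda>x. f x \<oplus>\<^bsub>W\<^esub> (- 1) \<odot>\<^bsub>W\<^esub> g x)"
    using assms by (intro linear_map_add_maps linear_map_smult_const)
  thus ?thesis using assms by (auto simp: linear_map_def vs_minus_eq Pi_iff)
qed

subsection \<open>Spaces of finitely supported functions\<close>

lemma lookup_scale [simp]: "Poly_Mapping.lookup (scale c f) k = c * Poly_Mapping.lookup f k"
  unfolding scale_def by (simp add: Poly_Mapping.map.rep_eq when_def)

lemma scale_simps [simp]: "scale 1 f = f" "scale 0 f = 0" "scale c 0 = 0"
  "scale c (Poly_Mapping.single k d) = Poly_Mapping.single k (c * d)"
  by (rule poly_mapping_eqI; simp add: lookup_single when_def)+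

lemma scale_add: "scale (c + d) f = scale c f + scale d f"
  and scale_add_right: "scale c (f + g) = scale c f + scale c g"
  and scale_diff: "scale (c - d) f = scale c f - scale d f"
  and scale_diff_right: "scale c (f - g) = scale c f - scale c g"
  and scale_minus: "scale (- c) f = - scale c f"
  and scale_scale: "scale c (scale d f) = scale (c * d) f"
  by (rule poly_mapping_eqI; simp add: lookup_add lookup_minus algebra_simps)+

lemma keys_scale: "Poly_Mapping.keys (scale c f) \<subseteq> Poly_Mapping.keys f"
  by (auto simp: in_keys_iff)

text \<open>The linear skeleton common to free algebras, pair spaces and Laurent polynomials.
  Isolating it allows linear extension and equality on basis vectors to be proved once for all
  three.\<close>

definition free_space :: "'b set \<Rightarrow> (complex, 'b \<Rightarrow>\<^sub>0 complex, 'm) module_scheme \<Rightarrow> bool" where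
  "free_space S F \<longleftrightarrow> carrier F = {f. Poly_Mapping.keys f \<subseteq> S} \<and> ring.add F = (+) \<and> \<zero>\<^bsub>F\<^esub> = 0 \<and> smult F = scale"

lemma free_spaceD:
  assumes "free_space S F"
  shows "carrier F = {f. Poly_Mapping.keys f \<subseteq> S}" "x \<oplus>\<^bsub>F\<^esub> y = x + y" "\<zero>\<^bsub>F\<^esub> = 0" "c \<odot>\<^bsub>F\<^esub> x = scale c x"
  using assms by (auto simp: free_space_def)

lemma free_space_vs:
  assumes "free_space S F" shows "complex_vector_space F"
proof (rule complex_vector_spaceI)
  note [simp] = free_spaceD[OF assms]
  show "abelian_group F"
  proof (rule abelian_groupI)
    show "\<exists>y\<in>carrier F. y \<oplus>\<^bsub>F\<^esub> x = \<zero>\<^bsub>F\<^esub>" if "x \<in> carrier F" for x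
      using that by (intro bexI[of _ "- x"]) (auto simp: in_keys_iff)
  qed (use keys_add[THEN subsetD] in \<open>fastforce simp: algebra_simps\<close>)+
qed (use keys_scale[THEN subsetD] in \<open>fastforce simp: free_spaceD[OF assms] scale_add scale_add_right scale_scale\<close>)+

lemma free_space_minus:
  assumes "free_space S F" "x \<in> carrier F" "y \<in> carrier F" shows "x \<ominus>\<^bsub>F\<^esub> y = x - y"
  using vs_minus_eq[OF free_space_vs[OF assms(1)] assms(2,3)] free_spaceD[OF assms(1)]
  by (simp add: scale_minus)

lemma free_space_single: "free_space S F \<Longrightarrow> s \<in> S \<Longrightarrow> Poly_Mapping.single s c \<in> carrier F"
  by (simp add: free_spaceD)

lemma free_space_expand:
  assumes "free_space S F" "f \<in> carrier F"
  shows "f = (\<Oplus>\<^bsub>F\<^esub>s\<in>Poly_Mapping.keys f. Poly_Mapping.single s (Poly_Mapping.lookup f s))"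
proof -
  note V = free_space_vs[OF assms(1)]
  have "A \<subseteq> S \<Longrightarrow> (\<Oplus>\<^bsub>F\<^esub>s\<in>A. Poly_Mapping.single s (Poly_Mapping.lookup f s)) =
      (\<Sum>s\<in>A. Poly_Mapping.single s (Poly_Mapping.lookup f s))" if "finite A" for A
    using that
  proof (induction A rule: finite_induct)
    case (insert a A)
    thus ?case
      by (subst vs_finsum_insert[OF V])
        (auto simp: free_spaceD[OF assms(1)] subset_iff intro!: free_space_single[OF assms(1)])
  qed (simp add: V free_spaceD[OF assms(1)])
  from this[OF finite_keys, of f] assms(2)
  have "(\<Oplus>\<^bsub>F\<^esub>s\<in>Poly_Mapping.keys f. Poly_Mapping.single s (Poly_Mapping.lookup f s)) =
    (\<Sum>s\<in>Poly_Mapping.keys f. Poly_Mapping.single s (Poly_Mapping.lookup f s))"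
    by (simp add: free_spaceD[OF assms(1)])
  also have "\<dots> = f"
    by (rule poly_mapping_eqI)
      (auto simp: lookup_sum lookup_single when_def in_keys_iff)
  finally show ?thesis by simp
qed

text \<open>Turns later identities between linear maps into checks on words, on pairs or on powers
  of \<open>t\<close>.\<close>

lemma free_space_linear_eq:
  assumes "free_space S F" "complex_vector_space Z" "linear_map F Z g" "linear_map F Z h"
    and "\<And>s. s \<in> S \<Longrightarrow> g (Poly_Mapping.single s 1) = h (Poly_Mapping.single s 1)" and "f \<in> carrier F"
  shows "g f = h f"
proof -
  note V = free_space_vs[OF assms(1)]
  have S: "Poly_Mapping.keys f \<subseteq> S" using assms(1,6) by (simp add: free_spaceD)
  have s: "g (Poly_Mapping.single s c) = h (Poly_Mapping.single s c)" if "s \<in> S" for s c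
  proof -
    have "Poly_Mapping.single s c = c \<odot>\<^bsub>F\<^esub> Poly_Mapping.single s 1"
      by (simp add: free_spaceD[OF assms(1)])
    thus ?thesis using that assms by (simp add: linear_map_smult free_space_single)
  qed
  have "g (\<Oplus>\<^bsub>F\<^esub>s\<in>Poly_Mapping.keys f. Poly_Mapping.single s (Poly_Mapping.lookup f s))
      = h (\<Oplus>\<^bsub>F\<^esub>s\<in>Poly_Mapping.keys f. Poly_Mapping.single s (Poly_Mapping.lookup f s))"
    using S
    by (auto simp: linear_map_finsum[OF V assms(2,3)] linear_map_finsum[OF V assms(2,4)] s
        free_space_single[OF assms(1)] subset_iff linear_map_closed[OF assms(4)]
        intro!: vs_finsum_cong[OF assms(2)])
  thus ?thesis using free_space_expand[OF assms(1,6)] by simp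
qed

text \<open>The finite sum inside \<open>free_eval\<close>, \<open>tensor_lift\<close> and the
  structure maps of \<open>CU1\<close>.\<close>

definition lin_ext :: "(complex, 'c, 'm) module_scheme \<Rightarrow> ('b \<Rightarrow> 'c) \<Rightarrow> ('b \<Rightarrow>\<^sub>0 complex) \<Rightarrow> 'c" where
  "lin_ext Z h f = (\<Oplus>\<^bsub>Z\<^esub>p\<in>Poly_Mapping.keys f. Poly_Mapping.lookup f p \<odot>\<^bsub>Z\<^esub> h p)"

text \<open>A larger index set adds only zero terms. The support of \<open>f + g\<close> may shrink
  by cancellation, so additivity is compared over the union of both supports.\<close>

lemma lin_ext_superset:
  assumes "complex_vector_space Z" "finite A" "Poly_Mapping.keys f \<subseteq> A" "\<And>p. p \<in> A \<Longrightarrow> h p \<in> carrier Z"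
  shows "lin_ext Z h f = (\<Oplus>\<^bsub>Z\<^esub>p\<in>A. Poly_Mapping.lookup f p \<odot>\<^bsub>Z\<^esub> h p)"
  unfolding lin_ext_def
  by (rule vs_finsum_mono_neutral) (use assms in \<open>auto simp: in_keys_iff\<close>)

lemma lin_ext_single:
  assumes "complex_vector_space Z" "h p \<in> carrier Z"
  shows "lin_ext Z h (Poly_Mapping.single p c) = c \<odot>\<^bsub>Z\<^esub> h p"
  by (subst lin_ext_superset[where A = "{p}"], use assms in simp_all)
    (subst vs_finsum_single[where a = p], use assms in simp_all)

lemma lin_ext_linear:
  assumes "free_space S F" "complex_vector_space Z" "\<And>p. p \<in> S \<Longrightarrow> h p \<in> carrier Z"
  shows "linear_map F Z (lin_ext Z h)"
proof (rule linear_mapI)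
  note [simp] = free_spaceD[OF assms(1)]
  fix f assume f: "f \<in> carrier F"
  thus "lin_ext Z h f \<in> carrier Z"
    using assms by (auto simp: lin_ext_def intro!: vs_finsum_closed)
  fix c
  have "lin_ext Z h (scale c f) = (\<Oplus>\<^bsub>Z\<^esub>p\<in>Poly_Mapping.keys f. c \<odot>\<^bsub>Z\<^esub> (Poly_Mapping.lookup f p \<odot>\<^bsub>Z\<^esub> h p))"
    using f assms keys_scale[THEN subsetD]
    by (subst lin_ext_superset[where A = "Poly_Mapping.keys f"])
      (auto simp: vs_smult_smult intro!: vs_finsum_cong)
  also have "\<dots> = c \<odot>\<^bsub>Z\<^esub> lin_ext Z h f"
    unfolding lin_ext_def using f assms by (intro vs_finsum_smult) auto
  finally show "lin_ext Z h (c \<odot>\<^bsub>F\<^esub> f) = c \<odot>\<^bsub>Z\<^esub> lin_ext Z h f" by simp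
  fix g assume g: "g \<in> carrier F"
  let ?A = "Poly_Mapping.keys f \<union> Poly_Mapping.keys g"
  have "lin_ext Z h (f + g) = (\<Oplus>\<^bsub>Z\<^esub>p\<in>?A. Poly_Mapping.lookup f p \<odot>\<^bsub>Z\<^esub> h p \<oplus>\<^bsub>Z\<^esub> Poly_Mapping.lookup g p \<odot>\<^bsub>Z\<^esub> h p)"
    using f g assms keys_add[of f g]
    by (subst lin_ext_superset[where A = ?A])
      (auto simp: lookup_add vs_smult_add intro!: vs_finsum_cong)
  also have "\<dots> = (\<Oplus>\<^bsub>Z\<^esub>p\<in>?A. Poly_Mapping.lookup f p \<odot>\<^bsub>Z\<^esub> h p) \<oplus>\<^bsub>Z\<^esub> (\<Oplus>\<^bsub>Z\<^esub>p\<in>?A. Poly_Mapping.lookup g p \<odot>\<^bsub>Z\<^esub> h p)"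
    using f g assms by (intro vs_finsum_add) auto
  also have "\<dots> = lin_ext Z h f \<oplus>\<^bsub>Z\<^esub> lin_ext Z h g"
    using f g assms
    by (subst (1 2) lin_ext_superset[where A = ?A]) auto
  finally show "lin_ext Z h (f \<oplus>\<^bsub>F\<^esub> g) = lin_ext Z h f \<oplus>\<^bsub>Z\<^esub> lin_ext Z h g" by simp
qed

subsection \<open>Quotients\<close>

lemma quot_fields:
  "carrier (quot F I) = carrier (F Quot I)" "monoid.mult (quot F I) = monoid.mult (F Quot I)"
  "\<one>\<^bsub>quot F I\<^esub> = \<one>\<^bsub>F Quot I\<^esub>" "\<zero>\<^bsub>quot F I\<^esub> = \<zero>\<^bsub>F Quot I\<^esub>" "ring.add (quot F I) = ring.add (F Quot I)"
  by (simp_all add: quot_def)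

context
  fixes F :: "(complex, 'a, 'm) module_scheme" and I :: "'a set"
  assumes F: "complex_vector_space F" and I: "submodule I complex_algebra F"
begin

interpretation F: module complex_algebra F by (rule F)
interpretation I: submodule I complex_algebra F by (rule I)
interpretation S: abelian_subgroup I F
  by (rule abelian_subgroupI3) (use I.subgroup_axioms F.abelian_group_axioms in \<open>auto intro: additive_subgroupI\<close>)

lemma coset_eq_iff: "x \<in> carrier F \<Longrightarrow> y \<in> carrier F \<Longrightarrow> I +>\<^bsub>F\<^esub> x = I +>\<^bsub>F\<^esub> y \<longleftrightarrow> x \<ominus>\<^bsub>F\<^esub> y \<in> I"
  using S.a_rcos_module[of y x] S.a_rcos_self[of x] S.a_repr_independence'[of x y]
  unfolding a_minus_def by auto

lemma coset_self: "x \<in> carrier F \<Longrightarrow> x \<in> I +>\<^bsub>F\<^esub> x"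
  by (rule S.a_rcos_self)

lemma coset_mem: "x \<in> carrier F \<Longrightarrow> y \<in> I +>\<^bsub>F\<^esub> x \<Longrightarrow> y \<in> carrier F \<and> I +>\<^bsub>F\<^esub> y = I +>\<^bsub>F\<^esub> x"
  using S.a_elemrcos_carrier[of x y] S.a_repr_independence'[of y x] by auto

lemma carrier_quot: "carrier (quot F I) = (\<lambda>x. I +>\<^bsub>F\<^esub> x) ` carrier F"
  by (auto simp: FactRing_simps quot_fields)

lemma quot_smult:
  assumes "x \<in> carrier F" shows "c \<odot>\<^bsub>quot F I\<^esub> (I +>\<^bsub>F\<^esub> x) = I +>\<^bsub>F\<^esub> (c \<odot>\<^bsub>F\<^esub> x)"
proof -
  have "I +>\<^bsub>F\<^esub> (c \<odot>\<^bsub>F\<^esub> y) = I +>\<^bsub>F\<^esub> (c \<odot>\<^bsub>F\<^esub> x)" if "y \<in> I +>\<^bsub>F\<^esub> x" for y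
  proof -
    have y: "y \<in> carrier F" "y \<ominus>\<^bsub>F\<^esub> x \<in> I"
      using coset_mem[OF assms that] coset_eq_iff assms by auto
    have "c \<odot>\<^bsub>F\<^esub> (y \<ominus>\<^bsub>F\<^esub> x) \<in> I" using I.smult_closed[of c] y by simp
    moreover have "c \<odot>\<^bsub>F\<^esub> (y \<ominus>\<^bsub>F\<^esub> x) = c \<odot>\<^bsub>F\<^esub> y \<ominus>\<^bsub>F\<^esub> c \<odot>\<^bsub>F\<^esub> x"
      using F assms y(1) by (simp add: vs_minus_eq vs_smult_add_right vs_smult_smult)
    ultimately show ?thesis using assms y F by (simp add: coset_eq_iff)
  qed
  hence "(\<Union>y\<in>I +>\<^bsub>F\<^esub> x. I +>\<^bsub>F\<^esub> (c \<odot>\<^bsub>F\<^esub> y)) = (\<Union>y\<in>I +>\<^bsub>F\<^esub> x. I +>\<^bsub>F\<^esub> (c \<odot>\<^bsub>F\<^esub> x))"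
    by (intro SUP_cong refl)
  also have "\<dots> = I +>\<^bsub>F\<^esub> (c \<odot>\<^bsub>F\<^esub> x)" using coset_self[OF assms] by blast
  finally show ?thesis by (simp add: quot_def)
qed

lemma quot_add:
  "x \<in> carrier F \<Longrightarrow> y \<in> carrier F \<Longrightarrow> (I +>\<^bsub>F\<^esub> x) \<oplus>\<^bsub>quot F I\<^esub> (I +>\<^bsub>F\<^esub> y) = I +>\<^bsub>F\<^esub> (x \<oplus>\<^bsub>F\<^esub> y)"
  by (simp add: quot_fields FactRing_def S.a_rcos_sum)

lemma quot_zero: "\<zero>\<^bsub>quot F I\<^esub> = I +>\<^bsub>F\<^esub> \<zero>\<^bsub>F\<^esub>"
  by (simp add: quot_fields FactRing_def S.a_subset)

lemma quot_vs: "complex_vector_space (quot F I)"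
proof (rule complex_vector_spaceI)
  show "abelian_group (quot F I)"
  proof (rule abelian_groupI)
    fix x assume "x \<in> carrier (quot F I)"
    then obtain x' where x': "x' \<in> carrier F" "x = I +>\<^bsub>F\<^esub> x'" by (auto simp: carrier_quot)
    show "\<exists>y\<in>carrier (quot F I). y \<oplus>\<^bsub>quot F I\<^esub> x = \<zero>\<^bsub>quot F I\<^esub>"
      using x' by (intro bexI[of _ "I +>\<^bsub>F\<^esub> (\<ominus>\<^bsub>F\<^esub> x')"])
        (auto simp: quot_add quot_zero F.M.l_neg carrier_quot)
  next
    fix x y z assume "x \<in> carrier (quot F I)" "y \<in> carrier (quot F I)" "z \<in> carrier (quot F I)"
    then obtain x' y' z' where "x' \<in> carrier F" "x = I +>\<^bsub>F\<^esub> x'" "y' \<in> carrier F" "y = I +>\<^bsub>F\<^esub> y'"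
      "z' \<in> carrier F" "z = I +>\<^bsub>F\<^esub> z'" by (auto simp: carrier_quot)
    thus "x \<oplus>\<^bsub>quot F I\<^esub> y \<oplus>\<^bsub>quot F I\<^esub> z = x \<oplus>\<^bsub>quot F I\<^esub> (y \<oplus>\<^bsub>quot F I\<^esub> z)"
      "x \<oplus>\<^bsub>quot F I\<^esub> y = y \<oplus>\<^bsub>quot F I\<^esub> x"
      using F.M.a_assoc[of x' y' z'] F.M.a_comm[of x' y'] by (simp_all add: quot_add)
  qed (auto simp: carrier_quot quot_add quot_zero)
qed (use F in \<open>auto simp: carrier_quot quot_add quot_smult vs_smult_add vs_smult_add_right vs_smult_smult\<close>)

lemma quot_proj_linear: "linear_map F (quot F I) (\<lambda>x. I +>\<^bsub>F\<^esub> x)"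
  by (rule linear_mapI) (auto simp: quot_add quot_smult carrier_quot)

text \<open>Elements of a quotient are sets of representatives and induced maps are written with
  \<open>the_elem\<close>; this is legitimate because \<open>g\<close> is constant on cosets once it
  kills \<open>I\<close>.\<close>

lemma the_elem_coset:
  assumes "complex_vector_space Z" "linear_map F Z g" "\<And>i. i \<in> I \<Longrightarrow> g i = \<zero>\<^bsub>Z\<^esub>" "x \<in> carrier F"
  shows "the_elem (g ` (I +>\<^bsub>F\<^esub> x)) = g x"
proof -
  have "g y = g x" if "y \<in> I +>\<^bsub>F\<^esub> x" for y
  proof -
    have y: "y \<in> carrier F" "y \<ominus>\<^bsub>F\<^esub> x \<in> I"
      using coset_mem[OF assms(4) that] coset_eq_iff assms(4) by auto
    have "g y \<ominus>\<^bsub>Z\<^esub> g x = \<zero>\<^bsub>Z\<^esub>"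
      using linear_map_minus[OF F assms(1,2) y(1) assms(4)] assms(3)[OF y(2)] by simp
    thus ?thesis using assms y by (simp add: linear_map_closed)
  qed
  hence "g ` (I +>\<^bsub>F\<^esub> x) = {g x}" using coset_self[OF assms(4)] by blast
  thus ?thesis by simp
qed

lemma quot_induced_linear:
  assumes "complex_vector_space Z" "linear_map F Z g" "\<And>i. i \<in> I \<Longrightarrow> g i = \<zero>\<^bsub>Z\<^esub>"
  shows "linear_map (quot F I) Z (\<lambda>Y. the_elem (g ` Y))"
  using F assms
  by (intro linear_mapI)
    (auto simp: carrier_quot quot_add quot_smult the_elem_coset linear_map_closed linear_map_add
      linear_map_smult)

end

lemma kernel_submodule:
  assumes "complex_vector_space V" "complex_vector_space Z" "linear_map V Z g"
  shows "submodule {x \<in> carrier V. g x = \<zero>\<^bsub>Z\<^esub>} complex_algebra V"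
proof -
  interpret module complex_algebra V by (rule assms(1))
  have "\<ominus>\<^bsub>V\<^esub> x = (- 1) \<odot>\<^bsub>V\<^esub> x" if "x \<in> carrier V" for x
    using vs_minus_eq[OF assms(1), of "\<zero>\<^bsub>V\<^esub>" x] that assms(1) by (simp add: a_minus_def)
  thus ?thesis
    using assms by (intro submoduleI) (auto simp: linear_map_zero linear_map_add linear_map_smult)
qed

section \<open>Complex algebras\<close>

definition complex_alg :: "(complex, 'a, 'm) module_scheme \<Rightarrow> bool" where
  "complex_alg B \<longleftrightarrow> ring B \<and> complex_vector_space B \<and>
     (\<forall>c. \<forall>x\<in>carrier B. \<forall>y\<in>carrier B.
        (c \<odot>\<^bsub>B\<^esub> x) \<otimes>\<^bsub>B\<^esub> y = c \<odot>\<^bsub>B\<^esub> (x \<otimes>\<^bsub>B\<^esub> y) \<and> x \<otimes>\<^bsub>B\<^esub> (c \<odot>\<^bsub>B\<^esub> y) = c \<odot>\<^bsub>B\<^esub> (x \<otimes>\<^bsub>B\<^esub> y))"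

definition alg_hom ::
    "(complex, 'a, 'm) module_scheme \<Rightarrow> (complex, 'b, 'n) module_scheme \<Rightarrow> ('a \<Rightarrow> 'b) \<Rightarrow> bool" where
  "alg_hom A B f \<longleftrightarrow> linear_map A B f \<and>
     (\<forall>x\<in>carrier A. \<forall>y\<in>carrier A. f (x \<otimes>\<^bsub>A\<^esub> y) = f x \<otimes>\<^bsub>B\<^esub> f y) \<and> f \<one>\<^bsub>A\<^esub> = \<one>\<^bsub>B\<^esub>"

lemma complex_alg_ring: "complex_alg B \<Longrightarrow> ring B"
  and complex_alg_vs [simp, intro]: "complex_alg B \<Longrightarrow> complex_vector_space B"
  and complex_alg_smult_left: "complex_alg B \<Longrightarrow> x \<in> carrier B \<Longrightarrow> y \<in> carrier B \<Longrightarrow>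
    (c \<odot>\<^bsub>B\<^esub> x) \<otimes>\<^bsub>B\<^esub> y = c \<odot>\<^bsub>B\<^esub> (x \<otimes>\<^bsub>B\<^esub> y)"
  and complex_alg_smult_right: "complex_alg B \<Longrightarrow> x \<in> carrier B \<Longrightarrow> y \<in> carrier B \<Longrightarrow>
    x \<otimes>\<^bsub>B\<^esub> (c \<odot>\<^bsub>B\<^esub> y) = c \<odot>\<^bsub>B\<^esub> (x \<otimes>\<^bsub>B\<^esub> y)"
  by (simp_all add: complex_alg_def)

context
  fixes B :: "(complex, 'a, 'm) module_scheme"
  assumes B: "complex_alg B"
begin
interpretation ring B by (rule complex_alg_ring[OF B])
lemma alg_mult_closed: "x \<in> carrier B \<Longrightarrow> y \<in> carrier B \<Longrightarrow> x \<otimes>\<^bsub>B\<^esub> y \<in> carrier B" by simp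
lemma alg_one_closed: "\<one>\<^bsub>B\<^esub> \<in> carrier B" by simp
lemma alg_assoc: "x \<in> carrier B \<Longrightarrow> y \<in> carrier B \<Longrightarrow> z \<in> carrier B \<Longrightarrow>
    x \<otimes>\<^bsub>B\<^esub> y \<otimes>\<^bsub>B\<^esub> z = x \<otimes>\<^bsub>B\<^esub> (y \<otimes>\<^bsub>B\<^esub> z)" by (rule m_assoc)
lemma alg_l_one: "x \<in> carrier B \<Longrightarrow> \<one>\<^bsub>B\<^esub> \<otimes>\<^bsub>B\<^esub> x = x" by simp
lemma alg_r_one: "x \<in> carrier B \<Longrightarrow> x \<otimes>\<^bsub>B\<^esub> \<one>\<^bsub>B\<^esub> = x" by simp
lemma alg_l_zero: "x \<in> carrier B \<Longrightarrow> \<zero>\<^bsub>B\<^esub> \<otimes>\<^bsub>B\<^esub> x = \<zero>\<^bsub>B\<^esub>" by simp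
lemma alg_r_zero: "x \<in> carrier B \<Longrightarrow> x \<otimes>\<^bsub>B\<^esub> \<zero>\<^bsub>B\<^esub> = \<zero>\<^bsub>B\<^esub>" by simp
lemma alg_l_distr: "x \<in> carrier B \<Longrightarrow> y \<in> carrier B \<Longrightarrow> z \<in> carrier B \<Longrightarrow>
    (x \<oplus>\<^bsub>B\<^esub> y) \<otimes>\<^bsub>B\<^esub> z = x \<otimes>\<^bsub>B\<^esub> z \<oplus>\<^bsub>B\<^esub> y \<otimes>\<^bsub>B\<^esub> z" by (rule l_distr)
lemma alg_r_distr: "x \<in> carrier B \<Longrightarrow> y \<in> carrier B \<Longrightarrow> z \<in> carrier B \<Longrightarrow>
    z \<otimes>\<^bsub>B\<^esub> (x \<oplus>\<^bsub>B\<^esub> y) = z \<otimes>\<^bsub>B\<^esub> x \<oplus>\<^bsub>B\<^esub> z \<otimes>\<^bsub>B\<^esub> y" by (rule r_distr)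
lemma alg_mult_left_linear: "y \<in> carrier B \<Longrightarrow> linear_map B B (\<lambda>x. x \<otimes>\<^bsub>B\<^esub> y)"
  using B by (intro linear_mapI) (auto simp: l_distr complex_alg_smult_left)
lemma alg_mult_right_linear: "y \<in> carrier B \<Longrightarrow> linear_map B B (\<lambda>x. y \<otimes>\<^bsub>B\<^esub> x)"
  using B by (intro linear_mapI) (auto simp: r_distr complex_alg_smult_right)
end

lemmas alg_closed [simp, intro] = alg_mult_closed alg_one_closed
lemmas alg_simps [simp] = alg_l_one alg_r_one alg_l_zero alg_r_zero

lemma complex_algI:
  assumes V: "complex_vector_space B"
    and "\<And>x y. x \<in> carrier B \<Longrightarrow> y \<in> carrier B \<Longrightarrow> x \<otimes>\<^bsub>B\<^esub> y \<in> carrier B"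
    and "\<one>\<^bsub>B\<^esub> \<in> carrier B"
    and "\<And>x y z. x \<in> carrier B \<Longrightarrow> y \<in> carrier B \<Longrightarrow> z \<in> carrier B \<Longrightarrow>
      x \<otimes>\<^bsub>B\<^esub> y \<otimes>\<^bsub>B\<^esub> z = x \<otimes>\<^bsub>B\<^esub> (y \<otimes>\<^bsub>B\<^esub> z)"
    and "\<And>x. x \<in> carrier B \<Longrightarrow> \<one>\<^bsub>B\<^esub> \<otimes>\<^bsub>B\<^esub> x = x"
    and "\<And>x. x \<in> carrier B \<Longrightarrow> x \<otimes>\<^bsub>B\<^esub> \<one>\<^bsub>B\<^esub> = x"
    and l: "\<And>y. y \<in> carrier B \<Longrightarrow> linear_map B B (\<lambda>x. x \<otimes>\<^bsub>B\<^esub> y)"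
    and r: "\<And>y. y \<in> carrier B \<Longrightarrow> linear_map B B (\<lambda>x. y \<otimes>\<^bsub>B\<^esub> x)"
  shows "complex_alg B"
  unfolding complex_alg_def
proof (intro conjI allI ballI)
  show "ring B"
  proof (rule ringI)
    show "Group.monoid B" by (rule monoidI) (use assms(2-6) in auto)
  qed (use assms vs_abelian_group[OF V] linear_map_add[OF l] linear_map_add[OF r] in auto)
qed (use V linear_map_smult[OF l] linear_map_smult[OF r] in auto)

lemma complex_alg_cong:
  fixes A :: "(complex, 'a, 'm) module_scheme" and B :: "(complex, 'a, 'n) module_scheme"
  assumes "complex_alg A" and "carrier B = carrier A" and "ring.add B = ring.add A"
    and "\<zero>\<^bsub>B\<^esub> = \<zero>\<^bsub>A\<^esub>" and "smult B = smult A" and "monoid.mult B = monoid.mult A" and "\<one>\<^bsub>B\<^esub> = \<one>\<^bsub>A\<^esub>"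
  shows "complex_alg B"
proof (rule complex_algI)
  show "complex_vector_space B"
    by (rule vs_cong[of A]) (use assms in auto)
qed (use assms(1) alg_mult_left_linear[OF assms(1)] alg_mult_right_linear[OF assms(1)] in
    \<open>auto simp: assms(2-) alg_assoc linear_map_def\<close>)

lemma alg_hom_linear: "alg_hom A B f \<Longrightarrow> linear_map A B f"
  and alg_hom_mult: "alg_hom A B f \<Longrightarrow> x \<in> carrier A \<Longrightarrow> y \<in> carrier A \<Longrightarrow> f (x \<otimes>\<^bsub>A\<^esub> y) = f x \<otimes>\<^bsub>B\<^esub> f y"
  and alg_hom_one: "alg_hom A B f \<Longrightarrow> f \<one>\<^bsub>A\<^esub> = \<one>\<^bsub>B\<^esub>"
  by (simp_all add: alg_hom_def)

lemma alg_hom_closed: "alg_hom A B f \<Longrightarrow> x \<in> carrier A \<Longrightarrow> f x \<in> carrier B"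
  using linear_map_closed[OF alg_hom_linear] .

lemma alg_hom_comp: "alg_hom A B f \<Longrightarrow> alg_hom B C g \<Longrightarrow> alg_hom A C (\<lambda>x. g (f x))"
  by (auto simp: alg_hom_def linear_map_closed intro: linear_map_comp)

lemma alg_hom_id: "alg_hom A A (\<lambda>x. x)" "alg_hom A A id"
  by (simp_all add: alg_hom_def linear_map_id)

context
  fixes F :: "(complex, 'a, 'm) module_scheme" and I :: "'a set"
  assumes F: "complex_alg F" and I: "ideal I F"
begin

interpretation I: ideal I F by (rule I)

text \<open>A scalar \<open>c\<close> acts as multiplication by \<open>c 1\<close>, so absorbing
  products already means absorbing scalars.\<close>

lemma ideal_submodule: "submodule I complex_algebra F"
proof -
  have "c \<odot>\<^bsub>F\<^esub> x \<in> I" if "x \<in> I" for c x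
  proof -
    have x: "x \<in> carrier F" using that by auto
    have "c \<odot>\<^bsub>F\<^esub> x = (c \<odot>\<^bsub>F\<^esub> \<one>\<^bsub>F\<^esub>) \<otimes>\<^bsub>F\<^esub> x"
      using F x by (simp add: complex_alg_smult_left)
    thus ?thesis using that F by (metis I.I_l_closed alg_one_closed complex_alg_vs vs_smult_closed)
  qed
  thus ?thesis
    by (intro submodule.intro submodule_axioms.intro I.a_subgroup) auto
qed

lemma quot_mult:
  "x \<in> carrier F \<Longrightarrow> y \<in> carrier F \<Longrightarrow> (I +>\<^bsub>F\<^esub> x) \<otimes>\<^bsub>quot F I\<^esub> (I +>\<^bsub>F\<^esub> y) = I +>\<^bsub>F\<^esub> (x \<otimes>\<^bsub>F\<^esub> y)"
  by (simp add: quot_fields FactRing_def I.rcoset_mult_add)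

lemma quot_one: "\<one>\<^bsub>quot F I\<^esub> = I +>\<^bsub>F\<^esub> \<one>\<^bsub>F\<^esub>"
  by (simp add: quot_fields FactRing_def)

lemma quot_alg: "complex_alg (quot F I)"
  using F complex_alg_vs[OF F] ideal_submodule
  by (intro complex_algI quot_vs linear_mapI)
    (auto simp: carrier_quot quot_mult quot_add quot_smult quot_one alg_assoc alg_l_distr
      alg_r_distr complex_alg_smult_left complex_alg_smult_right)

lemma quot_proj_hom: "alg_hom F (quot F I) (\<lambda>x. I +>\<^bsub>F\<^esub> x)"
  using complex_alg_vs[OF F] ideal_submodule
  by (simp add: alg_hom_def quot_proj_linear quot_mult quot_one)

end

lemma kernel_ideal:
  assumes "complex_alg A" "complex_alg B" "alg_hom A B f"
  shows "ideal {x \<in> carrier A. f x = \<zero>\<^bsub>B\<^esub>} A"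
proof (rule idealI)
  show "ring A" using assms by (simp add: complex_alg_ring)
  have "submodule {x \<in> carrier A. f x = \<zero>\<^bsub>B\<^esub>} complex_algebra A"
    using assms by (intro kernel_submodule alg_hom_linear) auto
  thus "subgroup {x \<in> carrier A. f x = \<zero>\<^bsub>B\<^esub>} (add_monoid A)"
    by (rule submodule.axioms)
qed (use assms in \<open>auto simp: alg_hom_mult alg_hom_closed\<close>)

subsection \<open>Presented algebras\<close>

lemma free_algebra_space: "free_space {w. set (letters w) \<subseteq> G} (free_algebra G)"
  by (auto simp: free_space_def free_algebra_def)

lemma letters_plus [simp]: "letters (v + w) = letters v @ letters w"
  by (simp add: plus_word_def)

lemma letters_zero [simp]: "letters 0 = []"
  by (simp add: zero_word_def)

lemma scale_conv_mult: "scale c (f :: 'b::monoid_add \<Rightarrow>\<^sub>0 complex) = Poly_Mapping.single 0 c * f"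
  unfolding scale_def by (rule mult_map_scale_conv_mult)

text \<open>Concatenation is not commutative, so no commutative ring law applies. The empty word is
  neutral on both sides, which settles the claim on basis vectors.\<close>

lemma single_zero_commute:
  "f * Poly_Mapping.single 0 c = Poly_Mapping.single 0 c * (f :: 'b::monoid_add \<Rightarrow>\<^sub>0 complex)"
proof -
  \<comment> \<open>The whole function type, packaged as a record so that equality on basis vectors
    becomes applicable.\<close>
  define F :: "(complex, 'b \<Rightarrow>\<^sub>0 complex) module" where
    "F = \<lparr>carrier = UNIV, monoid.mult = (*), one = 1, ring.zero = 0, ring.add = (+), smult = scale\<rparr>"
  have F: "free_space UNIV F" by (simp add: free_space_def F_def)
  have l: "linear_map F F (\<lambda>f. f * Poly_Mapping.single 0 c)"
    by (rule linear_mapI) (auto simp: F_def scale_conv_mult algebra_simps)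
  have r: "linear_map F F (\<lambda>f. Poly_Mapping.single 0 c * f)"
    by (rule linear_mapI)
      (auto simp: F_def scale_conv_mult distrib_left mult_single mult.commute simp flip: mult.assoc)
  have "f \<in> carrier F" by (simp add: F_def)
  from free_space_linear_eq[OF F free_space_vs[OF F] l r _ this] show ?thesis
    by (simp add: mult_single)
qed

lemma scale_mult_left: "scale c f * (g :: 'b::monoid_add \<Rightarrow>\<^sub>0 complex) = scale c (f * g)"
  and scale_mult_right: "f * scale c g = scale c (f * g)"
  by (simp_all add: scale_conv_mult mult.assoc) (simp add: single_zero_commute flip: mult.assoc)

lemma free_algebra_simps [simp]:
  "x \<otimes>\<^bsub>free_algebra G\<^esub> y = x * y" "\<one>\<^bsub>free_algebra G\<^esub> = 1" "\<zero>\<^bsub>free_algebra G\<^esub> = 0"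
  "x \<oplus>\<^bsub>free_algebra G\<^esub> y = x + y" "c \<odot>\<^bsub>free_algebra G\<^esub> x = scale c x"
  by (simp_all add: free_algebra_def)

lemma free_algebra_carrier:
  "x \<in> carrier (free_algebra G) \<longleftrightarrow> (\<forall>w\<in>Poly_Mapping.keys x. set (letters w) \<subseteq> G)"
  by (simp add: free_algebra_def)

lemma free_algebra_mult_closed:
  assumes "x \<in> carrier (free_algebra G)" "y \<in> carrier (free_algebra G)"
  shows "x * y \<in> carrier (free_algebra G)"
  using assms keys_mult[of x y] unfolding free_algebra_carrier by fastforce

lemma free_algebra_alg: "complex_alg (free_algebra G)"
  using free_space_vs[OF free_algebra_space, of G]
  by (intro complex_algI linear_mapI)
    (auto simp: free_algebra_mult_closed algebra_simps scale_mult_left scale_mult_right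
      free_algebra_carrier[of 1])

lemma free_algebra_closed [intro]:
  "x \<in> carrier (free_algebra G) \<Longrightarrow> y \<in> carrier (free_algebra G) \<Longrightarrow> x + y \<in> carrier (free_algebra G)"
  "x \<in> carrier (free_algebra G) \<Longrightarrow> y \<in> carrier (free_algebra G) \<Longrightarrow> x - y \<in> carrier (free_algebra G)"
  "x \<in> carrier (free_algebra G) \<Longrightarrow> y \<in> carrier (free_algebra G) \<Longrightarrow> x * y \<in> carrier (free_algebra G)"
  "x \<in> carrier (free_algebra G) \<Longrightarrow> scale c x \<in> carrier (free_algebra G)"
  "0 \<in> carrier (free_algebra G)" "1 \<in> carrier (free_algebra G)"
  using alg_mult_closed[OF free_algebra_alg, of x G y] alg_one_closed[OF free_algebra_alg, of G]
    vs_add_closed[OF complex_alg_vs[OF free_algebra_alg], of x G y]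
    vs_minus_closed[OF complex_alg_vs[OF free_algebra_alg], of x G y]
    vs_smult_closed[OF complex_alg_vs[OF free_algebra_alg], of x G c]
    vs_zero_closed[OF complex_alg_vs[OF free_algebra_alg], of G]
    free_space_minus[OF free_algebra_space, of x G y]
  by auto

lemma free_algebra_sum_closed [intro]:
  "(\<And>i. i \<in> A \<Longrightarrow> f i \<in> carrier (free_algebra G)) \<Longrightarrow> sum f A \<in> carrier (free_algebra G)"
  by (induction A rule: infinite_finite_induct) auto

lemma gen_closed [intro]: "g \<in> G \<Longrightarrow> gen g \<in> carrier (free_algebra G)"
  by (simp add: free_algebra_carrier gen_def)

lemma gen_mult_single: "gen g * Poly_Mapping.single (Word gs) 1 = Poly_Mapping.single (Word (g # gs)) 1"
  by (simp add: gen_def mult_single plus_word_def)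

lemma single_Nil: "Poly_Mapping.single (Word []) 1 = 1"
  by (simp add: single_one flip: zero_word_def)

text \<open>Uniqueness in the universal property: multiplicativity carries agreement from generators
  to words, linearity from words to all elements.\<close>

lemma free_algebra_hom_eq:
  assumes "complex_alg B" "alg_hom (free_algebra G) B f" "alg_hom (free_algebra G) B g"
    and "\<And>x. x \<in> G \<Longrightarrow> f (gen x) = g (gen x)" and "y \<in> carrier (free_algebra G)"
  shows "f y = g y"
proof (rule free_space_linear_eq[OF free_algebra_space _ _ _ _ assms(5)])
  fix w assume "w \<in> {w. set (letters w) \<subseteq> G}"
  moreover have "set gs \<subseteq> G \<Longrightarrow> f (Poly_Mapping.single (Word gs) 1) = g (Poly_Mapping.single (Word gs) 1)" for gs
  proof (induction gs)
    case Nil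
    thus ?case using alg_hom_one[OF assms(2)] alg_hom_one[OF assms(3)] by (simp add: single_Nil)
  next
    case (Cons x gs)
    have "gen x \<in> carrier (free_algebra G)" "Poly_Mapping.single (Word gs) 1 \<in> carrier (free_algebra G)"
      using Cons.prems by (auto simp: free_algebra_carrier gen_def)
    thus ?case using Cons assms(4)[of x]
        alg_hom_mult[OF assms(2), of "gen x" "Poly_Mapping.single (Word gs) 1"]
        alg_hom_mult[OF assms(3), of "gen x" "Poly_Mapping.single (Word gs) 1"]
      by (simp add: gen_mult_single)
  qed
  ultimately show "f (Poly_Mapping.single w 1) = g (Poly_Mapping.single w 1)"
    by (cases w) auto
qed (use assms in \<open>auto simp: alg_hom_linear\<close>)

lemma free_eval_conv_lin_ext:
  "free_eval B \<phi> = lin_ext B (\<lambda>w. foldr (\<lambda>g b. \<phi> g \<otimes>\<^bsub>B\<^esub> b) (letters w) \<one>\<^bsub>B\<^esub>)"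
  by (rule ext) (simp add: free_eval_def lin_ext_def)

section \<open>Evaluation of free algebras\<close>

context
  fixes B :: "(complex, 'b, 'm) module_scheme" and G :: "'g set" and \<phi> :: "'g \<Rightarrow> 'b"
  assumes B: "complex_alg B" and \<phi>: "\<And>g. g \<in> G \<Longrightarrow> \<phi> g \<in> carrier B"
begin

abbreviation (input) "word_eval gs \<equiv> foldr (\<lambda>g b. \<phi> g \<otimes>\<^bsub>B\<^esub> b) gs \<one>\<^bsub>B\<^esub>"

lemma word_eval_closed: "set gs \<subseteq> G \<Longrightarrow> word_eval gs \<in> carrier B"
  by (induction gs) (use B \<phi> in auto)

lemma word_eval_append: "set gs \<subseteq> G \<Longrightarrow> set hs \<subseteq> G \<Longrightarrow> word_eval (gs @ hs) = word_eval gs \<otimes>\<^bsub>B\<^esub> word_eval hs"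
  by (induction gs) (use B \<phi> word_eval_closed in \<open>auto simp: alg_assoc\<close>)

lemma free_eval_linear: "linear_map (free_algebra G) B (free_eval B \<phi>)"
  unfolding free_eval_conv_lin_ext
  by (rule lin_ext_linear[OF free_algebra_space]) (use B word_eval_closed in auto)

lemma free_eval_single:
  "set gs \<subseteq> G \<Longrightarrow> free_eval B \<phi> (Poly_Mapping.single (Word gs) c) = c \<odot>\<^bsub>B\<^esub> word_eval gs"
  unfolding free_eval_conv_lin_ext
  by (subst lin_ext_single) (use B word_eval_closed in auto)

lemma free_eval_gen: "g \<in> G \<Longrightarrow> free_eval B \<phi> (gen g) = \<phi> g"
  unfolding gen_def by (subst free_eval_single) (use B \<phi> in auto)

text \<open>Both sides of multiplicativity are linear in each factor, so two words suffice, and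
  there evaluation turns concatenation into the product.\<close>

lemma free_eval_hom: "alg_hom (free_algebra G) B (free_eval B \<phi>)"
  unfolding alg_hom_def
proof (intro conjI ballI)
  note lin = free_eval_linear
  note V = complex_alg_vs[OF B]
  fix x y assume x: "x \<in> carrier (free_algebra G)" and y: "y \<in> carrier (free_algebra G)"
  have right: "linear_map (free_algebra G) (free_algebra G) (\<lambda>y. x * y)" if "x \<in> carrier (free_algebra G)" for x
    using alg_mult_right_linear[OF free_algebra_alg that] by simp
  have left: "linear_map (free_algebra G) (free_algebra G) (\<lambda>x. x * y)"
    using alg_mult_left_linear[OF free_algebra_alg y] by simp
  show "free_eval B \<phi> (x \<otimes>\<^bsub>free_algebra G\<^esub> y) = free_eval B \<phi> x \<otimes>\<^bsub>B\<^esub> free_eval B \<phi> y"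
    unfolding free_algebra_simps
  proof (rule free_space_linear_eq[OF free_algebra_space V _ _ _ x])
    show "linear_map (free_algebra G) B (\<lambda>x. free_eval B \<phi> (x * y))"
      by (rule linear_map_comp[OF left lin])
    show "linear_map (free_algebra G) B (\<lambda>x. free_eval B \<phi> x \<otimes>\<^bsub>B\<^esub> free_eval B \<phi> y)"
      by (rule linear_map_comp[OF lin alg_mult_left_linear[OF B]]) (rule linear_map_closed[OF lin y])
    fix v :: "'g word" assume v: "v \<in> {w. set (letters w) \<subseteq> G}"
    let ?v = "Poly_Mapping.single v (1 :: complex)"
    have v': "?v \<in> carrier (free_algebra G)" using v by (simp add: free_algebra_carrier)
    show "free_eval B \<phi> (?v * y) = free_eval B \<phi> ?v \<otimes>\<^bsub>B\<^esub> free_eval B \<phi> y"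
    proof (rule free_space_linear_eq[OF free_algebra_space V _ _ _ y])
      show "linear_map (free_algebra G) B (\<lambda>y. free_eval B \<phi> (?v * y))"
        by (rule linear_map_comp[OF right[OF v'] lin])
      show "linear_map (free_algebra G) B (\<lambda>y. free_eval B \<phi> ?v \<otimes>\<^bsub>B\<^esub> free_eval B \<phi> y)"
        by (rule linear_map_comp[OF lin alg_mult_right_linear[OF B]]) (rule linear_map_closed[OF lin v'])
      fix w :: "'g word" assume w: "w \<in> {w. set (letters w) \<subseteq> G}"
      obtain gs hs where gs: "v = Word gs" and hs: "w = Word hs" by (cases v; cases w) auto
      show "free_eval B \<phi> (?v * Poly_Mapping.single w 1) = free_eval B \<phi> ?v \<otimes>\<^bsub>B\<^esub> free_eval B \<phi> (Poly_Mapping.single w 1)"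
        using v w word_eval_append[of gs hs] word_eval_closed[of gs] word_eval_closed[of hs] V B
        unfolding gs hs by (simp add: mult_single plus_word_def free_eval_single del: foldr_append)
    qed
  qed
next
  show "free_eval B \<phi> \<one>\<^bsub>free_algebra G\<^esub> = \<one>\<^bsub>B\<^esub>"
    using free_eval_single[of "[]" 1] B by (simp add: single_Nil)
qed (rule free_eval_linear)

end

lemma free_eval_cong:
  assumes "complex_alg B" "\<And>g. g \<in> G \<Longrightarrow> \<phi> g \<in> carrier B" "\<And>g. g \<in> G \<Longrightarrow> \<phi> g = \<psi> g"
    and "x \<in> carrier (free_algebra G)"
  shows "free_eval B \<phi> x = free_eval B \<psi> x"
  by (rule free_algebra_hom_eq[OF assms(1) free_eval_hom free_eval_hom _ assms(4)])
    (use assms in \<open>auto simp: free_eval_gen[where G = G]\<close>)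

section \<open>Quotients by the ideal of relators\<close>

context
  fixes G :: "'g set" and R :: "'g free set"
  assumes R: "R \<subseteq> carrier (free_algebra G)"
begin

lemma relators_ideal: "ideal (Idl\<^bsub>free_algebra G\<^esub> R) (free_algebra G)"
  by (rule ring.genideal_ideal[OF complex_alg_ring[OF free_algebra_alg] R])

lemma presented_alg: "complex_alg (presented_algebra G R)"
  unfolding presented_algebra_def by (rule quot_alg[OF free_algebra_alg relators_ideal])

lemma presented_proj_hom:
  "alg_hom (free_algebra G) (presented_algebra G R) (\<lambda>x. Idl\<^bsub>free_algebra G\<^esub> R +>\<^bsub>free_algebra G\<^esub> x)"
  unfolding presented_algebra_def by (rule quot_proj_hom[OF free_algebra_alg relators_ideal])

lemma presented_gen_closed: "g \<in> G \<Longrightarrow> presented_gen G R g \<in> carrier (presented_algebra G R)"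
  unfolding presented_gen_def by (rule alg_hom_closed[OF presented_proj_hom]) auto

lemma presented_carrierE:
  assumes "y \<in> carrier (presented_algebra G R)"
  obtains x where "x \<in> carrier (free_algebra G)" "y = Idl\<^bsub>free_algebra G\<^esub> R +>\<^bsub>free_algebra G\<^esub> x"
  using assms carrier_quot[OF complex_alg_vs[OF free_algebra_alg] ideal_submodule[OF free_algebra_alg relators_ideal]]
  unfolding presented_algebra_def by auto

lemma presented_relator:
  assumes "r \<in> R" shows "Idl\<^bsub>free_algebra G\<^esub> R +>\<^bsub>free_algebra G\<^esub> r = \<zero>\<^bsub>presented_algebra G R\<^esub>"
proof -
  note I = ideal_submodule[OF free_algebra_alg relators_ideal]
  note F = complex_alg_vs[OF free_algebra_alg]
  have "r \<in> Idl\<^bsub>free_algebra G\<^esub> R"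
    using ring.genideal_self[OF complex_alg_ring[OF free_algebra_alg] R] assms by blast
  moreover have "r \<in> carrier (free_algebra G)" using R assms by blast
  moreover have "r \<ominus>\<^bsub>free_algebra G\<^esub> 0 = r"
    using free_space_minus[OF free_algebra_space, of r G 0] \<open>r \<in> carrier _\<close> by auto
  ultimately show ?thesis
    unfolding presented_algebra_def quot_zero[OF F I]
    by (subst coset_eq_iff[OF F I]) auto
qed

lemma presented_eval:
  assumes "x \<in> carrier (free_algebra G)"
  shows "free_eval (presented_algebra G R) (presented_gen G R) x = Idl\<^bsub>free_algebra G\<^esub> R +>\<^bsub>free_algebra G\<^esub> x"
  by (rule free_algebra_hom_eq[OF presented_alg free_eval_hom presented_proj_hom _ assms])
    (auto simp: presented_alg presented_gen_closed free_eval_gen[where G = G] simp flip: presented_gen_def)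

lemma presented_hom_eq:
  assumes "complex_alg B" "alg_hom (presented_algebra G R) B f" "alg_hom (presented_algebra G R) B g"
    and "\<And>x. x \<in> G \<Longrightarrow> f (presented_gen G R x) = g (presented_gen G R x)"
    and "y \<in> carrier (presented_algebra G R)"
  shows "f y = g y"
proof -
  obtain x where x: "x \<in> carrier (free_algebra G)" "y = Idl\<^bsub>free_algebra G\<^esub> R +>\<^bsub>free_algebra G\<^esub> x"
    using presented_carrierE[OF assms(5)] .
  show ?thesis unfolding x(2)
    by (rule free_algebra_hom_eq[OF assms(1) alg_hom_comp[OF presented_proj_hom assms(2)]
          alg_hom_comp[OF presented_proj_hom assms(3)] _ x(1)])
      (use assms(4) in \<open>auto simp: presented_gen_def\<close>)
qed

context
  fixes B :: "(complex, 'b, 'm) module_scheme" and \<phi> :: "'g \<Rightarrow> 'b"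
  assumes B: "complex_alg B" and \<phi>: "\<And>g. g \<in> G \<Longrightarrow> \<phi> g \<in> carrier B"
    and rel: "\<And>r. r \<in> R \<Longrightarrow> free_eval B \<phi> r = \<zero>\<^bsub>B\<^esub>"
begin

text \<open>The kernel of the evaluation is an ideal containing \<open>R\<close>, and the generated
  ideal is the least one.\<close>

lemma free_eval_relators_ideal:
  assumes "i \<in> Idl\<^bsub>free_algebra G\<^esub> R" shows "free_eval B \<phi> i = \<zero>\<^bsub>B\<^esub>"
proof -
  have "Idl\<^bsub>free_algebra G\<^esub> R \<subseteq> {x \<in> carrier (free_algebra G). free_eval B \<phi> x = \<zero>\<^bsub>B\<^esub>}"
    by (rule ring.genideal_minimal[OF complex_alg_ring[OF free_algebra_alg]
          kernel_ideal[OF free_algebra_alg B free_eval_hom]])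
      (use R B \<phi> rel in auto)
  thus ?thesis using assms by auto
qed

lemma presented_hom_coset:
  "x \<in> carrier (free_algebra G) \<Longrightarrow>
   presented_hom B \<phi> (Idl\<^bsub>free_algebra G\<^esub> R +>\<^bsub>free_algebra G\<^esub> x) = free_eval B \<phi> x"
  unfolding presented_hom_def
  by (rule the_elem_coset[OF complex_alg_vs[OF free_algebra_alg] ideal_submodule[OF free_algebra_alg relators_ideal]
        complex_alg_vs[OF B] alg_hom_linear[OF free_eval_hom]])
    (use B \<phi> free_eval_relators_ideal in auto)

lemma presented_hom_gen: "g \<in> G \<Longrightarrow> presented_hom B \<phi> (presented_gen G R g) = \<phi> g"
  unfolding presented_gen_def
  by (subst presented_hom_coset) (auto intro!: free_eval_gen[where G = G] B \<phi>)

lemma presented_hom_hom: "alg_hom (presented_algebra G R) B (presented_hom B \<phi>)"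
proof -
  note hom = presented_proj_hom and ev = free_eval_hom[OF B \<phi>]
  have "alg_hom (presented_algebra G R) B (presented_hom B \<phi>)" if "\<And>g. g \<in> G \<Longrightarrow> \<phi> g \<in> carrier B"
    unfolding alg_hom_def
  proof (intro conjI linear_mapI ballI allI)
    fix y z c assume "y \<in> carrier (presented_algebra G R)"
    then obtain x where x: "x \<in> carrier (free_algebra G)" "y = Idl\<^bsub>free_algebra G\<^esub> R +>\<^bsub>free_algebra G\<^esub> x"
      by (rule presented_carrierE)
    show "presented_hom B \<phi> y \<in> carrier B"
      using x by (simp add: presented_hom_coset alg_hom_closed[OF ev])
    have "c \<odot>\<^bsub>presented_algebra G R\<^esub> y = Idl\<^bsub>free_algebra G\<^esub> R +>\<^bsub>free_algebra G\<^esub> (scale c x)"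
      using linear_map_smult[OF alg_hom_linear[OF hom] x(1), where c = c] x(2) by simp
    thus "presented_hom B \<phi> (c \<odot>\<^bsub>presented_algebra G R\<^esub> y) = c \<odot>\<^bsub>B\<^esub> presented_hom B \<phi> y"
      using x linear_map_smult[OF alg_hom_linear[OF ev] x(1), where c = c]
      by (simp add: presented_hom_coset free_algebra_closed)
    assume "z \<in> carrier (presented_algebra G R)"
    then obtain x' where x': "x' \<in> carrier (free_algebra G)" "z = Idl\<^bsub>free_algebra G\<^esub> R +>\<^bsub>free_algebra G\<^esub> x'"
      by (rule presented_carrierE)
    have "y \<oplus>\<^bsub>presented_algebra G R\<^esub> z = Idl\<^bsub>free_algebra G\<^esub> R +>\<^bsub>free_algebra G\<^esub> (x + x')"
      using linear_map_add[OF alg_hom_linear[OF hom] x(1) x'(1)] x(2) x'(2) by simp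
    thus "presented_hom B \<phi> (y \<oplus>\<^bsub>presented_algebra G R\<^esub> z) = presented_hom B \<phi> y \<oplus>\<^bsub>B\<^esub> presented_hom B \<phi> z"
      using x x' linear_map_add[OF alg_hom_linear[OF ev] x(1) x'(1)]
      by (simp add: presented_hom_coset free_algebra_closed)
    have "y \<otimes>\<^bsub>presented_algebra G R\<^esub> z = Idl\<^bsub>free_algebra G\<^esub> R +>\<^bsub>free_algebra G\<^esub> (x * x')"
      using alg_hom_mult[OF hom x(1) x'(1)] x(2) x'(2) by simp
    thus "presented_hom B \<phi> (y \<otimes>\<^bsub>presented_algebra G R\<^esub> z) = presented_hom B \<phi> y \<otimes>\<^bsub>B\<^esub> presented_hom B \<phi> z"
      using x x' alg_hom_mult[OF ev x(1) x'(1)]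
      by (simp add: presented_hom_coset free_algebra_closed)
  next
    have "\<one>\<^bsub>presented_algebra G R\<^esub> = Idl\<^bsub>free_algebra G\<^esub> R +>\<^bsub>free_algebra G\<^esub> 1"
      using alg_hom_one[OF hom] by simp
    thus "presented_hom B \<phi> \<one>\<^bsub>presented_algebra G R\<^esub> = \<one>\<^bsub>B\<^esub>"
      using alg_hom_one[OF ev] by (simp add: presented_hom_coset free_algebra_closed)
  qed
  thus ?thesis using \<phi> .
qed

end

end

section \<open>Tensor products\<close>

definition bilinear ::
    "(complex, 'a, 'l) module_scheme \<Rightarrow> (complex, 'b, 'm) module_scheme \<Rightarrow>
     (complex, 'c, 'n) module_scheme \<Rightarrow> ('a \<Rightarrow> 'b \<Rightarrow> 'c) \<Rightarrow> bool" where
  "bilinear V W Z h \<longleftrightarrow> (\<forall>w\<in>carrier W. linear_map V Z (\<lambda>v. h v w)) \<and> (\<forall>v\<in>carrier V. linear_map W Z (h v))"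

lemma bilinearI:
  assumes "\<And>w. w \<in> carrier W \<Longrightarrow> linear_map V Z (\<lambda>v. h v w)"
    and "\<And>v. v \<in> carrier V \<Longrightarrow> linear_map W Z (\<lambda>w. h v w)"
  shows "bilinear V W Z h"
  using assms by (simp add: bilinear_def)

lemma bilinear_left: "bilinear V W Z h \<Longrightarrow> w \<in> carrier W \<Longrightarrow> linear_map V Z (\<lambda>v. h v w)"
  and bilinear_right: "bilinear V W Z h \<Longrightarrow> v \<in> carrier V \<Longrightarrow> linear_map W Z (\<lambda>w. h v w)"
  by (simp_all add: bilinear_def)

lemma bilinear_closed:
  "bilinear V W Z h \<Longrightarrow> v \<in> carrier V \<Longrightarrow> w \<in> carrier W \<Longrightarrow> h v w \<in> carrier Z"
  by (rule linear_map_closed[OF bilinear_left])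

lemma bilinear_comp:
  assumes h: "bilinear V W Z h" and f: "linear_map V' V f" and g: "linear_map W' W g"
  shows "bilinear V' W' Z (\<lambda>v w. h (f v) (g w))"
  using linear_map_comp[OF f bilinear_left[OF h linear_map_closed[OF g]]]
    linear_map_comp[OF g bilinear_right[OF h linear_map_closed[OF f]]]
  by (intro bilinearI)

lemma bilinear_comp_linear:
  assumes h: "bilinear V W Z h" and f: "linear_map Z Z' f"
  shows "bilinear V W Z' (\<lambda>v w. f (h v w))"
  using linear_map_comp[OF bilinear_left[OF h] f] linear_map_comp[OF bilinear_right[OF h] f]
  by (intro bilinearI)

text \<open>Here linearity concerns a parameter of the vectors \<open>h p\<close> and not the
  coefficients \<open>f\<close>; the right factor of a product in a pair space enters in this
  way.\<close>

lemma linear_map_lin_ext_param: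
  assumes "complex_vector_space Z" "\<And>p. p \<in> Poly_Mapping.keys f \<Longrightarrow> linear_map E Z (h p)"
    and E: "complex_vector_space E"
  shows "linear_map E Z (\<lambda>x. lin_ext Z (\<lambda>p. h p x) f)"
proof -
  have "A \<subseteq> Poly_Mapping.keys f \<Longrightarrow> linear_map E Z (\<lambda>x. \<Oplus>\<^bsub>Z\<^esub>p\<in>A. Poly_Mapping.lookup f p \<odot>\<^bsub>Z\<^esub> h p x)"
    if "finite A" for A
    using that
  proof (induction A rule: finite_induct)
    case empty
    thus ?case using assms(1) by (simp add: linear_map_const_zero)
  next
    case (insert a A)
    have "linear_map E Z (\<lambda>x. Poly_Mapping.lookup f a \<odot>\<^bsub>Z\<^esub> h a x \<oplus>\<^bsub>Z\<^esub>
        (\<Oplus>\<^bsub>Z\<^esub>p\<in>A. Poly_Mapping.lookup f p \<odot>\<^bsub>Z\<^esub> h p x))"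
      using insert assms by (intro linear_map_add_maps linear_map_smult_const) auto
    moreover have "(\<Oplus>\<^bsub>Z\<^esub>p\<in>insert a A. Poly_Mapping.lookup f p \<odot>\<^bsub>Z\<^esub> h p x) =
        Poly_Mapping.lookup f a \<odot>\<^bsub>Z\<^esub> h a x \<oplus>\<^bsub>Z\<^esub> (\<Oplus>\<^bsub>Z\<^esub>p\<in>A. Poly_Mapping.lookup f p \<odot>\<^bsub>Z\<^esub> h p x)"
      if "x \<in> carrier E" for x
    proof -
      have "h p x \<in> carrier Z" if "p \<in> insert a A" for p
        using linear_map_closed[OF assms(2) \<open>x \<in> carrier E\<close>] that insert.prems by blast
      thus ?thesis using insert assms(1) by (intro vs_finsum_insert) auto
    qed
    ultimately show ?case
      by (rule linear_map_cong_fun[OF E])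
  qed
  thus ?thesis unfolding lin_ext_def by simp
qed

context
  fixes V :: "(complex, 'a, 'm) module_scheme" and W :: "(complex, 'b, 'n) module_scheme"
begin

lemma pair_space_free: "free_space (carrier V \<times> carrier W) (pair_space V W)"
  by (auto simp: free_space_def pair_space_def)

lemmas pair_space_vs = free_space_vs[OF pair_space_free]
lemmas pair_spaceD = free_spaceD[OF pair_space_free]

lemma pair_space_single [intro]:
  "v \<in> carrier V \<Longrightarrow> w \<in> carrier W \<Longrightarrow> Poly_Mapping.single (v, w) c \<in> carrier (pair_space V W)"
  using free_space_single[OF pair_space_free] by blast

lemma pair_space_closed [intro]:
  "x \<in> carrier (pair_space V W) \<Longrightarrow> y \<in> carrier (pair_space V W) \<Longrightarrow> x + y \<in> carrier (pair_space V W)"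
  "x \<in> carrier (pair_space V W) \<Longrightarrow> y \<in> carrier (pair_space V W) \<Longrightarrow> x - y \<in> carrier (pair_space V W)"
  "x \<in> carrier (pair_space V W) \<Longrightarrow> scale c x \<in> carrier (pair_space V W)"
  "0 \<in> carrier (pair_space V W)"
  using vs_add_closed[OF pair_space_vs, of x y] vs_smult_closed[OF pair_space_vs, of x c]
    vs_minus_closed[OF pair_space_vs, of x y] vs_zero_closed[OF pair_space_vs]
    free_space_minus[OF pair_space_free, of x y]
  by (auto simp: pair_spaceD)

lemma relatorsE:
  assumes "r \<in> bilinear_relators V W"
  obtains x y z where "x \<in> carrier V" "y \<in> carrier V" "z \<in> carrier W"
      "r = Poly_Mapping.single (x \<oplus>\<^bsub>V\<^esub> y, z) 1 - Poly_Mapping.single (x, z) 1 - Poly_Mapping.single (y, z) 1"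
    | x y z where "x \<in> carrier V" "y \<in> carrier W" "z \<in> carrier W"
      "r = Poly_Mapping.single (x, y \<oplus>\<^bsub>W\<^esub> z) 1 - Poly_Mapping.single (x, y) 1 - Poly_Mapping.single (x, z) 1"
    | c x y where "x \<in> carrier V" "y \<in> carrier W"
      "r = Poly_Mapping.single (c \<odot>\<^bsub>V\<^esub> x, y) 1 - scale c (Poly_Mapping.single (x, y) 1)"
    | c x y where "x \<in> carrier V" "y \<in> carrier W"
      "r = Poly_Mapping.single (x, c \<odot>\<^bsub>W\<^esub> y) 1 - scale c (Poly_Mapping.single (x, y) 1)"
  using assms unfolding bilinear_relators_def Let_def by blast

context
  assumes V: "complex_vector_space V" and W: "complex_vector_space W"
begin

lemma relators_closed: "bilinear_relators V W \<subseteq> carrier (pair_space V W)"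
proof
  fix r assume "r \<in> bilinear_relators V W"
  thus "r \<in> carrier (pair_space V W)"
    by (cases r rule: relatorsE) (use V W in \<open>auto simp del: scale_simps\<close>)
qed

lemma bilinear_kernel_submodule: "submodule (bilinear_kernel V W) complex_algebra (pair_space V W)"
proof -
  interpret P: module complex_algebra "pair_space V W" by (rule pair_space_vs)
  have c: "carrier (pair_space V W) \<in> {K. submodule K complex_algebra (pair_space V W) \<and> bilinear_relators V W \<subseteq> K}"
    using P.carrier_is_submodule relators_closed by blast
  show ?thesis
  proof (rule P.submoduleI)
    show "bilinear_kernel V W \<subseteq> carrier (pair_space V W)"
      unfolding bilinear_kernel_def using c by blast
    show "\<zero>\<^bsub>pair_space V W\<^esub> \<in> bilinear_kernel V W"
      unfolding bilinear_kernel_def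
      by (auto dest!: submodule.axioms(1) subgroup.one_closed)
  qed (auto simp: bilinear_kernel_def P.submoduleE(3,5) intro: submodule.smult_closed)
qed

lemma bilinear_kernel_relators: "bilinear_relators V W \<subseteq> bilinear_kernel V W"
  unfolding bilinear_kernel_def by blast

lemma bilinear_kernel_least:
  "submodule K complex_algebra (pair_space V W) \<Longrightarrow> bilinear_relators V W \<subseteq> K \<Longrightarrow> bilinear_kernel V W \<subseteq> K"
  unfolding bilinear_kernel_def by blast

lemma tensor_vs: "complex_vector_space (tensor V W)"
  unfolding tensor_def by (rule quot_vs[OF pair_space_vs bilinear_kernel_submodule])

lemma tensor_proj_linear:
  "linear_map (pair_space V W) (tensor V W) (\<lambda>x. bilinear_kernel V W +>\<^bsub>pair_space V W\<^esub> x)"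
  unfolding tensor_def by (rule quot_proj_linear[OF pair_space_vs bilinear_kernel_submodule])

lemma tens_closed: "v \<in> carrier V \<Longrightarrow> w \<in> carrier W \<Longrightarrow> tens V W v w \<in> carrier (tensor V W)"
  unfolding tens_def by (rule linear_map_closed[OF tensor_proj_linear]) auto

lemma tensor_carrierE:
  assumes "y \<in> carrier (tensor V W)"
  obtains x where "x \<in> carrier (pair_space V W)" "y = bilinear_kernel V W +>\<^bsub>pair_space V W\<^esub> x"
  using assms carrier_quot[OF pair_space_vs bilinear_kernel_submodule] unfolding tensor_def by auto

lemma relator_coset:
  assumes "r \<in> bilinear_relators V W"
  shows "bilinear_kernel V W +>\<^bsub>pair_space V W\<^esub> r = \<zero>\<^bsub>tensor V W\<^esub>"
proof -
  have r: "r \<in> carrier (pair_space V W)" using assms relators_closed by blast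
  have "r \<ominus>\<^bsub>pair_space V W\<^esub> 0 = r"
    using free_space_minus[OF pair_space_free r pair_space_closed(4)] by simp
  thus ?thesis
    using assms bilinear_kernel_relators r
    unfolding tensor_def quot_zero[OF pair_space_vs bilinear_kernel_submodule]
    by (subst coset_eq_iff[OF pair_space_vs bilinear_kernel_submodule]) (auto simp: pair_spaceD(3))
qed

lemma tensor_proj_diff:
  assumes "x \<in> carrier (pair_space V W)" "y \<in> carrier (pair_space V W)"
  shows "bilinear_kernel V W +>\<^bsub>pair_space V W\<^esub> (x - y) =
    (bilinear_kernel V W +>\<^bsub>pair_space V W\<^esub> x) \<ominus>\<^bsub>tensor V W\<^esub> (bilinear_kernel V W +>\<^bsub>pair_space V W\<^esub> y)"
  using linear_map_minus[OF pair_space_vs tensor_vs tensor_proj_linear assms]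
  by (simp add: free_space_minus[OF pair_space_free assms])

lemma tens_bilinear: "bilinear V W (tensor V W) (tens V W)"
proof -
  let ?k = "\<lambda>x. bilinear_kernel V W +>\<^bsub>pair_space V W\<^esub> x"
  have eq: "?k x = ?k y" if "x - y \<in> bilinear_relators V W"
    "x \<in> carrier (pair_space V W)" "y \<in> carrier (pair_space V W)" for x y
    using relator_coset[OF that(1)] tensor_proj_diff[OF that(2,3)] tensor_vs
      linear_map_closed[OF tensor_proj_linear that(2)] linear_map_closed[OF tensor_proj_linear that(3)]
    by simp
  have add: "?k (x + y) = ?k x \<oplus>\<^bsub>tensor V W\<^esub> ?k y"
    if "x \<in> carrier (pair_space V W)" "y \<in> carrier (pair_space V W)" for x y
    using linear_map_add[OF tensor_proj_linear that] by (simp add: pair_spaceD)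
  have smult: "?k (scale c x) = c \<odot>\<^bsub>tensor V W\<^esub> ?k x" if "x \<in> carrier (pair_space V W)" for c x
    using linear_map_smult[OF tensor_proj_linear that] by (simp add: pair_spaceD)
  show ?thesis
  proof (intro bilinearI linear_mapI)
    fix x y z assume *: "x \<in> carrier V" "y \<in> carrier V" "z \<in> carrier W"
    have "Poly_Mapping.single (x \<oplus>\<^bsub>V\<^esub> y, z) 1 - (Poly_Mapping.single (x, z) 1 + Poly_Mapping.single (y, z) 1)
        \<in> bilinear_relators V W"
      unfolding bilinear_relators_def Let_def using * by (auto simp: diff_diff_eq)
    from eq[OF this] show "tens V W (x \<oplus>\<^bsub>V\<^esub> y) z = tens V W x z \<oplus>\<^bsub>tensor V W\<^esub> tens V W y z"
      using * V W unfolding tens_def by (subst add[symmetric]) auto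
  next
    fix x y z assume *: "x \<in> carrier V" "y \<in> carrier W" "z \<in> carrier W"
    have "Poly_Mapping.single (x, y \<oplus>\<^bsub>W\<^esub> z) 1 - (Poly_Mapping.single (x, y) 1 + Poly_Mapping.single (x, z) 1)
        \<in> bilinear_relators V W"
      unfolding bilinear_relators_def Let_def using * by (auto simp: diff_diff_eq)
    from eq[OF this] show "tens V W x (y \<oplus>\<^bsub>W\<^esub> z) = tens V W x y \<oplus>\<^bsub>tensor V W\<^esub> tens V W x z"
      using * V W unfolding tens_def by (subst add[symmetric]) auto
  next
    fix c x y assume *: "x \<in> carrier V" "y \<in> carrier W"
    have "Poly_Mapping.single (c \<odot>\<^bsub>V\<^esub> x, y) 1 - scale c (Poly_Mapping.single (x, y) 1) \<in> bilinear_relators V W"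
      unfolding bilinear_relators_def Let_def using * by blast
    from eq[OF this] show "tens V W (c \<odot>\<^bsub>V\<^esub> x) y = c \<odot>\<^bsub>tensor V W\<^esub> tens V W x y"
      using * V W unfolding tens_def by (subst smult[symmetric]) auto
    have "Poly_Mapping.single (x, c \<odot>\<^bsub>W\<^esub> y) 1 - scale c (Poly_Mapping.single (x, y) 1) \<in> bilinear_relators V W"
      unfolding bilinear_relators_def Let_def using * by blast
    from eq[OF this] show "tens V W x (c \<odot>\<^bsub>W\<^esub> y) = c \<odot>\<^bsub>tensor V W\<^esub> tens V W x y"
      using * V W unfolding tens_def by (subst smult[symmetric]) auto
  qed (auto simp: tens_closed)
qed

lemmas tens_linear_left = bilinear_left[OF tens_bilinear]
lemmas tens_linear_right = bilinear_right[OF tens_bilinear]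

lemma tensor_linear_eq:
  assumes "complex_vector_space Z" "linear_map (tensor V W) Z f" "linear_map (tensor V W) Z g"
    and "\<And>v w. v \<in> carrier V \<Longrightarrow> w \<in> carrier W \<Longrightarrow> f (tens V W v w) = g (tens V W v w)"
    and "x \<in> carrier (tensor V W)"
  shows "f x = g x"
proof -
  obtain y where y: "y \<in> carrier (pair_space V W)" "x = bilinear_kernel V W +>\<^bsub>pair_space V W\<^esub> y"
    using tensor_carrierE[OF assms(5)] .
  show ?thesis unfolding y(2)
    by (rule free_space_linear_eq[OF pair_space_free assms(1) linear_map_comp[OF tensor_proj_linear assms(2)]
          linear_map_comp[OF tensor_proj_linear assms(3)] _ y(1)])
      (use assms(4) in \<open>auto simp: tens_def\<close>)
qed

context
  fixes Z :: "(complex, 'c, 'k) module_scheme" and h :: "'a \<Rightarrow> 'b \<Rightarrow> 'c"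
  assumes Z: "complex_vector_space Z" and h: "bilinear V W Z h"
begin

lemma bilinear_ext_linear: "linear_map (pair_space V W) Z (lin_ext Z (\<lambda>p. h (fst p) (snd p)))"
  by (rule lin_ext_linear[OF pair_space_free Z]) (auto intro: bilinear_closed[OF h])

lemma bilinear_ext_single:
  "v \<in> carrier V \<Longrightarrow> w \<in> carrier W \<Longrightarrow> lin_ext Z (\<lambda>p. h (fst p) (snd p)) (Poly_Mapping.single (v, w) 1) = h v w"
  by (subst lin_ext_single) (use Z bilinear_closed[OF h] in auto)

text \<open>\<open>bilinear_kernel\<close> is the least submodule containing the relators, and the
  kernel of the extension is such a submodule by bilinearity of \<open>h\<close>.\<close>

lemma bilinear_ext_kernel:
  assumes "i \<in> bilinear_kernel V W" shows "lin_ext Z (\<lambda>p. h (fst p) (snd p)) i = \<zero>\<^bsub>Z\<^esub>"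
proof -
  let ?e = "lin_ext Z (\<lambda>p. h (fst p) (snd p))"
  have d: "?e (x - y) = ?e x \<ominus>\<^bsub>Z\<^esub> ?e y" if "x \<in> carrier (pair_space V W)" "y \<in> carrier (pair_space V W)" for x y
    using linear_map_minus[OF pair_space_vs Z bilinear_ext_linear that]
    by (simp add: free_space_minus[OF pair_space_free that])
  have a: "?e (x + y) = ?e x \<oplus>\<^bsub>Z\<^esub> ?e y" if "x \<in> carrier (pair_space V W)" "y \<in> carrier (pair_space V W)" for x y
    using linear_map_add[OF bilinear_ext_linear that] by (simp add: pair_spaceD)
  have m: "?e (scale c x) = c \<odot>\<^bsub>Z\<^esub> ?e x" if "x \<in> carrier (pair_space V W)" for x c
    using linear_map_smult[OF bilinear_ext_linear that] by (simp add: pair_spaceD)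
  have "bilinear_kernel V W \<subseteq> {x \<in> carrier (pair_space V W). ?e x = \<zero>\<^bsub>Z\<^esub>}"
  proof (rule bilinear_kernel_least[OF kernel_submodule[OF pair_space_vs Z bilinear_ext_linear]], rule subsetI)
    fix r assume r: "r \<in> bilinear_relators V W"
    from r have "?e r = \<zero>\<^bsub>Z\<^esub>"
    proof (cases r rule: relatorsE)
      case (1 x y z)
      hence "h (x \<oplus>\<^bsub>V\<^esub> y) z = h x z \<oplus>\<^bsub>Z\<^esub> h y z"
        by (simp add: linear_map_add[OF bilinear_left[OF h]])
      thus ?thesis using 1 V W Z
        by (simp add: diff_diff_eq d a bilinear_ext_single pair_space_single pair_space_closed bilinear_closed[OF h])
    next
      case (2 x y z)
      hence "h x (y \<oplus>\<^bsub>W\<^esub> z) = h x y \<oplus>\<^bsub>Z\<^esub> h x z"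
        by (simp add: linear_map_add[OF bilinear_right[OF h]])
      thus ?thesis using 2 V W Z
        by (simp add: diff_diff_eq d a bilinear_ext_single pair_space_single pair_space_closed bilinear_closed[OF h])
    next
      case (3 c x y)
      hence "h (c \<odot>\<^bsub>V\<^esub> x) y = c \<odot>\<^bsub>Z\<^esub> h x y"
        by (simp add: linear_map_smult[OF bilinear_left[OF h]])
      thus ?thesis using 3 V W Z
        by (simp add: d m bilinear_ext_single pair_space_single pair_space_closed bilinear_closed[OF h] del: scale_simps)
    next
      case (4 c x y)
      hence "h x (c \<odot>\<^bsub>W\<^esub> y) = c \<odot>\<^bsub>Z\<^esub> h x y"
        by (simp add: linear_map_smult[OF bilinear_right[OF h]])
      thus ?thesis using 4 V W Z
        by (simp add: d m bilinear_ext_single pair_space_single pair_space_closed bilinear_closed[OF h] del: scale_simps)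
    qed
    thus "r \<in> {x \<in> carrier (pair_space V W). ?e x = \<zero>\<^bsub>Z\<^esub>}" using r relators_closed by blast
  qed
  thus ?thesis using assms by blast
qed

lemma tensor_lift_conv: "tensor_lift Z h Y = the_elem (lin_ext Z (\<lambda>p. h (fst p) (snd p)) ` Y)"
  by (simp add: tensor_lift_def lin_ext_def)

lemma tensor_lift_linear: "linear_map (tensor V W) Z (tensor_lift Z h)"
  using quot_induced_linear[OF pair_space_vs bilinear_kernel_submodule Z bilinear_ext_linear bilinear_ext_kernel]
  unfolding tensor_def tensor_lift_conv[symmetric] by simp

lemma tensor_lift_tens: "v \<in> carrier V \<Longrightarrow> w \<in> carrier W \<Longrightarrow> tensor_lift Z h (tens V W v w) = h v w"
  unfolding tensor_lift_conv tens_def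
  by (subst the_elem_coset[OF pair_space_vs bilinear_kernel_submodule Z bilinear_ext_linear bilinear_ext_kernel])
    (auto simp: bilinear_ext_single)

end

end

end

text \<open>\<open>tensor_assoc\<close> and the tensor coaction are nested lifts, so the inner lift
  has to be linear in the variables which it receives from the outer one.\<close>

lemma tensor_lift_param_linear:
  assumes "complex_vector_space V" "complex_vector_space W" "complex_vector_space E" "complex_vector_space Z"
    and "\<And>x. x \<in> carrier E \<Longrightarrow> bilinear V W Z (h x)"
    and "\<And>v w. v \<in> carrier V \<Longrightarrow> w \<in> carrier W \<Longrightarrow> linear_map E Z (\<lambda>x. h x v w)"
    and "y \<in> carrier (tensor V W)"
  shows "linear_map E Z (\<lambda>x. tensor_lift Z (h x) y)"
proof (rule linear_mapI)
  note l = tensor_lift_linear[OF assms(1,2,4)] and t = tensor_lift_tens[OF assms(1,2,4)]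
  fix x assume x: "x \<in> carrier E"
  show "tensor_lift Z (h x) y \<in> carrier Z"
    by (rule linear_map_closed[OF l[OF assms(5)[OF x]] assms(7)])
  show "tensor_lift Z (h (c \<odot>\<^bsub>E\<^esub> x)) y = c \<odot>\<^bsub>Z\<^esub> tensor_lift Z (h x) y" for c
    using assms x
    by (intro tensor_linear_eq[OF assms(1,2,4) l linear_map_smult_const[OF assms(4) l] _ assms(7)])
      (auto simp: t linear_map_smult[OF assms(6)])
  fix x' assume x': "x' \<in> carrier E"
  show "tensor_lift Z (h (x \<oplus>\<^bsub>E\<^esub> x')) y = tensor_lift Z (h x) y \<oplus>\<^bsub>Z\<^esub> tensor_lift Z (h x') y"
    using assms x x'
    by (intro tensor_linear_eq[OF assms(1,2,4) l linear_map_add_maps[OF assms(4) l l] _ assms(7)])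
      (auto simp: t linear_map_add[OF assms(6)])
qed

context
  fixes V :: "(complex, 'a, 'm) module_scheme" and W :: "(complex, 'b, 'n) module_scheme"
    and V' :: "(complex, 'c, 'k) module_scheme" and W' :: "(complex, 'd, 'l) module_scheme"
    and f :: "'a \<Rightarrow> 'c" and g :: "'b \<Rightarrow> 'd"
  assumes V: "complex_vector_space V" and W: "complex_vector_space W"
    and V': "complex_vector_space V'" and W': "complex_vector_space W'"
    and f: "linear_map V V' f" and g: "linear_map W W' g"
begin

lemma tensor_map_linear: "linear_map (tensor V W) (tensor V' W') (tensor_map V' W' f g)"
  unfolding tensor_map_def
  by (rule tensor_lift_linear[OF V W tensor_vs[OF V' W'] bilinear_comp[OF tens_bilinear[OF V' W'] f g]])

lemma tensor_map_tens:
  "v \<in> carrier V \<Longrightarrow> w \<in> carrier W \<Longrightarrow> tensor_map V' W' f g (tens V W v w) = tens V' W' (f v) (g w)"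
  unfolding tensor_map_def
  by (rule tensor_lift_tens[OF V W tensor_vs[OF V' W'] bilinear_comp[OF tens_bilinear[OF V' W'] f g]])

end

subsection \<open>Tensor products of algebras\<close>

lemma free_space_finsum:
  assumes "free_space S F" "\<And>i. i \<in> A \<Longrightarrow> f i \<in> carrier F"
  shows "(\<Oplus>\<^bsub>F\<^esub>i\<in>A. f i) = (\<Sum>i\<in>A. f i)"
proof (cases "finite A")
  case True
  thus ?thesis using assms(2)
  proof (induction A rule: finite_induct)
    case (insert a A)
    thus ?case using assms(1) free_space_vs[OF assms(1)] by (simp add: vs_finsum_insert free_spaceD)
  qed (use free_space_vs[OF assms(1)] assms(1) in \<open>simp add: free_spaceD\<close>)
next
  case False
  interpret module complex_algebra F by (rule free_space_vs[OF assms(1)])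
  show ?thesis using False M.add.finprod_infinite[OF False] assms(1) by (simp add: free_spaceD finsum_def)
qed

lemma scale_sum_right: "scale c (\<Sum>i\<in>A. f i) = (\<Sum>i\<in>A. scale c (f i))"
  by (induction A rule: infinite_finite_induct) (simp_all add: scale_add_right)

context
  fixes A :: "(complex, 'a, 'm) module_scheme" and B :: "(complex, 'b, 'n) module_scheme"
  assumes A: "complex_alg A" and B: "complex_alg B"
begin

lemmas VA = complex_alg_vs[OF A] and VB = complex_alg_vs[OF B]

abbreviation (input) "pmul p p' \<equiv> (fst p \<otimes>\<^bsub>A\<^esub> fst p', snd p \<otimes>\<^bsub>B\<^esub> snd p')"

text \<open>The product sums over both supports, which hides its bilinearity; as an iterated linear
  extension it is linear in each factor for formal reasons.\<close>

lemma pair_mult_conv: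
  assumes "f \<in> carrier (pair_space A B)" "g \<in> carrier (pair_space A B)"
  shows "f \<otimes>\<^bsub>pair_space A B\<^esub> g =
    lin_ext (pair_space A B) (\<lambda>p. lin_ext (pair_space A B) (\<lambda>p'. Poly_Mapping.single (pmul p p') 1) g) f"
proof -
  have c: "pmul p p' \<in> carrier A \<times> carrier B" if "p \<in> Poly_Mapping.keys f" "p' \<in> Poly_Mapping.keys g" for p p'
    using that assms A B by (cases p; cases p') (auto simp: pair_spaceD subset_iff)
  have s: "Poly_Mapping.single (pmul p p') 1 \<in> carrier (pair_space A B)"
    if "p \<in> Poly_Mapping.keys f" "p' \<in> Poly_Mapping.keys g" for p p' and z :: complex
    using free_space_single[OF pair_space_free c[OF that]] .
  have "lin_ext (pair_space A B) (\<lambda>p'. Poly_Mapping.single (pmul p p') 1) g =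
      (\<Sum>p'\<in>Poly_Mapping.keys g. scale (Poly_Mapping.lookup g p') (Poly_Mapping.single (pmul p p') 1))"
    if "p \<in> Poly_Mapping.keys f" for p
    unfolding lin_ext_def using s[OF that]
    by (subst free_space_finsum[OF pair_space_free]) (auto simp: pair_spaceD(4) simp del: scale_simps)
  moreover have "(\<Sum>p'\<in>Poly_Mapping.keys g. scale (Poly_Mapping.lookup g p') (Poly_Mapping.single (pmul p p') 1)) \<in> carrier (pair_space A B)"
    if "p \<in> Poly_Mapping.keys f" for p
    using c[OF that] keys_sum[of "\<lambda>p'. scale (Poly_Mapping.lookup g p') (Poly_Mapping.single (pmul p p') 1)" "Poly_Mapping.keys g"]
    by (fastforce simp: pair_spaceD(1))
  ultimately have "lin_ext (pair_space A B) (\<lambda>p. lin_ext (pair_space A B) (\<lambda>p'. Poly_Mapping.single (pmul p p') 1) g) f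
     = (\<Sum>p\<in>Poly_Mapping.keys f. scale (Poly_Mapping.lookup f p)
         (\<Sum>p'\<in>Poly_Mapping.keys g. scale (Poly_Mapping.lookup g p') (Poly_Mapping.single (pmul p p') 1)))"
    unfolding lin_ext_def[of _ _ f]
    by (subst free_space_finsum[OF pair_space_free]) (auto simp: pair_spaceD(4) intro!: sum.cong)
  thus ?thesis
    by (simp add: pair_space_def scale_sum_right split_beta)
qed

lemma pair_mult_left_linear:
  assumes "g \<in> carrier (pair_space A B)"
  shows "linear_map (pair_space A B) (pair_space A B) (\<lambda>f. f \<otimes>\<^bsub>pair_space A B\<^esub> g)"
proof (rule linear_map_cong_fun[OF pair_space_vs])
  show "linear_map (pair_space A B) (pair_space A B)
    (lin_ext (pair_space A B) (\<lambda>p. lin_ext (pair_space A B) (\<lambda>p'. Poly_Mapping.single (pmul p p') 1) g))"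
    using A B
    by (intro lin_ext_linear[OF pair_space_free pair_space_vs]
        linear_map_closed[OF lin_ext_linear[OF pair_space_free pair_space_vs] assms] pair_space_single) auto
qed (rule pair_mult_conv[OF _ assms])

lemma pair_mult_right_linear:
  assumes "f \<in> carrier (pair_space A B)"
  shows "linear_map (pair_space A B) (pair_space A B) (\<lambda>g. f \<otimes>\<^bsub>pair_space A B\<^esub> g)"
proof (rule linear_map_cong_fun[OF pair_space_vs])
  show "linear_map (pair_space A B) (pair_space A B)
    (\<lambda>g. lin_ext (pair_space A B) (\<lambda>p. lin_ext (pair_space A B) (\<lambda>p'. Poly_Mapping.single (pmul p p') 1) g) f)"
    using A B assms
    by (intro linear_map_lin_ext_param[OF pair_space_vs _ pair_space_vs] lin_ext_linear[OF pair_space_free pair_space_vs]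
        pair_space_single) (auto simp: pair_spaceD(1))
qed (rule pair_mult_conv[OF assms])

lemma pair_mult_closed:
  "f \<in> carrier (pair_space A B) \<Longrightarrow> g \<in> carrier (pair_space A B) \<Longrightarrow> f \<otimes>\<^bsub>pair_space A B\<^esub> g \<in> carrier (pair_space A B)"
  using linear_map_closed[OF pair_mult_left_linear] .

lemma pair_mult_single:
  "a \<in> carrier A \<Longrightarrow> b \<in> carrier B \<Longrightarrow> a' \<in> carrier A \<Longrightarrow> b' \<in> carrier B \<Longrightarrow>
   Poly_Mapping.single (a, b) 1 \<otimes>\<^bsub>pair_space A B\<^esub> Poly_Mapping.single (a', b') 1 =
   Poly_Mapping.single (a \<otimes>\<^bsub>A\<^esub> a', b \<otimes>\<^bsub>B\<^esub> b') 1"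
  by (simp add: pair_space_def)

lemma pair_one: "\<one>\<^bsub>pair_space A B\<^esub> = Poly_Mapping.single (\<one>\<^bsub>A\<^esub>, \<one>\<^bsub>B\<^esub>) 1"
  by (simp add: pair_space_def)

text \<open>Associativity is trilinear and is reduced, one factor at a time, to triples of basis
  pairs.\<close>

lemma pair_alg: "complex_alg (pair_space A B)"
proof (rule complex_algI)
  let ?P = "pair_space A B" and ?s = "\<lambda>p. Poly_Mapping.single p (1::complex)"
  note eq = free_space_linear_eq[OF pair_space_free pair_space_vs]
  note L = pair_mult_left_linear and R = pair_mult_right_linear
  show one: "\<one>\<^bsub>?P\<^esub> \<in> carrier ?P"
    unfolding pair_one using A B by auto
  fix x assume x: "x \<in> carrier ?P"
  show "\<one>\<^bsub>?P\<^esub> \<otimes>\<^bsub>?P\<^esub> x = x"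
    by (rule eq[OF R[OF one] linear_map_id(1) _ x]) (use A B in \<open>auto simp: pair_one pair_mult_single\<close>)
  show "x \<otimes>\<^bsub>?P\<^esub> \<one>\<^bsub>?P\<^esub> = x"
    by (rule eq[OF L[OF one] linear_map_id(1) _ x]) (use A B in \<open>auto simp: pair_one pair_mult_single\<close>)
  fix y z assume y: "y \<in> carrier ?P" and z: "z \<in> carrier ?P"
  note yz = pair_mult_closed[OF y z]
  have "?s p \<otimes>\<^bsub>?P\<^esub> ?s p' \<otimes>\<^bsub>?P\<^esub> z = ?s p \<otimes>\<^bsub>?P\<^esub> (?s p' \<otimes>\<^bsub>?P\<^esub> z)"
    if p: "p \<in> carrier A \<times> carrier B" and p': "p' \<in> carrier A \<times> carrier B" for p p'
  proof (rule eq[OF R linear_map_comp[OF R R] _ z])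
    show "?s p \<in> carrier ?P" "?s p' \<in> carrier ?P" "?s p \<otimes>\<^bsub>?P\<^esub> ?s p' \<in> carrier ?P"
      using p p' by (auto intro!: pair_mult_closed)
    fix p'' assume "p'' \<in> carrier A \<times> carrier B"
    thus "?s p \<otimes>\<^bsub>?P\<^esub> ?s p' \<otimes>\<^bsub>?P\<^esub> ?s p'' = ?s p \<otimes>\<^bsub>?P\<^esub> (?s p' \<otimes>\<^bsub>?P\<^esub> ?s p'')"
      using p p' A B by (auto simp: pair_mult_single alg_assoc)
  qed
  hence "?s p \<otimes>\<^bsub>?P\<^esub> y \<otimes>\<^bsub>?P\<^esub> z = ?s p \<otimes>\<^bsub>?P\<^esub> (y \<otimes>\<^bsub>?P\<^esub> z)" if p: "p \<in> carrier A \<times> carrier B" for p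
    using p z by (intro eq[OF linear_map_comp[OF R L] linear_map_comp[OF L R] _ y]) auto
  thus "x \<otimes>\<^bsub>?P\<^esub> y \<otimes>\<^bsub>?P\<^esub> z = x \<otimes>\<^bsub>?P\<^esub> (y \<otimes>\<^bsub>?P\<^esub> z)"
    using y z yz by (intro eq[OF linear_map_comp[OF L L] L _ x]) auto
qed (auto intro: pair_space_vs pair_mult_closed pair_mult_left_linear pair_mult_right_linear)

text \<open>By distributivity a basis pair times a relator is a relator of the same kind, not merely
  a combination of relators.\<close>

lemma single_mult_relator:
  assumes a: "a \<in> carrier A" and b: "b \<in> carrier B" and r: "r \<in> bilinear_relators A B"
  shows "Poly_Mapping.single (a, b) 1 \<otimes>\<^bsub>pair_space A B\<^esub> r \<in> bilinear_relators A B" (is ?L)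
    and "r \<otimes>\<^bsub>pair_space A B\<^esub> Poly_Mapping.single (a, b) 1 \<in> bilinear_relators A B" (is ?R)
proof -
  let ?P = "pair_space A B" and ?s = "\<lambda>p. Poly_Mapping.single p (1::complex)"
  have s: "?s (a, b) \<in> carrier ?P" using a b by auto
  have d: "?s (a, b) \<otimes>\<^bsub>?P\<^esub> (x - y) = ?s (a, b) \<otimes>\<^bsub>?P\<^esub> x - ?s (a, b) \<otimes>\<^bsub>?P\<^esub> y"
      "(x - y) \<otimes>\<^bsub>?P\<^esub> ?s (a, b) = x \<otimes>\<^bsub>?P\<^esub> ?s (a, b) - y \<otimes>\<^bsub>?P\<^esub> ?s (a, b)"
    if "x \<in> carrier ?P" "y \<in> carrier ?P" for x y
    using linear_map_minus[OF pair_space_vs pair_space_vs pair_mult_right_linear[OF s] that]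
      linear_map_minus[OF pair_space_vs pair_space_vs pair_mult_left_linear[OF s] that] that s
    by (simp_all add: free_space_minus[OF pair_space_free] pair_mult_closed)
  have m: "?s (a, b) \<otimes>\<^bsub>?P\<^esub> scale c x = scale c (?s (a, b) \<otimes>\<^bsub>?P\<^esub> x)"
      "scale c x \<otimes>\<^bsub>?P\<^esub> ?s (a, b) = scale c (x \<otimes>\<^bsub>?P\<^esub> ?s (a, b))"
    if "x \<in> carrier ?P" for x c
    using linear_map_smult[OF pair_mult_right_linear[OF s] that] linear_map_smult[OF pair_mult_left_linear[OF s] that]
    by (simp_all add: pair_spaceD)
  note facts = d m pair_mult_single pair_space_single pair_space_closed a b
  note dist = alg_l_distr[OF A] alg_l_distr[OF B] alg_r_distr[OF A] alg_r_distr[OF B]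
    complex_alg_smult_left[OF A] complex_alg_smult_left[OF B] complex_alg_smult_right[OF A] complex_alg_smult_right[OF B]
  note closed = vs_closed[OF VA] vs_closed[OF VB] alg_mult_closed[OF A] alg_mult_closed[OF B]
  from r have "?L \<and> ?R"
  proof (cases r rule: relatorsE)
    case (1 x y z)
    have "?s (a, b) \<otimes>\<^bsub>?P\<^esub> r = ?s (a \<otimes>\<^bsub>A\<^esub> x \<oplus>\<^bsub>A\<^esub> a \<otimes>\<^bsub>A\<^esub> y, b \<otimes>\<^bsub>B\<^esub> z) - ?s (a \<otimes>\<^bsub>A\<^esub> x, b \<otimes>\<^bsub>B\<^esub> z) - ?s (a \<otimes>\<^bsub>A\<^esub> y, b \<otimes>\<^bsub>B\<^esub> z)"
      "r \<otimes>\<^bsub>?P\<^esub> ?s (a, b) = ?s (x \<otimes>\<^bsub>A\<^esub> a \<oplus>\<^bsub>A\<^esub> y \<otimes>\<^bsub>A\<^esub> a, z \<otimes>\<^bsub>B\<^esub> b) - ?s (x \<otimes>\<^bsub>A\<^esub> a, z \<otimes>\<^bsub>B\<^esub> b) - ?s (y \<otimes>\<^bsub>A\<^esub> a, z \<otimes>\<^bsub>B\<^esub> b)"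
      using 1 by (simp_all add: facts dist closed)
    thus ?thesis using 1 a b unfolding bilinear_relators_def Let_def by (blast intro: closed)
  next
    case (2 x y z)
    have "?s (a, b) \<otimes>\<^bsub>?P\<^esub> r = ?s (a \<otimes>\<^bsub>A\<^esub> x, b \<otimes>\<^bsub>B\<^esub> y \<oplus>\<^bsub>B\<^esub> b \<otimes>\<^bsub>B\<^esub> z) - ?s (a \<otimes>\<^bsub>A\<^esub> x, b \<otimes>\<^bsub>B\<^esub> y) - ?s (a \<otimes>\<^bsub>A\<^esub> x, b \<otimes>\<^bsub>B\<^esub> z)"
      "r \<otimes>\<^bsub>?P\<^esub> ?s (a, b) = ?s (x \<otimes>\<^bsub>A\<^esub> a, y \<otimes>\<^bsub>B\<^esub> b \<oplus>\<^bsub>B\<^esub> z \<otimes>\<^bsub>B\<^esub> b) - ?s (x \<otimes>\<^bsub>A\<^esub> a, y \<otimes>\<^bsub>B\<^esub> b) - ?s (x \<otimes>\<^bsub>A\<^esub> a, z \<otimes>\<^bsub>B\<^esub> b)"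
      using 2 by (simp_all add: facts dist closed)
    thus ?thesis using 2 a b unfolding bilinear_relators_def Let_def by (blast intro: closed)
  next
    case (3 c x y)
    have "?s (a, b) \<otimes>\<^bsub>?P\<^esub> r = ?s (c \<odot>\<^bsub>A\<^esub> (a \<otimes>\<^bsub>A\<^esub> x), b \<otimes>\<^bsub>B\<^esub> y) - scale c (?s (a \<otimes>\<^bsub>A\<^esub> x, b \<otimes>\<^bsub>B\<^esub> y))"
      "r \<otimes>\<^bsub>?P\<^esub> ?s (a, b) = ?s (c \<odot>\<^bsub>A\<^esub> (x \<otimes>\<^bsub>A\<^esub> a), y \<otimes>\<^bsub>B\<^esub> b) - scale c (?s (x \<otimes>\<^bsub>A\<^esub> a, y \<otimes>\<^bsub>B\<^esub> b))"
      using 3 by (simp_all add: facts dist closed del: scale_simps)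
    thus ?thesis using 3 a b unfolding bilinear_relators_def Let_def by (blast intro: closed)
  next
    case (4 c x y)
    have "?s (a, b) \<otimes>\<^bsub>?P\<^esub> r = ?s (a \<otimes>\<^bsub>A\<^esub> x, c \<odot>\<^bsub>B\<^esub> (b \<otimes>\<^bsub>B\<^esub> y)) - scale c (?s (a \<otimes>\<^bsub>A\<^esub> x, b \<otimes>\<^bsub>B\<^esub> y))"
      "r \<otimes>\<^bsub>?P\<^esub> ?s (a, b) = ?s (x \<otimes>\<^bsub>A\<^esub> a, c \<odot>\<^bsub>B\<^esub> (y \<otimes>\<^bsub>B\<^esub> b)) - scale c (?s (x \<otimes>\<^bsub>A\<^esub> a, y \<otimes>\<^bsub>B\<^esub> b))"
      using 4 by (simp_all add: facts dist closed del: scale_simps)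
    thus ?thesis using 4 a b unfolding bilinear_relators_def Let_def by (blast intro: closed)
  qed
  thus ?L ?R by auto
qed

text \<open>For fixed \<open>x\<close>, the elements whose product with \<open>x\<close> vanishes in
  the tensor product form a submodule. It contains the relators, hence the whole kernel.\<close>

lemma bilinear_kernel_ideal: "ideal (bilinear_kernel A B) (pair_space A B)"
proof -
  let ?P = "pair_space A B" and ?K = "bilinear_kernel A B"
  let ?k = "\<lambda>x. ?K +>\<^bsub>?P\<^esub> x"
  note T = tensor_vs[OF VA VB] and proj = tensor_proj_linear[OF VA VB]
    and sub = bilinear_kernel_submodule[OF VA VB] and rel = relators_closed[OF VA VB]
  have ker: "x \<in> ?K \<longleftrightarrow> ?k x = \<zero>\<^bsub>tensor A B\<^esub>" if "x \<in> carrier ?P" for x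
  proof -
    have "x \<ominus>\<^bsub>?P\<^esub> \<zero>\<^bsub>?P\<^esub> = x"
      using that free_space_minus[OF pair_space_free that vs_zero_closed[OF pair_space_vs]] by (simp add: pair_spaceD)
    thus ?thesis using coset_eq_iff[OF pair_space_vs sub that vs_zero_closed[OF pair_space_vs]]
      unfolding tensor_def quot_zero[OF pair_space_vs sub] by simp
  qed
  have zero: "?k (x \<otimes>\<^bsub>?P\<^esub> i) = \<zero>\<^bsub>tensor A B\<^esub> \<and> ?k (i \<otimes>\<^bsub>?P\<^esub> x) = \<zero>\<^bsub>tensor A B\<^esub>"
    if x: "x \<in> carrier ?P" and i: "i \<in> ?K" for x i
  proof -
    have "?K \<subseteq> {i \<in> carrier ?P. ?k (x \<otimes>\<^bsub>?P\<^esub> i) = \<zero>\<^bsub>tensor A B\<^esub>}"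
    proof (rule bilinear_kernel_least[OF VA VB kernel_submodule[OF pair_space_vs T linear_map_comp[OF pair_mult_right_linear[OF x] proj]]], rule subsetI)
      fix r assume r: "r \<in> bilinear_relators A B"
      hence r': "r \<in> carrier ?P" using rel by blast
      have "?k (x \<otimes>\<^bsub>?P\<^esub> r) = \<zero>\<^bsub>tensor A B\<^esub>"
        by (rule free_space_linear_eq[OF pair_space_free T linear_map_comp[OF pair_mult_left_linear[OF r'] proj] linear_map_const_zero[OF T] _ x])
          (use single_mult_relator(1)[OF _ _ r] relator_coset[OF VA VB] in auto)
      thus "r \<in> {i \<in> carrier ?P. ?k (x \<otimes>\<^bsub>?P\<^esub> i) = \<zero>\<^bsub>tensor A B\<^esub>}" using r' by blast
    qed
    moreover have "?K \<subseteq> {i \<in> carrier ?P. ?k (i \<otimes>\<^bsub>?P\<^esub> x) = \<zero>\<^bsub>tensor A B\<^esub>}"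
    proof (rule bilinear_kernel_least[OF VA VB kernel_submodule[OF pair_space_vs T linear_map_comp[OF pair_mult_left_linear[OF x] proj]]], rule subsetI)
      fix r assume r: "r \<in> bilinear_relators A B"
      hence r': "r \<in> carrier ?P" using rel by blast
      have "?k (r \<otimes>\<^bsub>?P\<^esub> x) = \<zero>\<^bsub>tensor A B\<^esub>"
        by (rule free_space_linear_eq[OF pair_space_free T linear_map_comp[OF pair_mult_right_linear[OF r'] proj] linear_map_const_zero[OF T] _ x])
          (use single_mult_relator(2)[OF _ _ r] relator_coset[OF VA VB] in auto)
      thus "r \<in> {i \<in> carrier ?P. ?k (i \<otimes>\<^bsub>?P\<^esub> x) = \<zero>\<^bsub>tensor A B\<^esub>}" using r' by blast
    qed
    ultimately show ?thesis using i by blast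
  qed
  have K: "?K \<subseteq> carrier ?P"
    using module.submoduleE(1)[OF pair_space_vs sub] .
  show ?thesis
  proof (rule idealI[OF complex_alg_ring[OF pair_alg] submodule.axioms(1)[OF sub]])
    fix a x assume a: "a \<in> ?K" and x: "x \<in> carrier ?P"
    hence a': "a \<in> carrier ?P" using K by (rule_tac subsetD)
    show "x \<otimes>\<^bsub>?P\<^esub> a \<in> ?K" using zero[OF x a] by (simp only: ker[OF pair_mult_closed[OF x a']])
    show "a \<otimes>\<^bsub>?P\<^esub> x \<in> ?K" using zero[OF x a] by (simp only: ker[OF pair_mult_closed[OF a' x]])
  qed
qed

lemma tensor_alg: "complex_alg (tensor A B)"
  unfolding tensor_def by (rule quot_alg[OF pair_alg bilinear_kernel_ideal])

lemma tens_mult: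
  assumes "a \<in> carrier A" "b \<in> carrier B" "a' \<in> carrier A" "b' \<in> carrier B"
  shows "tens A B a b \<otimes>\<^bsub>tensor A B\<^esub> tens A B a' b' = tens A B (a \<otimes>\<^bsub>A\<^esub> a') (b \<otimes>\<^bsub>B\<^esub> b')"
  unfolding tensor_def tens_def
  by (subst quot_mult[OF pair_alg bilinear_kernel_ideal]) (use assms in \<open>auto simp: pair_mult_single\<close>)

lemma tens_one: "\<one>\<^bsub>tensor A B\<^esub> = tens A B \<one>\<^bsub>A\<^esub> \<one>\<^bsub>B\<^esub>"
  unfolding tensor_def tens_def quot_one[OF pair_alg bilinear_kernel_ideal] by (simp add: pair_one)

text \<open>Universal property of the tensor product of algebras. Commuting images are what moves
  \<open>f a'\<close> past \<open>g b\<close> in a product of two pure tensors.\<close>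

lemma tensor_lift_hom:
  assumes Z: "complex_alg Z" and f: "alg_hom A Z f" and g: "alg_hom B Z g"
    and comm: "\<And>a b. a \<in> carrier A \<Longrightarrow> b \<in> carrier B \<Longrightarrow> f a \<otimes>\<^bsub>Z\<^esub> g b = g b \<otimes>\<^bsub>Z\<^esub> f a"
  shows "bilinear A B Z (\<lambda>a b. f a \<otimes>\<^bsub>Z\<^esub> g b)" (is ?th1)
    and "alg_hom (tensor A B) Z (tensor_lift Z (\<lambda>a b. f a \<otimes>\<^bsub>Z\<^esub> g b))" (is ?th2)
proof -
  let ?h = "\<lambda>a b. f a \<otimes>\<^bsub>Z\<^esub> g b" and ?T = "tensor A B"
  note VZ = complex_alg_vs[OF Z] and T = tensor_alg
  note fc = alg_hom_closed[OF f] and gc = alg_hom_closed[OF g]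
  show h: ?th1
    using linear_map_comp[OF alg_hom_linear[OF f] alg_mult_left_linear[OF Z]]
      linear_map_comp[OF alg_hom_linear[OF g] alg_mult_right_linear[OF Z]]
    by (intro bilinearI) (auto simp: fc gc)
  note lin = tensor_lift_linear[OF VA VB VZ h] and val = tensor_lift_tens[OF VA VB VZ h]
  note cl = tens_closed[OF VA VB]
  have 1: "tensor_lift Z ?h (tens A B a b \<otimes>\<^bsub>?T\<^esub> y) = tensor_lift Z ?h (tens A B a b) \<otimes>\<^bsub>Z\<^esub> tensor_lift Z ?h y"
    if ab: "a \<in> carrier A" "b \<in> carrier B" and y: "y \<in> carrier ?T" for a b y
  proof (rule tensor_linear_eq[OF VA VB VZ linear_map_comp[OF alg_mult_right_linear[OF T cl[OF ab]] lin]
        linear_map_comp[OF lin alg_mult_right_linear[OF Z linear_map_closed[OF lin cl[OF ab]]]] _ y])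
    fix a' b' assume ab': "a' \<in> carrier A" "b' \<in> carrier B"
    note cl' = fc[OF ab(1)] fc[OF ab'(1)] gc[OF ab(2)] gc[OF ab'(2)]
    have "f (a \<otimes>\<^bsub>A\<^esub> a') \<otimes>\<^bsub>Z\<^esub> g (b \<otimes>\<^bsub>B\<^esub> b') = f a \<otimes>\<^bsub>Z\<^esub> ((f a' \<otimes>\<^bsub>Z\<^esub> g b) \<otimes>\<^bsub>Z\<^esub> g b')"
      using ab ab' Z cl' by (simp add: alg_hom_mult[OF f] alg_hom_mult[OF g] alg_assoc)
    also have "\<dots> = (f a \<otimes>\<^bsub>Z\<^esub> g b) \<otimes>\<^bsub>Z\<^esub> (f a' \<otimes>\<^bsub>Z\<^esub> g b')"
      unfolding comm[OF ab'(1) ab(2)] using Z cl' by (simp add: alg_assoc)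
    finally show "tensor_lift Z ?h (tens A B a b \<otimes>\<^bsub>?T\<^esub> tens A B a' b') =
        tensor_lift Z ?h (tens A B a b) \<otimes>\<^bsub>Z\<^esub> tensor_lift Z ?h (tens A B a' b')"
      using ab ab' A B by (simp add: tens_mult val)
  qed
  show ?th2
    unfolding alg_hom_def
  proof (intro conjI ballI lin)
    fix x y assume x: "x \<in> carrier ?T" and y: "y \<in> carrier ?T"
    show "tensor_lift Z ?h (x \<otimes>\<^bsub>?T\<^esub> y) = tensor_lift Z ?h x \<otimes>\<^bsub>Z\<^esub> tensor_lift Z ?h y"
      by (rule tensor_linear_eq[OF VA VB VZ linear_map_comp[OF alg_mult_left_linear[OF T y] lin]
        linear_map_comp[OF lin alg_mult_left_linear[OF Z linear_map_closed[OF lin y]]] 1[OF _ _ y] x])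
  next
    show "tensor_lift Z ?h \<one>\<^bsub>?T\<^esub> = \<one>\<^bsub>Z\<^esub>"
      using A B Z by (simp add: tens_one val alg_hom_one[OF f] alg_hom_one[OF g])
  qed
qed

lemma tens_left_hom: "alg_hom A (tensor A B) (\<lambda>a. tens A B a \<one>\<^bsub>B\<^esub>)"
  using tens_linear_left[OF VA VB alg_one_closed[OF B]] B
  by (auto simp: alg_hom_def tens_one tens_mult)

lemma tens_right_hom: "alg_hom B (tensor A B) (\<lambda>b. tens A B \<one>\<^bsub>A\<^esub> b)"
  using tens_linear_right[OF VA VB alg_one_closed[OF A]] A
  by (auto simp: alg_hom_def tens_one tens_mult)

end

text \<open>The legs f a \<otimes> 1 and 1 \<otimes> g b commute, so the universal property above
  applies to their product.\<close>

lemma tensor_map_hom: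
  assumes A: "complex_alg A" and B: "complex_alg B" and A': "complex_alg A'" and B': "complex_alg B'"
    and f: "alg_hom A A' f" and g: "alg_hom B B' g"
  shows "alg_hom (tensor A B) (tensor A' B') (tensor_map A' B' f g)"
proof -
  note V = complex_alg_vs[OF A] complex_alg_vs[OF B] complex_alg_vs[OF A'] complex_alg_vs[OF B']
  note lin = tensor_map_linear[OF V alg_hom_linear[OF f] alg_hom_linear[OF g]]
    and val = tensor_map_tens[OF V alg_hom_linear[OF f] alg_hom_linear[OF g]]
  note cl = alg_hom_closed[OF f] alg_hom_closed[OF g]
  note T' = tensor_alg[OF A' B']
  let ?h = "tensor_lift (tensor A' B') (\<lambda>a b. tens A' B' (f a) \<one>\<^bsub>B'\<^esub> \<otimes>\<^bsub>tensor A' B'\<^esub> tens A' B' \<one>\<^bsub>A'\<^esub> (g b))"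
  note f' = alg_hom_comp[OF f tens_left_hom[OF A' B']] and g' = alg_hom_comp[OF g tens_right_hom[OF A' B']]
  have comm: "tens A' B' (f a) \<one>\<^bsub>B'\<^esub> \<otimes>\<^bsub>tensor A' B'\<^esub> tens A' B' \<one>\<^bsub>A'\<^esub> (g b) =
      tens A' B' \<one>\<^bsub>A'\<^esub> (g b) \<otimes>\<^bsub>tensor A' B'\<^esub> tens A' B' (f a) \<one>\<^bsub>B'\<^esub>"
    if "a \<in> carrier A" "b \<in> carrier B" for a b
    using that A' B' cl by (simp add: tens_mult)
  note hom = tensor_lift_hom[OF A B T' f' g' comm]
  have eq: "tensor_map A' B' f g x = ?h x" if "x \<in> carrier (tensor A B)" for x
  proof (rule tensor_linear_eq[OF V(1,2) complex_alg_vs[OF T'] lin alg_hom_linear[OF hom(2)] _ that])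
    show "tensor_map A' B' f g (tens A B v w) = ?h (tens A B v w)" if "v \<in> carrier A" "w \<in> carrier B" for v w
      using that A' B' cl by (simp add: val tensor_lift_tens[OF V(1,2) complex_alg_vs[OF T'] hom(1)] tens_mult)
  qed auto
  have "alg_hom (tensor A B) (tensor A' B') ?h" by (rule hom(2)) auto
  thus ?thesis using eq lin tensor_alg[OF A B] unfolding alg_hom_def by auto
qed

section \<open>Quantum determinants\<close>

subsection \<open>Inversions\<close>

fun inversions :: "nat list \<Rightarrow> nat" where
  "inversions [] = 0"
| "inversions (x # xs) = length (filter (\<lambda>y. y < x) xs) + inversions xs"

lemma inversions_append:
  "inversions (xs @ ys) = inversions xs + inversions ys + (\<Sum>x\<leftarrow>xs. length (filter (\<lambda>y. y < x) ys))"
  by (induction xs) auto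

lemma inversions_swap:
  "x < y \<Longrightarrow> inversions (xs @ y # x # ys) = Suc (inversions (xs @ x # y # ys))"
  by (induction xs) auto

lemma inversions_strict: "sorted_wrt (<) xs \<Longrightarrow> inversions xs = 0"
  by (induction xs) (auto simp: filter_empty_conv)

lemma inversions_map_Suc [simp]: "inversions (map Suc xs) = inversions xs"
  by (induction xs) (auto simp: filter_map o_def)

lemma length_filter_distinct: "distinct xs \<Longrightarrow> length (filter P xs) = card {x \<in> set xs. P x}"
  by (metis distinct_card distinct_filter set_filter)

lemma inversions_conv_card:
  "inversions xs = card {(i, j). i < j \<and> j < length xs \<and> xs ! j < xs ! i}"
proof (induction xs)
  case (Cons x xs)
  let ?A = "{(i, j). i < j \<and> j < length xs \<and> xs ! j < xs ! i}"
  let ?B = "{j. j < length xs \<and> xs ! j < x}"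
  have eq: "{(i, j). i < j \<and> j < length (x # xs) \<and> (x # xs) ! j < (x # xs) ! i} =
      map_prod Suc Suc ` ?A \<union> (\<lambda>j. (0::nat, Suc j)) ` ?B" (is "?L = ?R")
  proof (rule Set.set_eqI)
    fix p :: "nat \<times> nat"
    obtain i j where p: "p = (i, j)" by (cases p)
    show "p \<in> ?L \<longleftrightarrow> p \<in> ?R"
      unfolding p by (cases i; cases j) (auto simp: image_iff)
  qed
  have fin: "finite ?A"
    by (rule finite_subset[of _ "{..<length xs} \<times> {..<length xs}"]) auto
  have "card (map_prod Suc Suc ` ?A \<union> (\<lambda>j. (0::nat, Suc j)) ` ?B) = card (map_prod Suc Suc ` ?A) + card ((\<lambda>j. (0::nat, Suc j)) ` ?B)"
    using fin by (subst Finite_Set.card_Un_disjoint) auto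
  also have "\<dots> = card ?A + card ?B"
    by (subst (1 2) card_image) (auto simp: inj_on_def)
  also have "card ?B = length (filter (\<lambda>y. y < x) xs)"
    by (simp add: length_filter_conv_card)
  finally show ?case using Cons unfolding eq by simp
qed simp

text \<open>The shift by \<open>Suc\<close> is between list positions, which start at 0, and matrix
  indices, which start at 1.\<close>

lemma inversions_permutation: "inversions (map \<pi> [1..<Suc n]) = perm_length n \<pi>"
proof -
  have "perm_length n \<pi> = card (map_prod Suc Suc ` {(i, j). i < j \<and> j < n \<and> \<pi> (Suc j) < \<pi> (Suc i)})"
    unfolding perm_length_def
  proof (rule arg_cong[where f = card], rule Set.set_eqI)
    fix p :: "nat \<times> nat"
    obtain i j where p: "p = (i, j)" by (cases p)
    show "p \<in> {(i, j). 1 \<le> i \<and> i < j \<and> j \<le> n \<and> \<pi> j < \<pi> i} \<longleftrightarrow>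
      p \<in> map_prod Suc Suc ` {(i, j). i < j \<and> j < n \<and> \<pi> (Suc j) < \<pi> (Suc i)}"
      unfolding p by (cases i; cases j) (auto simp: image_iff)
  qed
  also have "\<dots> = card {(i, j). i < j \<and> j < n \<and> \<pi> (Suc j) < \<pi> (Suc i)}"
    by (rule card_image) (auto simp: inj_on_def)
  also have "{(i, j). i < j \<and> j < n \<and> \<pi> (Suc j) < \<pi> (Suc i)} =
    {(i, j). i < j \<and> j < length (map \<pi> [1..<Suc n]) \<and> map \<pi> [1..<Suc n] ! j < map \<pi> [1..<Suc n] ! i}"
    by (auto simp del: upt_Suc)
  finally show ?thesis unfolding inversions_conv_card by simp
qed

text \<open>Drives the sorting of rows: a \<le> c covers a descent, which can be exchanged, as well
  as a repetition, which annihilates the minor.\<close>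

lemma strict_or_descent:
  fixes xs :: "nat list"
  shows "sorted_wrt (<) xs \<or> (\<exists>ps c a ss. xs = ps @ c # a # ss \<and> a \<le> c)"
proof (induction xs)
  case (Cons x xs)
  show ?case
  proof (cases "\<exists>ps c a ss. xs = ps @ c # a # ss \<and> a \<le> c")
    case True
    then obtain ps c a ss where "xs = ps @ c # a # ss \<and> a \<le> c" by blast
    hence "x # xs = (x # ps) @ c # a # ss \<and> a \<le> c" by simp
    thus ?thesis by blast
  next
    case False
    hence s: "sorted_wrt (<) xs" using Cons by blast
    show ?thesis
    proof (cases xs)
      case (Cons y ys)
      show ?thesis
      proof (cases "y \<le> x")
        case True
        hence "x # xs = [] @ x # y # ys \<and> y \<le> x" using Cons by simp
        thus ?thesis by blast
      qed (use s Cons in auto)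
    qed simp
  qed
qed simp

lemma sorted_list_of_set_eqI:
  assumes "sorted_wrt (<) (xs :: nat list)" "set xs = S" shows "sorted_list_of_set S = xs"
  using assms by (metis sorted_list_of_set.idem_if_sorted_distinct strict_sorted_iff)

subsection \<open>Ideals and q-matrices\<close>

text \<open>Congruence modulo \<open>I\<close> stands for equality in a quotient algebra, so that
  calculations stay in a type with class operations and without carrier conditions. In the
  applications \<open>I\<close> is the kernel of an evaluation.\<close>

locale two_sided_ideal =
  fixes I :: "('m::monoid_add \<Rightarrow>\<^sub>0 complex) set"
  assumes zero_mem: "0 \<in> I"
    and add_mem: "x \<in> I \<Longrightarrow> y \<in> I \<Longrightarrow> x + y \<in> I"
    and mult_left_mem: "x \<in> I \<Longrightarrow> z * x \<in> I"
    and mult_right_mem: "x \<in> I \<Longrightarrow> x * z \<in> I"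
begin

lemma scale_mem: "x \<in> I \<Longrightarrow> scale c x \<in> I"
  by (simp add: scale_conv_mult mult_left_mem)

lemma scale_mem_iff: "c \<noteq> 0 \<Longrightarrow> scale c x \<in> I \<longleftrightarrow> x \<in> I"
  using scale_mem[of x c] scale_mem[of "scale c x" "inverse c"] by (auto simp: scale_scale)

lemma minus_mem: "x \<in> I \<Longrightarrow> - x \<in> I"
  using scale_mem[of x "- 1"] by (simp add: scale_minus)

lemma diff_mem: "x \<in> I \<Longrightarrow> y \<in> I \<Longrightarrow> x - y \<in> I"
  using add_mem[of x "- y"] minus_mem by simp

lemma sum_mem: "(\<And>i. i \<in> A \<Longrightarrow> f i \<in> I) \<Longrightarrow> sum f A \<in> I"
  by (induction A rule: infinite_finite_induct) (auto simp: zero_mem add_mem)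

definition eqv (infix \<open>\<doteq>\<close> 50) where "x \<doteq> y \<longleftrightarrow> x - y \<in> I"

lemma eqv_refl [simp, intro]: "x \<doteq> x"
  by (simp add: eqv_def zero_mem)

lemma eqv_sym: "x \<doteq> y \<Longrightarrow> y \<doteq> x"
  using minus_mem[of "x - y"] by (simp add: eqv_def)

lemma eqv_trans [trans]: "x \<doteq> y \<Longrightarrow> y \<doteq> z \<Longrightarrow> x \<doteq> z"
  using add_mem[of "x - y" "y - z"] by (simp add: eqv_def)

lemma eq_eqv_trans [trans]: "x = y \<Longrightarrow> y \<doteq> z \<Longrightarrow> x \<doteq> z" "x \<doteq> y \<Longrightarrow> y = z \<Longrightarrow> x \<doteq> z"
  by auto

lemma eqv_diff: "x \<doteq> y \<Longrightarrow> x' \<doteq> y' \<Longrightarrow> x - x' \<doteq> y - y'"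
  using diff_mem[of "x - y" "x' - y'"] by (simp add: eqv_def algebra_simps)

lemma eqv_mult: "x \<doteq> y \<Longrightarrow> x' \<doteq> y' \<Longrightarrow> x * x' \<doteq> y * y'"
  using add_mem[OF mult_right_mem[of "x - y" x'] mult_left_mem[of "x' - y'" y]]
  by (simp add: eqv_def algebra_simps)

lemma eqv_scale: "x \<doteq> y \<Longrightarrow> scale c x \<doteq> scale c y"
  using scale_mem[of "x - y" c] by (simp add: eqv_def scale_diff_right)

lemma eqv_sum: "(\<And>i. i \<in> A \<Longrightarrow> f i \<doteq> g i) \<Longrightarrow> sum f A \<doteq> sum g A"
  using sum_mem[of A "\<lambda>i. f i - g i"] by (simp add: eqv_def sum_subtractf)

lemma eqv_mult_left: "x \<doteq> y \<Longrightarrow> z * x \<doteq> z * y"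
  and eqv_mult_right: "x \<doteq> y \<Longrightarrow> x * z \<doteq> y * z"
  by (simp_all add: eqv_mult)

lemma eqv_zero: "x \<doteq> 0 \<longleftrightarrow> x \<in> I"
  by (simp add: eqv_def)

lemma eqv_scale_cancel: "c \<noteq> 0 \<Longrightarrow> scale c x \<doteq> scale c y \<Longrightarrow> x \<doteq> y"
  using scale_mem_iff[of c "x - y"] by (simp add: eqv_def scale_diff_right)

end

text \<open>The content of the R-matrix relations, sorted by position: same row, same column,
  antidiagonal pair, diagonal pair. Rows and columns have separate index sets so that transposition
  can exchange them.\<close>

locale q_matrix = two_sided_ideal I
  for I :: "('m::monoid_add \<Rightarrow>\<^sub>0 complex) set" +
  fixes q :: real and u :: "nat \<Rightarrow> nat \<Rightarrow> ('m \<Rightarrow>\<^sub>0 complex)" and J K :: "nat set"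
  assumes q: "q > 0"
    and row: "a \<in> J \<Longrightarrow> b \<in> K \<Longrightarrow> d \<in> K \<Longrightarrow> b < d \<Longrightarrow> u a b * u a d \<doteq> scale (of_real q) (u a d * u a b)"
    and col: "a \<in> J \<Longrightarrow> c \<in> J \<Longrightarrow> b \<in> K \<Longrightarrow> a < c \<Longrightarrow> u a b * u c b \<doteq> scale (of_real q) (u c b * u a b)"
    and anti: "a \<in> J \<Longrightarrow> c \<in> J \<Longrightarrow> b \<in> K \<Longrightarrow> d \<in> K \<Longrightarrow> a < c \<Longrightarrow> b < d \<Longrightarrow> u c b * u a d \<doteq> u a d * u c b"
    and cross: "a \<in> J \<Longrightarrow> c \<in> J \<Longrightarrow> b \<in> K \<Longrightarrow> d \<in> K \<Longrightarrow> a < c \<Longrightarrow> b < d \<Longrightarrow>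
      u c d * u a b \<doteq> u a b * u c d - scale (of_real (q - inverse q)) (u a d * u c b)"
begin

text \<open>Row and column relations trade places. The correction term of \<open>cross\<close> gets
  its two factors reversed, which \<open>anti\<close> repairs.\<close>

lemma transposed: "q_matrix I q (\<lambda>i j. u j i) K J"
proof
  fix a b c d assume *: "a \<in> K" "c \<in> K" "b \<in> J" "d \<in> J" "a < c" "b < d"
  show "u b c * u d a \<doteq> u d a * u b c" using anti[of b d a c] * by (auto intro: eqv_sym)
  have "u d c * u b a \<doteq> u b a * u d c - scale (of_real (q - inverse q)) (u b c * u d a)"
    using cross[of b d a c] * by blast
  also have "\<dots> \<doteq> u b a * u d c - scale (of_real (q - inverse q)) (u d a * u b c)"
    using anti[of b d a c] * by (intro eqv_diff eqv_scale eqv_refl) (auto intro: eqv_sym)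
  finally show "u d c * u b a \<doteq> u b a * u d c - scale (of_real (q - inverse q)) (u d a * u b c)" .
qed (use q row col in auto)

end

definition wprod :: "(nat \<Rightarrow> nat \<Rightarrow> 'a::monoid_mult) \<Rightarrow> nat list \<Rightarrow> nat list \<Rightarrow> 'a" where
  "wprod u a b = prod_list (map2 u a b)"

lemma wprod_simps [simp]: "wprod u [] b = 1" "wprod u a [] = 1"
  "wprod u (i # a) (j # b) = u i j * wprod u a b"
  by (simp_all add: wprod_def)

lemma wprod_append: "length a = length b \<Longrightarrow> wprod u (a @ a') (b @ b') = wprod u a b * wprod u a' b'"
  by (simp add: wprod_def)

lemma wprod_transposed: "wprod (\<lambda>i j. u j i) b a = wprod u a b"
proof (induction a arbitrary: b)
  case (Cons x a)
  thus ?case by (cases b) auto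
qed simp

text \<open>The quantum minor with the (ordered, possibly repeated) rows \<open>a\<close> and the columns \<open>S\<close>.\<close>

definition rowdet ::
    "real \<Rightarrow> (nat \<Rightarrow> nat \<Rightarrow> ('m::monoid_add \<Rightarrow>\<^sub>0 complex)) \<Rightarrow> nat list \<Rightarrow> nat set \<Rightarrow> ('m \<Rightarrow>\<^sub>0 complex)" where
  "rowdet q u a S = (\<Sum>b\<in>permutations_of_set S. scale ((- of_real q) ^ inversions b) (wprod u a b))"

definition coldet ::
    "real \<Rightarrow> (nat \<Rightarrow> nat \<Rightarrow> ('m::monoid_add \<Rightarrow>\<^sub>0 complex)) \<Rightarrow> nat set \<Rightarrow> nat list \<Rightarrow> ('m \<Rightarrow>\<^sub>0 complex)" where
  "coldet q u S b = (\<Sum>a\<in>permutations_of_set S. scale ((- of_real q) ^ inversions a) (wprod u a b))"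

lemma coldet_transposed: "coldet q u S b = rowdet q (\<lambda>i j. u j i) b S"
  by (simp only: rowdet_def coldet_def wprod_transposed[of u])

lemma sum_permutations_Cons:
  fixes f :: "nat list \<Rightarrow> 'a::comm_monoid_add"
  assumes "finite S" "S \<noteq> {}"
  shows "(\<Sum>b\<in>permutations_of_set S. f b) = (\<Sum>j\<in>S. \<Sum>b\<in>permutations_of_set (S - {j}). f (j # b))"
proof -
  have "(\<Sum>b\<in>permutations_of_set S. f b) = (\<Sum>j\<in>S. sum f ((\<lambda>b. j # b) ` permutations_of_set (S - {j})))"
    unfolding permutations_of_set_nonempty[OF assms(2)]
    by (rule sum.UNION_disjoint) (use assms in auto)
  also have "\<dots> = (\<Sum>j\<in>S. \<Sum>b\<in>permutations_of_set (S - {j}). f (j # b))"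
    by (rule sum.cong[OF refl]) (simp add: sum.reindex inj_on_def)
  finally show ?thesis .
qed

lemma sum_permutations_rev: "(\<Sum>b\<in>permutations_of_set S. f b) = (\<Sum>b\<in>permutations_of_set S. f (rev b))"
  by (rule sum.reindex_bij_witness[where i = rev and j = rev]) (auto simp: permutations_of_set_def)

lemma sum_permutations_snoc:
  fixes f :: "nat list \<Rightarrow> 'a::comm_monoid_add"
  assumes "finite S" "S \<noteq> {}"
  shows "(\<Sum>b\<in>permutations_of_set S. f b) = (\<Sum>j\<in>S. \<Sum>b\<in>permutations_of_set (S - {j}). f (b @ [j]))"
  by (subst sum_permutations_rev, subst sum_permutations_Cons[OF assms], simp,
      subst sum_permutations_rev, simp)

lemma inversions_Cons_permutation:
  assumes "finite S" "b \<in> permutations_of_set (S - {j})"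
  shows "inversions (j # b) = card {y \<in> S. y < j} + inversions b"
proof -
  have "{x \<in> set b. x < j} = {y \<in> S. y < j}" "distinct b"
    using assms by (auto simp: permutations_of_set_def)
  thus ?thesis by (simp add: length_filter_distinct)
qed

lemma inversions_snoc_permutation:
  assumes "finite S" "b \<in> permutations_of_set (S - {j})"
  shows "inversions (b @ [j]) = inversions b + card {y \<in> S. j < y}"
proof -
  have "{x \<in> set b. j < x} = {y \<in> S. j < y}" "distinct b"
    using assms by (auto simp: permutations_of_set_def)
  moreover have "(\<Sum>x\<leftarrow>b. length (filter (\<lambda>y. y < x) [j])) = length (filter (\<lambda>x. j < x) b)" for b
    by (induction b) auto
  ultimately show ?thesis by (simp add: inversions_append length_filter_distinct)
qed

text \<open>Laplace expansion along the first listed row: a column \<open>j\<close> put first forms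
  an inversion with exactly the smaller columns.\<close>

lemma rowdet_Cons:
  assumes "finite S" "S \<noteq> {}"
  shows "rowdet q u (i # a) S =
    (\<Sum>j\<in>S. scale ((- of_real q) ^ card {y \<in> S. y < j}) (u i j * rowdet q u a (S - {j})))"
  unfolding rowdet_def sum_permutations_Cons[OF assms]
  by (intro sum.cong refl)
    (simp add: inversions_Cons_permutation[OF assms(1)] scale_sum_right sum_distrib_left power_add
      scale_scale scale_mult_right del: inversions.simps)

text \<open>Laplace expansion along the last listed column: a row \<open>i\<close> put last forms an
  inversion with exactly the larger rows.\<close>

lemma coldet_snoc:
  assumes "finite S" "S \<noteq> {}" "length b = card S - 1"
  shows "coldet q u S (b @ [l]) =
    (\<Sum>i\<in>S. scale ((- of_real q) ^ card {y \<in> S. i < y}) (coldet q u (S - {i}) b * u i l))"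
proof -
  have l: "length a = length b" if "a \<in> permutations_of_set (S - {i})" "i \<in> S" for a i
    using length_finite_permutations_of_set[OF that(1)] assms that(2) by simp
  show ?thesis
    unfolding coldet_def sum_permutations_snoc[OF assms(1,2)]
    by (intro sum.cong refl)
      (simp add: inversions_snoc_permutation[OF assms(1)] l wprod_append scale_sum_right sum_distrib_right power_add
        scale_scale scale_mult_left mult.commute)
qed

definition swap_at :: "nat \<Rightarrow> 'a list \<Rightarrow> 'a list" where
  "swap_at k xs = take k xs @ [xs ! Suc k, xs ! k] @ drop (Suc (Suc k)) xs"

lemma swap_at_append: "length bs = k \<Longrightarrow> swap_at k (bs @ x # y # ts) = bs @ y # x # ts"
  by (simp add: swap_at_def nth_append)

lemma split_at:
  assumes "Suc k < length b" obtains bs x y ts where "b = bs @ x # y # ts" "length bs = k"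
proof (rule that)
  show "b = take k b @ b ! k # b ! Suc k # drop (Suc (Suc k)) b"
    using assms id_take_nth_drop[of k b] Cons_nth_drop_Suc[of "Suc k" b] by simp
  show "length (take k b) = k" using assms by simp
qed

lemma swap_at_permutations:
  assumes "finite S" "Suc k < card S" "b \<in> permutations_of_set S"
  shows "swap_at k b \<in> permutations_of_set S" "swap_at k (swap_at k b) = b"
proof -
  obtain bs x y ts where b: "b = bs @ x # y # ts" "length bs = k"
    by (rule split_at[of k b]) (use assms length_finite_permutations_of_set[OF assms(3)] in auto)
  show "swap_at k b \<in> permutations_of_set S" "swap_at k (swap_at k b) = b"
    using assms(3) unfolding b(1) swap_at_append[OF b(2)] by (auto simp: permutations_of_set_def)
qed

context q_matrix
begin

text \<open>The 2x2 case of q-antisymmetry in the rows. After reordering,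
  \<open>u a d * u c b\<close> has the coefficient \<open>1 + q * (q - inverse q)\<close>, which is
  \<open>q^2\<close>.\<close>

lemma row_swap:
  assumes "a \<in> J" "c \<in> J" "a < c" "b \<in> K" "d \<in> K" "b < d"
  shows "u c b * u a d - scale q (u c d * u a b) \<doteq> scale (- q) (u a b * u c d - scale q (u a d * u c b))"
proof -
  have "u c b * u a d - scale q (u c d * u a b) \<doteq>
      u a d * u c b - scale q (u a b * u c d - scale (of_real (q - inverse q)) (u a d * u c b))"
    using assms by (intro eqv_diff anti eqv_scale cross)
  also have "\<dots> = scale (- q) (u a b * u c d - scale q (u a d * u c b))"
    using q by (intro poly_mapping_eqI) (simp add: lookup_minus field_simps)
  finally show ?thesis .
qed

text \<open>Pairing each permutation with the one obtained by exchanging two neighbours counts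
  every term twice, hence the factors 2.\<close>

lemma double_rowdet:
  assumes "finite S" "Suc (length ps) < card S"
  shows "scale 2 (rowdet q u a S) = (\<Sum>b\<in>permutations_of_set S.
    scale ((- of_real q) ^ inversions b) (wprod u a b) +
    scale ((- of_real q) ^ inversions (swap_at (length ps) b)) (wprod u a (swap_at (length ps) b)))"
proof -
  have "rowdet q u a S = (\<Sum>b\<in>permutations_of_set S.
      scale ((- of_real q) ^ inversions (swap_at (length ps) b)) (wprod u a (swap_at (length ps) b)))"
    unfolding rowdet_def
    by (rule sum.reindex_bij_witness[where i = "swap_at (length ps)" and j = "swap_at (length ps)"])
      (use swap_at_permutations[OF assms] in auto)
  moreover have "scale 2 (rowdet q u a S) = rowdet q u a S + rowdet q u a S"
    using scale_add[of 1 1 "rowdet q u a S"] by simp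
  ultimately show ?thesis
    unfolding sum.distrib by (simp add: rowdet_def)
qed

lemma rowdet_pair:
  assumes "distinct b" "set b = S" "S \<subseteq> K" "length b = length ps + Suc (Suc (length ss))"
  shows "\<exists>e P x y T. x \<in> K \<and> y \<in> K \<and> x < y \<and> (\<forall>c a. 
    scale ((- of_real q) ^ inversions b) (wprod u (ps @ c # a # ss) b) +
    scale ((- of_real q) ^ inversions (swap_at (length ps) b)) (wprod u (ps @ c # a # ss) (swap_at (length ps) b))
    = scale e (P * (u c x * u a y - scale q (u c y * u a x)) * T))"
proof -
  obtain bs x y ts where b: "b = bs @ x # y # ts" "length bs = length ps"
    by (rule split_at[of "length ps" b]) (use assms(4) in auto)
  \<comment> \<open>Exchanging ascending neighbours adds one inversion, hence the factor
    \<open>- q\<close> in the second term.\<close>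
  have main: "\<exists>e. \<forall>c a. scale ((- of_real q) ^ inversions (bs @ x # y # ts)) (wprod u (ps @ c # a # ss) (bs @ x # y # ts)) +
      scale ((- of_real q) ^ inversions (bs @ y # x # ts)) (wprod u (ps @ c # a # ss) (bs @ y # x # ts))
    = scale e (wprod u ps bs * (u c x * u a y - scale q (u c y * u a x)) * wprod u ss ts)" if "x < y" for x y
    using that b(2)
    by (intro exI[of _ "(- of_real q) ^ inversions (bs @ x # y # ts)"])
      (simp add: inversions_swap wprod_append right_diff_distrib left_diff_distrib scale_mult_right
        scale_mult_left scale_diff_right scale_scale scale_minus mult.assoc mult.commute[of "complex_of_real q"])
  have K: "x \<in> K" "y \<in> K" using assms(2,3) b(1) by auto
  show ?thesis
  proof (cases "x < y")
    case True
    obtain e where e: "\<forall>c a. scale ((- of_real q) ^ inversions (bs @ x # y # ts)) (wprod u (ps @ c # a # ss) (bs @ x # y # ts)) +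
      scale ((- of_real q) ^ inversions (bs @ y # x # ts)) (wprod u (ps @ c # a # ss) (bs @ y # x # ts))
      = scale e (wprod u ps bs * (u c x * u a y - scale q (u c y * u a x)) * wprod u ss ts)"
      using main[OF True] by blast
    show ?thesis unfolding b(1) swap_at_append[OF b(2)]
      by (rule exI[of _ e], rule exI[of _ "wprod u ps bs"], rule exI[of _ x], rule exI[of _ y],
          rule exI[of _ "wprod u ss ts"], intro conjI K True e)
  next
    case False
    hence yx: "y < x" using assms(1) b(1) by auto
    obtain e where e: "\<forall>c a. scale ((- of_real q) ^ inversions (bs @ y # x # ts)) (wprod u (ps @ c # a # ss) (bs @ y # x # ts)) +
      scale ((- of_real q) ^ inversions (bs @ x # y # ts)) (wprod u (ps @ c # a # ss) (bs @ x # y # ts))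
      = scale e (wprod u ps bs * (u c y * u a x - scale q (u c x * u a y)) * wprod u ss ts)"
      using main[OF yx] by blast
    show ?thesis unfolding b(1) swap_at_append[OF b(2)]
      by (rule exI[of _ e], rule exI[of _ "wprod u ps bs"], rule exI[of _ y], rule exI[of _ x],
          rule exI[of _ "wprod u ss ts"], subst add.commute, intro conjI K yx e)
  qed
qed

text \<open>Every pair of terms reduces to its 2x2 minor: \<open>row_swap\<close> gives
  \<open>- q\<close> for distinct rows, and the row relation annihilates the minor for equal
  ones.\<close>

lemma rowdet_swap:
  assumes "finite S" "S \<subseteq> K" "card S = length ps + Suc (Suc (length ss))" "a \<in> J" "c \<in> J"
  shows "a < c \<Longrightarrow> rowdet q u (ps @ c # a # ss) S \<doteq> scale (- of_real q) (rowdet q u (ps @ a # c # ss) S)"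
    and "rowdet q u (ps @ a # a # ss) S \<doteq> 0"
proof -
  have k: "Suc (length ps) < card S" using assms(3) by simp
  have b: "distinct b" "set b = S" "length b = length ps + Suc (Suc (length ss))" if "b \<in> permutations_of_set S" for b
    using that assms(3) length_finite_permutations_of_set[OF that] by (auto simp: permutations_of_set_def)
  {
    assume ac: "a < c"
    have "scale 2 (rowdet q u (ps @ c # a # ss) S) \<doteq> (\<Sum>b\<in>permutations_of_set S.
      scale (- of_real q) (scale ((- of_real q) ^ inversions b) (wprod u (ps @ a # c # ss) b) +
      scale ((- of_real q) ^ inversions (swap_at (length ps) b)) (wprod u (ps @ a # c # ss) (swap_at (length ps) b))))"
      unfolding double_rowdet[OF assms(1) k]
    proof (rule eqv_sum, goal_cases)
      case (1 b)
      obtain e P x y T where xy: "x \<in> K" "y \<in> K" "x < y" and eq: "\<And>c a.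
        scale ((- of_real q) ^ inversions b) (wprod u (ps @ c # a # ss) b) +
        scale ((- of_real q) ^ inversions (swap_at (length ps) b)) (wprod u (ps @ c # a # ss) (swap_at (length ps) b))
        = scale e (P * (u c x * u a y - scale q (u c y * u a x)) * T)"
        using rowdet_pair[OF b(1,2)[OF 1] assms(2) b(3)[OF 1]] by blast
      have "scale e (P * (u c x * u a y - scale q (u c y * u a x)) * T) \<doteq>
          scale e (P * (scale (- q) (u a x * u c y - scale q (u a y * u c x))) * T)"
        using assms ac xy by (intro eqv_scale eqv_mult_left eqv_mult_right row_swap)
      thus ?case unfolding eq
        by (simp add: scale_mult_left scale_mult_right scale_scale mult.commute)
    qed
    also have "\<dots> = scale 2 (scale (- of_real q) (rowdet q u (ps @ a # c # ss) S))"
      unfolding scale_sum_right[symmetric] double_rowdet[OF assms(1) k, symmetric]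
      by (simp add: scale_scale mult.commute)
    finally show "rowdet q u (ps @ c # a # ss) S \<doteq> scale (- of_real q) (rowdet q u (ps @ a # c # ss) S)"
      by (rule eqv_scale_cancel[rotated]) simp
  }
  have "scale 2 (rowdet q u (ps @ a # a # ss) S) \<doteq> (\<Sum>b\<in>permutations_of_set S. 0)"
    unfolding double_rowdet[OF assms(1) k]
  proof (rule eqv_sum, goal_cases)
    case (1 b)
    obtain e P x y T where xy: "x \<in> K" "y \<in> K" "x < y" and eq: "\<And>c a.
      scale ((- of_real q) ^ inversions b) (wprod u (ps @ c # a # ss) b) +
      scale ((- of_real q) ^ inversions (swap_at (length ps) b)) (wprod u (ps @ c # a # ss) (swap_at (length ps) b))
      = scale e (P * (u c x * u a y - scale q (u c y * u a x)) * T)"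
      using rowdet_pair[OF b(1,2)[OF 1] assms(2) b(3)[OF 1]] by blast
    have "u a x * u a y - scale q (u a y * u a x) \<in> I"
      using row[OF assms(4) xy] by (simp add: eqv_def)
    thus ?case unfolding eq eqv_zero by (intro scale_mem mult_right_mem mult_left_mem)
  qed
  hence "scale 2 (rowdet q u (ps @ a # a # ss) S) \<doteq> scale 2 0" by simp
  thus "rowdet q u (ps @ a # a # ss) S \<doteq> 0"
    by (rule eqv_scale_cancel[rotated]) simp
qed

text \<open>Bubble sort on the rows. Each exchange removes one inversion and costs a factor
  \<open>- q\<close>, and equal neighbours give zero. A list without inversions that is not strictly
  increasing must contain equal neighbours.\<close>

lemma rowdet_sort:
  assumes S: "finite S" "S \<subseteq> K"
  shows "length a = card S \<Longrightarrow> set a \<subseteq> J \<Longrightarrow> rowdet q u a S \<doteq>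
    (if distinct a then scale ((- of_real q) ^ inversions a) (rowdet q u (sorted_list_of_set (set a)) S) else 0)"
proof (induction "inversions a" arbitrary: a)
  case (0 a)
  consider "sorted_wrt (<) a" | ps c d ss where "a = ps @ c # d # ss" "d \<le> c"
    using strict_or_descent[of a] by blast
  thus ?case
  proof cases
    case 1
    thus ?thesis by (simp add: inversions_strict sorted_list_of_set_eqI strict_sorted_iff)
  next
    case 2
    hence "d = c" using 0(1) inversions_swap[of d c ps ss] by (cases "d < c") auto
    thus ?thesis using rowdet_swap(2)[OF S, of ps ss c c] 0(2,3) 2 by auto
  qed
next
  case (Suc k a)
  hence "\<not> sorted_wrt (<) a" using inversions_strict by force
  then obtain ps c d ss where a: "a = ps @ c # d # ss" "d \<le> c"
    using strict_or_descent[of a] by blast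
  show ?case
  proof (cases "d = c")
    case True
    thus ?thesis using rowdet_swap(2)[OF S, of ps ss c c] Suc.prems a by auto
  next
    case False
    hence dc: "d < c" using a by simp
    let ?a = "ps @ d # c # ss"
    have inv: "k = inversions ?a" using Suc(2) inversions_swap[OF dc] a by simp
    have "rowdet q u a S \<doteq> scale (- of_real q) (rowdet q u ?a S)"
      unfolding a(1) using Suc.prems a dc by (intro rowdet_swap(1)[OF S]) auto
    also have "\<dots> \<doteq> scale (- of_real q) (if distinct ?a then scale ((- of_real q) ^ inversions ?a)
       (rowdet q u (sorted_list_of_set (set ?a)) S) else 0)"
      using Suc.prems a by (intro eqv_scale Suc(1)[OF inv]) auto
    also have "\<dots> = (if distinct a then scale ((- of_real q) ^ inversions a)
       (rowdet q u (sorted_list_of_set (set a)) S) else 0)"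
    proof -
      have "distinct ?a = distinct a" "set ?a = set a" "inversions a = Suc (inversions ?a)"
        using a inversions_swap[OF dc] by auto
      thus ?thesis by (simp add: scale_scale)
    qed
    finally show ?thesis .
  qed
qed

lemma coldet_sort:
  assumes "finite S" "S \<subseteq> J" "length b = card S" "set b \<subseteq> K"
  shows "coldet q u S b \<doteq>
    (if distinct b then scale ((- of_real q) ^ inversions b) (coldet q u S (sorted_list_of_set (set b))) else 0)"
  using q_matrix.rowdet_sort[OF transposed assms] unfolding coldet_transposed .

end

subsection \<open>Row and column minors agree\<close>

text \<open>The factorial in base \<open>q^2\<close>, that is, the length generating function of the
  symmetric group at \<open>q^2\<close>. It is positive for positive \<open>q\<close> and can
  therefore be divided out.\<close>

definition qfact :: "real \<Rightarrow> nat \<Rightarrow> real" where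
  "qfact q n = (\<Prod>m<n. \<Sum>i\<le>m. q ^ (2 * i))"

lemma qfact_pos: "q > 0 \<Longrightarrow> qfact q n > 0"
  unfolding qfact_def by (intro prod_pos sum_pos) auto

text \<open>The rank within \<open>S\<close> maps \<open>S\<close> bijectively onto the numbers
  below \<open>card S\<close>.\<close>

lemma sum_rank:
  fixes f :: "nat \<Rightarrow> real" and S :: "nat set"
  assumes "finite S" shows "(\<Sum>x\<in>S. f (card {y \<in> S. y < x})) = (\<Sum>i<card S. f i)"
proof -
  let ?r = "\<lambda>x. card {y \<in> S. y < x}"
  have less: "?r x < ?r y" if "x \<in> S" "y \<in> S" "x < y" for x y
    using assms that by (intro psubset_card_mono) auto
  have inj: "inj_on ?r S"
  proof (rule inj_onI)
    fix x y assume "x \<in> S" "y \<in> S" "?r x = ?r y"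
    thus "x = y" using less[of x y] less[of y x] by (cases x y rule: linorder_cases) auto
  qed
  have "?r ` S \<subseteq> {..<card S}"
    using assms by (auto intro!: psubset_card_mono)
  hence "?r ` S = {..<card S}"
    by (intro card_subset_eq) (auto simp: card_image[OF inj])
  thus ?thesis using sum.reindex[OF inj, of f] by simp
qed

text \<open>The first entry contributes its rank independently of the rest, so every size adds one
  geometric sum as a factor.\<close>

lemma sum_inversions:
  "finite S \<Longrightarrow> (\<Sum>b\<in>permutations_of_set S. q ^ (2 * inversions b)) = qfact q (card S)"
proof (induction "card S" arbitrary: S)
  case 0
  thus ?case by (simp add: qfact_def)
next
  case (Suc n S)
  hence S: "finite S" "S \<noteq> {}" by auto
  have "(\<Sum>b\<in>permutations_of_set S. q ^ (2 * inversions b)) =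
      (\<Sum>j\<in>S. q ^ (2 * card {y \<in> S. y < j}) * qfact q n)"
    unfolding sum_permutations_Cons[OF S]
  proof (intro sum.cong refl)
    fix j assume j: "j \<in> S"
    have "(\<Sum>b\<in>permutations_of_set (S - {j}). q ^ (2 * inversions (j # b))) =
        q ^ (2 * card {y \<in> S. y < j}) * (\<Sum>b\<in>permutations_of_set (S - {j}). q ^ (2 * inversions b))"
      by (simp add: inversions_Cons_permutation[OF S(1)] sum_distrib_left power_add distrib_left del: inversions.simps)
    moreover have n: "n = card (S - {j})" using Suc(2) S j by simp
    have "(\<Sum>b\<in>permutations_of_set (S - {j}). q ^ (2 * inversions b)) = qfact q n"
      using Suc(1)[OF n] S(1) by (simp only: n finite_Diff)
    ultimately show "(\<Sum>b\<in>permutations_of_set (S - {j}). q ^ (2 * inversions (j # b))) =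
        q ^ (2 * card {y \<in> S. y < j}) * qfact q n"
      by (simp only:)
  qed
  also have "\<dots> = (\<Sum>i<card S. q ^ (2 * i)) * qfact q n"
    using sum_rank[OF S(1), of "\<lambda>i. q ^ (2 * i) * qfact q n"] by (simp add: sum_distrib_right)
  also have "\<dots> = qfact q (card S)"
    unfolding Suc(2)[symmetric] by (simp add: qfact_def mult.commute flip: lessThan_Suc_atMost)
  finally show ?case .
qed

lemma sorted_list_permutation: "finite S \<Longrightarrow> sorted_list_of_set S \<in> permutations_of_set S"
  by (simp add: permutations_of_set_def)

context q_matrix
begin

text \<open>Both signs are present in the double sum. Sorting the rows of the inner minor produces
  the sign of \<open>a\<close> a second time, so all row orders contribute the same minor with
  positive weights.\<close>

lemma double_sum_rowdet:
  assumes "finite S" "S \<subseteq> K" "finite T" "T \<subseteq> J" "card S = card T"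
  shows "(\<Sum>a\<in>permutations_of_set T. \<Sum>b\<in>permutations_of_set S.
      scale ((- of_real q) ^ inversions a * (- of_real q) ^ inversions b) (wprod u a b))
    \<doteq> scale (of_real (qfact q (card S))) (rowdet q u (sorted_list_of_set T) S)"
proof -
  have "(\<Sum>a\<in>permutations_of_set T. \<Sum>b\<in>permutations_of_set S.
      scale ((- of_real q) ^ inversions a * (- of_real q) ^ inversions b) (wprod u a b)) =
    (\<Sum>a\<in>permutations_of_set T. scale ((- of_real q) ^ inversions a) (rowdet q u a S))"
    by (simp add: rowdet_def scale_sum_right scale_scale)
  also have "\<dots> \<doteq> (\<Sum>a\<in>permutations_of_set T. scale ((- of_real q) ^ inversions a)
     (scale ((- of_real q) ^ inversions a) (rowdet q u (sorted_list_of_set T) S)))"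
  proof (intro eqv_sum eqv_scale)
    fix a assume a: "a \<in> permutations_of_set T"
    hence "length a = card S" "set a \<subseteq> J" "distinct a" "set a = T"
      using assms length_finite_permutations_of_set[OF a] by (auto simp: permutations_of_set_def)
    thus "rowdet q u a S \<doteq> scale ((- of_real q) ^ inversions a) (rowdet q u (sorted_list_of_set T) S)"
      using rowdet_sort[OF assms(1,2), of a] by simp
  qed
  also have "\<dots> = scale (\<Sum>a\<in>permutations_of_set T. of_real (q ^ (2 * inversions a))) (rowdet q u (sorted_list_of_set T) S)"
  proof -
    have "(- complex_of_real q) ^ k * (- complex_of_real q) ^ k = of_real (q ^ (2 * k))" for k
      by (simp add: power_mult power2_eq_square flip: power_mult_distrib)
    moreover have "scale (\<Sum>a\<in>A. g a) f = (\<Sum>a\<in>A. scale (g a) f)" for A and g :: "nat list \<Rightarrow> complex" and f :: "'m \<Rightarrow>\<^sub>0 complex"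
      by (induction A rule: infinite_finite_induct) (simp_all add: scale_add)
    ultimately show ?thesis by (simp add: scale_scale)
  qed
  also have "(\<Sum>a\<in>permutations_of_set T. complex_of_real (q ^ (2 * inversions a))) = of_real (qfact q (card S))"
    using sum_inversions[OF assms(3), of q] assms(5) by (metis of_real_sum)
  finally show ?thesis .
qed

text \<open>The double sum is symmetric in rows and columns. By transposition it is also
  \<open>qfact\<close> times the column version, and the positive factor cancels.\<close>

lemma rowdet_eqv_coldet:
  assumes "finite S" "S \<subseteq> K" "finite T" "T \<subseteq> J" "card S = card T"
  shows "rowdet q u (sorted_list_of_set T) S \<doteq> coldet q u T (sorted_list_of_set S)"
proof -
  have "(\<Sum>a\<in>permutations_of_set T. \<Sum>b\<in>permutations_of_set S.
      scale ((- of_real q) ^ inversions a * (- of_real q) ^ inversions b) (wprod u a b)) =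
    (\<Sum>b\<in>permutations_of_set S. \<Sum>a\<in>permutations_of_set T.
      scale ((- of_real q) ^ inversions b * (- of_real q) ^ inversions a) (wprod (\<lambda>i j. u j i) b a))"
    by (subst sum.swap, intro sum.cong refl, subst wprod_transposed[of u], subst mult.commute, rule refl)
  also have "\<dots> \<doteq> scale (of_real (qfact q (card T))) (coldet q u T (sorted_list_of_set S))"
    unfolding coldet_transposed
    using assms by (intro q_matrix.double_sum_rowdet[OF transposed]) auto
  finally have "scale (of_real (qfact q (card S))) (rowdet q u (sorted_list_of_set T) S) \<doteq>
      scale (of_real (qfact q (card T))) (coldet q u T (sorted_list_of_set S))"
    by (rule eqv_trans[OF eqv_sym[OF double_sum_rowdet[OF assms]]])
  hence "scale (of_real (qfact q (card S))) (rowdet q u (sorted_list_of_set T) S) \<doteq>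
      scale (of_real (qfact q (card S))) (coldet q u T (sorted_list_of_set S))"
    unfolding assms(5) .
  thus ?thesis
    using qfact_pos[OF q, of "card S"] by (rule_tac eqv_scale_cancel[rotated]) auto
qed

end

subsection \<open>Centrality of the quantum determinant\<close>

lemma sorted_list_of_interval: "sorted_list_of_set {1..n} = [1..<Suc n]"
  by (simp only: sorted_list_of_set_range flip: atLeastLessThanSuc_atLeastAtMost)

lemma inversions_sorted_list: "inversions (sorted_list_of_set S) = 0"
  by (rule inversions_strict) simp

lemma card_interval_less: "j \<in> {1..n} \<Longrightarrow> card {y \<in> {1..n}. y < j} = j - 1"
proof -
  assume "j \<in> {1..n}"
  hence "{y \<in> {1..n}. y < j} = {1..<j}" by auto
  thus ?thesis by simp
qed

lemma card_interval_greater: "card {y \<in> {1..n}. j < y} = n - j" if "j \<in> {1..n}" for j n :: nat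
proof -
  have "{y \<in> {1..n}. j < y} = {Suc j..n}" using that by auto
  thus ?thesis by simp
qed

abbreviation qminor ::
    "real \<Rightarrow> nat \<Rightarrow> (nat \<Rightarrow> nat \<Rightarrow> ('m::monoid_add \<Rightarrow>\<^sub>0 complex)) \<Rightarrow> nat \<Rightarrow> nat \<Rightarrow> ('m \<Rightarrow>\<^sub>0 complex)" where
  "qminor q n u k j \<equiv> rowdet q u (sorted_list_of_set ({1..n} - {k})) ({1..n} - {j})"

definition qdetm :: "real \<Rightarrow> nat \<Rightarrow> (nat \<Rightarrow> nat \<Rightarrow> ('m::monoid_add \<Rightarrow>\<^sub>0 complex)) \<Rightarrow> ('m \<Rightarrow>\<^sub>0 complex)" where
  "qdetm q n u = rowdet q u [1..<Suc n] {1..n}"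

locale square_q_matrix = q_matrix I q u "{1..n}" "{1..n}"
  for I :: "('m::monoid_add \<Rightarrow>\<^sub>0 complex) set" and q u and n :: nat
begin

text \<open>Putting row \<open>i\<close> in front of the rows other than \<open>k\<close> repeats a
  row unless \<open>i = k\<close>; in that case the row passes the \<open>k - 1\<close> smaller ones
  on the way to its place.\<close>

lemma row_laplace:
  assumes i: "i \<in> {1..n}" and k: "k \<in> {1..n}"
  shows "(\<Sum>j\<in>{1..n}. scale ((- of_real q) ^ (j - 1)) (u i j * qminor q n u k j)) \<doteq>
    (if i = k then scale ((- of_real q) ^ (k - 1)) (qdetm q n u) else 0)"
proof -
  let ?a = "i # sorted_list_of_set ({1..n} - {k})"
  have "rowdet q u ?a {1..n} = (\<Sum>j\<in>{1..n}. scale ((- of_real q) ^ card {y \<in> {1..n}. y < j}) (u i j * qminor q n u k j))"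
    by (rule rowdet_Cons) (use i in auto)
  also have "\<dots> = (\<Sum>j\<in>{1..n}. scale ((- of_real q) ^ (j - 1)) (u i j * qminor q n u k j))"
    by (rule sum.cong[OF refl]) (simp only: card_interval_less)
  finally have "(\<Sum>j\<in>{1..n}. scale ((- of_real q) ^ (j - 1)) (u i j * qminor q n u k j)) = rowdet q u ?a {1..n}"
    by (rule sym)
  also have "\<dots> \<doteq> (if distinct ?a then scale ((- of_real q) ^ inversions ?a)
      (rowdet q u (sorted_list_of_set (set ?a)) {1..n}) else 0)"
    using i k by (intro rowdet_sort) auto
  also have "\<dots> = (if i = k then scale ((- of_real q) ^ (k - 1)) (qdetm q n u) else 0)"
  proof (cases "i = k")
    case True
    have "distinct ?a" "set ?a = {1..n}" using True i by auto
    moreover have "inversions ?a = k - 1"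
      using inversions_Cons_permutation[OF _ sorted_list_permutation, of "{1..n}" i] True k
        card_interval_less[OF i]
      by (simp add: inversions_sorted_list del: inversions.simps)
    ultimately show ?thesis unfolding qdetm_def using True by (simp only: sorted_list_of_interval if_True refl)
  qed (use i in auto)
  finally show ?thesis .
qed

text \<open>Expansion along a column is available for \<open>coldet\<close>, so the minors are
  rewritten first. For \<open>j = l\<close> the appended column passes the \<open>n - j\<close>
  larger ones.\<close>

lemma col_laplace:
  assumes j: "j \<in> {1..n}" and l: "l \<in> {1..n}"
  shows "(\<Sum>i\<in>{1..n}. scale ((- of_real q) ^ (n - i)) (qminor q n u i j * u i l)) \<doteq>
    (if j = l then scale ((- of_real q) ^ (n - j)) (qdetm q n u) else 0)"
proof -
  let ?s = "sorted_list_of_set ({1..n} - {j})" let ?b = "?s @ [l]"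
  have "(\<Sum>i\<in>{1..n}. scale ((- of_real q) ^ (n - i)) (qminor q n u i j * u i l)) \<doteq>
      (\<Sum>i\<in>{1..n}. scale ((- of_real q) ^ (n - i)) (coldet q u ({1..n} - {i}) ?s * u i l))"
    using j by (intro eqv_sum eqv_scale eqv_mult_right rowdet_eqv_coldet) auto
  also have "\<dots> = (\<Sum>i\<in>{1..n}. scale ((- of_real q) ^ card {y \<in> {1..n}. i < y}) (coldet q u ({1..n} - {i}) ?s * u i l))"
    by (rule sum.cong[OF refl]) (simp only: card_interval_greater)
  also have "\<dots> = coldet q u {1..n} ?b"
    by (rule coldet_snoc[symmetric]) (use j in auto)
  also have "\<dots> \<doteq> (if distinct ?b then scale ((- of_real q) ^ inversions ?b)
      (coldet q u {1..n} (sorted_list_of_set (set ?b))) else 0)"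
    using j l by (intro coldet_sort) auto
  also have "\<dots> \<doteq> (if j = l then scale ((- of_real q) ^ (n - j)) (qdetm q n u) else 0)"
  proof (cases "j = l")
    case True
    have "distinct ?b" "set ?b = {1..n}" using True j by auto
    moreover have "inversions ?b = n - j"
      using inversions_snoc_permutation[OF _ sorted_list_permutation, of "{1..n}" j] True j
        card_interval_greater[OF j]
      by (simp add: inversions_sorted_list)
    moreover have "coldet q u {1..n} (sorted_list_of_set {1..n}) \<doteq> rowdet q u (sorted_list_of_set {1..n}) {1..n}"
      by (rule eqv_sym, rule rowdet_eqv_coldet) auto
    ultimately show ?thesis unfolding qdetm_def using True
      by (simp only: sorted_list_of_interval if_True refl eqv_scale)
  qed (use l in auto)
  finally show ?thesis .
qed

text \<open>The quantum adjugate: \<open>(- q)^(j - k)\<close> times the minor without row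
  \<open>k\<close> and column \<open>j\<close>. The exponent may be negative, hence the
  inverse.\<close>

definition adj :: "nat \<Rightarrow> nat \<Rightarrow> ('m \<Rightarrow>\<^sub>0 complex)" where
  "adj j k = scale ((- of_real q) ^ j * inverse ((- of_real q) ^ k)) (qminor q n u k j)"

lemma mult_adj:
  assumes "i \<in> {1..n}" "k \<in> {1..n}"
  shows "(\<Sum>j\<in>{1..n}. u i j * adj j k) \<doteq> (if i = k then qdetm q n u else 0)"
proof -
  \<comment> \<open>The powers independent of the summation index; one factor \<open>- q\<close>
    makes up for the exponent \<open>j - 1\<close> in the Laplace expansion.\<close>
  let ?c = "(- of_real q) * inverse ((- of_real q) ^ k) :: complex"
  have q0: "(- of_real q :: complex) \<noteq> 0" using q by simp
  have p: "(- complex_of_real q) * (- of_real q) ^ (j - 1) = (- of_real q) ^ j" if "j \<in> {1..n}" for j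
    using that by (cases j) auto
  have "(\<Sum>j\<in>{1..n}. u i j * adj j k) =
      scale ?c (\<Sum>j\<in>{1..n}. scale ((- of_real q) ^ (j - 1)) (u i j * qminor q n u k j))"
    unfolding adj_def scale_sum_right
    by (rule sum.cong[OF refl]) (simp add: scale_mult_right scale_scale mult_ac flip: p)
  also have "\<dots> \<doteq> scale ?c (if i = k then scale ((- of_real q) ^ (k - 1)) (qdetm q n u) else 0)"
    by (rule eqv_scale[OF row_laplace[OF assms]])
  also have "\<dots> = (if i = k then qdetm q n u else 0)"
  proof -
    have "?c * (- of_real q) ^ (k - 1) = ((- of_real q) * (- of_real q) ^ (k - 1)) * inverse ((- of_real q) ^ k)"
      by (simp only: mult_ac)
    also have "\<dots> = 1" unfolding p[OF assms(2)] using q0 by simp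
    finally show ?thesis by (simp only: scale_scale scale_simps if_distrib[of "scale _"])
  qed
  finally show ?thesis .
qed

lemma adj_mult:
  assumes "j \<in> {1..n}" "l \<in> {1..n}"
  shows "(\<Sum>i\<in>{1..n}. adj j i * u i l) \<doteq> (if j = l then qdetm q n u else 0)"
proof -
  \<comment> \<open>Division by \<open>(- q)^n\<close> turns the power \<open>n - i\<close> of the
    Laplace expansion into the inverse of the power \<open>i\<close> that \<open>adj\<close>
    carries.\<close>
  let ?c = "(- of_real q) ^ j * inverse ((- of_real q) ^ n) :: complex"
  have q0: "(- of_real q :: complex) \<noteq> 0" using q by simp
  have p: "inverse ((- complex_of_real q) ^ n) * (- of_real q) ^ (n - i) = inverse ((- of_real q) ^ i)"
    if "i \<in> {1..n}" for i
  proof -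
    have "(- complex_of_real q) ^ n = (- of_real q) ^ i * (- of_real q) ^ (n - i)"
      using that by (simp flip: power_add)
    thus ?thesis using q0 by simp
  qed
  have p': "?c * (- of_real q) ^ (n - i) = (- of_real q) ^ j * inverse ((- of_real q) ^ i)" if "i \<in> {1..n}" for i
    unfolding mult.assoc p[OF that] ..
  have "(\<Sum>i\<in>{1..n}. adj j i * u i l) =
      scale ?c (\<Sum>i\<in>{1..n}. scale ((- of_real q) ^ (n - i)) (qminor q n u i j * u i l))"
    unfolding adj_def scale_sum_right
    by (rule sum.cong[OF refl]) (simp only: scale_mult_left scale_scale p')
  also have "\<dots> \<doteq> scale ?c (if j = l then scale ((- of_real q) ^ (n - j)) (qdetm q n u) else 0)"
    by (rule eqv_scale[OF col_laplace[OF assms]])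
  also have "\<dots> = (if j = l then qdetm q n u else 0)"
    using q0 by (simp only: scale_scale scale_simps if_distrib[of "scale _"] p'[OF assms(1)]) (simp add: scale_simps)
  finally show ?thesis .
qed

text \<open>Up to the determinant, \<open>adj\<close> inverts \<open>u\<close> from both sides, so u
  det = u (adj u) = (u adj) u = det u, read entry by entry.\<close>

lemma det_central:
  assumes i: "i \<in> {1..n}" and l: "l \<in> {1..n}"
  shows "u i l * qdetm q n u \<doteq> qdetm q n u * u i l"
proof -
  let ?D = "qdetm q n u"
  have "u i l * ?D = (\<Sum>j\<in>{1..n}. u i j * (if j = l then ?D else 0))"
    using l by (simp add: if_distrib[of "(*) _"] cong: if_cong)
  also have "\<dots> \<doteq> (\<Sum>j\<in>{1..n}. u i j * (\<Sum>k\<in>{1..n}. adj j k * u k l))"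
    by (intro eqv_sum eqv_mult_left eqv_sym[OF adj_mult] l)
  also have "\<dots> = (\<Sum>k\<in>{1..n}. (\<Sum>j\<in>{1..n}. u i j * adj j k) * u k l)"
    unfolding sum_distrib_left sum_distrib_right by (subst sum.swap) (simp add: mult.assoc)
  also have "\<dots> \<doteq> (\<Sum>k\<in>{1..n}. (if i = k then ?D else 0) * u k l)"
    by (intro eqv_sum eqv_mult_right mult_adj i)
  also have "\<dots> = ?D * u i l"
    using i by (simp add: if_distrib[of "\<lambda>x. x * _"] cong: if_cong)
  finally show ?thesis .
qed

end

subsection \<open>The defining relations\<close>

text \<open>The defining relator as a function of the matrix, so that it can be stated for products
  and for tagged copies as well as for the generators.\<close>

definition relR ::
    "real \<Rightarrow> nat \<Rightarrow> (nat \<Rightarrow> nat \<Rightarrow> ('m::monoid_add \<Rightarrow>\<^sub>0 complex)) \<Rightarrow> nat \<Rightarrow> nat \<Rightarrow> nat \<Rightarrow> nat \<Rightarrow> ('m \<Rightarrow>\<^sub>0 complex)" where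
  "relR q n u a b c d =
     (\<Sum>w\<in>{1..n}. \<Sum>x\<in>{1..n}. scale (Rmat q a c w x) (u w b * u x d)) -
     (\<Sum>y\<in>{1..n}. \<Sum>z\<in>{1..n}. scale (Rmat q y z b d) (u a y * u c z))"

text \<open>With one pair of indices fixed, the R-matrix is supported on two pairs, the given one
  and its exchange.\<close>

lemma sum_two_points:
  fixes f :: "nat \<Rightarrow> nat \<Rightarrow> ('m \<Rightarrow>\<^sub>0 complex)"
  assumes "finite A" "a \<in> A" "c \<in> A"
  shows "(\<Sum>w\<in>A. \<Sum>x\<in>A. scale (e * of_bool (w = c) * of_bool (x = a) + e' * of_bool (w = a) * of_bool (x = c)) (f w x))
    = scale e (f c a) + scale e' (f a c)"
proof -
  have pt: "(\<Sum>w\<in>A. \<Sum>x\<in>A. scale (e * of_bool (w = c) * of_bool (x = a)) (f w x)) = scale e (f c a)"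
    if "a \<in> A" "c \<in> A" for a c e
  proof -
    have "(\<Sum>x\<in>A. scale (e * of_bool (w = c) * of_bool (x = a)) (f w x)) =
        (\<Sum>x\<in>A. if x = a then scale (e * of_bool (w = c)) (f w x) else 0)" for w
      by (intro sum.cong refl) simp
    also have "\<dots> w = (if w = c then scale e (f w a) else 0)" for w
      using assms(1) that by simp
    finally show ?thesis using assms(1) that by simp
  qed
  show ?thesis unfolding scale_add sum.distrib using pt assms by simp
qed

lemma relR_expand:
  assumes "a \<in> {1..n}" "b \<in> {1..n}" "c \<in> {1..n}" "d \<in> {1..n}"
  shows "relR q n u a b c d =
    (scale (if a = c then of_real q else 1) (u c b * u a d) +
     scale (if a < c then of_real (q - inverse q) else 0) (u a b * u c d)) -
    (scale (if b = d then of_real q else 1) (u a d * u c b) +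
     scale (if b < d then of_real (q - inverse q) else 0) (u a b * u c d))"
proof -
  have 1: "Rmat q a c w x = (if a = c then of_real q else 1) * of_bool (w = c) * of_bool (x = a) +
      (if a < c then of_real (q - inverse q) else 0) * of_bool (w = a) * of_bool (x = c)" for w x
    unfolding Rmat_def by (simp add: of_bool_def)
  have 2: "Rmat q y z b d = (if b = d then of_real q else 1) * of_bool (y = d) * of_bool (z = b) +
      (if b < d then of_real (q - inverse q) else 0) * of_bool (y = b) * of_bool (z = d)" for y z
    unfolding Rmat_def by (auto simp: of_bool_def)
  show ?thesis
    unfolding relR_def 1 2 using assms by (simp only: sum_two_points finite_atLeastAtMost)
qed

context two_sided_ideal
begin

text \<open>There are nine relative positions of two rows and two columns, and in each the relator
  is zero, a multiple of one sorted relation or a combination of two.\<close>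

lemma q_matrix_relR:
  assumes "q_matrix I q u {1..n} {1..n}" "a \<in> {1..n}" "b \<in> {1..n}" "c \<in> {1..n}" "d \<in> {1..n}"
  shows "relR q n u a b c d \<in> I"
proof -
  interpret q_matrix I q u "{1..n}" "{1..n}" by (rule assms(1))
  let ?v = "complex_of_real (q - inverse q)"
  have q0: "complex_of_real q \<noteq> 0" using q by simp
  have mem: "x - y \<in> I \<Longrightarrow> z = x - y \<or> z = y - x \<or> (\<exists>e. z = scale e (x - y)) \<Longrightarrow> z \<in> I" for x y z
    using minus_mem[of "x - y"] scale_mem by auto
  consider "a = c" "b = d" | "a = c" "b < d" | "a = c" "d < b" | "a < c" "b = d" | "c < a" "b = d"
    | "a < c" "b < d" | "a < c" "d < b" | "c < a" "b < d" | "c < a" "d < b"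
    by (meson linorder_less_linear)
  thus ?thesis
  proof cases
    case 1
    thus ?thesis using assms by (simp add: relR_expand zero_mem)
  next
    case 2
    have "relR q n u a b c d = scale (inverse q) (u a b * u a d - scale q (u a d * u a b))"
      using 2 assms q0 by (simp add: relR_expand scale_diff_right scale_scale scale_diff)
    thus ?thesis using row[of a b d] 2 assms by (simp add: eqv_def scale_mem)
  next
    case 3
    have "relR q n u a b c d = - (u a d * u a b - scale q (u a b * u a d))"
      using 3 assms q0 by (simp add: relR_expand)
    thus ?thesis using row[of a d b] 3 assms by (simp add: eqv_def minus_mem del: minus_diff_eq)
  next
    case 4
    have "relR q n u a b c d = - scale (inverse q) (u a b * u c b - scale q (u c b * u a b))"
      using 4 assms q0 by (simp add: relR_expand scale_diff_right scale_scale scale_diff)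
    thus ?thesis using col[of a c b] 4 assms by (simp add: eqv_def minus_mem scale_mem)
  next
    case 5
    have "relR q n u a b c d = (u c b * u a b - scale q (u a b * u c b))"
      using 5 assms q0 by (simp add: relR_expand)
    thus ?thesis using col[of c a b] 5 assms by (simp add: eqv_def)
  next
    case 6
    have "relR q n u a b c d = u c b * u a d - u a d * u c b"
      using 6 assms q0 by (simp add: relR_expand)
    thus ?thesis using anti[of a c b d] 6 assms by (simp add: eqv_def)
  next
    case 7
    have "relR q n u a b c d = u c b * u a d - (u a d * u c b - scale ?v (u a b * u c d))"
      using 7 assms q0 by (simp add: relR_expand)
    thus ?thesis using cross[of a c d b] 7 assms by (simp add: eqv_def)
  next
    case 8
    \<comment> \<open>In this position two reorderings are needed: \<open>?A\<close> is the diagonal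
      relation and \<open>?B\<close> the antidiagonal one, which corrects the order in the extra
      term.\<close>
    let ?A = "u a d * u c b - (u c b * u a d - scale ?v (u c d * u a b))"
    let ?B = "u a b * u c d - u c d * u a b"
    have "relR q n u a b c d = - (?A + scale ?v ?B)"
      using 8 assms q0 by (simp add: relR_expand scale_diff_right)
    moreover have "?A \<in> I" using cross[of c a b d] 8 assms by (simp add: eqv_def)
    moreover have "?B \<in> I" using anti[of c a b d] 8 assms by (simp add: eqv_def)
    ultimately show ?thesis by (simp only: minus_mem add_mem scale_mem)
  next
    case 9
    have "relR q n u a b c d = - (u a d * u c b - u c b * u a d)"
      using 9 assms q0 by (simp add: relR_expand)
    thus ?thesis using anti[of c a d b] 9 assms by (simp add: eqv_def minus_mem del: minus_diff_eq)
  qed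
qed

text \<open>Up to sign each sorted relation is a defining relator at suitable indices. This
  direction admits a new matrix to the determinant calculus.\<close>

lemma relR_q_matrix:
  assumes q: "q > 0" and rel: "\<And>a b c d. a \<in> {1..n} \<Longrightarrow> b \<in> {1..n} \<Longrightarrow> c \<in> {1..n} \<Longrightarrow> d \<in> {1..n} \<Longrightarrow>
    relR q n u a b c d \<in> I"
  shows "q_matrix I q u {1..n} {1..n}"
proof
  have q0: "complex_of_real q \<noteq> 0" using q by simp
  fix a b c d assume *: "a \<in> {1..n}" "b \<in> {1..n}" "c \<in> {1..n}" "d \<in> {1..n}"
  {
    assume "b < d"
    thus "u a b * u a d \<doteq> scale (of_real q) (u a d * u a b)"
      using minus_mem[OF rel[of a d a b]] * by (simp add: eqv_def relR_expand)
  }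
  {
    assume "a < c"
    thus "u a b * u c b \<doteq> scale (of_real q) (u c b * u a b)"
      using rel[of c b a b] * by (simp add: eqv_def relR_expand)
  }
  assume ac: "a < c" and bd: "b < d"
  show "u c b * u a d \<doteq> u a d * u c b"
    using rel[of a b c d] * ac bd by (simp add: eqv_def relR_expand)
  show "u c d * u a b \<doteq> u a b * u c d - scale (of_real (q - inverse q)) (u a d * u c b)"
    using rel[of a d c b] * ac bd by (simp add: eqv_def relR_expand diff_diff_eq2)
qed (rule q)

text \<open>In matrix notation with \<open>x = a b\<close>: \<open>R x\<^sub>1 x\<^sub>2 = R a\<^sub>1 a\<^sub>2 b\<^sub>1 b\<^sub>2 = a\<^sub>1 a\<^sub>2 R b\<^sub>1 b\<^sub>2 = x\<^sub>1 x\<^sub>2 R\<close>.\<close>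

lemma product_q_matrix:
  assumes a: "q_matrix I q a {1..n} {1..n}" and b: "q_matrix I q b {1..n} {1..n}"
    and comm: "\<And>i j k l. i \<in> {1..n} \<Longrightarrow> j \<in> {1..n} \<Longrightarrow> k \<in> {1..n} \<Longrightarrow> l \<in> {1..n} \<Longrightarrow>
      a i j * b k l \<doteq> b k l * a i j"
  shows "q_matrix I q (\<lambda>i j. \<Sum>k\<in>{1..n}. a i k * b k j) {1..n} {1..n}"
proof (rule relR_q_matrix)
  show "q > 0" using a by (rule q_matrix.q)
  let ?N = "{1..n}" let ?x = "\<lambda>i j. \<Sum>k\<in>?N. a i k * b k j"
  have four: "?x i j * ?x k l \<doteq> (\<Sum>r\<in>?N. \<Sum>s\<in>?N. (a i r * a k s) * (b r j * b s l))"
    if "i \<in> ?N" "j \<in> ?N" "k \<in> ?N" "l \<in> ?N" for i j k l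
  proof -
    have "?x i j * ?x k l = (\<Sum>r\<in>?N. \<Sum>s\<in>?N. a i r * (b r j * a k s) * b s l)"
      unfolding sum_product by (simp add: mult.assoc)
    also have "\<dots> \<doteq> (\<Sum>r\<in>?N. \<Sum>s\<in>?N. a i r * (a k s * b r j) * b s l)"
      using that by (intro eqv_sum eqv_mult_left eqv_mult_right eqv_sym[OF comm])
    also have "\<dots> = (\<Sum>r\<in>?N. \<Sum>s\<in>?N. (a i r * a k s) * (b r j * b s l))"
      by (simp add: mult.assoc)
    finally show ?thesis .
  qed
  fix i j k l assume *: "i \<in> ?N" "j \<in> ?N" "k \<in> ?N" "l \<in> ?N"
  have ra: "(\<Sum>w\<in>?N. \<Sum>x\<in>?N. scale (Rmat q i k w x) (a w r * a x s)) \<doteq>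
      (\<Sum>y\<in>?N. \<Sum>z\<in>?N. scale (Rmat q y z r s) (a i y * a k z))" if "r \<in> ?N" "s \<in> ?N" for r s
    using q_matrix_relR[OF a *(1) that(1) *(3) that(2)] by (simp only: eqv_def relR_def)
  have rb: "(\<Sum>w\<in>?N. \<Sum>x\<in>?N. scale (Rmat q y z w x) (b w j * b x l)) \<doteq>
      (\<Sum>r\<in>?N. \<Sum>s\<in>?N. scale (Rmat q r s j l) (b y r * b z s))" if "y \<in> ?N" "z \<in> ?N" for y z
    using q_matrix_relR[OF b that(1) *(2) that(2) *(4)] by (simp only: eqv_def relR_def)
  \<comment> \<open>Exchanges the outer with the inner double sum; this is how \<open>R\<close>
    travels from one side of a factor to the other.\<close>
  have swap4: "(\<Sum>w\<in>?N. \<Sum>x\<in>?N. \<Sum>r\<in>?N. \<Sum>s\<in>?N. f w x r s) = (\<Sum>r\<in>?N. \<Sum>s\<in>?N. \<Sum>w\<in>?N. \<Sum>x\<in>?N. f w x r s)"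
    for f :: "nat \<Rightarrow> nat \<Rightarrow> nat \<Rightarrow> nat \<Rightarrow> ('m \<Rightarrow>\<^sub>0 complex)"
  proof -
    have "(\<Sum>w\<in>?N. \<Sum>x\<in>?N. \<Sum>r\<in>?N. \<Sum>s\<in>?N. f w x r s) = (\<Sum>w\<in>?N. \<Sum>r\<in>?N. \<Sum>x\<in>?N. \<Sum>s\<in>?N. f w x r s)"
      by (intro sum.cong refl sum.swap)
    also have "\<dots> = (\<Sum>r\<in>?N. \<Sum>w\<in>?N. \<Sum>s\<in>?N. \<Sum>x\<in>?N. f w x r s)"
      by (subst sum.swap, intro sum.cong refl sum.swap)
    also have "\<dots> = (\<Sum>r\<in>?N. \<Sum>s\<in>?N. \<Sum>w\<in>?N. \<Sum>x\<in>?N. f w x r s)"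
      by (intro sum.cong refl sum.swap)
    finally show ?thesis .
  qed
  have "(\<Sum>w\<in>?N. \<Sum>x\<in>?N. scale (Rmat q i k w x) (?x w j * ?x x l)) \<doteq>
      (\<Sum>w\<in>?N. \<Sum>x\<in>?N. scale (Rmat q i k w x) (\<Sum>r\<in>?N. \<Sum>s\<in>?N. (a w r * a x s) * (b r j * b s l)))"
    using * by (intro eqv_sum eqv_scale four)
  also have "\<dots> = (\<Sum>r\<in>?N. \<Sum>s\<in>?N. (\<Sum>w\<in>?N. \<Sum>x\<in>?N. scale (Rmat q i k w x) (a w r * a x s)) * (b r j * b s l))"
    unfolding scale_sum_right sum_distrib_right by (subst swap4) (simp only: scale_mult_left)
  also have "\<dots> \<doteq> (\<Sum>r\<in>?N. \<Sum>s\<in>?N. (\<Sum>y\<in>?N. \<Sum>z\<in>?N. scale (Rmat q y z r s) (a i y * a k z)) * (b r j * b s l))"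
    by (intro eqv_sum eqv_mult_right ra)
  also have "\<dots> = (\<Sum>y\<in>?N. \<Sum>z\<in>?N. (a i y * a k z) * (\<Sum>r\<in>?N. \<Sum>s\<in>?N. scale (Rmat q y z r s) (b r j * b s l)))"
    unfolding sum_distrib_left sum_distrib_right
    by (subst swap4) (simp only: scale_mult_left scale_mult_right)
  also have "\<dots> \<doteq> (\<Sum>y\<in>?N. \<Sum>z\<in>?N. (a i y * a k z) * (\<Sum>r\<in>?N. \<Sum>s\<in>?N. scale (Rmat q r s j l) (b y r * b z s)))"
    by (intro eqv_sum eqv_mult_left rb)
  also have "\<dots> = (\<Sum>r\<in>?N. \<Sum>s\<in>?N. scale (Rmat q r s j l) (\<Sum>y\<in>?N. \<Sum>z\<in>?N. (a i y * a k z) * (b y r * b z s)))"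
    unfolding sum_distrib_left scale_sum_right by (subst swap4) (simp only: scale_mult_right)
  also have "\<dots> \<doteq> (\<Sum>r\<in>?N. \<Sum>s\<in>?N. scale (Rmat q r s j l) (?x i r * ?x k s))"
    using * by (intro eqv_sum eqv_scale eqv_sym[OF four])
  finally show "relR q n ?x i j k l \<in> I"
    by (simp only: eqv_def relR_def)
qed

lemma wprod_commute:
  assumes comm: "\<And>i j k l. i \<in> N \<Longrightarrow> j \<in> N \<Longrightarrow> k \<in> N \<Longrightarrow> l \<in> N \<Longrightarrow> a i j * b k l \<doteq> b k l * a i j"
    and k: "k \<in> N" "l \<in> N"
  shows "set as \<subseteq> N \<Longrightarrow> set bs \<subseteq> N \<Longrightarrow> b k l * wprod a as bs \<doteq> wprod a as bs * b k l"
proof (induction as arbitrary: bs)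
  case (Cons x xs)
  show ?case
  proof (cases bs)
    case Nil
    thus ?thesis by simp
  next
    fix y ys assume bs: "bs = y # ys"
    have "b k l * (a x y * wprod a xs ys) = (b k l * a x y) * wprod a xs ys" by (simp add: mult.assoc)
    also have "\<dots> \<doteq> (a x y * b k l) * wprod a xs ys"
      using Cons.prems bs k by (intro eqv_mult_right eqv_sym[OF comm]) auto
    also have "\<dots> = a x y * (b k l * wprod a xs ys)" by (simp add: mult.assoc)
    also have "\<dots> \<doteq> a x y * (wprod a xs ys * b k l)"
      using Cons.prems bs by (intro eqv_mult_left Cons.IH) auto
    finally show ?thesis using bs by (simp add: mult.assoc)
  qed
qed simp

text \<open>Multiplying out gives all index words \<open>ks\<close>; as the entries of
  \<open>a\<close> and \<open>b\<close> commute, those of \<open>a\<close> can be collected on the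
  left.\<close>

lemma wprod_product:
  assumes comm: "\<And>i j k l. i \<in> N \<Longrightarrow> j \<in> N \<Longrightarrow> k \<in> N \<Longrightarrow> l \<in> N \<Longrightarrow> a i j * b k l \<doteq> b k l * a i j"
    and "finite N"
  shows "length as = length bs \<Longrightarrow> set as \<subseteq> N \<Longrightarrow> set bs \<subseteq> N \<Longrightarrow>
    wprod (\<lambda>i j. \<Sum>k\<in>N. a i k * b k j) as bs \<doteq>
    (\<Sum>ks | set ks \<subseteq> N \<and> length ks = length as. wprod a as ks * wprod b ks bs)"
proof (induction as bs rule: list_induct2)
  case Nil
  have "{ks :: nat list. set ks \<subseteq> N \<and> length ks = length ([] :: nat list)} = {[]}" by auto
  thus ?case by simp
next
  case (Cons x xs y ys)
  let ?L = "\<lambda>m. {ks. set ks \<subseteq> N \<and> length ks = m}"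
  have fin: "finite (?L m)" for m using finite_lists_length_eq[OF assms(2)] .
  have L: "?L (Suc m) = (\<lambda>(k, ks). k # ks) ` (N \<times> ?L m)" for m
    by (auto simp: image_iff length_Suc_conv)
  have "wprod (\<lambda>i j. \<Sum>k\<in>N. a i k * b k j) (x # xs) (y # ys) \<doteq>
      (\<Sum>k\<in>N. a x k * b k y) * (\<Sum>ks\<in>?L (length xs). wprod a xs ks * wprod b ks ys)"
    unfolding wprod_simps using Cons by (intro eqv_mult_left) auto
  also have "\<dots> = (\<Sum>k\<in>N. \<Sum>ks\<in>?L (length xs). a x k * (b k y * wprod a xs ks) * wprod b ks ys)"
    unfolding sum_product by (simp add: mult.assoc)
  also have "\<dots> \<doteq> (\<Sum>k\<in>N. \<Sum>ks\<in>?L (length xs). a x k * (wprod a xs ks * b k y) * wprod b ks ys)"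
    using Cons.prems by (intro eqv_sum eqv_mult_left eqv_mult_right wprod_commute[where b = b] comm) auto
  also have "\<dots> = (\<Sum>(k, ks)\<in>N \<times> ?L (length xs). wprod a (x # xs) (k # ks) * wprod b (k # ks) (y # ys))"
    by (simp add: sum.cartesian_product mult.assoc)
  also have "\<dots> = (\<Sum>ks\<in>?L (Suc (length xs)). wprod a (x # xs) ks * wprod b ks (y # ys))"
    unfolding L by (subst sum.reindex) (auto simp: inj_on_def intro!: sum.cong)
  finally show ?case by simp
qed

text \<open>After expansion into middle index words \<open>ks\<close>, the sum over columns is a
  minor of \<open>b\<close> with rows \<open>ks\<close>. It vanishes unless \<open>ks\<close> is a
  permutation and otherwise sorts to the determinant of \<open>b\<close>; the signs produced
  assemble the determinant of \<open>a\<close>.\<close>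

lemma det_product:
  assumes a: "q_matrix I q a {1..n} {1..n}" and b: "q_matrix I q b {1..n} {1..n}"
    and comm: "\<And>i j k l. i \<in> {1..n} \<Longrightarrow> j \<in> {1..n} \<Longrightarrow> k \<in> {1..n} \<Longrightarrow> l \<in> {1..n} \<Longrightarrow>
      a i j * b k l \<doteq> b k l * a i j"
  shows "qdetm q n (\<lambda>i j. \<Sum>k\<in>{1..n}. a i k * b k j) \<doteq> qdetm q n a * qdetm q n b"
proof -
  interpret b: q_matrix I q b "{1..n}" "{1..n}" by (rule b)
  let ?N = "{1..n}" let ?o = "[1..<Suc n]" let ?L = "{ks. set ks \<subseteq> ?N \<and> length ks = length ?o}"
  have fin: "finite ?L" using finite_lists_length_eq[of ?N "length ?o"] by simp
  have perm: "permutations_of_set ?N \<subseteq> ?L"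
    using length_finite_permutations_of_set by (fastforce simp: permutations_of_set_def)
  have nd: "ks \<in> permutations_of_set ?N \<longleftrightarrow> distinct ks" if "ks \<in> ?L" for ks
  proof
    assume "distinct ks"
    hence "card (set ks) = card ?N" using that by (simp add: distinct_card)
    hence "set ks = ?N" using that by (intro card_subset_eq) auto
    thus "ks \<in> permutations_of_set ?N" using \<open>distinct ks\<close> by (simp add: permutations_of_set_def)
  qed (auto simp: permutations_of_set_def)
  have "qdetm q n (\<lambda>i j. \<Sum>k\<in>?N. a i k * b k j) \<doteq>
      (\<Sum>bs\<in>permutations_of_set ?N. scale ((- of_real q) ^ inversions bs) (\<Sum>ks\<in>?L. wprod a ?o ks * wprod b ks bs))"
    unfolding qdetm_def rowdet_def
  proof (intro eqv_sum eqv_scale wprod_product comm)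
    fix bs assume bs: "bs \<in> permutations_of_set ?N"
    show "length ?o = length bs" using length_finite_permutations_of_set[OF bs] by simp
    show "set bs \<subseteq> ?N" using bs by (simp add: permutations_of_set_def)
  qed auto
  also have "\<dots> = (\<Sum>ks\<in>?L. wprod a ?o ks * rowdet q b ks ?N)"
    unfolding rowdet_def scale_sum_right sum_distrib_left
    by (subst sum.swap) (simp only: scale_mult_right)
  also have "\<dots> \<doteq> (\<Sum>ks\<in>?L. wprod a ?o ks * (if ks \<in> permutations_of_set ?N then
      scale ((- of_real q) ^ inversions ks) (qdetm q n b) else 0))"
  proof (intro eqv_sum eqv_mult_left)
    fix ks assume ks: "ks \<in> ?L"
    have "set ks = ?N" if "distinct ks" using nd[OF ks] that by (simp add: permutations_of_set_def)
    thus "rowdet q b ks ?N \<doteq> (if ks \<in> permutations_of_set ?N then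
      scale ((- of_real q) ^ inversions ks) (qdetm q n b) else 0)"
      using b.rowdet_sort[of ?N ks] ks nd[OF ks] unfolding qdetm_def
      unfolding sorted_list_of_interval[symmetric] by (cases "distinct ks") simp_all
  qed
  also have "\<dots> = (\<Sum>ks\<in>permutations_of_set ?N. wprod a ?o ks * scale ((- of_real q) ^ inversions ks) (qdetm q n b))"
    using fin perm by (intro sum.mono_neutral_cong_right) auto
  also have "\<dots> = qdetm q n a * qdetm q n b"
    unfolding qdetm_def[of q n a] rowdet_def sum_distrib_right by (simp only: scale_mult_left scale_mult_right)
  finally show ?thesis .
qed

section \<open>Diagonal, rescaled and block matrices\<close>

lemma diagonal_q_matrix:
  assumes "q > 0" "\<And>i j. i \<in> J \<Longrightarrow> j \<in> J \<Longrightarrow> f i * f j \<doteq> f j * f i"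
  shows "q_matrix I q (\<lambda>i j. if i = j then f i else 0) J J"
  by unfold_locales (use assms in auto)

text \<open>The factors commute with everything in sight and can be pulled out of both sides of each
  quadratic relation. This serves to normalise the determinant of a matrix to 1.\<close>

lemma row_scaled_q_matrix:
  assumes u: "q_matrix I q u J K" and comm: "\<And>a b i. a \<in> J \<Longrightarrow> i \<in> J \<Longrightarrow> b \<in> K \<Longrightarrow> f i * u a b \<doteq> u a b * f i"
    and ff: "\<And>i j. i \<in> J \<Longrightarrow> j \<in> J \<Longrightarrow> f i * f j \<doteq> f j * f i"
  shows "q_matrix I q (\<lambda>i j. u i j * f i) J K"
proof -
  interpret q_matrix I q u J K by (rule u)
  have *: "(u a b * f a) * (u c d * f c) \<doteq> (u a b * u c d) * (f a * f c)"
    if "a \<in> J" "b \<in> K" "c \<in> J" "d \<in> K" for a b c d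
  proof -
    have "(u a b * f a) * (u c d * f c) = u a b * (f a * u c d) * f c" by (simp add: mult.assoc)
    also have "\<dots> \<doteq> u a b * (u c d * f a) * f c"
      using that by (intro eqv_mult_left eqv_mult_right comm)
    finally show ?thesis by (simp add: mult.assoc)
  qed
  have **: "(u c d * f c) * (u a b * f a) \<doteq> (u c d * u a b) * (f a * f c)"
    if "a \<in> J" "b \<in> K" "c \<in> J" "d \<in> K" for a b c d
    using eqv_trans[OF *[OF that(3,4,1,2)] eqv_mult_left[OF ff[OF that(3,1)]]] .
  show ?thesis
  proof
    fix a b d assume h: "a \<in> J" "b \<in> K" "d \<in> K" "b < d"
    have "(u a b * f a) * (u a d * f a) \<doteq> (u a b * u a d) * (f a * f a)" using h by (intro *)
    also have "\<dots> \<doteq> scale q (u a d * u a b) * (f a * f a)" using h by (intro eqv_mult_right row)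
    also have "\<dots> = scale q ((u a d * u a b) * (f a * f a))" by (simp add: scale_mult_left)
    also have "\<dots> \<doteq> scale q ((u a d * f a) * (u a b * f a))" using h by (intro eqv_scale eqv_sym[OF *])
    finally show "(u a b * f a) * (u a d * f a) \<doteq> scale q ((u a d * f a) * (u a b * f a))" .
  next
    fix a c b assume h: "a \<in> J" "c \<in> J" "b \<in> K" "a < c"
    have "(u a b * f a) * (u c b * f c) \<doteq> (u a b * u c b) * (f a * f c)" using h by (intro *)
    also have "\<dots> \<doteq> scale q (u c b * u a b) * (f a * f c)" using h by (intro eqv_mult_right col)
    also have "\<dots> = scale q ((u c b * u a b) * (f a * f c))" by (simp add: scale_mult_left)
    also have "\<dots> \<doteq> scale q ((u c b * f c) * (u a b * f a))" using h by (intro eqv_scale eqv_sym[OF **])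
    finally show "(u a b * f a) * (u c b * f c) \<doteq> scale q ((u c b * f c) * (u a b * f a))" .
  next
    fix a c b d assume h: "a \<in> J" "c \<in> J" "b \<in> K" "d \<in> K" "a < c" "b < d"
    have "(u c b * f c) * (u a d * f a) \<doteq> (u c b * u a d) * (f a * f c)" using h by (intro **)
    also have "\<dots> \<doteq> (u a d * u c b) * (f a * f c)" using h by (intro eqv_mult_right anti)
    also have "\<dots> \<doteq> (u a d * f a) * (u c b * f c)" using h by (intro eqv_sym[OF *])
    finally show "(u c b * f c) * (u a d * f a) \<doteq> (u a d * f a) * (u c b * f c)" .
    have "(u c d * f c) * (u a b * f a) \<doteq> (u c d * u a b) * (f a * f c)" using h by (intro **)
    also have "\<dots> \<doteq> (u a b * u c d - scale (of_real (q - inverse q)) (u a d * u c b)) * (f a * f c)"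
      using h by (intro eqv_mult_right cross)
    also have "\<dots> = (u a b * u c d) * (f a * f c) - scale (of_real (q - inverse q)) ((u a d * u c b) * (f a * f c))"
      by (simp only: scale_mult_left left_diff_distrib)
    also have "\<dots> \<doteq> (u a b * f a) * (u c d * f c) - scale (of_real (q - inverse q)) ((u a d * f a) * (u c b * f c))"
      using h by (intro eqv_diff eqv_scale eqv_sym[OF *])
    finally show "(u c d * f c) * (u a b * f a) \<doteq>
      (u a b * f a) * (u c d * f c) - scale (of_real (q - inverse q)) ((u a d * f a) * (u c b * f c))" .
  qed (rule q)
qed

end

definition block_matrix :: "'a::zero \<Rightarrow> (nat \<Rightarrow> nat \<Rightarrow> 'a) \<Rightarrow> nat \<Rightarrow> nat \<Rightarrow> 'a" where
  "block_matrix d v i j = (if i = 1 \<and> j = 1 then d else if i = 1 \<or> j = 1 then 0 else v (i - 1) (j - 1))"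

text \<open>Inside the block the relations are those of \<open>v\<close>. Outside it the zeros leave
  a single nontrivial condition, that the corner commutes with the block.\<close>

lemma (in two_sided_ideal) block_q_matrix:
  assumes v: "q_matrix I q v {1..n} {1..n}"
    and comm: "\<And>i j. i \<in> {1..n} \<Longrightarrow> j \<in> {1..n} \<Longrightarrow> d * v i j \<doteq> v i j * d"
  shows "q_matrix I q (block_matrix d v) {1..Suc n} {1..Suc n}"
proof -
  interpret q_matrix I q v "{1..n}" "{1..n}" by (rule v)
  have idx: "i - 1 \<in> {1..n}" if "i \<in> {1..Suc n}" "i \<noteq> 1" for i using that by auto
  show ?thesis
  proof
    fix a b d' assume "a \<in> {1..Suc n}" "b \<in> {1..Suc n}" "d' \<in> {1..Suc n}" "b < d'"
    thus "block_matrix d v a b * block_matrix d v a d' \<doteq> scale (of_real q) (block_matrix d v a d' * block_matrix d v a b)"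
      using row[of "a - 1" "b - 1" "d' - 1"] by (cases a; cases b; cases d') (auto simp: block_matrix_def)
  next
    fix a c b assume "a \<in> {1..Suc n}" "c \<in> {1..Suc n}" "b \<in> {1..Suc n}" "a < c"
    thus "block_matrix d v a b * block_matrix d v c b \<doteq> scale (of_real q) (block_matrix d v c b * block_matrix d v a b)"
      using col[of "a - 1" "c - 1" "b - 1"] by (cases a; cases b; cases c) (auto simp: block_matrix_def)
  next
    fix a c b d' assume h: "a \<in> {1..Suc n}" "c \<in> {1..Suc n}" "b \<in> {1..Suc n}" "d' \<in> {1..Suc n}" "a < c" "b < d'"
    thus "block_matrix d v c b * block_matrix d v a d' \<doteq> block_matrix d v a d' * block_matrix d v c b"
      using anti[of "a - 1" "c - 1" "b - 1" "d' - 1"]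
      by (cases a; cases b; cases c; cases d') (auto simp: block_matrix_def)
    show "block_matrix d v c d' * block_matrix d v a b \<doteq> block_matrix d v a b * block_matrix d v c d' -
        scale (of_real (q - inverse q)) (block_matrix d v a d' * block_matrix d v c b)"
      using h cross[of "a - 1" "c - 1" "b - 1" "d' - 1"] eqv_sym[OF comm[of "c - 1" "d' - 1"]]
      by (cases a; cases b; cases c; cases d') (auto simp: block_matrix_def)
  qed (rule q)
qed

lemma rowdet_shift:
  "rowdet q u (map Suc as) (Suc ` S) = rowdet q (\<lambda>i j. u (Suc i) (Suc j)) as S"
proof -
  have w: "wprod u (map Suc as) (map Suc bs) = wprod (\<lambda>i j. u (Suc i) (Suc j)) as bs" for bs
  proof (induction as arbitrary: bs)
    case (Cons a as)
    thus ?case by (cases bs) auto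
  qed simp
  have "permutations_of_set (Suc ` S) = map Suc ` permutations_of_set S"
    by (rule permutations_of_set_image_inj) simp
  thus ?thesis unfolding rowdet_def by (simp add: sum.reindex inj_on_def w)
qed

text \<open>Only the corner of the first row is nonzero, and column 1 in front causes no
  inversion.\<close>

lemma det_block: "qdetm q (Suc n) (block_matrix d v) = d * qdetm q n v"
proof -
  let ?u = "block_matrix d v"
  have "[1..<Suc (Suc n)] = 1 # map Suc [1..<Suc n]"
    by (simp add: map_Suc_upt upt_conv_Cons del: upt_Suc)
  hence "qdetm q (Suc n) ?u = (\<Sum>j\<in>{1..Suc n}. scale ((- of_real q) ^ card {y \<in> {1..Suc n}. y < j})
      (?u 1 j * rowdet q ?u (map Suc [1..<Suc n]) ({1..Suc n} - {j})))"
    unfolding qdetm_def by (simp only:) (rule rowdet_Cons, auto)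
  also have "\<dots> = (\<Sum>j\<in>{1..Suc n}. if j = 1 then d * rowdet q ?u (map Suc [1..<Suc n]) ({1..Suc n} - {1}) else 0)"
  proof (rule sum.cong[OF refl])
    fix j assume j: "j \<in> {1..Suc n}"
    show "scale ((- of_real q) ^ card {y \<in> {1..Suc n}. y < j}) (?u 1 j * rowdet q ?u (map Suc [1..<Suc n]) ({1..Suc n} - {j}))
      = (if j = 1 then d * rowdet q ?u (map Suc [1..<Suc n]) ({1..Suc n} - {1}) else 0)"
      unfolding card_interval_less[OF j] by (auto simp: block_matrix_def simp del: upt_Suc)
  qed
  also have "\<dots> = d * rowdet q ?u (map Suc [1..<Suc n]) (Suc ` {1..n})"
  proof -
    have "{1..Suc n} - {1} = Suc ` {1..n}" by (auto simp: image_iff)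
    thus ?thesis by (simp del: upt_Suc)
  qed
  also have "rowdet q ?u (map Suc [1..<Suc n]) (Suc ` {1..n}) = qdetm q n (\<lambda>i j. ?u (Suc i) (Suc j))"
    unfolding rowdet_shift qdetm_def ..
  also have "\<dots> = qdetm q n v"
  proof -
    have eq: "wprod (\<lambda>i j. ?u (Suc i) (Suc j)) as bs = wprod v as bs" if "set as \<subseteq> {1..n}" "set bs \<subseteq> {1..n}" for as bs
      using that
    proof (induction as arbitrary: bs)
      case (Cons a as)
      thus ?case by (cases bs) (auto simp: block_matrix_def)
    qed simp
    have "wprod (\<lambda>i j. ?u (Suc i) (Suc j)) [1..<Suc n] b = wprod v [1..<Suc n] b"
      if "b \<in> permutations_of_set {1..n}" for b
    proof (rule eq)
      show "set [1..<Suc n] \<subseteq> {1..n}" by auto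
      show "set b \<subseteq> {1..n}" using that by (simp add: permutations_of_set_def)
    qed
    thus ?thesis unfolding qdetm_def rowdet_def
      by (simp only: cong: sum.cong)
  qed
  finally show ?thesis .
qed

text \<open>In every monomial the last row supplies the last factor, so \<open>e\<close> stands at
  the right end without commuting past anything. The last row is also the one in which \<gamma>
  carries \<open>t\<close>.\<close>

lemma det_last_row_scaled:
  assumes "n \<ge> 1"
  shows "qdetm q n (\<lambda>i j. u i j * (if i = n then e else 1)) = qdetm q n u * e"
proof -
  have w: "wprod (\<lambda>i j. u i j * (if i = n then e else 1)) [1..<Suc n] b = wprod u [1..<Suc n] b * e"
    if b: "b \<in> permutations_of_set {1..n}" for b
  proof -
    obtain n' where n: "n = Suc n'" using assms by (cases n) auto
    have "length b = n" using length_finite_permutations_of_set[OF b] by simp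
    then obtain c j where c: "b = c @ [j]" "length c = length [1..<n]"
      using n by (cases b rule: rev_cases) auto
    have "wprod (\<lambda>i j. u i j * (if i = n then e else 1)) as c = wprod u as c" if "n \<notin> set as" for as
      using that
    proof (induction as arbitrary: c)
      case (Cons a as)
      thus ?case by (cases c) auto
    qed simp
    moreover have "[1..<Suc n] = [1..<n] @ [n]" using assms by simp
    ultimately show ?thesis
      unfolding c(1) using c(2) by (simp add: wprod_append mult.assoc del: upt_Suc)
  qed
  show ?thesis
    unfolding qdetm_def rowdet_def sum_distrib_right
    by (intro sum.cong refl) (simp only: w scale_mult_left)
qed

lemma det_diagonal: "qdetm q n (\<lambda>i j. if i = j then f i else 0) = prod_list (map f [1..<Suc n])"
proof -
  let ?o = "[1..<Suc n]"
  have "wprod (\<lambda>i j. if i = j then f i else 0) as bs = (if as = bs then prod_list (map f as) else 0)"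
    if "length as = length bs" for as bs
    using that by (induction as bs rule: list_induct2) auto
  hence "qdetm q n (\<lambda>i j. if i = j then f i else 0) = (\<Sum>b\<in>permutations_of_set {1..n}.
      if b = ?o then prod_list (map f ?o) else 0)"
    unfolding qdetm_def rowdet_def
    by (intro sum.cong refl)
      (auto simp: inversions_strict length_finite_permutations_of_set simp del: upt_Suc)
  also have "?o \<in> permutations_of_set {1..n}" by (auto simp: permutations_of_set_def)
  hence "(\<Sum>b\<in>permutations_of_set {1..n}. if b = ?o then prod_list (map f ?o) else 0) = prod_list (map f ?o)"
    by (simp del: upt_Suc)
  finally show ?thesis .
qed

text \<open>Passes from permutations as functions to their one-line lists, on which the calculus of
  minors works.\<close>

lemma qdet_conv_qdetm: "qdet q n = qdetm q n (\<lambda>i j. gen (U i j))"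
proof -
  let ?o = "[1..<Suc n]" let ?N = "{1..n}"
  have o: "distinct ?o" "set ?o = ?N" by auto
  have bij: "bij_betw (\<lambda>\<pi>. map \<pi> ?o) {\<pi>. \<pi> permutes ?N} (permutations_of_set ?N)"
  proof (rule bij_betwI')
    fix \<pi> \<sigma> assume *: "\<pi> \<in> {\<pi>. \<pi> permutes ?N}" "\<sigma> \<in> {\<pi>. \<pi> permutes ?N}"
    show "(map \<pi> ?o = map \<sigma> ?o) \<longleftrightarrow> \<pi> = \<sigma>"
    proof
      assume "map \<pi> ?o = map \<sigma> ?o"
      hence eq: "\<pi> x = \<sigma> x" if "x \<in> ?N" for x using that unfolding map_eq_conv o by blast
      show "\<pi> = \<sigma>"
      proof
        fix x show "\<pi> x = \<sigma> x"
          using * eq[of x] by (cases "x \<in> ?N") (auto simp: permutes_not_in)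
      qed
    qed simp
  next
    fix \<pi> assume *: "\<pi> \<in> {\<pi>. \<pi> permutes ?N}"
    hence "\<pi> ` ?N = ?N" "inj_on \<pi> ?N" by (auto simp: permutes_image permutes_inj_on)
    thus "map \<pi> ?o \<in> permutations_of_set ?N"
      using o by (auto simp: permutations_of_set_def distinct_map simp del: upt_Suc)
  next
    fix b assume b: "b \<in> permutations_of_set ?N"
    hence len: "length b = n" and db: "distinct b" "set b = ?N"
      using length_finite_permutations_of_set[OF b] by (auto simp: permutations_of_set_def)
    \<comment> \<open>The identity outside the interval, as \<open>permutes\<close> demands; the
      index \<open>x - 1\<close> is due to list positions starting at 0.\<close>
    define \<pi> where "\<pi> x = (if x \<in> ?N then b ! (x - 1) else x)" for x
    have m: "map \<pi> ?o = b"
      by (rule nth_equalityI) (auto simp: len \<pi>_def nth_append simp del: upt_Suc)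
    have "\<pi> permutes ?N"
    proof (rule bij_imp_permutes)
      have "inj_on \<pi> (set ?o)" using db(1) o(1) unfolding m[symmetric] distinct_map by blast
      moreover have "\<pi> ` set ?o = ?N" using db(2) m by (metis set_map)
      ultimately show "bij_betw \<pi> ?N ?N" unfolding o by (simp add: bij_betw_def)
    qed (auto simp: \<pi>_def)
    thus "\<exists>\<pi>\<in>{\<pi>. \<pi> permutes ?N}. b = map \<pi> ?o" using m by auto
  qed
  have w: "wprod u ?o (map \<pi> ?o) = prod_list (map (\<lambda>i. u i (\<pi> i)) ?o)" for u :: "nat \<Rightarrow> nat \<Rightarrow> qgen free" and \<pi>
    unfolding wprod_def by (simp add: zip_map2 zip_same_conv_map o_def del: upt_Suc)
  show ?thesis
    unfolding qdet_def qdetm_def rowdet_def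
    by (subst sum.reindex_bij_betw[OF bij, symmetric]) (simp only: inversions_permutation w of_real_power of_real_minus)
qed

lemma matrix_relators_conv_relR: "matrix_relators q n = {relR q n (\<lambda>i j. gen (U i j)) a b c d |
    a b c d. a \<in> {1..n} \<and> b \<in> {1..n} \<and> c \<in> {1..n} \<and> d \<in> {1..n}}"
  unfolding matrix_relators_def relR_def ..

section \<open>Homomorphisms between the quantum groups\<close>

subsection \<open>Substitution and kernels of evaluations\<close>

text \<open>Over the universal set of generators there are no carrier conditions, and determinants
  and relators of one matrix turn into those of another.\<close>

abbreviation subst_gens :: "('g \<Rightarrow> 'h free) \<Rightarrow> 'g free \<Rightarrow> 'h free" where
  "subst_gens \<theta> \<equiv> free_eval (free_algebra UNIV) \<theta>"

lemma carrier_free_UNIV [simp]: "carrier (free_algebra UNIV) = UNIV"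
  by (auto simp: free_algebra_carrier)

lemma subst_hom: "alg_hom (free_algebra UNIV) (free_algebra UNIV) (subst_gens \<theta>)"
  by (rule free_eval_hom[OF free_algebra_alg]) simp

lemma subst_simps:
  "subst_gens \<theta> (x + y) = subst_gens \<theta> x + subst_gens \<theta> y"
  "subst_gens \<theta> (x * y) = subst_gens \<theta> x * subst_gens \<theta> y"
  "subst_gens \<theta> 1 = 1" "subst_gens \<theta> (scale c x) = scale c (subst_gens \<theta> x)"
  "subst_gens \<theta> (x - y) = subst_gens \<theta> x - subst_gens \<theta> y"
  "subst_gens \<theta> (gen g) = \<theta> g"
proof -
  note lin = alg_hom_linear[OF subst_hom[of \<theta>]] and V = complex_alg_vs[OF free_algebra_alg]
  show add: "subst_gens \<theta> (x + y) = subst_gens \<theta> x + subst_gens \<theta> y" for x y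
    using linear_map_add[OF lin, of x y] by simp
  show "subst_gens \<theta> (x * y) = subst_gens \<theta> x * subst_gens \<theta> y"
    using alg_hom_mult[OF subst_hom[of \<theta>], of x y] by simp
  show "subst_gens \<theta> 1 = 1" using alg_hom_one[OF subst_hom[of \<theta>]] by simp
  show sc: "subst_gens \<theta> (scale c x) = scale c (subst_gens \<theta> x)" for c x
    using linear_map_smult[OF lin, of x c] by simp
  show "subst_gens \<theta> (x - y) = subst_gens \<theta> x - subst_gens \<theta> y"
    using add[of x "scale (- 1) y"] by (simp only: sc) (simp add: scale_minus)
  show "subst_gens \<theta> (gen g) = \<theta> g" by (rule free_eval_gen[OF free_algebra_alg, of UNIV]) auto
qed

lemma subst_sum: "subst_gens \<theta> (\<Sum>i\<in>A. f i) = (\<Sum>i\<in>A. subst_gens \<theta> (f i))"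
proof (induction A rule: infinite_finite_induct)
  have "subst_gens \<theta> 0 = 0" using subst_simps(4)[of \<theta> 0 0] by simp
  thus "\<And>A. infinite A \<Longrightarrow> subst_gens \<theta> (sum f A) = (\<Sum>i\<in>A. subst_gens \<theta> (f i))"
    "subst_gens \<theta> (sum f {}) = (\<Sum>i\<in>{}. subst_gens \<theta> (f i))" by simp_all
qed (simp add: subst_simps)

lemma subst_wprod: "subst_gens \<theta> (wprod u a b) = wprod (\<lambda>i j. subst_gens \<theta> (u i j)) a b"
proof (induction a arbitrary: b)
  case (Cons x a)
  thus ?case by (cases b) (simp_all add: subst_simps)
qed (simp add: subst_simps)

lemma subst_qdetm: "subst_gens \<theta> (qdetm q n u) = qdetm q n (\<lambda>i j. subst_gens \<theta> (u i j))"
  unfolding qdetm_def rowdet_def by (simp only: subst_sum subst_simps subst_wprod)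

lemma subst_relR: "subst_gens \<theta> (relR q n u a b c d) = relR q n (\<lambda>i j. subst_gens \<theta> (u i j)) a b c d"
  unfolding relR_def by (simp only: subst_sum subst_simps)

context
  fixes B :: "(complex, 'b, 'm) module_scheme" and \<phi> :: "'g \<Rightarrow> 'b"
  assumes B: "complex_alg B" and \<phi>: "\<And>g. \<phi> g \<in> carrier B"
begin

lemma eval_hom: "alg_hom (free_algebra UNIV) B (free_eval B \<phi>)"
  by (rule free_eval_hom[OF B \<phi>])

lemma eval_closed [simp, intro]: "free_eval B \<phi> x \<in> carrier B"
  using alg_hom_closed[OF eval_hom] by simp

lemma eval_simps:
  "free_eval B \<phi> (x + y) = free_eval B \<phi> x \<oplus>\<^bsub>B\<^esub> free_eval B \<phi> y"
  "free_eval B \<phi> (x * y) = free_eval B \<phi> x \<otimes>\<^bsub>B\<^esub> free_eval B \<phi> y"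
  "free_eval B \<phi> 1 = \<one>\<^bsub>B\<^esub>" "free_eval B \<phi> 0 = \<zero>\<^bsub>B\<^esub>"
  "free_eval B \<phi> (x - y) = free_eval B \<phi> x \<ominus>\<^bsub>B\<^esub> free_eval B \<phi> y"
  "free_eval B \<phi> (gen g) = \<phi> g"
  using linear_map_add[OF alg_hom_linear[OF eval_hom], of x y] alg_hom_mult[OF eval_hom, of x y]
    alg_hom_one[OF eval_hom] linear_map_zero[OF complex_alg_vs[OF free_algebra_alg] complex_alg_vs[OF B] alg_hom_linear[OF eval_hom]]
    linear_map_minus[OF complex_alg_vs[OF free_algebra_alg] complex_alg_vs[OF B] alg_hom_linear[OF eval_hom], of x y]
    free_eval_gen[OF B, of UNIV \<phi> g] \<phi>
    free_space_minus[OF free_algebra_space, of x UNIV y]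
  by simp_all

lemma eval_sum: "finite A \<Longrightarrow> free_eval B \<phi> (\<Sum>i\<in>A. f i) = (\<Oplus>\<^bsub>B\<^esub>i\<in>A. free_eval B \<phi> (f i))"
  using linear_map_finsum[OF complex_alg_vs[OF free_algebra_alg] complex_alg_vs[OF B] alg_hom_linear[OF eval_hom], of A f]
    free_space_finsum[OF free_algebra_space, of A f UNIV]
  by simp

lemma eval_subst:
  "free_eval B \<phi> (subst_gens \<theta> x) = free_eval B (\<lambda>g. free_eval B \<phi> (\<theta> g)) x"
proof -
  have h: "alg_hom (free_algebra UNIV) B (free_eval B (\<lambda>g. free_eval B \<phi> (\<theta> g)))"
    by (rule free_eval_hom[OF B]) simp
  show ?thesis
    by (rule free_algebra_hom_eq[OF B alg_hom_comp[OF subst_hom eval_hom] h])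
      (auto simp: subst_simps free_eval_gen[OF B, of UNIV])
qed

lemma eval_hom_comp:
  assumes "complex_alg C" "alg_hom B C f"
  shows "f (free_eval B \<phi> x) = free_eval C (\<lambda>g. f (\<phi> g)) x"
proof -
  have h: "alg_hom (free_algebra UNIV) C (free_eval C (\<lambda>g. f (\<phi> g)))"
    by (rule free_eval_hom[OF assms(1)]) (rule alg_hom_closed[OF assms(2) \<phi>])
  show ?thesis
    by (rule free_algebra_hom_eq[OF assms(1) alg_hom_comp[OF eval_hom assms(2)] h])
      (auto simp: eval_simps free_eval_gen[OF assms(1), of UNIV] alg_hom_closed[OF assms(2) \<phi>])
qed

end

text \<open>Congruence modulo this ideal is equality of values in \<open>B\<close>, which carries
  the determinant calculus over to \<open>B\<close>.\<close>

definition kerI :: "(complex, 'b, 'm) module_scheme \<Rightarrow> ('g \<Rightarrow> 'b) \<Rightarrow> 'g free set" where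
  "kerI B \<phi> = {x. free_eval B \<phi> x = \<zero>\<^bsub>B\<^esub>}"

lemma kerI_ideal:
  assumes "complex_alg B" "\<And>g. \<phi> g \<in> carrier B" shows "two_sided_ideal (kerI B \<phi>)"
  by unfold_locales (use assms in \<open>auto simp: kerI_def eval_simps[OF assms] eval_closed[OF assms]\<close>)

lemma kerI_eqv:
  assumes "complex_alg B" "\<And>g. \<phi> g \<in> carrier B"
  shows "two_sided_ideal.eqv (kerI B \<phi>) x y \<longleftrightarrow> free_eval B \<phi> x = free_eval B \<phi> y"
  unfolding two_sided_ideal.eqv_def[OF kerI_ideal[OF assms]]
  using assms by (simp add: kerI_def eval_simps[OF assms] eval_closed[OF assms])

lemma matrix_gens_closed:
  assumes "matrix_gens n \<subseteq> G" "i \<in> {1..n}" "j \<in> {1..n}"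
  shows "gen (U i j) \<in> carrier (free_algebra G)"
  using assms by (intro gen_closed) (auto simp: matrix_gens_def)

lemma matrix_relators_closed:
  assumes "matrix_gens n \<subseteq> G" shows "matrix_relators q n \<subseteq> carrier (free_algebra G)"
  unfolding matrix_relators_def using matrix_gens_closed[OF assms] by blast

lemma qdet_closed:
  assumes "matrix_gens n \<subseteq> G" shows "qdet q n \<in> carrier (free_algebra G)"
proof -
  have w: "wprod (\<lambda>i j. gen (U i j)) a b \<in> carrier (free_algebra G)" if "set a \<subseteq> {1..n}" "set b \<subseteq> {1..n}" for a b
    using that
  proof (induction a arbitrary: b)
    case (Cons x a)
    thus ?case using matrix_gens_closed[OF assms] by (cases b) auto
  qed auto
  show ?thesis unfolding qdet_conv_qdetm qdetm_def rowdet_def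
    by (auto simp: permutations_of_set_def simp del: upt_Suc
        intro!: free_algebra_sum_closed free_algebra_closed(4) w)
qed

text \<open>Substituting \<open>u\<close> for the generators turns evaluation by \<psi> into
  evaluation by \<phi>, so results modulo the kernel of \<phi> apply. The variables behind \<phi>
  are chosen for each target, for example tagged copies of the generators for a tensor square or
  integers for Laurent polynomials.\<close>

lemma eval_matrix:
  assumes B: "complex_alg B" and \<phi>: "\<And>g. \<phi> g \<in> carrier B"
    and \<psi>: "\<And>i j. i \<in> {1..n} \<Longrightarrow> j \<in> {1..n} \<Longrightarrow> \<psi> (U i j) = free_eval B \<phi> (u i j)"
    and q: "q_matrix (kerI B \<phi>) q u {1..n} {1..n}"
  shows "r \<in> matrix_relators q n \<Longrightarrow> free_eval B \<psi> r = \<zero>\<^bsub>B\<^esub>"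
    and "free_eval B \<psi> (qdet q n) = free_eval B \<phi> (qdetm q n u)"
proof -
  \<comment> \<open>The value at \<open>DetInv\<close> is arbitrary, as only polynomials in the
    matrix generators are substituted into.\<close>
  define \<theta> where "\<theta> g = (case g of U i j \<Rightarrow> u i j | DetInv \<Rightarrow> 1)" for g
  have \<theta>: "\<theta> (U i j) = u i j" for i j by (simp add: \<theta>_def)
  have eq: "free_eval B \<psi> x = free_eval B \<phi> (subst_gens \<theta> x)" if "x \<in> carrier (free_algebra (matrix_gens n))" for x
    unfolding eval_subst[OF B \<phi>]
    by (rule free_eval_cong[OF B _ _ that]) (auto simp: matrix_gens_def \<psi> \<theta> eval_closed[OF B \<phi>])
  {
    assume r: "r \<in> matrix_relators q n"
    then obtain a b c d where abcd: "a \<in> {1..n}" "b \<in> {1..n}" "c \<in> {1..n}" "d \<in> {1..n}"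
      and r': "r = relR q n (\<lambda>i j. gen (U i j)) a b c d"
      unfolding matrix_relators_conv_relR by blast
    have "free_eval B \<psi> r = free_eval B \<phi> (relR q n u a b c d)"
      using eq[of r] matrix_relators_closed[of n "matrix_gens n" q] r
      by (auto simp: r' subst_relR subst_simps \<theta>)
    also have "\<dots> = \<zero>\<^bsub>B\<^esub>"
      using two_sided_ideal.q_matrix_relR[OF kerI_ideal[OF B \<phi>] q abcd] by (simp add: kerI_def)
    finally show "free_eval B \<psi> r = \<zero>\<^bsub>B\<^esub>" .
  }
  show "free_eval B \<psi> (qdet q n) = free_eval B \<phi> (qdetm q n u)"
    using eq[OF qdet_closed[OF order.refl]] by (simp add: qdet_conv_qdetm subst_qdetm subst_simps \<theta>)
qed

subsection \<open>Records with the same algebra structure\<close>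

text \<open>The same quantum group occurs as a bialgebra, as a truncated algebra record and as a
  presented algebra. Homomorphisms and even the cosets forming a tensor product depend on these
  fields alone.\<close>

definition same_alg :: "(complex, 'a, 'm) module_scheme \<Rightarrow> (complex, 'a, 'n) module_scheme \<Rightarrow> bool" where
  "same_alg A B \<longleftrightarrow> carrier A = carrier B \<and> monoid.mult A = monoid.mult B \<and> \<one>\<^bsub>A\<^esub> = \<one>\<^bsub>B\<^esub> \<and>
     \<zero>\<^bsub>A\<^esub> = \<zero>\<^bsub>B\<^esub> \<and> ring.add A = ring.add B \<and> smult A = smult B"

lemma same_algD:
  assumes "same_alg A B"
  shows "carrier A = carrier B" "monoid.mult A = monoid.mult B" "\<one>\<^bsub>A\<^esub> = \<one>\<^bsub>B\<^esub>"
    "\<zero>\<^bsub>A\<^esub> = \<zero>\<^bsub>B\<^esub>" "ring.add A = ring.add B" "smult A = smult B"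
  using assms by (auto simp: same_alg_def)

lemma same_alg_sym: "same_alg A B \<Longrightarrow> same_alg B A"
  by (simp add: same_alg_def)

lemma same_alg_extend: "same_alg (module.extend A e) A" "same_alg (module.truncate B) B"
  by (simp_all add: same_alg_def module.defs)

lemma same_alg_complex_alg: "same_alg A B \<Longrightarrow> complex_alg A \<Longrightarrow> complex_alg B"
  by (rule complex_alg_cong[of A B]) (auto simp: same_alg_def)

lemma same_alg_hom_left: "same_alg A A' \<Longrightarrow> alg_hom A B f \<longleftrightarrow> alg_hom A' B f"
  and same_alg_hom_right: "same_alg B B' \<Longrightarrow> alg_hom A B f \<longleftrightarrow> alg_hom A B' f"
  by (simp_all add: alg_hom_def linear_map_def same_alg_def)

lemma same_alg_tensor:
  assumes "same_alg A A'" "same_alg B B'"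
  shows "tensor A B = tensor A' B'" "tens A B = tens A' B'"
proof -
  have p: "pair_space A B = pair_space A' B'"
    unfolding pair_space_def using same_algD[OF assms(1)] same_algD[OF assms(2)] by simp
  have k: "bilinear_kernel A B = bilinear_kernel A' B'"
    unfolding bilinear_kernel_def p bilinear_relators_def
    using same_algD[OF assms(1)] same_algD[OF assms(2)] by simp
  show "tensor A B = tensor A' B'" "tens A B = tens A' B'"
    unfolding tensor_def tens_def p k by auto
qed

subsection \<open>The presented quantum groups\<close>

lemma SU_relators_closed: "SU_relators q n \<subseteq> carrier (free_algebra (matrix_gens n))"
  unfolding SU_relators_def using matrix_relators_closed[of n "matrix_gens n" q] qdet_closed[of n "matrix_gens n" q] by auto

lemma U_relators_closed: "U_relators q n \<subseteq> carrier (free_algebra (insert DetInv (matrix_gens n)))"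
  unfolding U_relators_def
  using matrix_relators_closed[of n "insert DetInv (matrix_gens n)" q] qdet_closed[of n "insert DetInv (matrix_gens n)" q]
  by (auto intro!: gen_closed)

abbreviation "SU_presented q n \<equiv> presented_algebra (matrix_gens n) (SU_relators q n)"
abbreviation "U_presented q n \<equiv> presented_algebra (insert DetInv (matrix_gens n)) (U_relators q n)"

lemma CqSU_same: "same_alg (CqSU q n) (SU_presented q n)"
  and CqU_same: "same_alg (CqU q n) (U_presented q n)"
  unfolding CqSU_def CqU_def matrix_bialgebra_def Let_def by (rule same_alg_extend)+

lemma SU_algebra_eq: "SU_algebra q n = SU_presented q n"
  unfolding SU_algebra_def CqSU_def matrix_bialgebra_def Let_def by (simp add: module.defs)

lemma CqSU_SU_algebra: "same_alg (CqSU q n) (SU_algebra q n)"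
  unfolding SU_algebra_eq by (rule CqSU_same)

lemma SU_algebra_alg [simp, intro]: "complex_alg (SU_algebra q n)"
  unfolding SU_algebra_eq by (rule presented_alg[OF SU_relators_closed])

lemma CqSU_alg [simp, intro]: "complex_alg (CqSU q n)"
  using same_alg_complex_alg[OF same_alg_sym[OF CqSU_SU_algebra]] by simp

lemma CqU_alg [simp, intro]: "complex_alg (CqU q n)"
  by (rule same_alg_complex_alg[OF same_alg_sym[OF CqU_same] presented_alg[OF U_relators_closed]])

lemma u_SU_closed [simp, intro]: "i \<in> {1..n} \<Longrightarrow> j \<in> {1..n} \<Longrightarrow> u_SU q n i j \<in> carrier (SU_algebra q n)"
  unfolding u_SU_def SU_algebra_eq by (rule presented_gen_closed[OF SU_relators_closed]) (auto simp: matrix_gens_def)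

lemma u_U_closed [simp, intro]: "i \<in> {1..n} \<Longrightarrow> j \<in> {1..n} \<Longrightarrow> u_U q n i j \<in> carrier (CqU q n)"
  unfolding u_U_def same_algD(1)[OF CqU_same]
  by (rule presented_gen_closed[OF U_relators_closed]) (auto simp: matrix_gens_def)

lemma detinv_U_closed [simp, intro]: "detinv_U q n \<in> carrier (CqU q n)"
  unfolding detinv_U_def same_algD(1)[OF CqU_same] by (rule presented_gen_closed[OF U_relators_closed]) auto

text \<open>Junk generators are sent to \<open>0\<close>, which makes the evaluation total.\<close>

definition SU_gens :: "real \<Rightarrow> nat \<Rightarrow> qgen \<Rightarrow> qgen free set" where
  "SU_gens q n g = (if g \<in> matrix_gens n then presented_gen (matrix_gens n) (SU_relators q n) g else \<zero>\<^bsub>SU_algebra q n\<^esub>)"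

definition U_gens :: "real \<Rightarrow> nat \<Rightarrow> qgen \<Rightarrow> qgen free set" where
  "U_gens q n g = (if g \<in> insert DetInv (matrix_gens n)
     then presented_gen (insert DetInv (matrix_gens n)) (U_relators q n) g else \<zero>\<^bsub>CqU q n\<^esub>)"

lemma SU_gens_closed: "SU_gens q n g \<in> carrier (SU_algebra q n)"
  using presented_gen_closed[OF SU_relators_closed, of g n q] complex_alg_vs[OF SU_algebra_alg, of q n]
  by (auto simp: SU_gens_def SU_algebra_eq)

lemma U_gens_closed: "U_gens q n g \<in> carrier (CqU q n)"
  using presented_gen_closed[OF U_relators_closed, of g n q] vs_zero_closed[OF complex_alg_vs[OF CqU_alg, of q n]]
  by (auto simp: U_gens_def same_algD(1)[OF CqU_same])

lemma SU_gens_U: "i \<in> {1..n} \<Longrightarrow> j \<in> {1..n} \<Longrightarrow> SU_gens q n (U i j) = u_SU q n i j"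
  by (auto simp: SU_gens_def u_SU_def matrix_gens_def)

lemma U_gens_U: "i \<in> {1..n} \<Longrightarrow> j \<in> {1..n} \<Longrightarrow> U_gens q n (U i j) = u_U q n i j"
  and U_gens_DetInv: "U_gens q n DetInv = detinv_U q n"
  by (auto simp: U_gens_def u_U_def detinv_U_def matrix_gens_def)

lemma free_eval_same: "same_alg A B \<Longrightarrow> free_eval A \<phi> x = free_eval B \<phi> x"
proof -
  assume s: "same_alg A B"
  show ?thesis unfolding free_eval_def finsum_def finprod_def using same_algD[OF s] by simp
qed

lemma SU_eval_relator: "r \<in> SU_relators q n \<Longrightarrow> free_eval (SU_algebra q n) (SU_gens q n) r = \<zero>\<^bsub>SU_algebra q n\<^esub>"
proof -
  assume r: "r \<in> SU_relators q n"
  hence rc: "r \<in> carrier (free_algebra (matrix_gens n))" using SU_relators_closed by blast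
  have "free_eval (SU_algebra q n) (SU_gens q n) r = free_eval (SU_presented q n) (presented_gen (matrix_gens n) (SU_relators q n)) r"
    unfolding SU_algebra_eq
    by (rule free_eval_cong[OF presented_alg[OF SU_relators_closed] _ _ rc])
      (auto simp: SU_gens_def presented_gen_closed[OF SU_relators_closed])
  thus ?thesis
    by (simp add: presented_eval[OF SU_relators_closed rc] presented_relator[OF SU_relators_closed r] SU_algebra_eq)
qed

lemma U_eval_relator: "r \<in> U_relators q n \<Longrightarrow> free_eval (CqU q n) (U_gens q n) r = \<zero>\<^bsub>CqU q n\<^esub>"
proof -
  assume r: "r \<in> U_relators q n"
  hence rc: "r \<in> carrier (free_algebra (insert DetInv (matrix_gens n)))" using U_relators_closed by blast
  have "free_eval (CqU q n) (U_gens q n) r =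
      free_eval (U_presented q n) (presented_gen (insert DetInv (matrix_gens n)) (U_relators q n)) r"
    unfolding free_eval_same[OF CqU_same]
    by (rule free_eval_cong[OF presented_alg[OF U_relators_closed] _ _ rc])
      (auto simp: U_gens_def presented_gen_closed[OF U_relators_closed])
  thus ?thesis
    by (simp add: presented_eval[OF U_relators_closed rc] presented_relator[OF U_relators_closed r] same_algD[OF CqU_same])
qed

lemma SU_q_matrix:
  assumes "q > 0" shows "q_matrix (kerI (SU_algebra q n) (SU_gens q n)) q (\<lambda>i j. gen (U i j)) {1..n} {1..n}"
proof (rule two_sided_ideal.relR_q_matrix[OF kerI_ideal[OF SU_algebra_alg SU_gens_closed] assms])
  fix a b c d assume "a \<in> {1..n}" "b \<in> {1..n}" "c \<in> {1..n}" "d \<in> {1..n}"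
  hence "relR q n (\<lambda>i j. gen (U i j)) a b c d \<in> SU_relators q n"
    unfolding SU_relators_def matrix_relators_conv_relR by blast
  thus "relR q n (\<lambda>i j. gen (U i j)) a b c d \<in> kerI (SU_algebra q n) (SU_gens q n)"
    unfolding kerI_def by (simp add: SU_eval_relator)
qed

lemma U_q_matrix:
  assumes "q > 0" shows "q_matrix (kerI (CqU q n) (U_gens q n)) q (\<lambda>i j. gen (U i j)) {1..n} {1..n}"
proof (rule two_sided_ideal.relR_q_matrix[OF kerI_ideal[OF CqU_alg U_gens_closed] assms])
  fix a b c d assume "a \<in> {1..n}" "b \<in> {1..n}" "c \<in> {1..n}" "d \<in> {1..n}"
  hence "relR q n (\<lambda>i j. gen (U i j)) a b c d \<in> U_relators q n"
    unfolding U_relators_def matrix_relators_conv_relR by blast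
  thus "relR q n (\<lambda>i j. gen (U i j)) a b c d \<in> kerI (CqU q n) (U_gens q n)"
    unfolding kerI_def by (simp add: U_eval_relator)
qed

lemma SU_det: "free_eval (SU_algebra q n) (SU_gens q n) (qdet q n) = \<one>\<^bsub>SU_algebra q n\<^esub>"
  using SU_eval_relator[of "qdet q n - 1" q n] complex_alg_vs[OF SU_algebra_alg, of q n]
  by (auto simp: SU_relators_def eval_simps[OF SU_algebra_alg SU_gens_closed] eval_closed[OF SU_algebra_alg SU_gens_closed])

definition det_U :: "real \<Rightarrow> nat \<Rightarrow> qgen free set" where
  "det_U q n = free_eval (CqU q n) (U_gens q n) (qdet q n)"

lemma det_U_closed [simp, intro]: "det_U q n \<in> carrier (CqU q n)"
  unfolding det_U_def by (rule eval_closed[OF CqU_alg U_gens_closed])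

lemma det_U_inverse:
  "detinv_U q n \<otimes>\<^bsub>CqU q n\<^esub> det_U q n = \<one>\<^bsub>CqU q n\<^esub>"
  "det_U q n \<otimes>\<^bsub>CqU q n\<^esub> detinv_U q n = \<one>\<^bsub>CqU q n\<^esub>"
  using U_eval_relator[of "gen DetInv * qdet q n - 1" q n] U_eval_relator[of "qdet q n * gen DetInv - 1" q n]
    complex_alg_vs[OF CqU_alg, of q n]
  by (auto simp: U_relators_def det_U_def U_gens_DetInv eval_simps[OF CqU_alg U_gens_closed]
      eval_closed[OF CqU_alg U_gens_closed])

context
  fixes B :: "(complex, 'b, 'm) module_scheme" and \<phi> :: "'g \<Rightarrow> 'b" and \<psi> :: "qgen \<Rightarrow> 'b"
    and u :: "nat \<Rightarrow> nat \<Rightarrow> 'g free" and q n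
  assumes B: "complex_alg B" and \<phi>: "\<And>g. \<phi> g \<in> carrier B"
    and \<psi>: "\<And>i j. i \<in> {1..n} \<Longrightarrow> j \<in> {1..n} \<Longrightarrow> \<psi> (U i j) = free_eval B \<phi> (u i j)"
    and qm: "q_matrix (kerI B \<phi>) q u {1..n} {1..n}"
begin

text \<open>The quadratic relators are settled by \<open>eval_matrix\<close>, so the determinant
  relator is all that is left.\<close>

lemma SU_hom:
  assumes det: "free_eval B \<phi> (qdetm q n u) = \<one>\<^bsub>B\<^esub>"
  shows "alg_hom (SU_algebra q n) B (presented_hom B \<psi>)"
    and "i \<in> {1..n} \<Longrightarrow> j \<in> {1..n} \<Longrightarrow> presented_hom B \<psi> (u_SU q n i j) = \<psi> (U i j)"
proof -
  have c: "\<psi> g \<in> carrier B" if "g \<in> matrix_gens n" for g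
    using that by (auto simp: matrix_gens_def \<psi> eval_closed[OF B \<phi>])
  have r: "free_eval B \<psi> r = \<zero>\<^bsub>B\<^esub>" if "r \<in> SU_relators q n" for r
  proof (cases "r \<in> matrix_relators q n")
    case False
    hence r': "r = qdet q n - 1" using that by (simp add: SU_relators_def)
    have hom: "alg_hom (free_algebra (matrix_gens n)) B (free_eval B \<psi>)" by (rule free_eval_hom[OF B c])
    note h = alg_hom_linear[OF hom]
    have "free_eval B \<psi> (qdet q n - 1) = free_eval B \<psi> (qdet q n) \<ominus>\<^bsub>B\<^esub> free_eval B \<psi> 1"
      using linear_map_minus[OF complex_alg_vs[OF free_algebra_alg] complex_alg_vs[OF B] h, of "qdet q n" 1]
        free_space_minus[OF free_algebra_space, of "qdet q n" "matrix_gens n" 1] qdet_closed[of n "matrix_gens n" q]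
      by (auto simp: c)
    thus ?thesis using eval_matrix(2)[OF B \<phi> \<psi> qm] det alg_hom_one[OF hom] B
      by (simp add: r')
  qed (use eval_matrix(1)[OF B \<phi> \<psi> qm] in auto)
  show "alg_hom (SU_algebra q n) B (presented_hom B \<psi>)"
    unfolding SU_algebra_eq by (rule presented_hom_hom[OF SU_relators_closed B c r])
  show "i \<in> {1..n} \<Longrightarrow> j \<in> {1..n} \<Longrightarrow> presented_hom B \<psi> (u_SU q n i j) = \<psi> (U i j)"
    unfolding u_SU_def by (rule presented_hom_gen[OF SU_relators_closed B c r]) (auto simp: matrix_gens_def)
qed

text \<open>The image of \<open>DetInv\<close> is given by a polynomial \<open>e\<close> over the
  same variables, so that its two relators can be evaluated together with the determinant of
  \<open>u\<close>.\<close>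

lemma U_hom:
  assumes e: "\<psi> DetInv = free_eval B \<phi> e"
    and det: "free_eval B \<phi> (e * qdetm q n u) = \<one>\<^bsub>B\<^esub>" "free_eval B \<phi> (qdetm q n u * e) = \<one>\<^bsub>B\<^esub>"
  shows "alg_hom (CqU q n) B (presented_hom B \<psi>)"
    and "i \<in> {1..n} \<Longrightarrow> j \<in> {1..n} \<Longrightarrow> presented_hom B \<psi> (u_U q n i j) = \<psi> (U i j)"
    and "presented_hom B \<psi> (detinv_U q n) = \<psi> DetInv"
proof -
  let ?G = "insert DetInv (matrix_gens n)"
  have c: "\<psi> g \<in> carrier B" if "g \<in> ?G" for g
    using that by (auto simp: matrix_gens_def \<psi> e eval_closed[OF B \<phi>])
  have h: "alg_hom (free_algebra ?G) B (free_eval B \<psi>)" by (rule free_eval_hom[OF B c])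
  have D: "qdet q n \<in> carrier (free_algebra ?G)" "gen DetInv \<in> carrier (free_algebra ?G)"
    by (auto intro!: qdet_closed)
  have m: "free_eval B \<psi> (x * y) = free_eval B \<psi> x \<otimes>\<^bsub>B\<^esub> free_eval B \<psi> y"
    "free_eval B \<psi> (x * y - 1) = free_eval B \<psi> (x * y) \<ominus>\<^bsub>B\<^esub> \<one>\<^bsub>B\<^esub>"
    if "x \<in> carrier (free_algebra ?G)" "y \<in> carrier (free_algebra ?G)" for x y
  proof -
    show "free_eval B \<psi> (x * y) = free_eval B \<psi> x \<otimes>\<^bsub>B\<^esub> free_eval B \<psi> y"
      using alg_hom_mult[OF h that] by (simp add: c)
    show "free_eval B \<psi> (x * y - 1) = free_eval B \<psi> (x * y) \<ominus>\<^bsub>B\<^esub> \<one>\<^bsub>B\<^esub>"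
      using linear_map_minus[OF complex_alg_vs[OF free_algebra_alg] complex_alg_vs[OF B] alg_hom_linear[OF h], of "x * y" 1]
        free_space_minus[OF free_algebra_space, of "x * y" ?G 1] that alg_hom_one[OF h]
      by (auto simp: c)
  qed
  have g: "free_eval B \<psi> (gen DetInv) = \<psi> DetInv"
    by (rule free_eval_gen[OF B, of ?G]) (auto simp: c)
  have r: "free_eval B \<psi> r = \<zero>\<^bsub>B\<^esub>" if "r \<in> U_relators q n" for r
  proof (cases "r \<in> matrix_relators q n")
    case False
    hence r': "r = gen DetInv * qdet q n - 1 \<or> r = qdet q n * gen DetInv - 1" using that by (auto simp: U_relators_def)
    thus ?thesis
      using det B eval_matrix(2)[OF B \<phi> \<psi> qm] eval_closed[OF B \<phi>]
      by (auto simp: m D g e eval_simps[OF B \<phi>])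
  qed (use eval_matrix(1)[OF B \<phi> \<psi> qm] in auto)
  show "alg_hom (CqU q n) B (presented_hom B \<psi>)"
    unfolding same_alg_hom_left[OF CqU_same] by (rule presented_hom_hom[OF U_relators_closed B c r])
  show "i \<in> {1..n} \<Longrightarrow> j \<in> {1..n} \<Longrightarrow> presented_hom B \<psi> (u_U q n i j) = \<psi> (U i j)"
    unfolding u_U_def by (rule presented_hom_gen[OF U_relators_closed B c r]) (auto simp: matrix_gens_def)
  show "presented_hom B \<psi> (detinv_U q n) = \<psi> DetInv"
    unfolding detinv_U_def by (rule presented_hom_gen[OF U_relators_closed B c r]) auto
qed

end

lemma SU_hom_eq:
  assumes "complex_alg B" "alg_hom (SU_algebra q n) B f" "alg_hom (SU_algebra q n) B g"
    and "\<And>i j. i \<in> {1..n} \<Longrightarrow> j \<in> {1..n} \<Longrightarrow> f (u_SU q n i j) = g (u_SU q n i j)"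
    and "x \<in> carrier (SU_algebra q n)"
  shows "f x = g x"
  by (rule presented_hom_eq[OF SU_relators_closed assms(1) assms(2,3)[unfolded SU_algebra_eq] _
        assms(5)[unfolded SU_algebra_eq]])
    (use assms(4) in \<open>auto simp: matrix_gens_def u_SU_def\<close>)

subsection \<open>Coproducts\<close>

text \<open>The tag names the tensor leg. One free algebra on tagged generators holds two copies of
  the matrix, which commute modulo the kernel as \<open>det_product\<close> requires.\<close>

definition pair_gens :: "(complex, 'a, 'm) module_scheme \<Rightarrow> ('g \<Rightarrow> 'a) \<Rightarrow> bool \<times> 'g \<Rightarrow> ('a, 'a) tensor" where
  "pair_gens A \<phi> p = (if fst p then tens A A \<one>\<^bsub>A\<^esub> (\<phi> (snd p)) else tens A A (\<phi> (snd p)) \<one>\<^bsub>A\<^esub>)"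

lemma pair_gens_simps:
  "pair_gens A \<phi> (False, g) = tens A A (\<phi> g) \<one>\<^bsub>A\<^esub>" "pair_gens A \<phi> (True, g) = tens A A \<one>\<^bsub>A\<^esub> (\<phi> g)"
  by (simp_all add: pair_gens_def)

context
  fixes A :: "(complex, 'a, 'm) module_scheme" and \<phi> :: "qgen \<Rightarrow> 'a" and q :: real and n :: nat
  assumes A: "complex_alg A" and \<phi>: "\<And>g. \<phi> g \<in> carrier A"
    and qm: "q_matrix (kerI A \<phi>) q (\<lambda>i j. gen (U i j)) {1..n} {1..n}"
begin

abbreviation (input) "TA \<equiv> tensor A A"
abbreviation (input) "\<phi>2 \<equiv> pair_gens A \<phi>"
abbreviation (input) "entry c i j \<equiv> (gen (c, U i j) :: (bool \<times> qgen) free)"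
abbreviation (input) "prod_matrix i j \<equiv> (\<Sum>k\<in>{1..n}. entry False i k * entry True k j)"

lemma pair_gens_closed: "\<phi>2 g \<in> carrier TA"
  using A \<phi> by (auto simp: pair_gens_def intro!: tens_closed)

lemmas T_alg = tensor_alg[OF A A]
lemmas eval2 = eval_simps[OF T_alg pair_gens_closed] eval_closed[OF T_alg pair_gens_closed]

lemma eval_pair_left: "free_eval TA \<phi>2 (subst_gens (\<lambda>g. gen (False, g)) x) = tens A A (free_eval A \<phi> x) \<one>\<^bsub>A\<^esub>"
  unfolding eval_subst[OF T_alg pair_gens_closed] eval_hom_comp[OF A \<phi> T_alg tens_left_hom[OF A A]]
  by (simp add: eval2 pair_gens_simps)

lemma eval_pair_right: "free_eval TA \<phi>2 (subst_gens (\<lambda>g. gen (True, g)) x) = tens A A \<one>\<^bsub>A\<^esub> (free_eval A \<phi> x)"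
  unfolding eval_subst[OF T_alg pair_gens_closed] eval_hom_comp[OF A \<phi> T_alg tens_right_hom[OF A A]]
  by (simp add: eval2 pair_gens_simps)

lemma pair_zero: "tens A A \<zero>\<^bsub>A\<^esub> \<one>\<^bsub>A\<^esub> = \<zero>\<^bsub>TA\<^esub>" "tens A A \<one>\<^bsub>A\<^esub> \<zero>\<^bsub>A\<^esub> = \<zero>\<^bsub>TA\<^esub>"
  using linear_map_zero[OF complex_alg_vs[OF A] complex_alg_vs[OF T_alg] alg_hom_linear[OF tens_left_hom[OF A A]]]
    linear_map_zero[OF complex_alg_vs[OF A] complex_alg_vs[OF T_alg] alg_hom_linear[OF tens_right_hom[OF A A]]] by auto

lemma entry_q_matrix: "q_matrix (kerI TA \<phi>2) q (entry c) {1..n} {1..n}"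
proof (rule two_sided_ideal.relR_q_matrix[OF kerI_ideal[OF T_alg pair_gens_closed]])
  show "q > 0" using qm by (rule q_matrix.q)
  fix a b d e assume *: "a \<in> {1..n}" "b \<in> {1..n}" "d \<in> {1..n}" "e \<in> {1..n}"
  have 0: "free_eval A \<phi> (relR q n (\<lambda>i j. gen (U i j)) a b d e) = \<zero>\<^bsub>A\<^esub>"
    using two_sided_ideal.q_matrix_relR[OF kerI_ideal[OF A \<phi>] qm *] by (simp add: kerI_def)
  have "relR q n (entry c) a b d e = subst_gens (\<lambda>g. gen (c, g)) (relR q n (\<lambda>i j. gen (U i j)) a b d e)"
    by (simp only: subst_relR subst_simps)
  thus "relR q n (entry c) a b d e \<in> kerI TA \<phi>2"
    by (cases c) (simp_all add: kerI_def eval_pair_left eval_pair_right 0 pair_zero)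
qed

lemma entry_comm:
  "two_sided_ideal.eqv (kerI TA \<phi>2) (entry False i j * entry True k l) (entry True k l * entry False i j)"
  unfolding kerI_eqv[OF T_alg pair_gens_closed]
  using A \<phi> by (simp add: eval2 pair_gens_simps tens_mult)

lemma prod_matrix_q: "q_matrix (kerI TA \<phi>2) q prod_matrix {1..n} {1..n}"
  by (rule two_sided_ideal.product_q_matrix[OF kerI_ideal[OF T_alg pair_gens_closed]
        entry_q_matrix entry_q_matrix entry_comm])

lemma eval_prod_matrix:
  "free_eval TA \<phi>2 (prod_matrix i j) = (\<Oplus>\<^bsub>TA\<^esub>k\<in>{1..n}. tens A A (\<phi> (U i k)) (\<phi> (U k j)))"
  using A \<phi> by (simp add: eval_sum[OF T_alg pair_gens_closed] eval2 pair_gens_simps tens_mult)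

text \<open>The source of grouplikeness: the determinant is multiplicative on the two commuting
  copies, and each of them lives in one leg.\<close>

lemma eval_prod_det:
  "free_eval TA \<phi>2 (qdetm q n prod_matrix) = tens A A (free_eval A \<phi> (qdet q n)) (free_eval A \<phi> (qdet q n))"
proof -
  have e: "qdetm q n (entry c) = subst_gens (\<lambda>g. gen (c, g)) (qdet q n)" for c
    by (simp only: qdet_conv_qdetm subst_qdetm subst_simps)
  have "free_eval TA \<phi>2 (qdetm q n prod_matrix) = free_eval TA \<phi>2 (qdetm q n (entry False) * qdetm q n (entry True))"
    using two_sided_ideal.det_product[OF kerI_ideal[OF T_alg pair_gens_closed] entry_q_matrix entry_q_matrix entry_comm]
    unfolding kerI_eqv[OF T_alg pair_gens_closed] .
  thus ?thesis
    using A \<phi> eval_closed[OF A \<phi>]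
    by (simp add: eval2 e eval_pair_left eval_pair_right tens_mult)
qed

end

text \<open>The prescribed values come from a homomorphism on the quotient, so the relators are
  killed without inspection. This is how \<beta> and \<gamma> are identified with
  composites.\<close>

lemma presented_hom_factor:
  assumes R: "R \<subseteq> carrier (free_algebra G)" and B: "complex_alg B"
    and F: "alg_hom (presented_algebra G R) B F" and \<psi>: "\<And>g. g \<in> G \<Longrightarrow> \<psi> g = F (presented_gen G R g)"
    and y: "y \<in> carrier (presented_algebra G R)"
  shows "presented_hom B \<psi> y = F y"
proof -
  have c: "\<psi> g \<in> carrier B" if "g \<in> G" for g
    using alg_hom_closed[OF F presented_gen_closed[OF R that]] \<psi>[OF that] by simp
  have eq: "free_eval B \<psi> x = F (Idl\<^bsub>free_algebra G\<^esub> R +>\<^bsub>free_algebra G\<^esub> x)" if "x \<in> carrier (free_algebra G)" for x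
  proof (rule free_algebra_hom_eq[OF B free_eval_hom[OF B c] alg_hom_comp[OF presented_proj_hom[OF R] F] _ that])
    fix g assume g: "g \<in> G"
    have "free_eval B \<psi> (gen g) = \<psi> g" by (rule free_eval_gen[OF B c g])
    thus "free_eval B \<psi> (gen g) = F (Idl\<^bsub>free_algebra G\<^esub> R +>\<^bsub>free_algebra G\<^esub> gen g)"
      using \<psi>[OF g] by (simp only: presented_gen_def)
  qed
  have r: "free_eval B \<psi> r = \<zero>\<^bsub>B\<^esub>" if "r \<in> R" for r
    using that R eq[of r] presented_relator[OF R that]
      linear_map_zero[OF complex_alg_vs[OF presented_alg[OF R]] complex_alg_vs[OF B] alg_hom_linear[OF F]]
    by auto
  obtain x where x: "x \<in> carrier (free_algebra G)" "y = Idl\<^bsub>free_algebra G\<^esub> R +>\<^bsub>free_algebra G\<^esub> x"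
    using presented_carrierE[OF R y] .
  show ?thesis unfolding x(2)
    by (rule trans[OF presented_hom_coset[OF R B _ _ x(1)] eq[OF x(1)]]) (use c r in blast)+
qed

subsection \<open>Laurent polynomials\<close>

lemma CU1_same: "same_alg CU1 laurent_algebra"
  unfolding CU1_def Let_def by (rule same_alg_extend)

lemma laurent_simps [simp]:
  "carrier CU1 = UNIV" "x \<otimes>\<^bsub>CU1\<^esub> y = x * y" "\<one>\<^bsub>CU1\<^esub> = 1" "\<zero>\<^bsub>CU1\<^esub> = 0"
  "x \<oplus>\<^bsub>CU1\<^esub> y = x + y" "c \<odot>\<^bsub>CU1\<^esub> x = scale c x"
  using same_algD[OF CU1_same] by (simp_all add: laurent_algebra_def)

lemma CU1_free: "free_space UNIV CU1"
  using same_algD[OF CU1_same] by (simp add: free_space_def laurent_algebra_def)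

lemma CU1_alg [simp, intro]: "complex_alg CU1"
  by (rule complex_algI[OF free_space_vs[OF CU1_free]])
    (auto simp: algebra_simps scale_mult_left scale_mult_right intro!: linear_mapI)

lemma complex_algebra_alg [simp, intro]: "complex_alg complex_algebra"
proof (rule complex_algI)
  show "complex_vector_space complex_algebra"
    by (rule complex_vector_spaceI)
      (use complex_algebra_cring in \<open>auto simp: cring_def ring_def algebra_simps\<close>)
qed (auto simp: algebra_simps intro!: linear_mapI)

lemma tpow_simps: "tpow k * tpow l = tpow (k + l)" "tpow 0 = 1"
  by (simp_all add: tpow_def mult_single)

subsection \<open>The concrete maps\<close>

lemma comult_SU: "comult (CqSU q n) = presented_hom (tensor (SU_algebra q n) (SU_algebra q n)) (\<lambda>g. case g of
    U i j \<Rightarrow> (\<Oplus>\<^bsub>tensor (SU_algebra q n) (SU_algebra q n)\<^esub>k\<in>{1..n}.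
      tens (SU_algebra q n) (SU_algebra q n) (u_SU q n i k) (u_SU q n k j))
  | DetInv \<Rightarrow> tens (SU_algebra q n) (SU_algebra q n) (presented_gen (matrix_gens n) (SU_relators q n) DetInv)
      (presented_gen (matrix_gens n) (SU_relators q n) DetInv))"
  unfolding CqSU_def matrix_bialgebra_def Let_def SU_algebra_eq u_SU_def
  by (simp add: module.defs bialgebra.defs del: One_nat_def)

lemma comult_U: "comult (CqU q n) = presented_hom (tensor (CqU q n) (CqU q n)) (\<lambda>g. case g of
    U i j \<Rightarrow> (\<Oplus>\<^bsub>tensor (CqU q n) (CqU q n)\<^esub>k\<in>{1..n}. tens (CqU q n) (CqU q n) (u_U q n i k) (u_U q n k j))
  | DetInv \<Rightarrow> tens (CqU q n) (CqU q n) (detinv_U q n) (detinv_U q n))"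
  unfolding same_alg_tensor[OF CqU_same CqU_same] u_U_def detinv_U_def
  unfolding CqU_def matrix_bialgebra_def Let_def
  by (simp add: module.defs bialgebra.defs del: One_nat_def)

lemma counit_U: "counit (CqU q n) = presented_hom complex_algebra (\<lambda>g. case g of
    U i j \<Rightarrow> of_bool (i = j) | DetInv \<Rightarrow> 1)"
  unfolding CqU_def matrix_bialgebra_def Let_def by (simp add: module.defs bialgebra.defs)

lemma comult_CU1: "comult CU1 = lin_ext (tensor CU1 CU1) (\<lambda>k. tens CU1 CU1 (tpow k) (tpow k))"
proof -
  have "comult CU1 = lin_ext (tensor laurent_algebra laurent_algebra)
      (\<lambda>k. tens laurent_algebra laurent_algebra (tpow k) (tpow k))"
    unfolding CU1_def Let_def lin_ext_def by (rule ext) (simp add: module.defs bialgebra.defs)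
  thus ?thesis unfolding same_alg_tensor[OF CU1_same CU1_same] .
qed

lemma counit_CU1: "counit CU1 f = (\<Sum>k\<in>Poly_Mapping.keys f. Poly_Mapping.lookup f k)"
  unfolding CU1_def Let_def by (simp add: module.defs bialgebra.defs)

lemma counit_CU1_lin_ext: "counit CU1 = lin_ext complex_algebra (\<lambda>_. 1)"
proof
  fix f
  have "(\<Oplus>\<^bsub>complex_algebra\<^esub>p\<in>A. g p) = (\<Sum>p\<in>A. g p)" if "finite A" for A and g :: "int \<Rightarrow> complex"
    using that by (induction A rule: finite_induct)
      (auto simp: vs_finsum_insert[OF complex_alg_vs[OF complex_algebra_alg]] vs_finsum_empty[OF complex_alg_vs[OF complex_algebra_alg]])
  thus "counit CU1 f = lin_ext complex_algebra (\<lambda>_. 1) f"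
    by (simp add: counit_CU1 lin_ext_def)
qed

text \<open>Dual to the inclusion of the special unitary group in the unitary group.\<close>

definition pi_map :: "real \<Rightarrow> nat \<Rightarrow> qgen free set \<Rightarrow> qgen free set" where
  "pi_map q n = presented_hom (CqSU q n) (\<lambda>g. case g of U i j \<Rightarrow> u_SU q n i j | DetInv \<Rightarrow> \<one>\<^bsub>CqSU q n\<^esub>)"

text \<open>Dual to the circle of diagonal matrices whose last entry is \<open>t\<close> and whose
  other entries are 1. Through it \<gamma> factors over \<alpha>.\<close>

definition torus_map :: "real \<Rightarrow> nat \<Rightarrow> qgen free set \<Rightarrow> laurent" where
  "torus_map q n = presented_hom CU1 (\<lambda>g. case g of
     U i j \<Rightarrow> if i \<noteq> j then 0 else if i = n then tpow 1 else 1 | DetInv \<Rightarrow> tpow (- 1))"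

text \<open>A section of \<open>pi_map\<close>.\<close>

definition sec_map :: "real \<Rightarrow> nat \<Rightarrow> qgen free set \<Rightarrow> qgen free set" where
  "sec_map q n = presented_hom (CqU q n) (\<lambda>g. case g of
     U i j \<Rightarrow> u_U q n i j \<otimes>\<^bsub>CqU q n\<^esub> (if i = n then detinv_U q n else \<one>\<^bsub>CqU q n\<^esub>) | DetInv \<Rightarrow> \<one>\<^bsub>CqU q n\<^esub>)"

text \<open>Powers in a monoid have natural exponents, so the negative ones are powers of
  \<open>DetInv\<close>.\<close>

definition det_pow :: "real \<Rightarrow> nat \<Rightarrow> int \<Rightarrow> qgen free set" where
  "det_pow q n k = (if 0 \<le> k then det_U q n [^]\<^bsub>CqU q n\<^esub> nat k else detinv_U q n [^]\<^bsub>CqU q n\<^esub> nat (- k))"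

definition det_map :: "real \<Rightarrow> nat \<Rightarrow> laurent \<Rightarrow> qgen free set" where
  "det_map q n = lin_ext (CqU q n) (det_pow q n)"

lemma U_hom_eq:
  assumes B: "complex_alg B" and f: "alg_hom (CqU q n) B f" and g: "alg_hom (CqU q n) B g"
    and u: "\<And>i j. i \<in> {1..n} \<Longrightarrow> j \<in> {1..n} \<Longrightarrow> f (u_U q n i j) = g (u_U q n i j)"
    and d: "f (detinv_U q n) = g (detinv_U q n)"
    and x: "x \<in> carrier (CqU q n)"
  shows "f x = g x"
  by (rule presented_hom_eq[OF U_relators_closed B f[unfolded same_alg_hom_left[OF CqU_same]]
        g[unfolded same_alg_hom_left[OF CqU_same]] _ x[unfolded same_algD(1)[OF CqU_same]]])
    (use u d in \<open>auto simp: matrix_gens_def u_U_def detinv_U_def\<close>)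

text \<open>Inverses are unique, so the image of the determinant is read off from that of the
  generator \<open>DetInv\<close>, without expanding the determinant.\<close>

lemma hom_det_unique:
  assumes B: "complex_alg B" and f: "alg_hom (CqU q n) B f"
    and y: "y \<in> carrier B" "f (detinv_U q n) \<otimes>\<^bsub>B\<^esub> y = \<one>\<^bsub>B\<^esub>"
  shows "f (det_U q n) = y"
proof -
  note c = alg_hom_closed[OF f det_U_closed] alg_hom_closed[OF f detinv_U_closed]
  have "f (det_U q n) = f (det_U q n) \<otimes>\<^bsub>B\<^esub> (f (detinv_U q n) \<otimes>\<^bsub>B\<^esub> y)"
    using y B c by simp
  also have "\<dots> = f (det_U q n \<otimes>\<^bsub>CqU q n\<^esub> detinv_U q n) \<otimes>\<^bsub>B\<^esub> y"
    using y B c by (simp add: alg_hom_mult[OF f] alg_assoc)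
  also have "\<dots> = y" using y B by (simp add: det_U_inverse alg_hom_one[OF f])
  finally show ?thesis .
qed

lemma det_pow_closed [simp, intro]: "det_pow q n k \<in> carrier (CqU q n)"
proof -
  interpret ring "CqU q n" by (rule complex_alg_ring[OF CqU_alg])
  show ?thesis
    unfolding det_pow_def using nat_pow_closed[OF det_U_closed] nat_pow_closed[OF detinv_U_closed] by presburger
qed

lemma det_pow_0: "det_pow q n 0 = \<one>\<^bsub>CqU q n\<^esub>"
proof -
  interpret ring "CqU q n" by (rule complex_alg_ring[OF CqU_alg])
  show ?thesis by (simp add: det_pow_def)
qed

lemma det_pow_plus: "det_pow q n (k + 1) = det_pow q n k \<otimes>\<^bsub>CqU q n\<^esub> det_U q n"
proof -
  interpret ring "CqU q n" by (rule complex_alg_ring[OF CqU_alg])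
  show ?thesis
  proof (cases "0 \<le> k")
    case True
    hence "nat (k + 1) = Suc (nat k)" by simp
    thus ?thesis using True by (simp add: det_pow_def)
  next
    case False
    \<comment> \<open>The exponent left after one cancellation. It is 0 for \<open>k = -1\<close>,
      where \<open>det_pow\<close> changes to its other branch.\<close>
    define m where "m = nat (- k - 1)"
    have m: "nat (- k) = Suc m" "nat (- (k + 1)) = m" using False by (auto simp: m_def)
    have "detinv_U q n [^]\<^bsub>CqU q n\<^esub> Suc m \<otimes>\<^bsub>CqU q n\<^esub> det_U q n = detinv_U q n [^]\<^bsub>CqU q n\<^esub> m"
      by (simp add: m_assoc det_U_inverse)
    moreover have "det_pow q n (k + 1) = detinv_U q n [^]\<^bsub>CqU q n\<^esub> m"
    proof (cases "k + 1 = 0")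
      case True
      hence "m = 0" using m(2) by simp
      thus ?thesis using True by (simp add: det_pow_def)
    next
      case False
      hence "\<not> 0 \<le> k + 1" using \<open>\<not> 0 \<le> k\<close> by simp
      thus ?thesis by (simp only: det_pow_def m(2) if_False)
    qed
    ultimately show ?thesis using False m(1) by (simp only: det_pow_def if_False)
  qed
qed

lemma det_pow_minus: "det_pow q n (k - 1) = det_pow q n k \<otimes>\<^bsub>CqU q n\<^esub> detinv_U q n"
proof -
  have "det_pow q n k \<otimes>\<^bsub>CqU q n\<^esub> detinv_U q n =
      det_pow q n (k - 1) \<otimes>\<^bsub>CqU q n\<^esub> (det_U q n \<otimes>\<^bsub>CqU q n\<^esub> detinv_U q n)"
    using det_pow_plus[of q n "k - 1"] by (simp add: alg_assoc)
  thus ?thesis by (simp add: det_U_inverse)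
qed

text \<open>Integer induction runs upwards and downwards from 0, hence a recursion for
  \<open>g\<close> in each direction.\<close>

lemma hom_det_pow:
  assumes B: "complex_alg B" and f: "alg_hom (CqU q n) B f" and 0: "g 0 = \<one>\<^bsub>B\<^esub>"
    and 1: "\<And>k. g (k + 1) = g k \<otimes>\<^bsub>B\<^esub> f (det_U q n)" and m: "\<And>k. g (k - 1) = g k \<otimes>\<^bsub>B\<^esub> f (detinv_U q n)"
  shows "f (det_pow q n k) = g k"
proof (induction k rule: int_induct[where k = 0])
  case base
  show ?case by (simp add: det_pow_0 0 alg_hom_one[OF f])
next
  case (step1 i)
  thus ?case by (simp add: det_pow_plus 1 alg_hom_mult[OF f])
next
  case (step2 i)
  thus ?case by (simp add: det_pow_minus m alg_hom_mult[OF f])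
qed

lemma det_pow_add: "det_pow q n (k + l) = det_pow q n k \<otimes>\<^bsub>CqU q n\<^esub> det_pow q n l"
proof (induction l rule: int_induct[where k = 0])
  case base
  show ?case by (simp add: det_pow_0)
next
  case (step1 i)
  thus ?case using det_pow_plus[of q n "k + i"] by (simp add: det_pow_plus alg_assoc add.assoc)
next
  case (step2 i)
  have "det_pow q n (k + (i - 1)) = det_pow q n (k + i) \<otimes>\<^bsub>CqU q n\<^esub> detinv_U q n"
    using det_pow_minus[of q n "k + i"] by (simp add: algebra_simps)
  thus ?case using step2 by (simp add: det_pow_minus alg_assoc)
qed

lemma det_map_linear: "linear_map CU1 (CqU q n) (det_map q n)"
  unfolding det_map_def by (rule lin_ext_linear[OF CU1_free complex_alg_vs[OF CqU_alg]]) auto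

lemma det_map_tpow: "det_map q n (tpow k) = det_pow q n k"
  unfolding det_map_def tpow_def
  by (subst lin_ext_single[OF complex_alg_vs[OF CqU_alg]]) (auto simp: complex_alg_vs[OF CqU_alg])

text \<open>Multiplicativity is bilinear and reduces to \<open>det_pow_add\<close> on powers of
  \<open>t\<close>.\<close>

lemma det_map_hom: "alg_hom CU1 (CqU q n) (det_map q n)"
  unfolding alg_hom_def
proof (intro conjI ballI det_map_linear)
  note V = complex_alg_vs[OF CqU_alg] and lin = det_map_linear
  have c: "det_map q n y \<in> carrier (CqU q n)" for y using linear_map_closed[OF lin] by simp
  have 1: "det_map q n (tpow k * y) = det_map q n (tpow k) \<otimes>\<^bsub>CqU q n\<^esub> det_map q n y" for k y
  proof (rule free_space_linear_eq[OF CU1_free V _ linear_map_comp[OF lin alg_mult_right_linear[OF CqU_alg c]]])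
    show "linear_map CU1 (CqU q n) (\<lambda>y. det_map q n (tpow k * y))"
      using linear_map_comp[OF alg_mult_right_linear[OF CU1_alg, of "tpow k"] lin] by simp
    fix l show "det_map q n (tpow k * Poly_Mapping.single l 1) = det_map q n (tpow k) \<otimes>\<^bsub>CqU q n\<^esub> det_map q n (Poly_Mapping.single l 1)"
      by (simp add: tpow_simps det_map_tpow det_pow_add flip: tpow_def)
  qed simp
  fix x y :: laurent
  have "det_map q n (x * y) = det_map q n x \<otimes>\<^bsub>CqU q n\<^esub> det_map q n y"
  proof (rule free_space_linear_eq[OF CU1_free V _ linear_map_comp[OF lin alg_mult_left_linear[OF CqU_alg c]]])
    show "linear_map CU1 (CqU q n) (\<lambda>x. det_map q n (x * y))"
      using linear_map_comp[OF alg_mult_left_linear[OF CU1_alg, of y] lin] by simp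
    fix l show "det_map q n (Poly_Mapping.single l 1 * y) = det_map q n (Poly_Mapping.single l 1) \<otimes>\<^bsub>CqU q n\<^esub> det_map q n y"
      using 1[of l y] by (simp add: tpow_def)
  qed simp
  thus "det_map q n (x \<otimes>\<^bsub>CU1\<^esub> y) = det_map q n x \<otimes>\<^bsub>CqU q n\<^esub> det_map q n y" by simp
  show "det_map q n \<one>\<^bsub>CU1\<^esub> = \<one>\<^bsub>CqU q n\<^esub>"
    using det_map_tpow[of q n 0] by (simp add: tpow_simps det_pow_0)
qed

section \<open>Central determinant and well-definedness of the structure maps\<close>

context
  fixes q :: real and n :: nat
  assumes q: "q > 0" and n: "n \<ge> 1"
begin

lemma det_U_commutes_gen: "i \<in> {1..n} \<Longrightarrow> j \<in> {1..n} \<Longrightarrow> u_U q n i j \<otimes>\<^bsub>CqU q n\<^esub> det_U q n = det_U q n \<otimes>\<^bsub>CqU q n\<^esub> u_U q n i j"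
proof -
  assume ij: "i \<in> {1..n}" "j \<in> {1..n}"
  interpret square_q_matrix "kerI (CqU q n) (U_gens q n)" q "\<lambda>i j. gen (U i j)" n
    unfolding square_q_matrix_def by (rule U_q_matrix[OF q])
  show ?thesis
    using det_central[OF ij]
    unfolding kerI_eqv[OF CqU_alg U_gens_closed] det_U_def qdet_conv_qdetm
    by (simp add: eval_simps[OF CqU_alg U_gens_closed] U_gens_U[OF ij])
qed

text \<open>Conjugation by the determinant is an algebra endomorphism. It fixes the matrix entries
  by the adjugate argument and \<open>DetInv\<close> trivially, hence everything.\<close>

lemma det_U_central:
  assumes x: "x \<in> carrier (CqU q n)"
  shows "det_U q n \<otimes>\<^bsub>CqU q n\<^esub> x = x \<otimes>\<^bsub>CqU q n\<^esub> det_U q n"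
proof -
  let ?H = "CqU q n" and ?D = "det_U q n" and ?E = "detinv_U q n"
  let ?f = "\<lambda>x. ?D \<otimes>\<^bsub>?H\<^esub> x \<otimes>\<^bsub>?H\<^esub> ?E"
  have hom: "alg_hom ?H ?H ?f"
    unfolding alg_hom_def
  proof (intro conjI ballI)
    show "linear_map ?H ?H ?f"
      by (rule linear_map_comp[OF alg_mult_right_linear alg_mult_left_linear]) auto
    fix x y assume xy: "x \<in> carrier ?H" "y \<in> carrier ?H"
    have "?f x \<otimes>\<^bsub>?H\<^esub> ?f y = ?D \<otimes>\<^bsub>?H\<^esub> x \<otimes>\<^bsub>?H\<^esub> (?E \<otimes>\<^bsub>?H\<^esub> ?D) \<otimes>\<^bsub>?H\<^esub> y \<otimes>\<^bsub>?H\<^esub> ?E"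
      using xy by (simp add: alg_assoc)
    thus "?f (x \<otimes>\<^bsub>?H\<^esub> y) = ?f x \<otimes>\<^bsub>?H\<^esub> ?f y"
      using xy by (simp add: det_U_inverse alg_assoc)
  qed (simp add: det_U_inverse)
  have "?f x = x"
  proof (rule U_hom_eq[OF CqU_alg hom alg_hom_id(1) _ _ x])
    fix i j assume ij: "i \<in> {1..n}" "j \<in> {1..n}"
    have "?f (u_U q n i j) = u_U q n i j \<otimes>\<^bsub>?H\<^esub> (?D \<otimes>\<^bsub>?H\<^esub> ?E)"
      using ij by (simp add: alg_assoc flip: det_U_commutes_gen[OF ij])
    thus "?f (u_U q n i j) = u_U q n i j" using ij by (simp add: det_U_inverse)
  qed (simp add: det_U_inverse)
  hence "?D \<otimes>\<^bsub>?H\<^esub> x \<otimes>\<^bsub>?H\<^esub> ?E \<otimes>\<^bsub>?H\<^esub> ?D = x \<otimes>\<^bsub>?H\<^esub> ?D" by simp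
  thus ?thesis using x by (simp add: alg_assoc det_U_inverse)
qed

lemma detinv_U_central:
  assumes x: "x \<in> carrier (CqU q n)"
  shows "detinv_U q n \<otimes>\<^bsub>CqU q n\<^esub> x = x \<otimes>\<^bsub>CqU q n\<^esub> detinv_U q n"
proof -
  let ?H = "CqU q n" and ?D = "det_U q n" and ?E = "detinv_U q n"
  have "?E \<otimes>\<^bsub>?H\<^esub> x = ?E \<otimes>\<^bsub>?H\<^esub> (x \<otimes>\<^bsub>?H\<^esub> ?D) \<otimes>\<^bsub>?H\<^esub> ?E"
    using x by (simp add: alg_assoc det_U_inverse)
  also have "\<dots> = (?E \<otimes>\<^bsub>?H\<^esub> ?D) \<otimes>\<^bsub>?H\<^esub> x \<otimes>\<^bsub>?H\<^esub> ?E"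
    using x by (simp add: alg_assoc flip: det_U_central[OF x])
  finally show ?thesis using x by (simp add: det_U_inverse)
qed

lemma det_pow_central:
  assumes x: "x \<in> carrier (CqU q n)"
  shows "det_pow q n k \<otimes>\<^bsub>CqU q n\<^esub> x = x \<otimes>\<^bsub>CqU q n\<^esub> det_pow q n k"
proof (induction k rule: int_induct[where k = 0])
  case base
  show ?case using x by (simp add: det_pow_0)
next
  case (step1 i)
  have "det_pow q n i \<otimes>\<^bsub>CqU q n\<^esub> (det_U q n \<otimes>\<^bsub>CqU q n\<^esub> x) = (det_pow q n i \<otimes>\<^bsub>CqU q n\<^esub> x) \<otimes>\<^bsub>CqU q n\<^esub> det_U q n"
    using x by (simp add: det_U_central[OF x] alg_assoc)
  thus ?case using x step1 by (simp add: det_pow_plus alg_assoc)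
next
  case (step2 i)
  have "det_pow q n i \<otimes>\<^bsub>CqU q n\<^esub> (detinv_U q n \<otimes>\<^bsub>CqU q n\<^esub> x) = (det_pow q n i \<otimes>\<^bsub>CqU q n\<^esub> x) \<otimes>\<^bsub>CqU q n\<^esub> detinv_U q n"
    using x by (simp add: detinv_U_central[OF x] alg_assoc)
  thus ?case using x step2 by (simp add: det_pow_minus alg_assoc)
qed

lemma det_map_central:
  assumes x: "x \<in> carrier (CqU q n)"
  shows "det_map q n f \<otimes>\<^bsub>CqU q n\<^esub> x = x \<otimes>\<^bsub>CqU q n\<^esub> det_map q n f"
proof (rule free_space_linear_eq[OF CU1_free complex_alg_vs[OF CqU_alg]
      linear_map_comp[OF det_map_linear alg_mult_left_linear[OF CqU_alg x]]
      linear_map_comp[OF det_map_linear alg_mult_right_linear[OF CqU_alg x]]])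
  fix k show "det_map q n (Poly_Mapping.single k 1) \<otimes>\<^bsub>CqU q n\<^esub> x = x \<otimes>\<^bsub>CqU q n\<^esub> det_map q n (Poly_Mapping.single k 1)"
    using det_pow_central[OF x, of k] by (simp add: det_map_tpow flip: tpow_def)
qed simp

text \<open>The matrix is a block matrix with corner \<open>DetInv\<close>. The corner commutes with
  the block by centrality, and the determinant is \<open>DetInv\<close> times the determinant of the
  block, which is 1.\<close>

lemma alpha_hom:
  shows "alg_hom (SU_algebra q (Suc n)) (CqU q n) (alpha q (Suc n))"
    and "i \<in> {1..Suc n} \<Longrightarrow> j \<in> {1..Suc n} \<Longrightarrow> alpha q (Suc n) (u_SU q (Suc n) i j) =
      (if i = 1 \<and> j = 1 then detinv_U q n else if i = 1 \<or> j = 1 then \<zero>\<^bsub>CqU q n\<^esub> else u_U q n (i - 1) (j - 1))"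
proof -
  let ?\<phi> = "U_gens q n" and ?H = "CqU q n" let ?u = "block_matrix (gen DetInv) (\<lambda>i j. gen (U i j))"
  let ?\<psi> = "\<lambda>g. case g of U i j \<Rightarrow> if i = 1 \<and> j = 1 then detinv_U q n
       else if i = 1 \<or> j = 1 then \<zero>\<^bsub>?H\<^esub> else u_U q n (i - 1) (j - 1) | DetInv \<Rightarrow> undefined"
  note ev = eval_simps[OF CqU_alg U_gens_closed]
  have \<psi>: "?\<psi> (U i j) = free_eval ?H ?\<phi> (?u i j)" if "i \<in> {1..Suc n}" "j \<in> {1..Suc n}" for i j
  proof -
    have "U_gens q n (U (i - 1) (j - 1)) = u_U q n (i - 1) (j - 1)" if "i \<noteq> 1" "j \<noteq> 1"
      by (rule U_gens_U) (use that \<open>i \<in> _\<close> \<open>j \<in> _\<close> in auto)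
    thus ?thesis by (cases "i = 1"; cases "j = 1") (simp_all add: block_matrix_def ev U_gens_DetInv)
  qed
  have qm: "q_matrix (kerI ?H ?\<phi>) q ?u {1..Suc n} {1..Suc n}"
  proof (rule two_sided_ideal.block_q_matrix[OF kerI_ideal[OF CqU_alg U_gens_closed] U_q_matrix[OF q]])
    fix i j assume ij: "i \<in> {1..n}" "j \<in> {1..n}"
    show "two_sided_ideal.eqv (kerI ?H ?\<phi>) (gen DetInv * gen (U i j)) (gen (U i j) * gen DetInv)"
      unfolding kerI_eqv[OF CqU_alg U_gens_closed]
      using ij by (simp add: ev U_gens_DetInv U_gens_U detinv_U_central)
  qed
  have det: "free_eval ?H ?\<phi> (qdetm q (Suc n) ?u) = \<one>\<^bsub>?H\<^esub>"
    by (simp add: det_block ev U_gens_DetInv det_U_inverse flip: det_U_def qdet_conv_qdetm)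
  have a: "alpha q (Suc n) = presented_hom ?H ?\<psi>" unfolding alpha_def diff_Suc_1 ..
  show "alg_hom (SU_algebra q (Suc n)) ?H (alpha q (Suc n))"
    unfolding a by (rule SU_hom(1)[OF CqU_alg U_gens_closed \<psi> qm det])
  show "i \<in> {1..Suc n} \<Longrightarrow> j \<in> {1..Suc n} \<Longrightarrow> alpha q (Suc n) (u_SU q (Suc n) i j) =
      (if i = 1 \<and> j = 1 then detinv_U q n else if i = 1 \<or> j = 1 then \<zero>\<^bsub>?H\<^esub> else u_U q n (i - 1) (j - 1))"
    unfolding a using SU_hom(2)[OF CqU_alg U_gens_closed \<psi> qm det, of i j] by simp
qed

lemma pi_hom:
  shows "alg_hom (CqU q n) (CqSU q n) (pi_map q n)"
    and "i \<in> {1..n} \<Longrightarrow> j \<in> {1..n} \<Longrightarrow> pi_map q n (u_U q n i j) = u_SU q n i j"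
    and "pi_map q n (detinv_U q n) = \<one>\<^bsub>CqSU q n\<^esub>"
proof -
  let ?\<psi> = "\<lambda>g. case g of U i j \<Rightarrow> u_SU q n i j | DetInv \<Rightarrow> \<one>\<^bsub>CqSU q n\<^esub>"
  note s = CqSU_SU_algebra
  note one = same_algD(3)[OF s]
  note ev = eval_simps[OF SU_algebra_alg SU_gens_closed]
  have \<psi>: "?\<psi> (U i j) = free_eval (SU_algebra q n) (SU_gens q n) (gen (U i j))" if "i \<in> {1..n}" "j \<in> {1..n}" for i j
    using that by (simp add: ev SU_gens_U)
  have p: "pi_map q n = presented_hom (SU_algebra q n) ?\<psi>"
    by (rule ext) (simp add: pi_map_def presented_hom_def free_eval_same[OF s])
  have e: "?\<psi> DetInv = free_eval (SU_algebra q n) (SU_gens q n) 1" by (simp add: ev one)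
  have D: "free_eval (SU_algebra q n) (SU_gens q n) (qdetm q n (\<lambda>i j. gen (U i j))) = \<one>\<^bsub>SU_algebra q n\<^esub>"
    using SU_det[of q n] by (simp add: qdet_conv_qdetm)
  have det: "free_eval (SU_algebra q n) (SU_gens q n) (1 * qdetm q n (\<lambda>i j. gen (U i j))) = \<one>\<^bsub>SU_algebra q n\<^esub>"
    "free_eval (SU_algebra q n) (SU_gens q n) (qdetm q n (\<lambda>i j. gen (U i j)) * 1) = \<one>\<^bsub>SU_algebra q n\<^esub>"
    using D by simp_all
  note H = U_hom[OF SU_algebra_alg SU_gens_closed \<psi> SU_q_matrix[OF q] e det]
  show "alg_hom (CqU q n) (CqSU q n) (pi_map q n)"
    unfolding same_alg_hom_right[OF s] p by (rule H(1))
  show "i \<in> {1..n} \<Longrightarrow> j \<in> {1..n} \<Longrightarrow> pi_map q n (u_U q n i j) = u_SU q n i j"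
    unfolding p using H(2)[of i j] by simp
  show "pi_map q n (detinv_U q n) = \<one>\<^bsub>CqSU q n\<^esub>" unfolding p using H(3) by simp
qed

lemma torus_hom:
  shows "alg_hom (CqU q n) CU1 (torus_map q n)"
    and "i \<in> {1..n} \<Longrightarrow> j \<in> {1..n} \<Longrightarrow> torus_map q n (u_U q n i j) = (if i \<noteq> j then 0 else if i = n then tpow 1 else 1)"
    and "torus_map q n (detinv_U q n) = tpow (- 1)"
proof -
  let ?\<psi> = "\<lambda>g. case g of U i j \<Rightarrow> if i \<noteq> j then 0 else if i = n then tpow 1 else 1 | DetInv \<Rightarrow> tpow (- 1)"
  \<comment> \<open>Integers serve as variables, with \<open>k\<close> evaluated to
    \<open>t^k\<close>, so that \<open>gen 1\<close> and \<open>gen (- 1)\<close> stand for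
    \<open>t\<close> and its inverse.\<close>
  let ?f = "\<lambda>i. if i = n then gen (1 :: int) else 1" let ?u = "\<lambda>i j. if i = j then ?f i else 0"
  have c: "tpow k \<in> carrier CU1" for k by simp
  note ev = eval_simps[OF CU1_alg c]
  have \<psi>: "?\<psi> (U i j) = free_eval CU1 tpow (?u i j)" for i j
    by (simp add: ev)
  have qm: "q_matrix (kerI CU1 tpow) q ?u {1..n} {1..n}"
    by (rule two_sided_ideal.diagonal_q_matrix[OF kerI_ideal[OF CU1_alg c] q])
      (auto intro: two_sided_ideal.eqv_refl[OF kerI_ideal[OF CU1_alg c]])
  have "prod_list (map ?f xs) = 1" if "n \<notin> set xs" for xs
    using that by (induction xs) auto
  from this[of "[1..<n]"] have "prod_list (map ?f ([1..<n] @ [n])) = gen 1"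
    by simp
  moreover have "[1..<Suc n] = [1..<n] @ [n]" using n by simp
  ultimately have "qdetm q n ?u = gen 1" unfolding det_diagonal by (simp only:)
  hence D: "free_eval CU1 tpow (gen (- 1) * qdetm q n ?u) = \<one>\<^bsub>CU1\<^esub>" "free_eval CU1 tpow (qdetm q n ?u * gen (- 1)) = \<one>\<^bsub>CU1\<^esub>"
    by (simp_all add: ev tpow_simps)
  have e: "?\<psi> DetInv = free_eval CU1 tpow (gen (- 1))" by (simp add: ev)
  note H = U_hom[OF CU1_alg c \<psi> qm e D]
  show "alg_hom (CqU q n) CU1 (torus_map q n)" unfolding torus_map_def by (rule H(1))
  show "i \<in> {1..n} \<Longrightarrow> j \<in> {1..n} \<Longrightarrow> torus_map q n (u_U q n i j) = (if i \<noteq> j then 0 else if i = n then tpow 1 else 1)"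
    unfolding torus_map_def using H(2)[of i j] by simp
  show "torus_map q n (detinv_U q n) = tpow (- 1)" unfolding torus_map_def using H(3) by simp
qed

text \<open>Dual to sending \<open>g\<close> to diag(1, ..., 1, 1/det g) g, a matrix of determinant
  1. Centrality of \<open>DetInv\<close> keeps the rescaled matrix within the quadratic
  relations.\<close>

lemma sec_hom:
  shows "alg_hom (CqSU q n) (CqU q n) (sec_map q n)"
    and "i \<in> {1..n} \<Longrightarrow> j \<in> {1..n} \<Longrightarrow> sec_map q n (u_SU q n i j) =
      u_U q n i j \<otimes>\<^bsub>CqU q n\<^esub> (if i = n then detinv_U q n else \<one>\<^bsub>CqU q n\<^esub>)"
proof -
  let ?H = "CqU q n" and ?\<phi> = "U_gens q n"
  let ?\<psi> = "\<lambda>g. case g of U i j \<Rightarrow> u_U q n i j \<otimes>\<^bsub>?H\<^esub> (if i = n then detinv_U q n else \<one>\<^bsub>?H\<^esub>) | DetInv \<Rightarrow> \<one>\<^bsub>?H\<^esub>"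
  let ?f = "\<lambda>i. if i = n then gen DetInv else 1" let ?u = "\<lambda>i j. gen (U i j) * ?f i"
  note ev = eval_simps[OF CqU_alg U_gens_closed]
  note I = kerI_ideal[OF CqU_alg U_gens_closed[of q n]]
  have \<psi>: "?\<psi> (U i j) = free_eval ?H ?\<phi> (?u i j)" if "i \<in> {1..n}" "j \<in> {1..n}" for i j
    using that by (simp add: ev U_gens_U U_gens_DetInv)
  have qm: "q_matrix (kerI ?H ?\<phi>) q ?u {1..n} {1..n}"
  proof (rule two_sided_ideal.row_scaled_q_matrix[OF I U_q_matrix[OF q]])
    show "two_sided_ideal.eqv (kerI ?H ?\<phi>) (?f i * gen (U a b)) (gen (U a b) * ?f i)"
      if "a \<in> {1..n}" "b \<in> {1..n}" for a b i
      unfolding kerI_eqv[OF CqU_alg U_gens_closed]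
      using that by (simp add: ev U_gens_U U_gens_DetInv detinv_U_central)
    show "two_sided_ideal.eqv (kerI ?H ?\<phi>) (?f i * ?f j) (?f j * ?f i)" for i j
      by (auto intro: two_sided_ideal.eqv_refl[OF I])
  qed
  have det: "free_eval ?H ?\<phi> (qdetm q n ?u) = \<one>\<^bsub>?H\<^esub>"
    using det_last_row_scaled[OF n, of q "\<lambda>i j. gen (U i j)" "gen DetInv"]
    by (simp add: ev U_gens_DetInv det_U_inverse flip: det_U_def qdet_conv_qdetm)
  note H = SU_hom[OF CqU_alg U_gens_closed \<psi> qm det]
  show "alg_hom (CqSU q n) (CqU q n) (sec_map q n)"
    unfolding same_alg_hom_left[OF CqSU_SU_algebra] sec_map_def by (rule H(1))
  show "i \<in> {1..n} \<Longrightarrow> j \<in> {1..n} \<Longrightarrow> sec_map q n (u_SU q n i j) =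
      u_U q n i j \<otimes>\<^bsub>CqU q n\<^esub> (if i = n then detinv_U q n else \<one>\<^bsub>CqU q n\<^esub>)"
    unfolding sec_map_def using H(2)[of i j] by simp
qed

text \<open>The coproduct of the generators is the product of the two tagged copies, whose
  determinant is 1 \<otimes> 1.\<close>

lemma comult_SU_hom:
  shows "alg_hom (SU_algebra q n) (tensor (SU_algebra q n) (SU_algebra q n)) (comult (CqSU q n))"
    and "i \<in> {1..n} \<Longrightarrow> j \<in> {1..n} \<Longrightarrow> comult (CqSU q n) (u_SU q n i j) =
      (\<Oplus>\<^bsub>tensor (SU_algebra q n) (SU_algebra q n)\<^esub>k\<in>{1..n}. tens (SU_algebra q n) (SU_algebra q n) (u_SU q n i k) (u_SU q n k j))"
proof -
  let ?A = "SU_algebra q n" let ?\<phi> = "SU_gens q n"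
  note A = SU_algebra_alg[of q n] and c = SU_gens_closed[of q n] and qm = SU_q_matrix[OF q, of n]
  note T = tensor_alg[OF A A]
  let ?u = "\<lambda>i j. \<Sum>k\<in>{1..n}. gen (False, U i k) * gen (True, U k j)"
  have \<psi>: "(\<Oplus>\<^bsub>tensor ?A ?A\<^esub>k\<in>{1..n}. tens ?A ?A (u_SU q n i k) (u_SU q n k j)) =
      free_eval (tensor ?A ?A) (pair_gens ?A ?\<phi>) (?u i j)" if "i \<in> {1..n}" "j \<in> {1..n}" for i j
    unfolding eval_prod_matrix[OF A c qm]
    using that complex_alg_vs[OF A]
    by (intro vs_finsum_cong[OF complex_alg_vs[OF T]]) (auto simp: SU_gens_U intro!: tens_closed)
  have det: "free_eval (tensor ?A ?A) (pair_gens ?A ?\<phi>) (qdetm q n ?u) = \<one>\<^bsub>tensor ?A ?A\<^esub>"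
    unfolding eval_prod_det[OF A c qm] by (simp add: SU_det tens_one[OF A A])
  note H = SU_hom[where \<psi> = "\<lambda>g. case g of
    U i j \<Rightarrow> (\<Oplus>\<^bsub>tensor ?A ?A\<^esub>k\<in>{1..n}. tens ?A ?A (u_SU q n i k) (u_SU q n k j))
  | DetInv \<Rightarrow> tens ?A ?A (presented_gen (matrix_gens n) (SU_relators q n) DetInv)
      (presented_gen (matrix_gens n) (SU_relators q n) DetInv)",
      OF T pair_gens_closed[OF A c qm] _ prod_matrix_q[OF A c qm] det, folded comult_SU, unfolded qgen.case]
  show "alg_hom ?A (tensor ?A ?A) (comult (CqSU q n))"
    by (rule H(1)) (rule \<psi>)
  show "i \<in> {1..n} \<Longrightarrow> j \<in> {1..n} \<Longrightarrow> comult (CqSU q n) (u_SU q n i j) =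
      (\<Oplus>\<^bsub>tensor ?A ?A\<^esub>k\<in>{1..n}. tens ?A ?A (u_SU q n i k) (u_SU q n k j))"
    by (rule H(2)) (rule \<psi>)
qed

lemma comult_U_hom:
  shows "alg_hom (CqU q n) (tensor (CqU q n) (CqU q n)) (comult (CqU q n))"
    and "i \<in> {1..n} \<Longrightarrow> j \<in> {1..n} \<Longrightarrow> comult (CqU q n) (u_U q n i j) =
      (\<Oplus>\<^bsub>tensor (CqU q n) (CqU q n)\<^esub>k\<in>{1..n}. tens (CqU q n) (CqU q n) (u_U q n i k) (u_U q n k j))"
    and "comult (CqU q n) (detinv_U q n) = tens (CqU q n) (CqU q n) (detinv_U q n) (detinv_U q n)"
proof -
  let ?A = "CqU q n" let ?\<phi> = "U_gens q n"
  note A = CqU_alg[of q n] and c = U_gens_closed[of q n] and qm = U_q_matrix[OF q, of n]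
  note T = tensor_alg[OF A A]
  note ev = eval_simps[OF T pair_gens_closed[OF A c qm]]
  let ?u = "\<lambda>i j. \<Sum>k\<in>{1..n}. gen (False, U i k) * gen (True, U k j)"
  let ?e = "gen (False, DetInv) * gen (True, DetInv)"
  have \<psi>: "(\<Oplus>\<^bsub>tensor ?A ?A\<^esub>k\<in>{1..n}. tens ?A ?A (u_U q n i k) (u_U q n k j)) =
      free_eval (tensor ?A ?A) (pair_gens ?A ?\<phi>) (?u i j)" if "i \<in> {1..n}" "j \<in> {1..n}" for i j
    unfolding eval_prod_matrix[OF A c qm]
    using that complex_alg_vs[OF A]
    by (intro vs_finsum_cong[OF complex_alg_vs[OF T]]) (auto simp: U_gens_U intro!: tens_closed)
  have e: "tens ?A ?A (detinv_U q n) (detinv_U q n) = free_eval (tensor ?A ?A) (pair_gens ?A ?\<phi>) ?e"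
    by (simp add: ev pair_gens_simps U_gens_DetInv tens_mult)
  have det: "free_eval (tensor ?A ?A) (pair_gens ?A ?\<phi>) (?e * qdetm q n ?u) = \<one>\<^bsub>tensor ?A ?A\<^esub>"
    "free_eval (tensor ?A ?A) (pair_gens ?A ?\<phi>) (qdetm q n ?u * ?e) = \<one>\<^bsub>tensor ?A ?A\<^esub>"
    unfolding ev(2)[where x = ?e] ev(2)[where y = ?e] e[symmetric] eval_prod_det[OF A c qm]
    by (simp_all add: tens_mult det_U_inverse tens_one[OF A A] flip: det_U_def)
  note H = U_hom[where \<psi> = "\<lambda>g. case g of
    U i j \<Rightarrow> (\<Oplus>\<^bsub>tensor ?A ?A\<^esub>k\<in>{1..n}. tens ?A ?A (u_U q n i k) (u_U q n k j))
  | DetInv \<Rightarrow> tens ?A ?A (detinv_U q n) (detinv_U q n)",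
      OF T pair_gens_closed[OF A c qm] _ prod_matrix_q[OF A c qm] _ det, folded comult_U, unfolded qgen.case]
  show "alg_hom ?A (tensor ?A ?A) (comult ?A)"
    by (rule H(1)) (rule \<psi> e, assumption?, assumption?)+
  show "i \<in> {1..n} \<Longrightarrow> j \<in> {1..n} \<Longrightarrow> comult ?A (u_U q n i j) =
      (\<Oplus>\<^bsub>tensor ?A ?A\<^esub>k\<in>{1..n}. tens ?A ?A (u_U q n i k) (u_U q n k j))"
    by (rule H(2)) (rule \<psi> e | assumption)+
  show "comult ?A (detinv_U q n) = tens ?A ?A (detinv_U q n) (detinv_U q n)"
    by (rule H(3)) (rule \<psi> e | assumption)+
qed

lemma counit_U_hom:
  shows "alg_hom (CqU q n) complex_algebra (counit (CqU q n))" and "counit (CqU q n) (detinv_U q n) = 1"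
proof -
  let ?\<psi> = "\<lambda>g. case g of U i j \<Rightarrow> of_bool (i = j) | DetInv \<Rightarrow> (1 :: complex)"
  \<comment> \<open>The unit matrix contains only constants, so a free algebra on one dummy variable
    suffices.\<close>
  let ?\<phi> = "\<lambda>_ :: unit. 1 :: complex"
  have c: "?\<phi> g \<in> carrier complex_algebra" for g by simp
  note ev = eval_simps[OF complex_algebra_alg c]
  let ?u = "\<lambda>i j. if i = j then 1 else 0 :: unit free"
  have \<psi>: "?\<psi> (U i j) = free_eval complex_algebra ?\<phi> (?u i j)" for i j by (simp add: ev)
  have qm: "q_matrix (kerI complex_algebra ?\<phi>) q ?u {1..n} {1..n}"
    by (rule two_sided_ideal.diagonal_q_matrix[OF kerI_ideal[OF complex_algebra_alg c] q])
      (auto intro: two_sided_ideal.eqv_refl[OF kerI_ideal[OF complex_algebra_alg c]])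
  have "prod_list (map (\<lambda>i. 1) xs) = (1 :: unit free)" for xs :: "nat list"
    by (induction xs) auto
  hence "qdetm q n ?u = 1" unfolding det_diagonal .
  hence D: "free_eval complex_algebra ?\<phi> (1 * qdetm q n ?u) = \<one>\<^bsub>complex_algebra\<^esub>"
    "free_eval complex_algebra ?\<phi> (qdetm q n ?u * 1) = \<one>\<^bsub>complex_algebra\<^esub>"
    by (simp_all add: ev)
  have e: "?\<psi> DetInv = free_eval complex_algebra ?\<phi> 1" by (simp add: ev)
  note H = U_hom[OF complex_algebra_alg c \<psi> qm e D]
  show "alg_hom (CqU q n) complex_algebra (counit (CqU q n))" unfolding counit_U by (rule H(1))
  show "counit (CqU q n) (detinv_U q n) = 1" unfolding counit_U using H(3) by simp
qed

section \<open>Structure maps on powers of the determinant, and factorisations through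
  \<alpha>\<close>

lemma pi_det_pow: "pi_map q n (det_pow q n k) = \<one>\<^bsub>CqSU q n\<^esub>"
proof -
  have "pi_map q n (det_U q n) = \<one>\<^bsub>CqSU q n\<^esub>"
    by (rule hom_det_unique[OF CqSU_alg pi_hom(1)]) (simp_all add: pi_hom(3))
  thus ?thesis by (intro hom_det_pow[OF CqSU_alg pi_hom(1), of "\<lambda>_. \<one>\<^bsub>CqSU q n\<^esub>"]) (simp_all add: pi_hom(3))
qed

text \<open>Makes \<open>torus_map\<close> a left inverse of \<open>det_map\<close>, so that the
  circle is split off.\<close>

lemma torus_det_pow: "torus_map q n (det_pow q n k) = tpow k"
proof -
  have "torus_map q n (det_U q n) = tpow 1"
    by (rule hom_det_unique[OF CU1_alg torus_hom(1)]) (simp_all add: torus_hom(3) tpow_simps)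
  thus ?thesis by (intro hom_det_pow[OF CU1_alg torus_hom(1), of tpow]) (simp_all add: torus_hom(3) tpow_simps)
qed

text \<open>Makes \<open>det_map\<close> compatible with the coproducts, which is what turns circle
  comodules into comodules of \<open>CqU q n\<close>.\<close>

lemma comult_det_pow: "comult (CqU q n) (det_pow q n k) = tens (CqU q n) (CqU q n) (det_pow q n k) (det_pow q n k)"
proof -
  note T = tensor_alg[OF CqU_alg CqU_alg]
  have "comult (CqU q n) (det_U q n) = tens (CqU q n) (CqU q n) (det_U q n) (det_U q n)"
    by (rule hom_det_unique[OF T comult_U_hom(1)])
      (auto simp: comult_U_hom(3) tens_mult det_U_inverse tens_one intro!: tens_closed)
  thus ?thesis
    by (intro hom_det_pow[OF T comult_U_hom(1)])
      (simp_all add: comult_U_hom(3) tens_mult tens_one det_pow_0 det_pow_plus det_pow_minus)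
qed

lemma counit_det_pow: "counit (CqU q n) (det_pow q n k) = 1"
proof -
  have "counit (CqU q n) (det_U q n) = 1"
    by (rule hom_det_unique[OF complex_algebra_alg counit_U_hom(1)]) (simp_all add: counit_U_hom(2))
  thus ?thesis
    using hom_det_pow[OF complex_algebra_alg counit_U_hom(1), of "\<lambda>_. 1" k] by (simp add: counit_U_hom(2))
qed

text \<open>The composite is already a homomorphism with the right values on generators, so \<beta>
  inherits its well-definedness. It also follows that coinvariants for \<alpha> are coinvariant for
  \<beta>.\<close>

lemma beta_conv: "x \<in> carrier (SU_algebra q (Suc n)) \<Longrightarrow> beta q (Suc n) x = pi_map q n (alpha q (Suc n) x)"
  unfolding beta_def SU_algebra_eq
proof (rule presented_hom_factor[OF SU_relators_closed CqSU_alg])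
  show "alg_hom (SU_presented q (Suc n)) (CqSU q (Suc n - 1)) (\<lambda>x. pi_map q n (alpha q (Suc n) x))"
    using alg_hom_comp[OF alpha_hom(1) pi_hom(1)] by (simp add: SU_algebra_eq)
  have z: "pi_map q n \<zero>\<^bsub>CqU q n\<^esub> = \<zero>\<^bsub>CqSU q n\<^esub>"
    by (rule linear_map_zero[OF _ _ alg_hom_linear[OF pi_hom(1)]]) auto
  fix g assume "g \<in> matrix_gens (Suc n)"
  then obtain i j where g: "g = U i j" and ij: "i \<in> {1..Suc n}" "j \<in> {1..Suc n}" by (auto simp: matrix_gens_def)
  show "(case g of U i j \<Rightarrow> if i = 1 \<and> j = 1 then \<one>\<^bsub>CqSU q (Suc n - 1)\<^esub>
       else if i = 1 \<or> j = 1 then \<zero>\<^bsub>CqSU q (Suc n - 1)\<^esub>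
       else u_SU q (Suc n - 1) (i - 1) (j - 1) | DetInv \<Rightarrow> undefined) =
      pi_map q n (alpha q (Suc n) (presented_gen (matrix_gens (Suc n)) (SU_relators q (Suc n)) g))"
  proof -
    have "pi_map q n (u_U q n (i - 1) (j - 1)) = u_SU q n (i - 1) (j - 1)" if "i \<noteq> 1" "j \<noteq> 1"
      by (rule pi_hom(2)) (use that ij in auto)
    thus ?thesis
      unfolding g u_SU_def[symmetric] alpha_hom(2)[OF ij] by (cases "i = 1"; cases "j = 1") (simp_all add: pi_hom(3) z)
  qed
qed

text \<open>The corner \<open>DetInv\<close> goes to the inverse of \<open>t\<close>, as \<gamma>
  prescribes for the first entry, and the last entry of the block supplies \<open>t\<close>.\<close>

lemma gamma_conv: "x \<in> carrier (SU_algebra q (Suc n)) \<Longrightarrow> gamma q (Suc n) x = torus_map q n (alpha q (Suc n) x)"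
  unfolding gamma_def SU_algebra_eq
proof (rule presented_hom_factor[OF SU_relators_closed CU1_alg])
  show "alg_hom (SU_presented q (Suc n)) CU1 (\<lambda>x. torus_map q n (alpha q (Suc n) x))"
    using alg_hom_comp[OF alpha_hom(1) torus_hom(1)] by (simp add: SU_algebra_eq)
  have z: "torus_map q n \<zero>\<^bsub>CqU q n\<^esub> = 0"
    using linear_map_zero[OF _ _ alg_hom_linear[OF torus_hom(1)]] by simp
  fix g assume "g \<in> matrix_gens (Suc n)"
  then obtain i j where g: "g = U i j" and ij: "i \<in> {1..Suc n}" "j \<in> {1..Suc n}" by (auto simp: matrix_gens_def)
  show "(case g of U i j \<Rightarrow> if i \<noteq> j then 0 else if i = 1 then tpow (- 1) else if i = Suc n then tpow 1 else 1
       | DetInv \<Rightarrow> undefined) =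
      torus_map q n (alpha q (Suc n) (presented_gen (matrix_gens (Suc n)) (SU_relators q (Suc n)) g))"
  proof -
    have "torus_map q n (u_U q n (i - 1) (j - 1)) = (if i - 1 \<noteq> j - 1 then 0 else if i - 1 = n then tpow 1 else 1)"
      if "i \<noteq> 1" "j \<noteq> 1"
      by (rule torus_hom(2)) (use that ij in auto)
    thus ?thesis
      unfolding g u_SU_def[symmetric] alpha_hom(2)[OF ij] using ij
      by (cases "i = 1"; cases "j = 1") (auto simp: torus_hom(3) z)
  qed
qed

end

section \<open>Splittings of linear maps\<close>

lemma vector_space_scale: "vector_space (scale :: complex \<Rightarrow> ('a \<Rightarrow>\<^sub>0 complex) \<Rightarrow> _)"
  by unfold_locales (simp_all add: scale_add scale_add_right scale_scale)

text \<open>Linear extension problems on an abstract carrier are solved in the free space over it, which is a type.\<close>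

lemma submodule_retraction:
  fixes Q :: "(complex, 'a, 'm) module_scheme"
  assumes Q: "complex_vector_space Q" and T: "submodule T complex_algebra Q"
  obtains r where "linear_map Q Q r" "\<And>x. x \<in> carrier Q \<Longrightarrow> r x \<in> T" "\<And>x. x \<in> T \<Longrightarrow> r x = x"
proof -
  interpret Q: module complex_algebra Q by (rule Q)
  note sub = Q.submoduleE[OF T]
  define F :: "(complex, 'a \<Rightarrow>\<^sub>0 complex) module" where
    "F = \<lparr>carrier = {f. Poly_Mapping.keys f \<subseteq> carrier Q}, monoid.mult = (\<lambda>x y. 0), one = 0, ring.zero = 0, ring.add = (+), smult = scale\<rparr>"
  have F: "free_space (carrier Q) F" by (simp add: free_space_def F_def)
  note FV = free_space_vs[OF F] and FD = free_spaceD[OF F]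
  define e where "e = lin_ext Q (\<lambda>x. x)"
  have e: "linear_map F Q e" unfolding e_def by (rule lin_ext_linear[OF F Q])
  have es: "e (Poly_Mapping.single x 1) = x" if "x \<in> carrier Q" for x
    unfolding e_def using that Q by (subst lin_ext_single) auto
  have sF: "Poly_Mapping.single x c \<in> carrier F" if "x \<in> carrier Q" for x c
    by (rule free_space_single[OF F that])
  have T0: "\<zero>\<^bsub>Q\<^esub> \<in> T"
    using submodule.axioms(1)[OF T] subgroup.one_closed by fastforce
  define S where "S = {f \<in> carrier F. e f \<in> T}"
  interpret vp: vector_space_pair "scale :: complex \<Rightarrow> ('a \<Rightarrow>\<^sub>0 complex) \<Rightarrow> _" "scale :: complex \<Rightarrow> ('a \<Rightarrow>\<^sub>0 complex) \<Rightarrow> _"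
    by (intro vector_space_pair.intro vector_space_scale)
  have "vp.vs1.subspace S"
  proof (rule vp.vs1.subspaceI)
    show "0 \<in> S" using vs_zero_closed[OF FV] linear_map_zero[OF FV Q e] T0 by (simp add: S_def FD)
    show "x + y \<in> S" if "x \<in> S" "y \<in> S" for x y
      using that vs_add_closed[OF FV, of x y] linear_map_add[OF e, of x y] sub(5) by (auto simp: S_def FD(2))
    show "scale c x \<in> S" if "x \<in> S" for c x
      using that vs_smult_closed[OF FV, of x c] linear_map_smult[OF e, of x c] sub(4) by (auto simp: S_def FD(4))
  qed
  moreover have "Vector_Spaces.linear scale scale (\<lambda>x :: 'a \<Rightarrow>\<^sub>0 complex. x)"
    by (rule vp.vs1.linear_ident)
  \<comment> \<open>A left inverse of the identity on \<open>S\<close> with range in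
    \<open>S\<close> is a projection of the whole type onto \<open>S\<close>.\<close>
  ultimately obtain g where g: "range g \<subseteq> S" "Vector_Spaces.linear scale scale g" "\<And>v. v \<in> S \<Longrightarrow> g v = v"
    using vp.linear_exists_left_inverse_on[of "\<lambda>x. x" S] by auto
  have gadd: "g (x + y) = g x + g y" and gsc: "g (scale c x) = scale c (g x)" for x y c
    using g(2) by (auto simp: Vector_Spaces.linear_iff)
  have gF: "g x \<in> carrier F" "e (g x) \<in> T" for x using g(1) by (auto simp: S_def)
  \<comment> \<open>\<open>g\<close> fixes the kernel of \<open>e\<close>, which lies in
    \<open>S\<close>; hence \<open>e (g x)\<close> depends on \<open>e x\<close> only and descends
    to \<open>Q\<close>.\<close>
  have eg: "e (g x) = e (g y)" if "x - y \<in> carrier F" "e (x - y) = \<zero>\<^bsub>Q\<^esub>" for x y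
  proof -
    have "x - y \<in> S" using that T0 by (simp add: S_def)
    hence "g x = g y + (x - y)" using gadd[of y "x - y"] g(3) by simp
    hence "e (g x) = e (g y) \<oplus>\<^bsub>Q\<^esub> e (x - y)" using linear_map_add[OF e gF(1) that(1)] by (simp add: FD)
    thus ?thesis using that(2) linear_map_closed[OF e gF(1)] Q by simp
  qed
  have ed: "x - y \<in> carrier F \<and> e (x - y) = \<zero>\<^bsub>Q\<^esub>" if "x \<in> carrier F" "y \<in> carrier F" "e x = e y" for x y
    using that vs_minus_closed[OF FV that(1,2)] linear_map_minus[OF FV Q e that(1,2)] linear_map_closed[OF e that(1)]
      linear_map_closed[OF e that(2)] Q
    by (simp add: free_space_minus[OF F that(1,2)])
  show thesis
  proof (rule that[of "\<lambda>x. e (g (Poly_Mapping.single x 1))"])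
    show "linear_map Q Q (\<lambda>x. e (g (Poly_Mapping.single x 1)))"
    proof (rule linear_mapI)
      fix x y c assume x: "x \<in> carrier Q"
      show "e (g (Poly_Mapping.single x 1)) \<in> carrier Q" by (rule linear_map_closed[OF e gF(1)])
      have "e (g (Poly_Mapping.single (c \<odot>\<^bsub>Q\<^esub> x) 1)) = e (g (scale c (Poly_Mapping.single x 1)))"
        using linear_map_smult[OF e sF[OF x], of c 1] vs_smult_closed[OF FV sF[OF x], of c 1] x Q
        by (intro eg conjunct1[OF ed] conjunct2[OF ed]) (auto simp: es FD(4) sF simp del: scale_simps)
      also have "\<dots> = c \<odot>\<^bsub>Q\<^esub> e (g (Poly_Mapping.single x 1))"
        using linear_map_smult[OF e gF(1)] by (simp add: gsc FD(4) del: scale_simps)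
      finally show "e (g (Poly_Mapping.single (c \<odot>\<^bsub>Q\<^esub> x) 1)) = c \<odot>\<^bsub>Q\<^esub> e (g (Poly_Mapping.single x 1))" .
      assume y: "y \<in> carrier Q"
      have "e (g (Poly_Mapping.single (x \<oplus>\<^bsub>Q\<^esub> y) 1)) = e (g (Poly_Mapping.single x 1 + Poly_Mapping.single y 1))"
        using linear_map_add[OF e sF[OF x] sF[OF y], of 1 1] vs_add_closed[OF FV sF[OF x] sF[OF y], of 1 1] x y Q
        by (intro eg conjunct1[OF ed] conjunct2[OF ed]) (auto simp: es FD(2) sF)
      also have "\<dots> = e (g (Poly_Mapping.single x 1)) \<oplus>\<^bsub>Q\<^esub> e (g (Poly_Mapping.single y 1))"
        using linear_map_add[OF e gF(1) gF(1)] by (simp add: gadd FD(2))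
      finally show "e (g (Poly_Mapping.single (x \<oplus>\<^bsub>Q\<^esub> y) 1)) = e (g (Poly_Mapping.single x 1)) \<oplus>\<^bsub>Q\<^esub> e (g (Poly_Mapping.single y 1))" .
    qed
    show "e (g (Poly_Mapping.single x 1)) \<in> T" for x by (rule gF(2))
    show "e (g (Poly_Mapping.single x 1)) = x" if "x \<in> T" for x
    proof -
      have "x \<in> carrier Q" using that sub(1) by blast
      hence "Poly_Mapping.single x 1 \<in> S" using that by (simp add: S_def sF es)
      thus ?thesis using \<open>x \<in> carrier Q\<close> by (simp add: g(3) es)
    qed
  qed
qed

lemma image_submodule:
  assumes P: "complex_vector_space P" and Q: "complex_vector_space Q" and f: "linear_map P Q f"
  shows "submodule (f ` carrier P) complex_algebra Q"
proof -
  interpret Q: module complex_algebra Q by (rule Q)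
  have neg: "\<ominus>\<^bsub>Q\<^esub> x = (- 1) \<odot>\<^bsub>Q\<^esub> x" if "x \<in> carrier Q" for x
    using vs_minus_eq[OF Q, of "\<zero>\<^bsub>Q\<^esub>" x] that Q by (simp add: a_minus_def)
  show ?thesis
  proof (rule Q.submoduleI)
    show "f ` carrier P \<subseteq> carrier Q" using linear_map_closed[OF f] by blast
    show "\<zero>\<^bsub>Q\<^esub> \<in> f ` carrier P" using linear_map_zero[OF P Q f] vs_zero_closed[OF P] by force
    show "\<ominus>\<^bsub>Q\<^esub> a \<in> f ` carrier P" if a: "a \<in> f ` carrier P" for a
    proof -
      obtain x where x: "x \<in> carrier P" "a = f x" using a by blast
      have "\<ominus>\<^bsub>Q\<^esub> a = f ((- 1) \<odot>\<^bsub>P\<^esub> x)"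
        using x neg[OF linear_map_closed[OF f x(1)]] linear_map_smult[OF f x(1)] by simp
      thus ?thesis using x P by blast
    qed
    show "a \<oplus>\<^bsub>Q\<^esub> b \<in> f ` carrier P" if ab: "a \<in> f ` carrier P" "b \<in> f ` carrier P" for a b
    proof -
      obtain x y where x: "x \<in> carrier P" "a = f x" "y \<in> carrier P" "b = f y" using ab by blast
      hence "a \<oplus>\<^bsub>Q\<^esub> b = f (x \<oplus>\<^bsub>P\<^esub> y)" using linear_map_add[OF f x(1,3)] by simp
      thus ?thesis using x P by blast
    qed
    show "c \<odot>\<^bsub>Q\<^esub> a \<in> f ` carrier P" if a: "a \<in> f ` carrier P" for c a
    proof -
      obtain x where x: "x \<in> carrier P" "a = f x" using a by blast
      hence "c \<odot>\<^bsub>Q\<^esub> a = f (c \<odot>\<^bsub>P\<^esub> x)" using linear_map_smult[OF f x(1)] by simp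
      thus ?thesis using x P by blast
    qed
  qed
qed

text \<open>Choose complements of the kernel in \<open>P\<close> and of the image in
  \<open>Q\<close>; between the first complement and the image \<open>f\<close> is
  invertible.\<close>

lemma generalized_inverse:
  assumes P: "complex_vector_space P" and Q: "complex_vector_space Q" and f: "linear_map P Q f"
  obtains g where "linear_map Q P g" "\<And>x. x \<in> carrier P \<Longrightarrow> f (g (f x)) = f x"
proof -
  obtain r where r: "linear_map P P r" "\<And>x. x \<in> carrier P \<Longrightarrow> r x \<in> {x \<in> carrier P. f x = \<zero>\<^bsub>Q\<^esub>}"
      "\<And>x. x \<in> {x \<in> carrier P. f x = \<zero>\<^bsub>Q\<^esub>} \<Longrightarrow> r x = x"
    using submodule_retraction[OF P kernel_submodule[OF P Q f]] by blast
  obtain s where s: "linear_map Q Q s" "\<And>x. x \<in> carrier Q \<Longrightarrow> s x \<in> f ` carrier P"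
      "\<And>x. x \<in> f ` carrier P \<Longrightarrow> s x = x"
    using submodule_retraction[OF Q image_submodule[OF P Q f]] by blast
  \<comment> \<open>Projection along the kernel. Its value depends on \<open>f x\<close> only, so
    arbitrarily chosen preimages still yield a linear map.\<close>
  define k where "k x = x \<ominus>\<^bsub>P\<^esub> r x" for x
  have k: "linear_map P P k" unfolding k_def by (rule linear_map_minus_maps[OF P linear_map_id(1) r(1)])
  have k_eq: "k x = k y" if "x \<in> carrier P" "y \<in> carrier P" "f x = f y" for x y
  proof -
    have d: "x \<ominus>\<^bsub>P\<^esub> y \<in> carrier P" using that P by simp
    have "f (x \<ominus>\<^bsub>P\<^esub> y) = \<zero>\<^bsub>Q\<^esub>" using that linear_map_closed[OF f] Q by (simp add: linear_map_minus[OF P Q f])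
    hence "k (x \<ominus>\<^bsub>P\<^esub> y) = \<zero>\<^bsub>P\<^esub>" using r(3)[of "x \<ominus>\<^bsub>P\<^esub> y"] d P by (simp add: k_def)
    thus ?thesis using linear_map_minus[OF P P k that(1,2)] linear_map_closed[OF k] that P by simp
  qed
  have fk: "f (k x) = f x" if "x \<in> carrier P" for x
  proof -
    have "r x \<in> carrier P" "f (r x) = \<zero>\<^bsub>Q\<^esub>" using r(2)[OF that] by auto
    hence "f (k x) = f x \<ominus>\<^bsub>Q\<^esub> \<zero>\<^bsub>Q\<^esub>" using that by (simp add: k_def linear_map_minus[OF P Q f])
    thus ?thesis using vs_minus_eq[OF Q linear_map_closed[OF f that] vs_zero_closed[OF Q]] linear_map_closed[OF f that] Q by simp
  qed
  define p where "p y = (SOME x. x \<in> carrier P \<and> f x = s y)" for y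
  have p: "p y \<in> carrier P \<and> f (p y) = s y" if "y \<in> carrier Q" for y
    unfolding p_def by (rule someI_ex) (use s(2)[OF that] in force)
  show thesis
  proof (rule that[of "\<lambda>y. k (p y)"])
    show "linear_map Q P (\<lambda>y. k (p y))"
    proof (rule linear_mapI)
      fix y z c assume y: "y \<in> carrier Q"
      show "k (p y) \<in> carrier P" using p[OF y] linear_map_closed[OF k] by blast
      have "k (p (c \<odot>\<^bsub>Q\<^esub> y)) = k (c \<odot>\<^bsub>P\<^esub> p y)"
        using p[OF y] p[of "c \<odot>\<^bsub>Q\<^esub> y"] y P Q linear_map_smult[OF s(1) y] by (intro k_eq) (auto simp: linear_map_smult[OF f])
      thus "k (p (c \<odot>\<^bsub>Q\<^esub> y)) = c \<odot>\<^bsub>P\<^esub> k (p y)" using p[OF y] by (simp add: linear_map_smult[OF k])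
      assume z: "z \<in> carrier Q"
      have "k (p (y \<oplus>\<^bsub>Q\<^esub> z)) = k (p y \<oplus>\<^bsub>P\<^esub> p z)"
        using p[OF y] p[OF z] p[of "y \<oplus>\<^bsub>Q\<^esub> z"] y z P Q linear_map_add[OF s(1) y z]
        by (intro k_eq) (auto simp: linear_map_add[OF f])
      thus "k (p (y \<oplus>\<^bsub>Q\<^esub> z)) = k (p y) \<oplus>\<^bsub>P\<^esub> k (p z)" using p[OF y] p[OF z] by (simp add: linear_map_add[OF k])
    qed
    fix x assume x: "x \<in> carrier P"
    hence "f x \<in> carrier Q" "s (f x) = f x" using linear_map_closed[OF f] s(3) by auto
    thus "f (k (p (f x))) = f x" using p[of "f x"] fk by auto
  qed
qed

section \<open>Coordinates in tensor products with Laurent polynomials\<close>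

text \<open>Coefficients are absorbed into the left factor, so every tensor is a plain sum of pure
  ones.\<close>

lemma tensor_induct:
  assumes V: "complex_vector_space V" and W: "complex_vector_space W" and x: "x \<in> carrier (tensor V W)"
    and 0: "Q \<zero>\<^bsub>tensor V W\<^esub>" and t: "\<And>v w. v \<in> carrier V \<Longrightarrow> w \<in> carrier W \<Longrightarrow> Q (tens V W v w)"
    and a: "\<And>x y. x \<in> carrier (tensor V W) \<Longrightarrow> y \<in> carrier (tensor V W) \<Longrightarrow> Q x \<Longrightarrow> Q y \<Longrightarrow> Q (x \<oplus>\<^bsub>tensor V W\<^esub> y)"
  shows "Q x"
proof -
  note T = tensor_vs[OF V W] and proj = tensor_proj_linear[OF V W]
  let ?k = "\<lambda>x. bilinear_kernel V W +>\<^bsub>pair_space V W\<^esub> x"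
  obtain y where y: "y \<in> carrier (pair_space V W)" "x = ?k y" using tensor_carrierE[OF V W x] .
  let ?s = "\<lambda>p. ?k (Poly_Mapping.single p (Poly_Mapping.lookup y p))"
  have keys: "Poly_Mapping.keys y \<subseteq> carrier V \<times> carrier W" using y(1) by (simp add: pair_spaceD)
  have s: "?s p = tens V W (Poly_Mapping.lookup y p \<odot>\<^bsub>V\<^esub> fst p) (snd p)" if "p \<in> carrier V \<times> carrier W" for p
  proof -
    have "Poly_Mapping.single p (Poly_Mapping.lookup y p) = scale (Poly_Mapping.lookup y p) (Poly_Mapping.single p 1)" by simp
    hence "?s p = Poly_Mapping.lookup y p \<odot>\<^bsub>tensor V W\<^esub> ?k (Poly_Mapping.single p 1)"
      using linear_map_smult[OF proj, of "Poly_Mapping.single p 1" "Poly_Mapping.lookup y p"] that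
      by (auto simp: pair_spaceD(4) simp del: scale_simps)
    also have "?k (Poly_Mapping.single p 1) = tens V W (fst p) (snd p)" by (simp add: tens_def)
    also have "Poly_Mapping.lookup y p \<odot>\<^bsub>tensor V W\<^esub> tens V W (fst p) (snd p) = tens V W (Poly_Mapping.lookup y p \<odot>\<^bsub>V\<^esub> fst p) (snd p)"
      using linear_map_smult[OF tens_linear_left[OF V W, of "snd p"], of "fst p"] that by auto
    finally show ?thesis .
  qed
  have "A \<subseteq> Poly_Mapping.keys y \<Longrightarrow> Q (\<Oplus>\<^bsub>tensor V W\<^esub>p\<in>A. ?s p) \<and> (\<Oplus>\<^bsub>tensor V W\<^esub>p\<in>A. ?s p) \<in> carrier (tensor V W)"
    if "finite A" for A
    using that
  proof (induction A rule: finite_induct)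
    case empty
    thus ?case using 0 T by simp
  next
    case (insert p A)
    have pk: "r \<in> carrier V \<times> carrier W" if "r \<in> insert p A" for r using that insert.prems keys by blast
    have Qc: "Q (?s r) \<and> ?s r \<in> carrier (tensor V W)" if "r \<in> insert p A" for r
    proof -
      have "Poly_Mapping.lookup y r \<odot>\<^bsub>V\<^esub> fst r \<in> carrier V" "snd r \<in> carrier W" using pk[OF that] V by auto
      thus ?thesis unfolding s[OF pk[OF that]] by (intro conjI t tens_closed[OF V W])
    qed
    have IH: "Q (\<Oplus>\<^bsub>tensor V W\<^esub>p\<in>A. ?s p)" "(\<Oplus>\<^bsub>tensor V W\<^esub>p\<in>A. ?s p) \<in> carrier (tensor V W)"
      using insert.IH insert.prems by auto
    have "(\<Oplus>\<^bsub>tensor V W\<^esub>p\<in>insert p A. ?s p) = ?s p \<oplus>\<^bsub>tensor V W\<^esub> (\<Oplus>\<^bsub>tensor V W\<^esub>p\<in>A. ?s p)"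
      by (rule vs_finsum_insert[OF T insert.hyps(1,2)]) (use Qc in auto)
    thus ?case using IH Qc[of p] a T by auto
  qed
  from this[OF finite_keys] have "Q (\<Oplus>\<^bsub>tensor V W\<^esub>p\<in>Poly_Mapping.keys y. ?s p)" by blast
  also have "(\<Oplus>\<^bsub>tensor V W\<^esub>p\<in>Poly_Mapping.keys y. ?s p) =
      ?k (\<Oplus>\<^bsub>pair_space V W\<^esub>p\<in>Poly_Mapping.keys y. Poly_Mapping.single p (Poly_Mapping.lookup y p))"
    by (rule sym, rule linear_map_finsum[OF pair_space_vs T proj finite_keys])
      (use keys free_space_single[OF pair_space_free] in blast)
  also have "\<dots> = ?k y" by (rule arg_cong[where f = ?k, OF free_space_expand[OF pair_space_free y(1), symmetric]])
  finally show ?thesis unfolding y(2) .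
qed

text \<open>V \<otimes> CU1 is a direct sum of copies of \<open>V\<close> indexed by the powers of
  \<open>t\<close>; this is the component at \<open>t^k\<close>.\<close>

definition coord :: "(complex, 'a, 'm) module_scheme \<Rightarrow> int \<Rightarrow> ('a, laurent) tensor \<Rightarrow> 'a" where
  "coord V k = tensor_lift V (\<lambda>x f. Poly_Mapping.lookup f k \<odot>\<^bsub>V\<^esub> x)"

lemma CU1_vs [simp, intro]: "complex_vector_space CU1"
  by (rule complex_alg_vs) simp

context
  fixes V :: "(complex, 'a, 'm) module_scheme"
  assumes V: "complex_vector_space V"
begin

lemma coord_bilinear: "bilinear V CU1 V (\<lambda>x f. Poly_Mapping.lookup f k \<odot>\<^bsub>V\<^esub> x)"
  using V by (intro bilinearI linear_mapI)
    (auto simp: lookup_add vs_smult_add vs_smult_add_right vs_smult_smult mult.commute)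

lemma coord_linear: "linear_map (tensor V CU1) V (coord V k)"
  unfolding coord_def by (rule tensor_lift_linear[OF V CU1_vs V coord_bilinear])

lemma coord_tens: "x \<in> carrier V \<Longrightarrow> coord V k (tens V CU1 x f) = Poly_Mapping.lookup f k \<odot>\<^bsub>V\<^esub> x"
  unfolding coord_def by (rule tensor_lift_tens[OF V CU1_vs V coord_bilinear]) auto

text \<open>Claimed for all finite sets beyond some \<open>K\<close>, so that two tensors can be
  expanded over a common index set. The induction step for sums and the uniqueness of coordinates
  both rely on this.\<close>

lemma laurent_expand:
  assumes "z \<in> carrier (tensor V CU1)"
  shows "\<exists>K. finite K \<and> (\<forall>K'. finite K' \<longrightarrow> K \<subseteq> K' \<longrightarrow> z = (\<Oplus>\<^bsub>tensor V CU1\<^esub>k\<in>K'. tens V CU1 (coord V k z) (tpow k)))"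
proof -
  let ?T = "tensor V CU1"
  note T = tensor_vs[OF V CU1_vs] and tc = tens_closed[OF V CU1_vs]
  have cc: "coord V k z \<in> carrier V" if "z \<in> carrier ?T" for k z using linear_map_closed[OF coord_linear that] .
  show ?thesis
  proof (rule tensor_induct[OF V CU1_vs assms])
    show "\<exists>K. finite K \<and> (\<forall>K'. finite K' \<longrightarrow> K \<subseteq> K' \<longrightarrow> \<zero>\<^bsub>?T\<^esub> = (\<Oplus>\<^bsub>?T\<^esub>k\<in>K'. tens V CU1 (coord V k \<zero>\<^bsub>?T\<^esub>) (tpow k)))"
    proof (intro exI[of _ "{}"] conjI allI impI)
      fix K' :: "int set" assume K': "finite K'"
      have "tens V CU1 (coord V k \<zero>\<^bsub>?T\<^esub>) (tpow k) = \<zero>\<^bsub>?T\<^esub>" for k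
        using linear_map_zero[OF T V coord_linear] linear_map_zero[OF V T tens_linear_left[OF V CU1_vs, of "tpow k"]] by simp
      thus "\<zero>\<^bsub>?T\<^esub> = (\<Oplus>\<^bsub>?T\<^esub>k\<in>K'. tens V CU1 (coord V k \<zero>\<^bsub>?T\<^esub>) (tpow k))"
        using vs_finsum_mono_neutral[OF T K', of "{}" "\<lambda>k. tens V CU1 (coord V k \<zero>\<^bsub>?T\<^esub>) (tpow k)"] T by simp
    qed simp
  next
    fix x :: 'a and f :: laurent assume x: "x \<in> carrier V"
    show "\<exists>K. finite K \<and> (\<forall>K'. finite K' \<longrightarrow> K \<subseteq> K' \<longrightarrow> tens V CU1 x f = (\<Oplus>\<^bsub>?T\<^esub>k\<in>K'. tens V CU1 (coord V k (tens V CU1 x f)) (tpow k)))"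
    proof (intro exI[of _ "Poly_Mapping.keys f"] conjI allI impI)
      fix K' assume K': "finite K'" "Poly_Mapping.keys f \<subseteq> K'"
      have "tens V CU1 x f = tens V CU1 x (\<Oplus>\<^bsub>CU1\<^esub>k\<in>Poly_Mapping.keys f. Poly_Mapping.single k (Poly_Mapping.lookup f k))"
        using free_space_expand[OF CU1_free, of f] by simp
      also have "\<dots> = (\<Oplus>\<^bsub>?T\<^esub>k\<in>Poly_Mapping.keys f. tens V CU1 x (Poly_Mapping.single k (Poly_Mapping.lookup f k)))"
        by (rule linear_map_finsum[OF CU1_vs T tens_linear_right[OF V CU1_vs x]]) auto
      also have "\<dots> = (\<Oplus>\<^bsub>?T\<^esub>k\<in>K'. tens V CU1 x (Poly_Mapping.single k (Poly_Mapping.lookup f k)))"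
        using K' x linear_map_zero[OF CU1_vs T tens_linear_right[OF V CU1_vs x]]
        by (intro vs_finsum_mono_neutral[OF T]) (auto simp: in_keys_iff intro!: tc)
      also have "\<dots> = (\<Oplus>\<^bsub>?T\<^esub>k\<in>K'. tens V CU1 (coord V k (tens V CU1 x f)) (tpow k))"
      proof (rule vs_finsum_cong[OF T])
        fix k
        show "tens V CU1 (coord V k (tens V CU1 x f)) (tpow k) \<in> carrier ?T" using x by (intro tc cc) auto
        have "Poly_Mapping.single k (Poly_Mapping.lookup f k) = Poly_Mapping.lookup f k \<odot>\<^bsub>CU1\<^esub> tpow k" by (simp add: tpow_def)
        thus "tens V CU1 x (Poly_Mapping.single k (Poly_Mapping.lookup f k)) = tens V CU1 (coord V k (tens V CU1 x f)) (tpow k)"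
          using x linear_map_smult[OF tens_linear_right[OF V CU1_vs x], of "tpow k" "Poly_Mapping.lookup f k"]
            linear_map_smult[OF tens_linear_left[OF V CU1_vs, of "tpow k"] x, of "Poly_Mapping.lookup f k"]
          by (simp add: coord_tens)
      qed
      finally show "tens V CU1 x f = (\<Oplus>\<^bsub>?T\<^esub>k\<in>K'. tens V CU1 (coord V k (tens V CU1 x f)) (tpow k))" .
    qed simp
  next
    fix x y assume x: "x \<in> carrier ?T" and y: "y \<in> carrier ?T"
      and ex: "\<exists>K. finite K \<and> (\<forall>K'. finite K' \<longrightarrow> K \<subseteq> K' \<longrightarrow> x = (\<Oplus>\<^bsub>?T\<^esub>k\<in>K'. tens V CU1 (coord V k x) (tpow k)))"
        "\<exists>K. finite K \<and> (\<forall>K'. finite K' \<longrightarrow> K \<subseteq> K' \<longrightarrow> y = (\<Oplus>\<^bsub>?T\<^esub>k\<in>K'. tens V CU1 (coord V k y) (tpow k)))"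
    from ex(1) obtain K where K0: "finite K \<and> (\<forall>K'. finite K' \<longrightarrow> K \<subseteq> K' \<longrightarrow> x = (\<Oplus>\<^bsub>?T\<^esub>k\<in>K'. tens V CU1 (coord V k x) (tpow k)))" by (rule exE)
    from ex(2) obtain L where L0: "finite L \<and> (\<forall>K'. finite K' \<longrightarrow> L \<subseteq> K' \<longrightarrow> y = (\<Oplus>\<^bsub>?T\<^esub>k\<in>K'. tens V CU1 (coord V k y) (tpow k)))" by (rule exE)
    note K = conjunct1[OF K0] conjunct2[OF K0, rule_format] and L = conjunct1[OF L0] conjunct2[OF L0, rule_format]
    show "\<exists>K. finite K \<and> (\<forall>K'. finite K' \<longrightarrow> K \<subseteq> K' \<longrightarrow> x \<oplus>\<^bsub>?T\<^esub> y = (\<Oplus>\<^bsub>?T\<^esub>k\<in>K'. tens V CU1 (coord V k (x \<oplus>\<^bsub>?T\<^esub> y)) (tpow k)))"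
    proof (intro exI[of _ "K \<union> L"] conjI allI impI)
      fix K' assume K': "finite K'" "K \<union> L \<subseteq> K'"
      have "(\<Oplus>\<^bsub>?T\<^esub>k\<in>K'. tens V CU1 (coord V k (x \<oplus>\<^bsub>?T\<^esub> y)) (tpow k)) =
          (\<Oplus>\<^bsub>?T\<^esub>k\<in>K'. tens V CU1 (coord V k x) (tpow k) \<oplus>\<^bsub>?T\<^esub> tens V CU1 (coord V k y) (tpow k))"
        using x y cc T
        by (intro vs_finsum_cong[OF T])
          (auto simp: linear_map_add[OF coord_linear] linear_map_add[OF tens_linear_left[OF V CU1_vs]] intro!: vs_add_closed tc)
      also have "\<dots> = (\<Oplus>\<^bsub>?T\<^esub>k\<in>K'. tens V CU1 (coord V k x) (tpow k)) \<oplus>\<^bsub>?T\<^esub> (\<Oplus>\<^bsub>?T\<^esub>k\<in>K'. tens V CU1 (coord V k y) (tpow k))"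
        using x y cc by (intro vs_finsum_add[OF T] tc) auto
      also have "\<dots> = x \<oplus>\<^bsub>?T\<^esub> y" using K(2)[OF K'(1)] L(2)[OF K'(1)] K'(2) by simp
      finally show "x \<oplus>\<^bsub>?T\<^esub> y = (\<Oplus>\<^bsub>?T\<^esub>k\<in>K'. tens V CU1 (coord V k (x \<oplus>\<^bsub>?T\<^esub> y)) (tpow k))" by simp
    qed (use K(1) L(1) in simp)
  qed
qed

lemma laurent_expandE:
  assumes z: "z \<in> carrier (tensor V CU1)"
  obtains K where "finite K"
    "\<And>K'. finite K' \<Longrightarrow> K \<subseteq> K' \<Longrightarrow> z = (\<Oplus>\<^bsub>tensor V CU1\<^esub>k\<in>K'. tens V CU1 (coord V k z) (tpow k))"
proof -
  from laurent_expand[OF z] obtain K where K: "finite K \<and> (\<forall>K'. finite K' \<longrightarrow> K \<subseteq> K' \<longrightarrow> z = (\<Oplus>\<^bsub>tensor V CU1\<^esub>k\<in>K'. tens V CU1 (coord V k z) (tpow k)))" by (rule exE)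
  show thesis by (rule that[OF conjunct1[OF K] conjunct2[OF K, rule_format]])
qed

lemma coord_eqI:
  assumes x: "x \<in> carrier (tensor V CU1)" and y: "y \<in> carrier (tensor V CU1)"
    and eq: "\<And>k. coord V k x = coord V k y"
  shows "x = y"
proof -
  obtain K where K: "finite K"
    "\<And>K'. finite K' \<Longrightarrow> K \<subseteq> K' \<Longrightarrow> x = (\<Oplus>\<^bsub>tensor V CU1\<^esub>k\<in>K'. tens V CU1 (coord V k x) (tpow k))"
    by (rule laurent_expandE[OF x]) blast
  obtain L where L: "finite L"
    "\<And>K'. finite K' \<Longrightarrow> L \<subseteq> K' \<Longrightarrow> y = (\<Oplus>\<^bsub>tensor V CU1\<^esub>k\<in>K'. tens V CU1 (coord V k y) (tpow k))"
    by (rule laurent_expandE[OF y]) blast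
  have "x = (\<Oplus>\<^bsub>tensor V CU1\<^esub>k\<in>K \<union> L. tens V CU1 (coord V k x) (tpow k))" by (rule K(2)) (simp_all add: K(1) L(1))
  also have "\<dots> = (\<Oplus>\<^bsub>tensor V CU1\<^esub>k\<in>K \<union> L. tens V CU1 (coord V k y) (tpow k))" by (simp only: eq)
  also have "\<dots> = y" by (rule sym, rule L(2)) (simp_all add: K(1) L(1))
  finally show ?thesis .
qed

text \<open>Equality is demanded on the components of the given \<open>z\<close> alone; for a value
  of a coaction these are weight vectors, unlike arbitrary vectors.\<close>

lemma laurent_linear_eq:
  assumes Z: "complex_vector_space Z" and f: "linear_map (tensor V CU1) Z f" and g: "linear_map (tensor V CU1) Z g"
    and z: "z \<in> carrier (tensor V CU1)"
    and eq: "\<And>k. f (tens V CU1 (coord V k z) (tpow k)) = g (tens V CU1 (coord V k z) (tpow k))"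
  shows "f z = g z"
proof -
  obtain K where K: "finite K" "z = (\<Oplus>\<^bsub>tensor V CU1\<^esub>k\<in>K. tens V CU1 (coord V k z) (tpow k))"
    by (rule laurent_expandE[OF z]) blast
  have c: "tens V CU1 (coord V k z) (tpow k) \<in> carrier (tensor V CU1)" for k
    by (rule tens_closed[OF V CU1_vs linear_map_closed[OF coord_linear z]]) simp
  have "f (\<Oplus>\<^bsub>tensor V CU1\<^esub>k\<in>K. tens V CU1 (coord V k z) (tpow k)) = g (\<Oplus>\<^bsub>tensor V CU1\<^esub>k\<in>K. tens V CU1 (coord V k z) (tpow k))"
    using linear_map_finsum[OF tensor_vs[OF V CU1_vs] Z f K(1) c] linear_map_finsum[OF tensor_vs[OF V CU1_vs] Z g K(1) c] eq
    by simp
  thus ?thesis using K(2) by simp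
qed

end

lemma coord_natural:
  assumes V: "complex_vector_space V" and W: "complex_vector_space W" and f: "linear_map V W f"
    and z: "z \<in> carrier (tensor V CU1)"
  shows "coord W k (tensor_map W CU1 f id z) = f (coord V k z)"
proof (rule tensor_linear_eq[OF V CU1_vs W _ linear_map_comp[OF coord_linear[OF V] f] _ z])
  show "linear_map (tensor V CU1) W (\<lambda>z. coord W k (tensor_map W CU1 f id z))"
    by (rule linear_map_comp[OF tensor_map_linear[OF V CU1_vs W CU1_vs f linear_map_id(2)] coord_linear[OF W]])
  fix x g assume x: "x \<in> carrier V" "g \<in> carrier CU1"
  show "coord W k (tensor_map W CU1 f id (tens V CU1 x g)) = f (coord V k (tens V CU1 x g))"
    using x linear_map_closed[OF f x(1)]
    by (simp add: tensor_map_tens[OF V CU1_vs W CU1_vs f linear_map_id(2)] coord_tens[OF V] coord_tens[OF W]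
        linear_map_smult[OF f])
qed

section \<open>The tensor product coaction\<close>

text \<open>The tensor coaction with the two coactions stripped off: p0 \<otimes> p1 and v0
  \<otimes> v1 give (p0 \<otimes> v0) \<otimes> p1 v1. In this form it is bilinear and natural in
  all three spaces.\<close>

definition coaction_product ::
    "(complex, 'h, 'k) module_scheme \<Rightarrow> (complex, 'p, 'm) module_scheme \<Rightarrow> (complex, 'v, 'n) module_scheme \<Rightarrow>
     ('p, 'h) tensor \<Rightarrow> ('v, 'h) tensor \<Rightarrow> (('p, 'v) tensor, 'h) tensor" where
  "coaction_product H P V y z = tensor_lift (tensor (tensor P V) H) (\<lambda>p0 p1.
     tensor_lift (tensor (tensor P V) H) (\<lambda>v0 v1. tens (tensor P V) H (tens P V p0 v0) (p1 \<otimes>\<^bsub>H\<^esub> v1)) z) y"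

lemma tensor_coaction_conv:
  "tensor_coaction H P \<rho>P V \<rho>V = tensor_lift (tensor (tensor P V) H) (\<lambda>p v. coaction_product H P V (\<rho>P p) (\<rho>V v))"
  unfolding tensor_coaction_def coaction_product_def Let_def ..

context
  fixes H :: "(complex, 'h, 'k) module_scheme" and P :: "(complex, 'p, 'm) module_scheme"
    and V :: "(complex, 'v, 'n) module_scheme"
  assumes H: "complex_alg H" and P: "complex_vector_space P" and V: "complex_vector_space V"
begin

abbreviation (input) "cPV \<equiv> tensor P V"
abbreviation (input) "cZ \<equiv> tensor (tensor P V) H"

lemmas VH = complex_alg_vs[OF H]
lemmas VPV = tensor_vs[OF P V]
lemmas VZ = tensor_vs[OF VPV VH]

lemma product_inner_bilinear:
  assumes "p0 \<in> carrier P" "p1 \<in> carrier H"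
  shows "bilinear V H cZ (\<lambda>v0 v1. tens cPV H (tens P V p0 v0) (p1 \<otimes>\<^bsub>H\<^esub> v1))"
  by (rule bilinear_comp[OF tens_bilinear[OF VPV VH] tens_linear_right[OF P V assms(1)] alg_mult_right_linear[OF H assms(2)]])

lemma product_outer_bilinear:
  assumes z: "z \<in> carrier (tensor V H)"
  shows "bilinear P H cZ (\<lambda>p0 p1. tensor_lift cZ (\<lambda>v0 v1. tens cPV H (tens P V p0 v0) (p1 \<otimes>\<^bsub>H\<^esub> v1)) z)"
proof (rule bilinearI)
  fix p1 assume p1: "p1 \<in> carrier H"
  show "linear_map P cZ (\<lambda>p0. tensor_lift cZ (\<lambda>v0 v1. tens cPV H (tens P V p0 v0) (p1 \<otimes>\<^bsub>H\<^esub> v1)) z)"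
  proof (rule tensor_lift_param_linear[OF V VH P VZ product_inner_bilinear[OF _ p1] _ z])
    fix v w assume "v \<in> carrier V" "w \<in> carrier H"
    thus "linear_map P cZ (\<lambda>x. tens cPV H (tens P V x v) (p1 \<otimes>\<^bsub>H\<^esub> w))"
      using p1 H by (intro linear_map_comp[OF tens_linear_left[OF P V] tens_linear_left[OF VPV VH]]) auto
  qed
next
  fix p0 assume p0: "p0 \<in> carrier P"
  show "linear_map H cZ (\<lambda>p1. tensor_lift cZ (\<lambda>v0 v1. tens cPV H (tens P V p0 v0) (p1 \<otimes>\<^bsub>H\<^esub> v1)) z)"
  proof (rule tensor_lift_param_linear[OF V VH VH VZ product_inner_bilinear[OF p0] _ z])
    fix v w assume "v \<in> carrier V" "w \<in> carrier H"
    thus "linear_map H cZ (\<lambda>x. tens cPV H (tens P V p0 v) (x \<otimes>\<^bsub>H\<^esub> w))"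
      using p0 by (intro linear_map_comp[OF alg_mult_left_linear[OF H] tens_linear_right[OF VPV VH]] tens_closed[OF P V]) auto
  qed
qed

lemma coaction_product_tens:
  assumes "p0 \<in> carrier P" "p1 \<in> carrier H" "v0 \<in> carrier V" "v1 \<in> carrier H"
  shows "coaction_product H P V (tens P H p0 p1) (tens V H v0 v1) = tens cPV H (tens P V p0 v0) (p1 \<otimes>\<^bsub>H\<^esub> v1)"
  unfolding coaction_product_def
  using tensor_lift_tens[OF P VH VZ product_outer_bilinear[OF tens_closed[OF V VH assms(3,4)]] assms(1,2)]
    tensor_lift_tens[OF V VH VZ product_inner_bilinear[OF assms(1,2)] assms(3,4)]
  by simp

lemma coaction_product_bilinear: "bilinear (tensor P H) (tensor V H) cZ (coaction_product H P V)"
proof (rule bilinearI)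
  show "linear_map (tensor P H) cZ (\<lambda>y. coaction_product H P V y z)" if "z \<in> carrier (tensor V H)" for z
    unfolding coaction_product_def by (rule tensor_lift_linear[OF P VH VZ product_outer_bilinear[OF that]])
  show "linear_map (tensor V H) cZ (\<lambda>z. coaction_product H P V y z)" if y: "y \<in> carrier (tensor P H)" for y
    unfolding coaction_product_def
  proof (rule tensor_lift_param_linear[OF P VH tensor_vs[OF V VH] VZ product_outer_bilinear _ y])
    fix p0 p1 assume "p0 \<in> carrier P" "p1 \<in> carrier H"
    thus "linear_map (tensor V H) cZ (\<lambda>z. tensor_lift cZ (\<lambda>v0 v1. tens cPV H (tens P V p0 v0) (p1 \<otimes>\<^bsub>H\<^esub> v1)) z)"
      by (rule tensor_lift_linear[OF V VH VZ product_inner_bilinear])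
  qed
qed

context
  fixes \<rho>P \<rho>V
  assumes \<rho>P: "linear_map P (tensor P H) \<rho>P" and \<rho>V: "linear_map V (tensor V H) \<rho>V"
begin

lemma product_coaction_bilinear: "bilinear P V cZ (\<lambda>p v. coaction_product H P V (\<rho>P p) (\<rho>V v))"
  by (rule bilinear_comp[OF coaction_product_bilinear \<rho>P \<rho>V])

end

end

lemma tensor_bilinear_eq:
  assumes "complex_vector_space P" "complex_vector_space Q" "complex_vector_space V" "complex_vector_space W" "complex_vector_space Z"
    and f: "bilinear (tensor P Q) (tensor V W) Z f" and g: "bilinear (tensor P Q) (tensor V W) Z g"
    and eq: "\<And>p q v w. p \<in> carrier P \<Longrightarrow> q \<in> carrier Q \<Longrightarrow> v \<in> carrier V \<Longrightarrow> w \<in> carrier W \<Longrightarrow>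
      f (tens P Q p q) (tens V W v w) = g (tens P Q p q) (tens V W v w)"
    and y: "y \<in> carrier (tensor P Q)" and z: "z \<in> carrier (tensor V W)"
  shows "f y z = g y z"
proof (rule tensor_linear_eq[OF assms(1,2,5) bilinear_left[OF f z] bilinear_left[OF g z] _ y])
  fix p q assume pq: "p \<in> carrier P" "q \<in> carrier Q"
  show "f (tens P Q p q) z = g (tens P Q p q) z"
    by (rule tensor_linear_eq[OF assms(3,4,5) bilinear_right[OF f tens_closed[OF assms(1,2) pq]]
          bilinear_right[OF g tens_closed[OF assms(1,2) pq]] eq[OF pq] z])
qed

text \<open>Checked on pure tensors, where multiplicativity of \<open>c\<close> takes it inside the
  product p1 v1. It is applied both to the inclusion of the sphere and to the projection onto the
  smaller quantum group.\<close>

lemma coaction_product_natural: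
  assumes H: "complex_alg H" and H': "complex_alg H'" and P: "complex_vector_space P" and P': "complex_vector_space P'"
    and V: "complex_vector_space V" and V': "complex_vector_space V'"
    and a: "linear_map P P' a" and b: "linear_map V V' b" and c: "alg_hom H H' c"
    and y: "y \<in> carrier (tensor P H)" and z: "z \<in> carrier (tensor V H)"
  shows "tensor_map (tensor P' V') H' (tensor_map P' V' a b) c (coaction_product H P V y z) =
    coaction_product H' P' V' (tensor_map P' H' a c y) (tensor_map V' H' b c z)"
proof -
  note VH = complex_alg_vs[OF H] complex_alg_vs[OF H']
  note c' = alg_hom_linear[OF c]
  note ab = tensor_map_linear[OF P V P' V' a b]
  note L = tensor_map_linear[OF tensor_vs[OF P V] VH(1) tensor_vs[OF P' V'] VH(2) ab c']
  note cl = linear_map_closed[OF a] linear_map_closed[OF b] alg_hom_closed[OF c]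
  show ?thesis
    by (rule tensor_bilinear_eq[OF P VH(1) V VH(1) tensor_vs[OF tensor_vs[OF P' V'] VH(2)]
          bilinear_comp_linear[OF coaction_product_bilinear[OF H P V] L]
          bilinear_comp[OF coaction_product_bilinear[OF H' P' V'] tensor_map_linear[OF P VH(1) P' VH(2) a c']
            tensor_map_linear[OF V VH(1) V' VH(2) b c']] _ y z])
      (use H H' in \<open>simp add: coaction_product_tens[OF H P V] coaction_product_tens[OF H' P' V'] cl
        tensor_map_tens[OF P VH(1) P' VH(2) a c'] tensor_map_tens[OF V VH(1) V' VH(2) b c']
        tensor_map_tens[OF tensor_vs[OF P V] VH(1) tensor_vs[OF P' V'] VH(2) ab c']
        tensor_map_tens[OF P V P' V' a b] tens_closed[OF P V] alg_hom_mult[OF c]\<close>)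
qed

section \<open>Comodules over the circle\<close>

context
  fixes V1 :: "(complex, 'a, 'l) module_scheme" and V2 :: "(complex, 'b, 'm) module_scheme"
    and V3 :: "(complex, 'c, 'n) module_scheme"
  assumes V1: "complex_vector_space V1" and V2: "complex_vector_space V2" and V3: "complex_vector_space V3"
begin

lemma assoc_inner_bilinear:
  assumes "w \<in> carrier V3"
  shows "bilinear V1 V2 (tensor V1 (tensor V2 V3)) (\<lambda>u v. tens V1 (tensor V2 V3) u (tens V2 V3 v w))"
  by (rule bilinear_comp[OF tens_bilinear[OF V1 tensor_vs[OF V2 V3]] linear_map_id(1) tens_linear_left[OF V2 V3 assms]])

lemma assoc_outer_bilinear:
  "bilinear (tensor V1 V2) V3 (tensor V1 (tensor V2 V3))
     (\<lambda>x w. tensor_lift (tensor V1 (tensor V2 V3)) (\<lambda>u v. tens V1 (tensor V2 V3) u (tens V2 V3 v w)) x)"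
proof (rule bilinearI)
  note Z = tensor_vs[OF V1 tensor_vs[OF V2 V3]]
  show "linear_map (tensor V1 V2) (tensor V1 (tensor V2 V3))
      (\<lambda>x. tensor_lift (tensor V1 (tensor V2 V3)) (\<lambda>u v. tens V1 (tensor V2 V3) u (tens V2 V3 v w)) x)"
    if "w \<in> carrier V3" for w
    by (rule tensor_lift_linear[OF V1 V2 Z assoc_inner_bilinear[OF that]])
  show "linear_map V3 (tensor V1 (tensor V2 V3))
      (\<lambda>w. tensor_lift (tensor V1 (tensor V2 V3)) (\<lambda>u v. tens V1 (tensor V2 V3) u (tens V2 V3 v w)) x)"
    if x: "x \<in> carrier (tensor V1 V2)" for x
  proof (rule tensor_lift_param_linear[OF V1 V2 V3 Z assoc_inner_bilinear _ x])
    fix v w assume "v \<in> carrier V1" "w \<in> carrier V2"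
    thus "linear_map V3 (tensor V1 (tensor V2 V3)) (\<lambda>x. tens V1 (tensor V2 V3) v (tens V2 V3 w x))"
      by (intro linear_map_comp[OF tens_linear_right[OF V2 V3] tens_linear_right[OF V1 tensor_vs[OF V2 V3]]])
  qed
qed

lemma tensor_assoc_linear: "linear_map (tensor (tensor V1 V2) V3) (tensor V1 (tensor V2 V3)) (tensor_assoc V1 V2 V3)"
  unfolding tensor_assoc_def
  by (rule tensor_lift_linear[OF tensor_vs[OF V1 V2] V3 tensor_vs[OF V1 tensor_vs[OF V2 V3]] assoc_outer_bilinear])

lemma tensor_assoc_tens:
  assumes "u \<in> carrier V1" "v \<in> carrier V2" "w \<in> carrier V3"
  shows "tensor_assoc V1 V2 V3 (tens (tensor V1 V2) V3 (tens V1 V2 u v) w) = tens V1 (tensor V2 V3) u (tens V2 V3 v w)"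
  unfolding tensor_assoc_def
  using tensor_lift_tens[OF tensor_vs[OF V1 V2] V3 tensor_vs[OF V1 tensor_vs[OF V2 V3]] assoc_outer_bilinear
      tens_closed[OF V1 V2 assms(1,2)] assms(3)]
    tensor_lift_tens[OF V1 V2 tensor_vs[OF V1 tensor_vs[OF V2 V3]] assoc_inner_bilinear[OF assms(3)] assms(1,2)]
  by simp

end

lemma lookup_tpow: "Poly_Mapping.lookup (tpow m) k = (if m = k then 1 else 0)"
  by (simp add: tpow_def lookup_single when_def)

lemma comult_CU1_linear: "linear_map CU1 (tensor CU1 CU1) (comult CU1)"
  unfolding comult_CU1
  by (rule lin_ext_linear[OF CU1_free tensor_vs[OF CU1_vs CU1_vs]]) (rule tens_closed[OF CU1_vs CU1_vs], auto)

lemma comult_CU1_tpow: "comult CU1 (tpow k) = tens CU1 CU1 (tpow k) (tpow k)"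
proof -
  have "tens CU1 CU1 (tpow k) (tpow k) \<in> carrier (tensor CU1 CU1)" by (rule tens_closed[OF CU1_vs CU1_vs]) auto
  thus ?thesis unfolding comult_CU1 tpow_def[of k]
    using lin_ext_single[OF tensor_vs[OF CU1_vs CU1_vs], of "\<lambda>k. tens CU1 CU1 (tpow k) (tpow k)" k 1] tensor_vs[OF CU1_vs CU1_vs]
    by (simp add: tpow_def)
qed

lemma counit_CU1_linear: "linear_map CU1 complex_algebra (counit CU1)"
  unfolding counit_CU1_lin_ext by (rule lin_ext_linear[OF CU1_free complex_alg_vs[OF complex_algebra_alg]]) simp

lemma counit_CU1_tpow: "counit CU1 (tpow k) = 1"
  by (simp add: counit_CU1 tpow_def)

lemma counit_action_bilinear:
  assumes V: "complex_vector_space V" and \<epsilon>: "linear_map H complex_algebra \<epsilon>"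
  shows "bilinear V H V (\<lambda>w h. \<epsilon> h \<odot>\<^bsub>V\<^esub> w)"
  using V linear_map_add[OF \<epsilon>] linear_map_smult[OF \<epsilon>]
  by (intro bilinearI linear_mapI)
    (auto simp: vs_smult_add vs_smult_add_right vs_smult_smult mult.commute)

section \<open>Weight decomposition of a circle comodule\<close>

context
  fixes V :: "(complex, 'v) module" and \<rho>V :: "'v \<Rightarrow> ('v, laurent) tensor"
  assumes com: "right_comodule CU1 V \<rho>V"
begin

lemma comodule_vs: "complex_vector_space V"
  and comodule_linear: "linear_map V (tensor V CU1) \<rho>V"
  and comodule_assoc: "v \<in> carrier V \<Longrightarrow> tensor_assoc V CU1 CU1 (tensor_map (tensor V CU1) CU1 \<rho>V id (\<rho>V v)) =
        tensor_map V (tensor CU1 CU1) id (comult CU1) (\<rho>V v)"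
  and comodule_counit: "v \<in> carrier V \<Longrightarrow> tensor_lift V (\<lambda>w h. counit CU1 h \<odot>\<^bsub>V\<^esub> w) (\<rho>V v) = v"
  using com by (auto simp: right_comodule_def)

text \<open>Compare the coefficients of \<open>t^k\<close> in the last leg of coassociativity. One
  side gives the coaction of the component; the other gives the component tensored with
  \<open>t^k\<close>, since powers of \<open>t\<close> are grouplike.\<close>

lemma component_homogeneous:
  assumes v: "v \<in> carrier V"
  shows "\<rho>V (coord V k (\<rho>V v)) = tens V CU1 (coord V k (\<rho>V v)) (tpow k)"
proof -
  note V = comodule_vs and \<rho> = comodule_linear
  note VL = tensor_vs[OF V CU1_vs] and LL = tensor_vs[OF CU1_vs CU1_vs]
  note w = linear_map_closed[OF \<rho> v]
  \<comment> \<open>After rebracketing, this extracts the coefficient of \<open>t^k\<close> in the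
    third leg.\<close>
  let ?c = "tensor_map V CU1 id (coord CU1 k)"
  note c = tensor_map_linear[OF V LL V CU1_vs linear_map_id(2) coord_linear[OF CU1_vs]]
    and ct = tensor_map_tens[OF V LL V CU1_vs linear_map_id(2) coord_linear[OF CU1_vs]]
  have A: "?c (tensor_assoc V CU1 CU1 y) = coord (tensor V CU1) k y" if y: "y \<in> carrier (tensor (tensor V CU1) CU1)" for y
  proof (rule tensor_linear_eq[OF VL CU1_vs VL linear_map_comp[OF tensor_assoc_linear[OF V CU1_vs CU1_vs] c] coord_linear[OF VL] _ y])
    fix x g assume x: "x \<in> carrier (tensor V CU1)" and g: "g \<in> carrier CU1"
    show "?c (tensor_assoc V CU1 CU1 (tens (tensor V CU1) CU1 x g)) = coord (tensor V CU1) k (tens (tensor V CU1) CU1 x g)"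
    proof (rule tensor_linear_eq[OF V CU1_vs VL _ _ _ x])
      show "linear_map (tensor V CU1) (tensor V CU1) (\<lambda>x. ?c (tensor_assoc V CU1 CU1 (tens (tensor V CU1) CU1 x g)))"
        by (rule linear_map_comp[OF tens_linear_left[OF VL CU1_vs g] linear_map_comp[OF tensor_assoc_linear[OF V CU1_vs CU1_vs] c]])
      show "linear_map (tensor V CU1) (tensor V CU1) (\<lambda>x. coord (tensor V CU1) k (tens (tensor V CU1) CU1 x g))"
        by (rule linear_map_comp[OF tens_linear_left[OF VL CU1_vs g] coord_linear[OF VL]])
      fix u f assume u: "u \<in> carrier V" and f: "f \<in> carrier CU1"
      show "?c (tensor_assoc V CU1 CU1 (tens (tensor V CU1) CU1 (tens V CU1 u f) g)) = coord (tensor V CU1) k (tens (tensor V CU1) CU1 (tens V CU1 u f) g)"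
        using u f g linear_map_smult[OF tens_linear_right[OF V CU1_vs u] f, of "Poly_Mapping.lookup g k"]
        by (simp add: tensor_assoc_tens[OF V CU1_vs CU1_vs] ct tens_closed[OF CU1_vs CU1_vs] coord_tens[OF VL]
            tens_closed[OF V CU1_vs] coord_tens[OF CU1_vs])
    qed
  qed
  have \<Delta>: "coord CU1 k (comult CU1 f) = scale (Poly_Mapping.lookup f k) (tpow k)" for f
  proof (rule free_space_linear_eq[OF CU1_free CU1_vs linear_map_comp[OF comult_CU1_linear coord_linear[OF CU1_vs]]])
    show "linear_map CU1 CU1 (\<lambda>f. scale (Poly_Mapping.lookup f k) (tpow k))"
      by (rule linear_mapI) (auto simp: lookup_add scale_add scale_scale)
    fix m show "coord CU1 k (comult CU1 (Poly_Mapping.single m 1)) = scale (Poly_Mapping.lookup (Poly_Mapping.single m 1) k) (tpow k)"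
      unfolding tpow_def[symmetric] by (simp add: comult_CU1_tpow coord_tens[OF CU1_vs] lookup_tpow)
  qed simp
  have B: "?c (tensor_map V (tensor CU1 CU1) id (comult CU1) y) = tens V CU1 (coord V k y) (tpow k)"
    if y: "y \<in> carrier (tensor V CU1)" for y
  proof (rule tensor_linear_eq[OF V CU1_vs VL linear_map_comp[OF tensor_map_linear[OF V CU1_vs V LL linear_map_id(2) comult_CU1_linear] c]
        linear_map_comp[OF coord_linear[OF V] tens_linear_left[OF V CU1_vs]] _ y])
    fix u f assume u: "u \<in> carrier V" and f: "f \<in> carrier CU1"
    show "?c (tensor_map V (tensor CU1 CU1) id (comult CU1) (tens V CU1 u f)) = tens V CU1 (coord V k (tens V CU1 u f)) (tpow k)"
      using u linear_map_smult[OF tens_linear_right[OF V CU1_vs u], of "tpow k" "Poly_Mapping.lookup f k"]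
        linear_map_smult[OF tens_linear_left[OF V CU1_vs, of "tpow k"] u, of "Poly_Mapping.lookup f k"]
      by (simp add: tensor_map_tens[OF V CU1_vs V LL linear_map_id(2) comult_CU1_linear] ct
          linear_map_closed[OF comult_CU1_linear] \<Delta> coord_tens[OF V])
  qed simp
  have "\<rho>V (coord V k (\<rho>V v)) = coord (tensor V CU1) k (tensor_map (tensor V CU1) CU1 \<rho>V id (\<rho>V v))"
    by (rule coord_natural[OF V VL \<rho> w, symmetric])
  also have "\<dots> = ?c (tensor_assoc V CU1 CU1 (tensor_map (tensor V CU1) CU1 \<rho>V id (\<rho>V v)))"
    by (rule A[symmetric]) (rule linear_map_closed[OF tensor_map_linear[OF V CU1_vs VL CU1_vs \<rho> linear_map_id(2)] w])
  also have "\<dots> = tens V CU1 (coord V k (\<rho>V v)) (tpow k)"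
    unfolding comodule_assoc[OF v] by (rule B[OF w])
  finally show ?thesis .
qed

text \<open>By the counit axiom a vector is the sum of its components, and these are weight vectors.
  So comodule identities need checking on weight vectors only.\<close>

lemma comodule_linear_eq:
  assumes Z: "complex_vector_space Z" and f: "linear_map V Z f" and g: "linear_map V Z g"
    and eq: "\<And>k x. x \<in> carrier V \<Longrightarrow> \<rho>V x = tens V CU1 x (tpow k) \<Longrightarrow> f x = g x"
    and v: "v \<in> carrier V"
  shows "f v = g v"
proof -
  note V = comodule_vs and \<rho> = comodule_linear
  let ?e = "tensor_lift V (\<lambda>w h. counit CU1 h \<odot>\<^bsub>V\<^esub> w)"
  note b = counit_action_bilinear[OF V counit_CU1_linear]
  note e = tensor_lift_linear[OF V CU1_vs V b] and et = tensor_lift_tens[OF V CU1_vs V b]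
  note w = linear_map_closed[OF \<rho> v]
  have "f (?e (\<rho>V v)) = g (?e (\<rho>V v))"
  proof (rule laurent_linear_eq[OF V Z linear_map_comp[OF e f] linear_map_comp[OF e g] w])
    fix k
    have c: "coord V k (\<rho>V v) \<in> carrier V" by (rule linear_map_closed[OF coord_linear[OF V] w])
    show "f (?e (tens V CU1 (coord V k (\<rho>V v)) (tpow k))) = g (?e (tens V CU1 (coord V k (\<rho>V v)) (tpow k)))"
      using eq[OF c component_homogeneous[OF v]] c V by (simp add: et counit_CU1_tpow)
  qed
  thus ?thesis by (simp only: comodule_counit[OF v])
qed

end

section \<open>The coactions on the quantum special unitary group\<close>

lemma alg_hom_cong:
  assumes A: "complex_alg A" and f: "alg_hom A B f" and eq: "\<And>x. x \<in> carrier A \<Longrightarrow> g x = f x"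
  shows "alg_hom A B g"
  using assms linear_map_cong_fun[OF complex_alg_vs[OF A] alg_hom_linear[OF f] eq]
  by (auto simp: alg_hom_def)

context
  fixes q :: real and n :: nat
  assumes q: "q > 0" and n: "n \<ge> 1"
begin

abbreviation (input) "qP \<equiv> SU_algebra q (Suc n)"
abbreviation (input) "qH \<equiv> CqU q n"
abbreviation (input) "qK \<equiv> CqSU q n"
abbreviation (input) "\<rho>\<alpha> \<equiv> coaction_via q (Suc n) (CqU q n) (alpha q (Suc n))"
abbreviation (input) "\<rho>\<beta> \<equiv> coaction_via q (Suc n) (CqSU q n) (beta q (Suc n))"
abbreviation (input) "\<rho>\<gamma> \<equiv> coaction_via q (Suc n) CU1 (gamma q (Suc n))"
abbreviation (input) "uP \<equiv> u_SU q (Suc n)"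

lemma beta_hom: "alg_hom qP qK (beta q (Suc n))"
  by (rule alg_hom_cong[OF SU_algebra_alg alg_hom_comp[OF alpha_hom(1)[OF q n] pi_hom(1)[OF q n]] beta_conv[OF q n]])

lemma gamma_hom: "alg_hom qP CU1 (gamma q (Suc n))"
  by (rule alg_hom_cong[OF SU_algebra_alg alg_hom_comp[OF alpha_hom(1)[OF q n] torus_hom(1)[OF q n]] gamma_conv[OF q n]])

lemma beta_gen:
  assumes ij: "i \<in> {1..Suc n}" "j \<in> {1..Suc n}"
  shows "beta q (Suc n) (uP i j) = (if i = 1 \<and> j = 1 then \<one>\<^bsub>qK\<^esub> else if i = 1 \<or> j = 1 then \<zero>\<^bsub>qK\<^esub>
    else u_SU q n (i - 1) (j - 1))"
proof -
  have "pi_map q n \<zero>\<^bsub>qH\<^esub> = \<zero>\<^bsub>qK\<^esub>"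
    by (rule linear_map_zero[OF _ _ alg_hom_linear[OF pi_hom(1)[OF q n]]]) auto
  moreover have "pi_map q n (u_U q n (i - 1) (j - 1)) = u_SU q n (i - 1) (j - 1)" if "i \<noteq> 1" "j \<noteq> 1"
    by (rule pi_hom(2)[OF q n]) (use that ij in auto)
  ultimately show ?thesis
    unfolding beta_conv[OF q n u_SU_closed[OF ij]] alpha_hom(2)[OF q n ij]
    by (cases "i = 1"; cases "j = 1") (simp_all add: pi_hom(3)[OF q n])
qed

lemma gamma_gen:
  assumes ij: "i \<in> {1..Suc n}" "j \<in> {1..Suc n}"
  shows "gamma q (Suc n) (uP i j) = (if i \<noteq> j then 0 else if i = 1 then tpow (- 1) else if i = Suc n then tpow 1 else 1)"
proof -
  have "torus_map q n \<zero>\<^bsub>qH\<^esub> = 0"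
    using linear_map_zero[OF _ _ alg_hom_linear[OF torus_hom(1)[OF q n]]] by simp
  moreover have "torus_map q n (u_U q n (i - 1) (j - 1)) = (if i - 1 \<noteq> j - 1 then 0 else if i - 1 = n then tpow 1 else 1)"
    if "i \<noteq> 1" "j \<noteq> 1"
    by (rule torus_hom(2)[OF q n]) (use that ij in auto)
  ultimately show ?thesis
    unfolding gamma_conv[OF q n u_SU_closed[OF ij]] alpha_hom(2)[OF q n ij] using ij
    by (cases "i = 1"; cases "j = 1") (auto simp: torus_hom(3)[OF q n])
qed

lemma coaction_via_hom:
  assumes B: "complex_alg B" and f: "alg_hom qP B f"
  shows "alg_hom qP (tensor qP B) (coaction_via q (Suc n) B f)"
proof -
  have "coaction_via q (Suc n) B f = (\<lambda>x. tensor_map qP B id f (comult (CqSU q (Suc n)) x))"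
    by (rule ext) (simp add: coaction_via_def)
  thus ?thesis
    using alg_hom_comp[OF comult_SU_hom(1)[OF q, of "Suc n"]
        tensor_map_hom[OF SU_algebra_alg SU_algebra_alg SU_algebra_alg B alg_hom_id(2) f]] by simp
qed

lemma coaction_via_gen:
  assumes B: "complex_alg B" and f: "alg_hom qP B f" and ij: "i \<in> {1..Suc n}" "j \<in> {1..Suc n}"
  shows "coaction_via q (Suc n) B f (uP i j) = (\<Oplus>\<^bsub>tensor qP B\<^esub>k\<in>{1..Suc n}. tens qP B (uP i k) (f (uP k j)))"
proof -
  note V = complex_alg_vs[OF SU_algebra_alg[of q "Suc n"]] and VB = complex_alg_vs[OF B]
  note m = tensor_map_linear[OF V V V VB linear_map_id(2) alg_hom_linear[OF f]]
    and mt = tensor_map_tens[OF V V V VB linear_map_id(2) alg_hom_linear[OF f]]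
  have c: "comult (CqSU q (Suc n)) (uP i j) = (\<Oplus>\<^bsub>tensor qP qP\<^esub>k\<in>{1..Suc n}. tens qP qP (uP i k) (uP k j))"
    by (rule comult_SU_hom(2)[OF q _ ij]) simp
  have "coaction_via q (Suc n) B f (uP i j) = tensor_map qP B id f (\<Oplus>\<^bsub>tensor qP qP\<^esub>k\<in>{1..Suc n}. tens qP qP (uP i k) (uP k j))"
    unfolding coaction_via_def c ..
  also have "\<dots> = (\<Oplus>\<^bsub>tensor qP B\<^esub>k\<in>{1..Suc n}. tensor_map qP B id f (tens qP qP (uP i k) (uP k j)))"
    by (rule linear_map_finsum[OF tensor_vs[OF V V] tensor_vs[OF V VB] m]) (use ij in \<open>auto intro!: tens_closed[OF V V]\<close>)
  also have "\<dots> = (\<Oplus>\<^bsub>tensor qP B\<^esub>k\<in>{1..Suc n}. tens qP B (uP i k) (f (uP k j)))"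
    by (rule vs_finsum_cong[OF tensor_vs[OF V VB]])
      (use ij in \<open>auto simp: mt intro!: tens_closed[OF V VB] alg_hom_closed[OF f]\<close>)
  finally show ?thesis .
qed

lemmas VP = complex_alg_vs[OF SU_algebra_alg[of q "Suc n"]]
lemmas VqH = complex_alg_vs[OF CqU_alg[of q n]]
lemmas VqK = complex_alg_vs[OF CqSU_alg[of q n]]

lemma tens_zero_right:
  assumes "complex_vector_space A" "complex_vector_space B" "a \<in> carrier A"
  shows "tens A B a \<zero>\<^bsub>B\<^esub> = \<zero>\<^bsub>tensor A B\<^esub>"
  by (rule linear_map_zero[OF assms(2) tensor_vs[OF assms(1,2)] tens_linear_right[OF assms]])

text \<open>\<gamma> vanishes off the diagonal, so one summand of the coproduct survives.\<close>

lemma gamma_coaction_gen: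
  assumes ij: "i \<in> {1..Suc n}" "j \<in> {1..Suc n}"
  shows "\<rho>\<gamma> (uP i j) = tens qP CU1 (uP i j) (gamma q (Suc n) (uP j j))"
  unfolding coaction_via_gen[OF CU1_alg gamma_hom ij]
proof (rule vs_finsum_single[OF tensor_vs[OF VP CU1_vs]])
  fix k assume "k \<in> {1..Suc n}" "k \<noteq> j"
  thus "tens qP CU1 (uP i k) (gamma q (Suc n) (uP k j)) = \<zero>\<^bsub>tensor qP CU1\<^esub>"
    using ij tens_zero_right[OF VP CU1_vs, of "uP i k"] by (simp add: gamma_gen)
qed (use ij in \<open>auto intro!: tens_closed[OF VP CU1_vs]\<close>)

text \<open>The map \<open>\<alpha>\<close> is the convolution product of \<open>\<gamma>\<close>, with \<open>t\<close> read as the determinant, and of \<open>\<beta>\<close>,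
  lifted along \<open>sec_map\<close>.\<close>

lemma alpha_factor:
  assumes kj: "k \<in> {1..Suc n}" "j \<in> {1..Suc n}"
  shows "det_map q n (gamma q (Suc n) (uP k k)) \<otimes>\<^bsub>qH\<^esub> sec_map q n (beta q (Suc n) (uP k j)) = alpha q (Suc n) (uP k j)"
proof -
  have zero: "sec_map q n \<zero>\<^bsub>qK\<^esub> = \<zero>\<^bsub>qH\<^esub>"
    by (rule linear_map_zero[OF VqK VqH alg_hom_linear[OF sec_hom(1)[OF q n]]])
  have dc: "det_map q n f \<in> carrier qH" for f using linear_map_closed[OF det_map_linear] by simp
  have m1: "det_map q n (tpow (- 1)) = detinv_U q n"
    using det_pow_minus[of q n 0] by (simp add: det_map_tpow det_pow_0)
  have p1: "det_map q n (tpow 1) = det_U q n"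
    using det_pow_plus[of q n 0] by (simp add: det_map_tpow det_pow_0)
  have d1: "det_map q n 1 = \<one>\<^bsub>qH\<^esub>" using alg_hom_one[OF det_map_hom] by simp
  consider "k = 1" "j = 1" | "k = 1" "j \<noteq> 1" | "k \<noteq> 1" "j = 1" | "k \<noteq> 1" "j \<noteq> 1" by blast
  thus ?thesis
  proof cases
    case 4
    have idx: "k - 1 \<in> {1..n}" "j - 1 \<in> {1..n}" using kj 4 by auto
    let ?u = "u_U q n (k - 1) (j - 1)"
    have u: "?u \<in> carrier qH" using idx by blast
    have a: "alpha q (Suc n) (uP k j) = ?u" using 4 by (simp add: alpha_hom(2)[OF q n kj])
    have b: "sec_map q n (beta q (Suc n) (uP k j)) = ?u \<otimes>\<^bsub>qH\<^esub> (if k - 1 = n then detinv_U q n else \<one>\<^bsub>qH\<^esub>)"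
      unfolding beta_gen[OF kj] using 4 sec_hom(2)[OF q n idx] by (simp only: if_False simp_thms)
    show ?thesis
    \<comment> \<open>In the last row the section inserts \<open>DetInv\<close> while \<gamma>
      contributes the determinant, and the two cancel by centrality. In the other rows of the block
      both are 1.\<close>
    proof (cases "k = Suc n")
      case True
      hence g: "gamma q (Suc n) (uP k k) = tpow 1" using 4 kj by (simp add: gamma_gen)
      have "det_U q n \<otimes>\<^bsub>qH\<^esub> (?u \<otimes>\<^bsub>qH\<^esub> detinv_U q n) = ?u \<otimes>\<^bsub>qH\<^esub> (det_U q n \<otimes>\<^bsub>qH\<^esub> detinv_U q n)"
        using u det_U_central[OF q n u] by (simp add: alg_assoc[symmetric, OF CqU_alg])
      thus ?thesis unfolding a b g p1 using True u by (simp add: det_U_inverse)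
    next
      case False
      hence g: "gamma q (Suc n) (uP k k) = 1" using 4 kj by (simp add: gamma_gen)
      have "k - 1 \<noteq> n" using False 4 kj by auto
      thus ?thesis unfolding a b g d1 using u by simp
    qed
  qed (use kj in \<open>simp_all add: gamma_gen beta_gen alpha_hom(2)[OF q n] zero m1 dc alg_hom_one[OF sec_hom(1)[OF q n]]\<close>)
qed

lemma det_tensor_hom: "alg_hom (tensor qP CU1) (tensor qP qH) (tensor_map qP qH id (det_map q n))"
  by (rule tensor_map_hom[OF SU_algebra_alg CU1_alg SU_algebra_alg CqU_alg alg_hom_id(2) det_map_hom])

lemmas det_tensor_tens = tensor_map_tens[OF VP CU1_vs VP VqH linear_map_id(2) det_map_linear]

text \<open>By \<open>alpha_factor\<close>, \<rho>\<alpha> is \<rho>\<beta> followed by multiplying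
  the \<gamma>-coaction of \<open>p\<close> with the lift of \<open>b\<close>, for p \<otimes> b. On
  the sphere \<open>b\<close> is 1 and only the \<gamma>-part remains.\<close>

lemma alpha_coaction_sphere:
  assumes s: "s \<in> carrier qP" "\<rho>\<beta> s = tens qP qK s \<one>\<^bsub>qK\<^esub>"
  shows "\<rho>\<alpha> s = tensor_map qP qH id (det_map q n) (\<rho>\<gamma> s)"
proof -
  let ?D = "tensor_map qP qH id (det_map q n)"
  note A = SU_algebra_alg[of q "Suc n"] and H = CqU_alg[of q n] and K = CqSU_alg[of q n]
  note T = tensor_alg[OF A H]
  note F = alg_hom_comp[OF coaction_via_hom[OF CU1_alg gamma_hom] det_tensor_hom]
  note G = alg_hom_comp[OF sec_hom(1)[OF q n] tens_right_hom[OF A H]]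
  have dc: "det_map q n f \<in> carrier qH" for f using linear_map_closed[OF det_map_linear] by simp
  \<comment> \<open>The image of \<open>det_map\<close> is central, so the two factors commute,
    \<open>?O\<close> is an algebra map, and the comparison needs generators only.\<close>
  have comm: "?D w \<otimes>\<^bsub>tensor qP qH\<^esub> tens qP qH \<one>\<^bsub>qP\<^esub> h = tens qP qH \<one>\<^bsub>qP\<^esub> h \<otimes>\<^bsub>tensor qP qH\<^esub> ?D w"
    if w: "w \<in> carrier (tensor qP CU1)" and h: "h \<in> carrier qH" for w h
  proof -
    have c: "tens qP qH \<one>\<^bsub>qP\<^esub> h \<in> carrier (tensor qP qH)" using h by (intro tens_closed[OF VP VqH]) auto
    show ?thesis
      by (rule tensor_linear_eq[OF VP CU1_vs complex_alg_vs[OF T]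
            linear_map_comp[OF alg_hom_linear[OF det_tensor_hom] alg_mult_left_linear[OF T c]]
            linear_map_comp[OF alg_hom_linear[OF det_tensor_hom] alg_mult_right_linear[OF T c]] _ w])
        (use h in \<open>simp add: det_tensor_tens tens_mult[OF A H] dc det_map_central[OF q n]\<close>)
  qed
  let ?h = "\<lambda>p b. ?D (\<rho>\<gamma> p) \<otimes>\<^bsub>tensor qP qH\<^esub> tens qP qH \<one>\<^bsub>qP\<^esub> (sec_map q n b)"
  let ?O = "tensor_lift (tensor qP qH) ?h"
  have cm: "?D (\<rho>\<gamma> p) \<otimes>\<^bsub>tensor qP qH\<^esub> tens qP qH \<one>\<^bsub>qP\<^esub> (sec_map q n b) =
      tens qP qH \<one>\<^bsub>qP\<^esub> (sec_map q n b) \<otimes>\<^bsub>tensor qP qH\<^esub> ?D (\<rho>\<gamma> p)"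
    if "p \<in> carrier qP" "b \<in> carrier qK" for p b
    by (rule comm[OF alg_hom_closed[OF coaction_via_hom[OF CU1_alg gamma_hom] that(1)] alg_hom_closed[OF sec_hom(1)[OF q n] that(2)]])
  have bil: "bilinear qP qK (tensor qP qH) ?h" and hom: "alg_hom (tensor qP qK) (tensor qP qH) ?O"
    by (rule tensor_lift_hom[OF A K T F G cm], assumption+)+
  note Ot = tensor_lift_tens[OF VP VqK complex_alg_vs[OF T] bil]
  have eq: "\<rho>\<alpha> x = ?O (\<rho>\<beta> x)" if "x \<in> carrier qP" for x
  proof (rule SU_hom_eq[OF T coaction_via_hom[OF H alpha_hom(1)[OF q n]] alg_hom_comp[OF coaction_via_hom[OF K beta_hom] hom] _ that])
    fix i j assume ij: "i \<in> {1..Suc n}" "j \<in> {1..Suc n}"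
    have "?O (\<rho>\<beta> (uP i j)) = (\<Oplus>\<^bsub>tensor qP qH\<^esub>k\<in>{1..Suc n}. ?O (tens qP qK (uP i k) (beta q (Suc n) (uP k j))))"
      unfolding coaction_via_gen[OF K beta_hom ij]
      by (rule linear_map_finsum[OF tensor_vs[OF VP VqK] complex_alg_vs[OF T] alg_hom_linear[OF hom]])
        (use ij in \<open>auto intro!: tens_closed[OF VP VqK] alg_hom_closed[OF beta_hom]\<close>)
    also have "\<dots> = (\<Oplus>\<^bsub>tensor qP qH\<^esub>k\<in>{1..Suc n}. tens qP qH (uP i k) (alpha q (Suc n) (uP k j)))"
    proof (rule vs_finsum_cong[OF complex_alg_vs[OF T]])
      fix k assume k: "k \<in> {1..Suc n}"
      show "tens qP qH (uP i k) (alpha q (Suc n) (uP k j)) \<in> carrier (tensor qP qH)"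
        using ij k by (intro tens_closed[OF VP VqH] alg_hom_closed[OF alpha_hom(1)[OF q n]]) auto
      have "?O (tens qP qK (uP i k) (beta q (Suc n) (uP k j))) =
          tens qP qH (uP i k) (det_map q n (gamma q (Suc n) (uP k k)) \<otimes>\<^bsub>qH\<^esub> sec_map q n (beta q (Suc n) (uP k j)))"
        using ij k alg_hom_closed[OF beta_hom u_SU_closed[OF k ij(2)]]
          alg_hom_closed[OF sec_hom(1)[OF q n] alg_hom_closed[OF beta_hom u_SU_closed[OF k ij(2)]]]
        by (simp add: Ot gamma_coaction_gen det_tensor_tens tens_mult[OF A H] dc)
      thus "?O (tens qP qK (uP i k) (beta q (Suc n) (uP k j))) = tens qP qH (uP i k) (alpha q (Suc n) (uP k j))"
        unfolding alpha_factor[OF k ij(2)] .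
    qed
    also have "\<dots> = \<rho>\<alpha> (uP i j)" unfolding coaction_via_gen[OF H alpha_hom(1)[OF q n] ij] ..
    finally show "\<rho>\<alpha> (uP i j) = ?O (\<rho>\<beta> (uP i j))" by simp
  qed
  have "\<rho>\<alpha> s = ?h s \<one>\<^bsub>qK\<^esub>" using eq[OF s(1)] s by (simp add: Ot)
  thus ?thesis
    using alg_hom_one[OF sec_hom(1)[OF q n]] alg_hom_closed[OF F s(1)] T
    by (simp add: tens_one[OF A H, symmetric])
qed

text \<open>Splitting the last leg of \<rho>\<alpha> by the coproduct and applying
  \<open>pi_map\<close> and \<open>torus_map\<close> recovers \<rho>\<beta> after \<rho>\<gamma>. On
  the sphere that leg consists of powers of the determinant, which split into 1 \<otimes> t^k;
  comparing coefficients shows each component to be \<beta>-coinvariant.\<close>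

lemma sphere_components:
  assumes s: "s \<in> carrier qP" "\<rho>\<beta> s = tens qP qK s \<one>\<^bsub>qK\<^esub>"
  shows "\<rho>\<beta> (coord qP k (\<rho>\<gamma> s)) = tens qP qK (coord qP k (\<rho>\<gamma> s)) \<one>\<^bsub>qK\<^esub>"
proof -
  note A = SU_algebra_alg[of q "Suc n"] and H = CqU_alg[of q n] and K = CqSU_alg[of q n]
  note PK = tensor_alg[OF A K]
  note T = tensor_alg[OF PK CU1_alg] and HH = tensor_alg[OF H H]
  let ?PK = "tensor qP qK" let ?T = "tensor ?PK CU1"
  let ?j = "\<lambda>a. tens qP qK \<one>\<^bsub>qP\<^esub> (pi_map q n a)"
  let ?z = "tensor_map ?PK CU1 ?j (torus_map q n)"
  let ?\<xi> = "\<lambda>h. ?z (comult qH h)"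
  note pi = pi_hom[OF q n] and tor = torus_hom[OF q n] and \<Delta> = comult_U_hom[OF q n]
  note j = alg_hom_comp[OF pi(1) tens_right_hom[OF A K]]
  note z0 = tensor_map_hom[OF H H PK CU1_alg j tor(1)]
  note zt = tensor_map_tens[OF VqH VqH complex_alg_vs[OF PK] CU1_vs alg_hom_linear[OF j] alg_hom_linear[OF tor(1)]]
  note \<xi> = alg_hom_comp[OF \<Delta>(1) z0]
  let ?l = "\<lambda>p. tens ?PK CU1 (tens qP qK p \<one>\<^bsub>qK\<^esub>) \<one>\<^bsub>CU1\<^esub>"
  note l = alg_hom_comp[OF tens_left_hom[OF A K] tens_left_hom[OF PK CU1_alg]]
  note pc = alg_hom_closed[OF pi(1)]
  have tc: "tens qP qK p b \<in> carrier ?PK" if "p \<in> carrier qP" "b \<in> carrier qK" for p b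
    by (rule tens_closed[OF VP VqK that])
  have comm0: "?l p \<otimes>\<^bsub>?T\<^esub> ?z w = ?z w \<otimes>\<^bsub>?T\<^esub> ?l p" if p: "p \<in> carrier qP" and w: "w \<in> carrier (tensor qH qH)" for p w
    by (rule tensor_linear_eq[OF VqH VqH complex_alg_vs[OF T]
          linear_map_comp[OF alg_hom_linear[OF z0] alg_mult_right_linear[OF T alg_hom_closed[OF l p]]]
          linear_map_comp[OF alg_hom_linear[OF z0] alg_mult_left_linear[OF T alg_hom_closed[OF l p]]] _ w])
      (use p in \<open>simp add: zt tens_mult[OF PK CU1_alg] tens_mult[OF A K] tc pc\<close>)
  have comm: "?l p \<otimes>\<^bsub>?T\<^esub> ?\<xi> h = ?\<xi> h \<otimes>\<^bsub>?T\<^esub> ?l p" if "p \<in> carrier qP" "h \<in> carrier qH" for p h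
    by (rule comm0[OF that(1) alg_hom_closed[OF \<Delta>(1) that(2)]])
  \<comment> \<open>Splits the last leg of \<rho>\<alpha> into a leg in \<open>CqSU q n\<close> and
    a circle leg. It is multiplicative since \<open>?l\<close> and \<open>?\<xi>\<close> take values
    in different legs.\<close>
  let ?X = "tensor_lift ?T (\<lambda>p h. ?l p \<otimes>\<^bsub>?T\<^esub> ?\<xi> h)"
  have bil: "bilinear qP qH ?T (\<lambda>p h. ?l p \<otimes>\<^bsub>?T\<^esub> ?\<xi> h)" and hom: "alg_hom (tensor qP qH) ?T ?X"
    by (rule tensor_lift_hom[OF A H T l \<xi> comm], assumption+)+
  note Xt = tensor_lift_tens[OF VP VqH complex_alg_vs[OF T] bil]
  let ?Y = "tensor_map ?PK CU1 \<rho>\<beta> id"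
  note rb = coaction_via_hom[OF K beta_hom] and rg = coaction_via_hom[OF CU1_alg gamma_hom]
  note Y = tensor_map_hom[OF A CU1_alg PK CU1_alg rb alg_hom_id(2)]
  note Yt = tensor_map_tens[OF VP CU1_vs complex_alg_vs[OF PK] CU1_vs alg_hom_linear[OF rb] linear_map_id(2)]
  have \<xi>u: "?\<xi> (u_U q n a b) = tens ?PK CU1 (tens qP qK \<one>\<^bsub>qP\<^esub> (u_SU q n a b)) (torus_map q n (u_U q n b b))"
    if ab: "a \<in> {1..n}" "b \<in> {1..n}" for a b
  proof -
    have "?\<xi> (u_U q n a b) = (\<Oplus>\<^bsub>?T\<^esub>m\<in>{1..n}. ?z (tens qH qH (u_U q n a m) (u_U q n m b)))"
      unfolding \<Delta>(2)[OF ab]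
      by (rule linear_map_finsum[OF complex_alg_vs[OF HH] complex_alg_vs[OF T] alg_hom_linear[OF z0]])
        (use ab in \<open>auto intro!: tens_closed[OF VqH VqH]\<close>)
    also have "\<dots> = ?z (tens qH qH (u_U q n a b) (u_U q n b b))"
    proof (rule vs_finsum_single[OF complex_alg_vs[OF T]])
      fix m assume m: "m \<in> {1..n}" "m \<noteq> b"
      have "torus_map q n (u_U q n m b) = \<zero>\<^bsub>CU1\<^esub>" using tor(2)[OF m(1) ab(2)] m by simp
      hence "?z (tens qH qH (u_U q n a m) (u_U q n m b)) = tens ?PK CU1 (?j (u_U q n a m)) \<zero>\<^bsub>CU1\<^esub>"
        using m ab by (subst zt) auto
      also have "\<dots> = \<zero>\<^bsub>?T\<^esub>"
        using m ab by (intro tens_zero_right[OF complex_alg_vs[OF PK] CU1_vs] tc pc) auto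
      finally show "?z (tens qH qH (u_U q n a m) (u_U q n m b)) = \<zero>\<^bsub>?T\<^esub>" .
    qed (use ab in \<open>auto intro!: alg_hom_closed[OF z0] tens_closed[OF VqH VqH]\<close>)
    finally show ?thesis using ab by (simp add: zt pi(2))
  qed
  have \<xi>alpha: "?\<xi> (alpha q (Suc n) (uP k j)) =
      tens ?PK CU1 (tens qP qK \<one>\<^bsub>qP\<^esub> (beta q (Suc n) (uP k j))) (gamma q (Suc n) (uP j j))"
    if kj: "k \<in> {1..Suc n}" "j \<in> {1..Suc n}" for k j
  proof -
    have z: "?\<xi> \<zero>\<^bsub>qH\<^esub> = \<zero>\<^bsub>?T\<^esub>" by (rule linear_map_zero[OF VqH complex_alg_vs[OF T] alg_hom_linear[OF \<xi>]])
    have z': "tens ?PK CU1 (tens qP qK \<one>\<^bsub>qP\<^esub> \<zero>\<^bsub>qK\<^esub>) f = \<zero>\<^bsub>?T\<^esub>" for f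
      using tens_zero_right[OF VP VqK, of "\<one>\<^bsub>qP\<^esub>"]
        linear_map_zero[OF complex_alg_vs[OF PK] complex_alg_vs[OF T] tens_linear_left[OF complex_alg_vs[OF PK] CU1_vs, of f]] by simp
    consider "k = 1" "j = 1" | "k = 1" "j \<noteq> 1" | "k \<noteq> 1" "j = 1" | "k \<noteq> 1" "j \<noteq> 1" by blast
    thus ?thesis
    proof cases
      case 1
      thus ?thesis by (simp add: alpha_hom(2)[OF q n] beta_gen gamma_gen \<Delta>(3) zt pi(3) tor(3))
    next
      case 4
      have idx: "k - 1 \<in> {1..n}" "j - 1 \<in> {1..n}" using kj 4 by auto
      have g: "gamma q (Suc n) (uP j j) = torus_map q n (u_U q n (j - 1) (j - 1))"
        using 4 kj by (simp add: gamma_conv[OF q n] alpha_hom(2)[OF q n])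
      show ?thesis
        using 4 \<xi>u[OF idx] unfolding g alpha_hom(2)[OF q n kj] beta_gen[OF kj] by simp
    qed (use kj in \<open>simp_all add: alpha_hom(2)[OF q n] beta_gen z z'\<close>)
  qed
  \<comment> \<open>Coassociativity in disguise: in Sweedler notation both sides are x0 \<otimes>
    \<beta>(x1) \<otimes> \<gamma>(x2). Both are homomorphisms, so generators suffice.\<close>
  have eq: "?X (\<rho>\<alpha> x) = ?Y (\<rho>\<gamma> x)" if "x \<in> carrier qP" for x
  proof (rule SU_hom_eq[OF T alg_hom_comp[OF coaction_via_hom[OF H alpha_hom(1)[OF q n]] hom] alg_hom_comp[OF rg Y] _ that])
    fix i j assume ij: "i \<in> {1..Suc n}" "j \<in> {1..Suc n}"
    let ?g = "gamma q (Suc n) (uP j j)"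
    have "?X (\<rho>\<alpha> (uP i j)) = (\<Oplus>\<^bsub>?T\<^esub>k\<in>{1..Suc n}. ?X (tens qP qH (uP i k) (alpha q (Suc n) (uP k j))))"
      unfolding coaction_via_gen[OF H alpha_hom(1)[OF q n] ij]
      by (rule linear_map_finsum[OF tensor_vs[OF VP VqH] complex_alg_vs[OF T] alg_hom_linear[OF hom]])
        (use ij in \<open>auto intro!: tens_closed[OF VP VqH] alg_hom_closed[OF alpha_hom(1)[OF q n]]\<close>)
    also have "\<dots> = (\<Oplus>\<^bsub>?T\<^esub>k\<in>{1..Suc n}. tens ?PK CU1 (tens qP qK (uP i k) (beta q (Suc n) (uP k j))) ?g)"
    proof (rule vs_finsum_cong[OF complex_alg_vs[OF T]])
      fix k assume k: "k \<in> {1..Suc n}"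
      have b: "beta q (Suc n) (uP k j) \<in> carrier qK" using k ij by (intro alg_hom_closed[OF beta_hom]) auto
      have u: "uP i k \<in> carrier qP" using k ij by auto
      have a: "alpha q (Suc n) (uP k j) \<in> carrier qH" using k ij by (intro alg_hom_closed[OF alpha_hom(1)[OF q n]]) auto
      show "tens ?PK CU1 (tens qP qK (uP i k) (beta q (Suc n) (uP k j))) ?g \<in> carrier ?T"
        by (rule tens_closed[OF complex_alg_vs[OF PK] CU1_vs tc[OF u b]]) simp
      show "?X (tens qP qH (uP i k) (alpha q (Suc n) (uP k j))) = tens ?PK CU1 (tens qP qK (uP i k) (beta q (Suc n) (uP k j))) ?g"
        unfolding Xt[OF u a] \<xi>alpha[OF k ij(2)]
        using u b by (simp add: tens_mult[OF PK CU1_alg] tens_mult[OF A K] tc)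
    qed
    also have "\<dots> = tens ?PK CU1 (\<rho>\<beta> (uP i j)) ?g"
      unfolding coaction_via_gen[OF K beta_hom ij]
      by (rule sym, rule linear_map_finsum[OF complex_alg_vs[OF PK] complex_alg_vs[OF T] tens_linear_left[OF complex_alg_vs[OF PK] CU1_vs]])
        (use ij in \<open>auto intro!: tc alg_hom_closed[OF beta_hom]\<close>)
    also have "\<dots> = ?Y (\<rho>\<gamma> (uP i j))"
      using ij by (simp add: gamma_coaction_gen Yt)
    finally show "?X (\<rho>\<alpha> (uP i j)) = ?Y (\<rho>\<gamma> (uP i j))" .
  qed
  \<comment> \<open>Powers of the determinant are grouplike, trivial under \<open>pi_map\<close> and
    sent to powers of \<open>t\<close> by \<open>torus_map\<close>.\<close>
  have \<xi>det: "?\<xi> (det_map q n f) = tens ?PK CU1 (tens qP qK \<one>\<^bsub>qP\<^esub> \<one>\<^bsub>qK\<^esub>) f" for f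
  proof (rule free_space_linear_eq[OF CU1_free complex_alg_vs[OF T] linear_map_comp[OF det_map_linear alg_hom_linear[OF \<xi>]]])
    show "linear_map CU1 ?T (\<lambda>f. tens ?PK CU1 (tens qP qK \<one>\<^bsub>qP\<^esub> \<one>\<^bsub>qK\<^esub>) f)"
      by (rule tens_linear_right[OF complex_alg_vs[OF PK] CU1_vs]) (use A K tc in auto)
    fix k show "?\<xi> (det_map q n (Poly_Mapping.single k 1)) = tens ?PK CU1 (tens qP qK \<one>\<^bsub>qP\<^esub> \<one>\<^bsub>qK\<^esub>) (Poly_Mapping.single k 1)"
      unfolding tpow_def[symmetric]
      by (simp add: det_map_tpow comult_det_pow[OF q n] zt pi_det_pow[OF q n] torus_det_pow[OF q n])
  qed simp
  let ?L = "\<lambda>p. tens qP qK p \<one>\<^bsub>qK\<^esub>"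
  note L = alg_hom_linear[OF tens_left_hom[OF A K]]
  let ?M = "tensor_map ?PK CU1 ?L id"
  note M = tensor_map_linear[OF VP CU1_vs complex_alg_vs[OF PK] CU1_vs L linear_map_id(2)]
    and Mt = tensor_map_tens[OF VP CU1_vs complex_alg_vs[OF PK] CU1_vs L linear_map_id(2)]
  have XD: "?X (tensor_map qP qH id (det_map q n) w) = ?M w" if w: "w \<in> carrier (tensor qP CU1)" for w
  proof (rule tensor_linear_eq[OF VP CU1_vs complex_alg_vs[OF T] linear_map_comp[OF alg_hom_linear[OF det_tensor_hom] alg_hom_linear[OF hom]] M _ w])
    fix p f assume p: "p \<in> carrier qP" and f: "f \<in> carrier CU1"
    have d: "det_map q n f \<in> carrier qH" using linear_map_closed[OF det_map_linear] by simp
    show "?X (tensor_map qP qH id (det_map q n) (tens qP CU1 p f)) = ?M (tens qP CU1 p f)"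
      unfolding det_tensor_tens[OF p f] Mt[OF p f] id_apply Xt[OF p d] \<xi>det
      using p K A by (simp add: tens_mult[OF PK CU1_alg] tens_mult[OF A K] tc)
  qed
  have w: "\<rho>\<gamma> s \<in> carrier (tensor qP CU1)" by (rule alg_hom_closed[OF rg s(1)])
  have "?Y (\<rho>\<gamma> s) = ?M (\<rho>\<gamma> s)"
    using eq[OF s(1)] XD[OF w] by (simp add: alpha_coaction_sphere[OF s])
  hence "coord ?PK k (?Y (\<rho>\<gamma> s)) = coord ?PK k (?M (\<rho>\<gamma> s))" by simp
  thus ?thesis
    unfolding coord_natural[OF VP complex_alg_vs[OF PK] alg_hom_linear[OF rb] w]
      coord_natural[OF VP complex_alg_vs[OF PK] L w] .
qed

text \<open>On a vector \<open>x\<close> of weight \<open>k\<close> the new coaction is x \<otimes>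
  det^k, and the axioms say that det^k is grouplike with counit 1.\<close>

lemma det_comodule:
  fixes V :: "(complex, 'v) module"
  assumes com: "right_comodule CU1 V \<rho>V"
  shows "right_comodule qH V (\<lambda>v. tensor_map V qH id (det_map q n) (\<rho>V v))"
proof -
  note V = comodule_vs[OF com] and \<rho> = comodule_linear[OF com]
  let ?\<rho>W = "\<lambda>v. tensor_map V qH id (det_map q n) (\<rho>V v)"
  note D = tensor_map_linear[OF V CU1_vs V VqH linear_map_id(2) det_map_linear]
    and Dt = tensor_map_tens[OF V CU1_vs V VqH linear_map_id(2) det_map_linear]
  note W = linear_map_comp[OF \<rho> D]
  note VH = tensor_vs[OF V VqH] and HH = tensor_vs[OF VqH VqH]
  have Wh: "?\<rho>W x = tens V qH x (det_pow q n k)" if "x \<in> carrier V" "\<rho>V x = tens V CU1 x (tpow k)" for x k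
    using that by (simp add: Dt det_map_tpow)
  note comult = alg_hom_linear[OF comult_U_hom(1)[OF q n]] and counit = alg_hom_linear[OF counit_U_hom(1)[OF q n]]
  note m1 = tensor_map_linear[OF V VqH VH VqH W linear_map_id(2)] and m1t = tensor_map_tens[OF V VqH VH VqH W linear_map_id(2)]
  note m2 = tensor_map_linear[OF V VqH V HH linear_map_id(2) comult] and m2t = tensor_map_tens[OF V VqH V HH linear_map_id(2) comult]
  note e = tensor_lift_linear[OF V VqH V counit_action_bilinear[OF V counit]]
    and et = tensor_lift_tens[OF V VqH V counit_action_bilinear[OF V counit]]
  show ?thesis
    unfolding right_comodule_def
  proof (intro conjI ballI V W)
    fix v assume v: "v \<in> carrier V"
    show "tensor_assoc V qH qH (tensor_map (tensor V qH) qH ?\<rho>W id (?\<rho>W v)) = tensor_map V (tensor qH qH) id (comult qH) (?\<rho>W v)"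
    proof (rule comodule_linear_eq[OF com tensor_vs[OF V HH] linear_map_comp[OF linear_map_comp[OF W m1] tensor_assoc_linear[OF V VqH VqH]]
          linear_map_comp[OF W m2] _ v])
      fix k x assume x: "x \<in> carrier V" "\<rho>V x = tens V CU1 x (tpow k)"
      show "tensor_assoc V qH qH (tensor_map (tensor V qH) qH ?\<rho>W id (?\<rho>W x)) = tensor_map V (tensor qH qH) id (comult qH) (?\<rho>W x)"
        unfolding Wh[OF x] m1t[OF x(1) det_pow_closed] m2t[OF x(1) det_pow_closed] comult_det_pow[OF q n]
        by (simp only: Wh[OF x] id_apply tensor_assoc_tens[OF V VqH VqH x(1) det_pow_closed det_pow_closed])
    qed
    show "tensor_lift V (\<lambda>w h. counit qH h \<odot>\<^bsub>V\<^esub> w) (?\<rho>W v) = v"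
    proof (rule comodule_linear_eq[OF com V linear_map_comp[OF W e] linear_map_id(1) _ v])
      fix k x assume x: "x \<in> carrier V" "\<rho>V x = tens V CU1 x (tpow k)"
      show "tensor_lift V (\<lambda>w h. counit qH h \<odot>\<^bsub>V\<^esub> w) (?\<rho>W x) = x"
        unfolding Wh[OF x] et[OF x(1) det_pow_closed] using x V by (simp add: counit_det_pow[OF q n])
    qed
  qed
qed

end

section \<open>Reduction of the structure group to the circle\<close>

text \<open>
  The quotient quantum group \<open>H\<close> acts on \<open>P\<close> through \<open>\<rho>H\<close>; its quotient \<open>K\<close> has the coinvariants
  \<open>S\<close>. The residual circle sits in \<open>H\<close> by \<open>\<delta>\<close>, which the map \<open>\<tau>\<close> splits.
\<close>

locale circle_reduction =
  fixes P :: "(complex, 'p) module" and H :: "'h bialgebra" and K :: "'k bialgebra"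
    and \<rho>H :: "'p \<Rightarrow> ('p, 'h) tensor" and \<rho>K :: "'p \<Rightarrow> ('p, 'k) tensor" and \<rho>L :: "'p \<Rightarrow> ('p, laurent) tensor"
    and \<delta> :: "laurent \<Rightarrow> 'h" and \<pi> :: "'h \<Rightarrow> 'k" and \<tau> :: "'h \<Rightarrow> laurent"
  assumes P_alg: "complex_alg P" and H_alg: "complex_alg H" and K_alg: "complex_alg K"
    and \<rho>H: "linear_map P (tensor P H) \<rho>H" and \<rho>K: "alg_hom P (tensor P K) \<rho>K"
    and \<rho>L: "linear_map P (tensor P CU1) \<rho>L"
    and \<delta>: "alg_hom CU1 H \<delta>" and \<pi>: "alg_hom H K \<pi>" and \<tau>: "alg_hom H CU1 \<tau>"
    and \<tau>_\<delta>: "\<tau> (\<delta> f) = f" and \<pi>_\<delta>: "\<pi> (\<delta> (tpow k)) = \<one>\<^bsub>K\<^esub>"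
    and \<rho>K_conv: "x \<in> carrier P \<Longrightarrow> \<rho>K x = tensor_map P K id \<pi> (\<rho>H x)"
    and \<rho>H_conv: "x \<in> carrier P \<Longrightarrow> \<rho>K x = tens P K x \<one>\<^bsub>K\<^esub> \<Longrightarrow> \<rho>H x = tensor_map P H id \<delta> (\<rho>L x)"
    and component: "x \<in> carrier P \<Longrightarrow> \<rho>K x = tens P K x \<one>\<^bsub>K\<^esub> \<Longrightarrow>
      \<rho>K (coord P k (\<rho>L x)) = tens P K (coord P k (\<rho>L x)) \<one>\<^bsub>K\<^esub>"
begin

definition S :: "(complex, 'p) module" where
  "S = subspace P (coinvariants K P \<rho>K)"

definition S_coaction :: "'p \<Rightarrow> ('p, laurent) tensor" where
  "S_coaction x = the_inv_into (carrier (tensor S CU1)) (tensor_map P CU1 id id) (\<rho>L x)"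

text \<open>Presents \<open>S\<close> as the kernel of a linear map, to which a generalized inverse
  can be applied.\<close>

definition defect :: "'p \<Rightarrow> ('p, 'k) tensor" where
  "defect x = \<rho>K x \<ominus>\<^bsub>tensor P K\<^esub> tens P K x \<one>\<^bsub>K\<^esub>"

lemmas P_vs = complex_alg_vs[OF P_alg] and H_vs = complex_alg_vs[OF H_alg] and K_vs = complex_alg_vs[OF K_alg]
lemmas PK_vs = tensor_vs[OF P_vs K_vs]

lemma S_carrier: "x \<in> carrier S \<longleftrightarrow> x \<in> carrier P \<and> \<rho>K x = tens P K x \<one>\<^bsub>K\<^esub>"
  and S_simps: "x \<oplus>\<^bsub>S\<^esub> y = x \<oplus>\<^bsub>P\<^esub> y" "c \<odot>\<^bsub>S\<^esub> x = c \<odot>\<^bsub>P\<^esub> x" "x \<otimes>\<^bsub>S\<^esub> y = x \<otimes>\<^bsub>P\<^esub> y" "\<zero>\<^bsub>S\<^esub> = \<zero>\<^bsub>P\<^esub>"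
  by (auto simp: S_def subspace_def coinvariants_def module.defs)

lemma unit_linear: "linear_map P (tensor P K) (\<lambda>x. tens P K x \<one>\<^bsub>K\<^esub>)"
  by (rule tens_linear_left[OF P_vs K_vs]) (use K_alg in auto)

lemma defect_linear: "linear_map P (tensor P K) defect"
  unfolding defect_def by (rule linear_map_minus_maps[OF PK_vs alg_hom_linear[OF \<rho>K] unit_linear])

lemma S_defect: "x \<in> carrier S \<longleftrightarrow> x \<in> carrier P \<and> defect x = \<zero>\<^bsub>tensor P K\<^esub>"
  unfolding S_carrier defect_def
  using vs_minus_eq_zero_iff[OF PK_vs alg_hom_closed[OF \<rho>K] linear_map_closed[OF unit_linear]] by auto

lemma S_submodule: "submodule (carrier S) complex_algebra P"
proof -
  have "carrier S = {x \<in> carrier P. defect x = \<zero>\<^bsub>tensor P K\<^esub>}" by (auto simp: S_defect)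
  thus ?thesis using kernel_submodule[OF P_vs PK_vs defect_linear] by simp
qed

lemma S_vs: "complex_vector_space S"
  by (rule vs_cong[OF submodule.submodule_is_module[OF S_submodule P_vs]])
    (auto simp: S_def subspace_def module.defs)

lemma S_incl: "linear_map S P id"
  by (rule linear_mapI) (auto simp: S_carrier S_simps)

lemma S_retraction:
  obtains r where "linear_map P S r" "\<And>x. x \<in> carrier S \<Longrightarrow> r x = x"
proof -
  obtain r where r: "linear_map P P r" "\<And>x. x \<in> carrier P \<Longrightarrow> r x \<in> carrier S" "\<And>x. x \<in> carrier S \<Longrightarrow> r x = x"
    using submodule_retraction[OF P_vs S_submodule] by blast
  have "linear_map P S r"
    by (rule linear_mapI) (auto simp: r(2) S_simps linear_map_add[OF r(1)] linear_map_smult[OF r(1)])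
  thus thesis using r(3) by (rule that)
qed

lemma S_mult_closed:
  assumes "x \<in> carrier S" "y \<in> carrier S" shows "x \<otimes>\<^bsub>P\<^esub> y \<in> carrier S"
  using assms P_alg K_alg by (simp add: S_carrier alg_hom_mult[OF \<rho>K] tens_mult[OF P_alg K_alg])

text \<open>Applying \<pi> to the second leg turns coinvariance under \<open>H\<close> into
  coinvariance under \<open>K\<close>; hence the base acts on \<open>S\<close> by multiplication
  inside \<open>S\<close>.\<close>

lemma base_subset:
  assumes "m \<in> coinvariants H P \<rho>H" shows "m \<in> carrier S"
proof -
  have m: "m \<in> carrier P" "\<rho>H m = tens P H m \<one>\<^bsub>H\<^esub>" using assms by (auto simp: coinvariants_def)
  show ?thesis
    using m H_alg by (simp add: S_carrier \<rho>K_conv alg_hom_one[OF \<pi>]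
        tensor_map_tens[OF P_vs H_vs P_vs K_vs linear_map_id(2) alg_hom_linear[OF \<pi>]])
qed

lemmas incl_map_linear = tensor_map_linear[OF S_vs CU1_vs P_vs CU1_vs S_incl linear_map_id(2)]
lemmas incl_map_tens = tensor_map_tens[OF S_vs CU1_vs P_vs CU1_vs S_incl linear_map_id(2)]

text \<open>Coordinates are natural and determine a tensor, so the inclusion stays injective after
  tensoring with \<open>CU1\<close>. This gives \<open>the_inv_into\<close> its meaning.\<close>

lemma incl_map_inj: "inj_on (tensor_map P CU1 id id) (carrier (tensor S CU1))"
proof (rule inj_onI)
  fix x y assume xy: "x \<in> carrier (tensor S CU1)" "y \<in> carrier (tensor S CU1)"
    "tensor_map P CU1 id id x = tensor_map P CU1 id id y"
  show "x = y"
  proof (rule coord_eqI[OF S_vs xy(1,2)])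
    show "coord S k x = coord S k y" for k
      using coord_natural[OF S_vs P_vs S_incl xy(1), of k] coord_natural[OF S_vs P_vs S_incl xy(2), of k] xy(3) by simp
  qed
qed

text \<open>All components of \<rho>L x lie in \<open>S\<close>, so the expansion in powers of
  \<open>t\<close> can be written over \<open>S\<close> instead of \<open>P\<close>.\<close>

lemma S_coaction_spec:
  assumes x: "x \<in> carrier S"
  shows "S_coaction x \<in> carrier (tensor S CU1)" and "tensor_map P CU1 id id (S_coaction x) = \<rho>L x"
proof -
  have xP: "x \<in> carrier P" "\<rho>K x = tens P K x \<one>\<^bsub>K\<^esub>" using x by (auto simp: S_carrier)
  have w: "\<rho>L x \<in> carrier (tensor P CU1)" by (rule linear_map_closed[OF \<rho>L xP(1)])
  obtain J where J: "finite J" "\<rho>L x = (\<Oplus>\<^bsub>tensor P CU1\<^esub>k\<in>J. tens P CU1 (coord P k (\<rho>L x)) (tpow k))"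
    by (rule laurent_expandE[OF P_vs w]) blast
  let ?y = "\<Oplus>\<^bsub>tensor S CU1\<^esub>k\<in>J. tens S CU1 (coord P k (\<rho>L x)) (tpow k)"
  have c: "coord P k (\<rho>L x) \<in> carrier S" for k
    using component[OF xP] linear_map_closed[OF coord_linear[OF P_vs] w] by (simp add: S_carrier)
  have t: "tens S CU1 (coord P k (\<rho>L x)) (tpow k) \<in> carrier (tensor S CU1)" for k
    by (rule tens_closed[OF S_vs CU1_vs c]) simp
  have y: "?y \<in> carrier (tensor S CU1)" by (rule vs_finsum_closed[OF tensor_vs[OF S_vs CU1_vs] t])
  have "tensor_map P CU1 id id ?y = (\<Oplus>\<^bsub>tensor P CU1\<^esub>k\<in>J. tens P CU1 (coord P k (\<rho>L x)) (tpow k))"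
    using linear_map_finsum[OF tensor_vs[OF S_vs CU1_vs] tensor_vs[OF P_vs CU1_vs] incl_map_linear J(1) t]
    by (simp add: incl_map_tens c)
  also have "\<dots> = \<rho>L x" by (rule J(2)[symmetric])
  finally have eq: "tensor_map P CU1 id id ?y = \<rho>L x" .
  have im: "\<rho>L x \<in> tensor_map P CU1 id id ` carrier (tensor S CU1)" 
    using imageI[OF y, of "tensor_map P CU1 id id"] by (simp only: eq)
  show "S_coaction x \<in> carrier (tensor S CU1)"
    unfolding S_coaction_def by (rule the_inv_into_into[OF incl_map_inj im subset_refl])
  show "tensor_map P CU1 id id (S_coaction x) = \<rho>L x"
    unfolding S_coaction_def by (rule f_the_inv_into_f[OF incl_map_inj im])
qed

lemma S_coaction_linear: "linear_map S (tensor S CU1) S_coaction"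
proof (rule linear_mapI)
  note T = tensor_vs[OF S_vs CU1_vs] and inj = inj_onD[OF incl_map_inj]
  fix x c assume x: "x \<in> carrier S"
  show "S_coaction x \<in> carrier (tensor S CU1)" by (rule S_coaction_spec[OF x])
  have xP: "x \<in> carrier P" using x by (simp add: S_carrier)
  have cx: "c \<odot>\<^bsub>S\<^esub> x \<in> carrier S" by (rule vs_smult_closed[OF S_vs x])
  show "S_coaction (c \<odot>\<^bsub>S\<^esub> x) = c \<odot>\<^bsub>tensor S CU1\<^esub> S_coaction x"
  proof (rule inj[OF _ S_coaction_spec(1)[OF cx] vs_smult_closed[OF T S_coaction_spec(1)[OF x]]])
    show "tensor_map P CU1 id id (S_coaction (c \<odot>\<^bsub>S\<^esub> x)) = tensor_map P CU1 id id (c \<odot>\<^bsub>tensor S CU1\<^esub> S_coaction x)"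
      unfolding S_coaction_spec(2)[OF cx, unfolded S_simps] linear_map_smult[OF incl_map_linear S_coaction_spec(1)[OF x]]
        S_coaction_spec(2)[OF x] S_simps by (rule linear_map_smult[OF \<rho>L xP])
  qed
  fix y assume y: "y \<in> carrier S"
  have yP: "y \<in> carrier P" using y by (simp add: S_carrier)
  have xy: "x \<oplus>\<^bsub>S\<^esub> y \<in> carrier S" by (rule vs_add_closed[OF S_vs x y])
  note sx = S_coaction_spec[OF x] and sy = S_coaction_spec[OF y]
  show "S_coaction (x \<oplus>\<^bsub>S\<^esub> y) = S_coaction x \<oplus>\<^bsub>tensor S CU1\<^esub> S_coaction y"
  proof (rule inj[OF _ S_coaction_spec(1)[OF xy] vs_add_closed[OF T sx(1) sy(1)]])
    show "tensor_map P CU1 id id (S_coaction (x \<oplus>\<^bsub>S\<^esub> y)) = tensor_map P CU1 id id (S_coaction x \<oplus>\<^bsub>tensor S CU1\<^esub> S_coaction y)"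
      unfolding S_coaction_spec(2)[OF xy, unfolded S_simps] linear_map_add[OF incl_map_linear sx(1) sy(1)]
        sx(2) sy(2) S_simps by (rule linear_map_add[OF \<rho>L xP yP])
  qed
qed

lemma S_coaction_\<rho>H:
  assumes x: "x \<in> carrier S" shows "tensor_map P H id \<delta> (S_coaction x) = \<rho>H x"
proof -
  note d = alg_hom_linear[OF \<delta>]
  have "tensor_map P H id \<delta> z = tensor_map P H id \<delta> (tensor_map P CU1 id id z)" if z: "z \<in> carrier (tensor S CU1)" for z
  proof (rule tensor_linear_eq[OF S_vs CU1_vs tensor_vs[OF P_vs H_vs] tensor_map_linear[OF S_vs CU1_vs P_vs H_vs S_incl d]
        linear_map_comp[OF incl_map_linear tensor_map_linear[OF P_vs CU1_vs P_vs H_vs linear_map_id(2) d]] _ z])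
    fix p f assume p: "p \<in> carrier S" and f: "f \<in> carrier CU1"
    have "p \<in> carrier P" using p by (simp add: S_carrier)
    thus "tensor_map P H id \<delta> (tens S CU1 p f) = tensor_map P H id \<delta> (tensor_map P CU1 id id (tens S CU1 p f))"
      using p f by (simp add: tensor_map_tens[OF S_vs CU1_vs P_vs H_vs S_incl d] incl_map_tens
          tensor_map_tens[OF P_vs CU1_vs P_vs H_vs linear_map_id(2) d])
  qed
  from this[OF S_coaction_spec(1)[OF x]] show ?thesis
    using x \<rho>H_conv by (simp add: S_coaction_spec(2)[OF x] S_carrier)
qed

section \<open>Comparison of the two bundles for a fixed circle comodule\<close>

context
  fixes V :: "(complex, 'v) module" and \<rho>V :: "'v \<Rightarrow> ('v, laurent) tensor"
  assumes com: "right_comodule CU1 V \<rho>V"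
begin

abbreviation (input) "\<rho>W \<equiv> \<lambda>v. tensor_map V H id \<delta> (\<rho>V v)"
abbreviation (input) "incl \<equiv> tensor_map P V id id"
abbreviation (input) "co_S \<equiv> tensor_coaction CU1 S S_coaction V \<rho>V"
abbreviation (input) "co_P \<equiv> tensor_coaction H P \<rho>H V \<rho>W"

lemmas V_vs = comodule_vs[OF com] and \<rho>V = comodule_linear[OF com]
lemmas SV_vs = tensor_vs[OF S_vs V_vs] and PV_vs = tensor_vs[OF P_vs V_vs]
lemmas PVH_vs = tensor_vs[OF PV_vs H_vs] and PVK_vs = tensor_vs[OF PV_vs K_vs] and SVL_vs = tensor_vs[OF SV_vs CU1_vs]
lemmas incl_linear = tensor_map_linear[OF S_vs V_vs P_vs V_vs S_incl linear_map_id(2)]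
lemmas incl_tens = tensor_map_tens[OF S_vs V_vs P_vs V_vs S_incl linear_map_id(2)]

lemma \<rho>W: "linear_map V (tensor V H) \<rho>W"
  by (rule linear_map_comp[OF \<rho>V tensor_map_linear[OF V_vs CU1_vs V_vs H_vs linear_map_id(2) alg_hom_linear[OF \<delta>]]])

lemmas co_S_bilinear = product_coaction_bilinear[OF CU1_alg S_vs V_vs S_coaction_linear \<rho>V]
lemmas co_P_bilinear = product_coaction_bilinear[OF H_alg P_vs V_vs \<rho>H \<rho>W]

lemma co_S_linear: "linear_map (tensor S V) (tensor (tensor S V) CU1) co_S"
  unfolding tensor_coaction_conv by (rule tensor_lift_linear[OF S_vs V_vs SVL_vs co_S_bilinear])

lemma co_P_linear: "linear_map (tensor P V) (tensor (tensor P V) H) co_P"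
  unfolding tensor_coaction_conv by (rule tensor_lift_linear[OF P_vs V_vs PVH_vs co_P_bilinear])

lemmas co_S_tens = tensor_lift_tens[OF S_vs V_vs SVL_vs co_S_bilinear, folded tensor_coaction_conv]
lemmas co_P_tens = tensor_lift_tens[OF P_vs V_vs PVH_vs co_P_bilinear, folded tensor_coaction_conv]

lemmas incl_\<delta>_linear = tensor_map_linear[OF SV_vs CU1_vs PV_vs H_vs incl_linear alg_hom_linear[OF \<delta>]]
lemmas incl_\<delta>_tens = tensor_map_tens[OF SV_vs CU1_vs PV_vs H_vs incl_linear alg_hom_linear[OF \<delta>]]

text \<open>Naturality of \<open>coaction_product\<close> along the inclusion of \<open>S\<close>
  and \<delta>, because \<delta> turns the circle coaction of \<open>S\<close> into \<rho>H.\<close>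

lemma incl_co:
  assumes y: "y \<in> carrier (tensor S V)"
  shows "tensor_map (tensor P V) H incl \<delta> (co_S y) = co_P (incl y)"
proof (rule tensor_linear_eq[OF S_vs V_vs PVH_vs linear_map_comp[OF co_S_linear incl_\<delta>_linear]
      linear_map_comp[OF incl_linear co_P_linear] _ y])
  fix s v assume s: "s \<in> carrier S" and v: "v \<in> carrier V"
  have sP: "id s \<in> carrier P" and v': "id v \<in> carrier V" using s v by (simp_all add: S_carrier)
  have "tensor_map (tensor P V) H incl \<delta> (co_S (tens S V s v)) =
      coaction_product H P V (tensor_map P H id \<delta> (S_coaction s)) (\<rho>W v)"
    unfolding co_S_tens[OF s v]
    by (rule coaction_product_natural[OF CU1_alg H_alg S_vs P_vs V_vs V_vs S_incl linear_map_id(2) \<delta>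
          S_coaction_spec(1)[OF s] linear_map_closed[OF \<rho>V v]])
  also have "\<dots> = co_P (incl (tens S V s v))"
    unfolding S_coaction_\<rho>H[OF s] incl_tens[OF s v] co_P_tens[OF sP v'] by simp
  finally show "tensor_map (tensor P V) H incl \<delta> (co_S (tens S V s v)) = co_P (incl (tens S V s v))" .
qed

text \<open>Tensoring a linear retraction of \<open>P\<close> onto \<open>S\<close> with
  \<open>V\<close> splits the map induced by the inclusion.\<close>

lemma incl_left_inverse:
  obtains r where "linear_map (tensor P V) (tensor S V) r" "\<And>y. y \<in> carrier (tensor S V) \<Longrightarrow> r (incl y) = y"
proof -
  obtain r where r: "linear_map P S r" "\<And>x. x \<in> carrier S \<Longrightarrow> r x = x" by (rule S_retraction) blast
  note l = tensor_map_linear[OF P_vs V_vs S_vs V_vs r(1) linear_map_id(2)]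
    and t = tensor_map_tens[OF P_vs V_vs S_vs V_vs r(1) linear_map_id(2)]
  show thesis
  proof (rule that[OF l])
    fix y assume y: "y \<in> carrier (tensor S V)"
    show "tensor_map S V r id (incl y) = y"
    proof (rule tensor_linear_eq[OF S_vs V_vs SV_vs linear_map_comp[OF incl_linear l] linear_map_id(1) _ y])
      fix s v assume "s \<in> carrier S" "v \<in> carrier V"
      thus "tensor_map S V r id (incl (tens S V s v)) = tens S V s v"
        using S_carrier[of s] by (simp add: incl_tens t r(2))
    qed
  qed
qed

text \<open>The two coactions, and likewise the two trivial ones, correspond under incl \<otimes>
  \<delta>. That map is injective, since a retraction together with \<tau> provides a left
  inverse.\<close>

lemma coinvariant_iff:
  assumes y: "y \<in> carrier (tensor S V)"
  shows "co_P (incl y) = tens (tensor P V) H (incl y) \<one>\<^bsub>H\<^esub> \<longleftrightarrow> co_S y = tens (tensor S V) CU1 y \<one>\<^bsub>CU1\<^esub>"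
proof -
  obtain r where r: "linear_map (tensor P V) (tensor S V) r" "\<And>y. y \<in> carrier (tensor S V) \<Longrightarrow> r (incl y) = y"
    by (rule incl_left_inverse) blast
  let ?M = "tensor_map (tensor P V) H incl \<delta>" and ?R = "tensor_map (tensor S V) CU1 r \<tau>"
  note l = tensor_map_linear[OF PV_vs H_vs SV_vs CU1_vs r(1) alg_hom_linear[OF \<tau>]]
    and t = tensor_map_tens[OF PV_vs H_vs SV_vs CU1_vs r(1) alg_hom_linear[OF \<tau>]]
  have RM: "?R (?M z) = z" if z: "z \<in> carrier (tensor (tensor S V) CU1)" for z
  proof (rule tensor_linear_eq[OF SV_vs CU1_vs SVL_vs linear_map_comp[OF incl_\<delta>_linear l] linear_map_id(1) _ z])
    fix s f assume s: "s \<in> carrier (tensor S V)" and f: "f \<in> carrier CU1"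
    show "?R (?M (tens (tensor S V) CU1 s f)) = tens (tensor S V) CU1 s f"
      unfolding incl_\<delta>_tens[OF s f] t[OF linear_map_closed[OF incl_linear s] alg_hom_closed[OF \<delta> f]] r(2)[OF s] \<tau>_\<delta> ..
  qed
  have one: "\<one>\<^bsub>CU1\<^esub> \<in> carrier CU1" by simp
  have z: "co_S y \<in> carrier (tensor (tensor S V) CU1)" "tens (tensor S V) CU1 y \<one>\<^bsub>CU1\<^esub> \<in> carrier (tensor (tensor S V) CU1)"
    by (rule linear_map_closed[OF co_S_linear y]) (rule tens_closed[OF SV_vs CU1_vs y one])
  have M1: "?M (tens (tensor S V) CU1 y \<one>\<^bsub>CU1\<^esub>) = tens (tensor P V) H (incl y) \<one>\<^bsub>H\<^esub>"
    unfolding incl_\<delta>_tens[OF y one] alg_hom_one[OF \<delta>] ..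
  have "co_P (incl y) = tens (tensor P V) H (incl y) \<one>\<^bsub>H\<^esub> \<longleftrightarrow> ?M (co_S y) = ?M (tens (tensor S V) CU1 y \<one>\<^bsub>CU1\<^esub>)"
    unfolding incl_co[OF y] M1 by (rule refl)
  also have "\<dots> \<longleftrightarrow> co_S y = tens (tensor S V) CU1 y \<one>\<^bsub>CU1\<^esub>"
    using RM[OF z(1)] RM[OF z(2)] by metis
  finally show ?thesis .
qed

text \<open>As a comodule of \<open>K\<close> the space \<open>V\<close> becomes trivial, since
  \<pi> sends the powers of the determinant to 1; weight vectors suffice.\<close>

lemma \<rho>W_\<pi>:
  assumes v: "v \<in> carrier V" shows "tensor_map V K id \<pi> (\<rho>W v) = tens V K v \<one>\<^bsub>K\<^esub>"
proof (rule comodule_linear_eq[OF com tensor_vs[OF V_vs K_vs] linear_map_comp[OF \<rho>W] tens_linear_left[OF V_vs K_vs] _ v])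
  note \<pi>l = alg_hom_linear[OF \<pi>] and \<delta>l = alg_hom_linear[OF \<delta>]
  show "linear_map (tensor V H) (tensor V K) (tensor_map V K id \<pi>)"
    by (rule tensor_map_linear[OF V_vs H_vs V_vs K_vs linear_map_id(2) \<pi>l])
  show "\<one>\<^bsub>K\<^esub> \<in> carrier K" using K_alg by simp
  fix k x assume x: "x \<in> carrier V" "\<rho>V x = tens V CU1 x (tpow k)"
  show "tensor_map V K id \<pi> (\<rho>W x) = tens V K x \<one>\<^bsub>K\<^esub>"
    using x alg_hom_closed[OF \<delta>, of "tpow k"]
    by (simp add: tensor_map_tens[OF V_vs CU1_vs V_vs H_vs linear_map_id(2) \<delta>l]
        tensor_map_tens[OF V_vs H_vs V_vs K_vs linear_map_id(2) \<pi>l] \<pi>_\<delta>)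
qed

text \<open>
  Taking coinvariants commutes with tensoring by \<open>V\<close>: a generalized inverse of \<open>defect\<close> provides
  a projection of \<open>P\<close> onto \<open>S\<close> which is the identity on coinvariant tensors.
\<close>

lemma coinvariant_in_incl:
  assumes z: "z \<in> carrier (tensor P V)" "co_P z = tens (tensor P V) H z \<one>\<^bsub>H\<^esub>"
  obtains y where "y \<in> carrier (tensor S V)" "incl y = z"
proof -
  let ?u = "\<lambda>x. tens P K x \<one>\<^bsub>K\<^esub>"
  have oneK: "\<one>\<^bsub>K\<^esub> \<in> carrier K" and oneH: "\<one>\<^bsub>H\<^esub> \<in> carrier H" using K_alg H_alg by auto
  have b: "bilinear P V (tensor (tensor P V) K) (\<lambda>p v. coaction_product K P V (\<rho>K p) (tens V K v \<one>\<^bsub>K\<^esub>))"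
    by (rule product_coaction_bilinear[OF K_alg P_vs V_vs alg_hom_linear[OF \<rho>K] tens_linear_left[OF V_vs K_vs oneK]])
  \<comment> \<open>The coaction of \<open>K\<close> on P \<otimes> V with \<open>V\<close> regarded
    as trivial.\<close>
  let ?co = "tensor_lift (tensor (tensor P V) K) (\<lambda>p v. coaction_product K P V (\<rho>K p) (tens V K v \<one>\<^bsub>K\<^esub>))"
  note col = tensor_lift_linear[OF P_vs V_vs PVK_vs b] and cot = tensor_lift_tens[OF P_vs V_vs PVK_vs b]
  note il = tensor_map_linear[OF P_vs V_vs P_vs V_vs linear_map_id(2) linear_map_id(2)]
    and it = tensor_map_tens[OF P_vs V_vs P_vs V_vs linear_map_id(2) linear_map_id(2)]
  have id: "incl w = w" if "w \<in> carrier (tensor P V)" for w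
    by (rule tensor_linear_eq[OF P_vs V_vs PV_vs il linear_map_id(1) _ that]) (simp add: it)
  let ?L = "tensor_map (tensor P V) K incl \<pi>"
  note Ll = tensor_map_linear[OF PV_vs H_vs PV_vs K_vs il alg_hom_linear[OF \<pi>]]
    and Lt = tensor_map_tens[OF PV_vs H_vs PV_vs K_vs il alg_hom_linear[OF \<pi>]]
  \<comment> \<open>Applying \<pi> to the last leg turns the coinvariance of \<open>z\<close> under
    \<open>H\<close> into coinvariance under \<open>K\<close>.\<close>
  have "?L (co_P z) = ?co z"
  proof (rule tensor_linear_eq[OF P_vs V_vs PVK_vs linear_map_comp[OF co_P_linear Ll] col _ z(1)])
    fix p v assume p: "p \<in> carrier P" and v: "v \<in> carrier V"
    show "?L (co_P (tens P V p v)) = ?co (tens P V p v)"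
      unfolding co_P_tens[OF p v] cot[OF p v]
        coaction_product_natural[OF H_alg K_alg P_vs P_vs V_vs V_vs linear_map_id(2) linear_map_id(2) \<pi>
          linear_map_closed[OF \<rho>H p] linear_map_closed[OF \<rho>W v]]
        \<rho>W_\<pi>[OF v] \<rho>K_conv[OF p] ..
  qed
  hence co_z: "?co z = tens (tensor P V) K z \<one>\<^bsub>K\<^esub>"
    by (simp add: z(2) Lt[OF z(1) oneH] id[OF z(1)] alg_hom_one[OF \<pi>])
  obtain g where g: "linear_map (tensor P K) P g" "\<And>x. x \<in> carrier P \<Longrightarrow> defect (g (defect x)) = defect x"
    using generalized_inverse[OF P_vs PK_vs defect_linear] by blast
  \<comment> \<open>Because \<open>g\<close> is a generalized inverse, \<open>defect\<close>
    vanishes on \<open>e p\<close>, which therefore lies in \<open>S\<close>.\<close>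
  define e where "e p = p \<ominus>\<^bsub>P\<^esub> g (defect p)" for p
  note gd = linear_map_comp[OF defect_linear g(1)]
  have eP: "linear_map P P e" unfolding e_def by (rule linear_map_minus_maps[OF P_vs linear_map_id(1) gd])
  have e_S: "e p \<in> carrier S" if p: "p \<in> carrier P" for p
    using linear_map_closed[OF eP p] linear_map_minus[OF P_vs PK_vs defect_linear p linear_map_closed[OF gd p]]
      g(2)[OF p] vs_minus_eq_zero_iff[OF PK_vs] linear_map_closed[OF defect_linear p]
    by (simp add: S_defect e_def)
  have e: "linear_map P S e"
    by (rule linear_mapI) (auto simp: e_S S_simps linear_map_add[OF eP] linear_map_smult[OF eP])
  have gb1: "bilinear P K (tensor P V) (\<lambda>a b. tens P V (g (tens P K a b)) v)" if v: "v \<in> carrier V" for v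
    by (rule bilinear_comp_linear[OF tens_bilinear[OF P_vs K_vs] linear_map_comp[OF g(1) tens_linear_left[OF P_vs V_vs v]]])
  have gb2: "bilinear P V (tensor P V) (\<lambda>a v. tens P V (g (tens P K a b)) v)" if b: "b \<in> carrier K" for b
    by (rule bilinear_comp[OF tens_bilinear[OF P_vs V_vs] linear_map_comp[OF tens_linear_left[OF P_vs K_vs b] g(1)] linear_map_id(1)])
  have gb3: "bilinear (tensor P V) K (tensor P V) (\<lambda>w b. tensor_lift (tensor P V) (\<lambda>a v. tens P V (g (tens P K a b)) v) w)"
  proof (rule bilinearI)
    show "linear_map (tensor P V) (tensor P V) (\<lambda>w. tensor_lift (tensor P V) (\<lambda>a v. tens P V (g (tens P K a b)) v) w)"
      if "b \<in> carrier K" for b by (rule tensor_lift_linear[OF P_vs V_vs PV_vs gb2[OF that]])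
    show "linear_map K (tensor P V) (\<lambda>b. tensor_lift (tensor P V) (\<lambda>a v. tens P V (g (tens P K a b)) v) w)"
      if w: "w \<in> carrier (tensor P V)" for w
    proof (rule tensor_lift_param_linear[OF P_vs V_vs K_vs PV_vs gb2 _ w])
      fix a v assume "a \<in> carrier P" "v \<in> carrier V"
      thus "linear_map K (tensor P V) (\<lambda>b. tens P V (g (tens P K a b)) v)" using bilinear_right[OF gb1] by blast
    qed
  qed
  \<comment> \<open>Sends (a \<otimes> v) \<otimes> b to g (a \<otimes> b) \<otimes> v, letting
    \<open>g\<close> act although \<open>v\<close> stands between its two arguments.\<close>
  let ?G = "tensor_lift (tensor P V) (\<lambda>w b. tensor_lift (tensor P V) (\<lambda>a v. tens P V (g (tens P K a b)) v) w)"
  note Gl = tensor_lift_linear[OF PV_vs K_vs PV_vs gb3]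
  have Gt: "?G (tens (tensor P V) K (tens P V a v) b) = tens P V (g (tens P K a b)) v"
    if "a \<in> carrier P" "v \<in> carrier V" "b \<in> carrier K" for a v b
    unfolding tensor_lift_tens[OF PV_vs K_vs PV_vs gb3 tens_closed[OF P_vs V_vs that(1,2)] that(3)]
    by (rule tensor_lift_tens[OF P_vs V_vs PV_vs gb2[OF that(3)] that(1,2)])
  have Gco: "?G (coaction_product K P V x (tens V K v \<one>\<^bsub>K\<^esub>)) = tens P V (g x) v"
    if x: "x \<in> carrier (tensor P K)" and v: "v \<in> carrier V" for x v
  proof (rule tensor_linear_eq[OF P_vs K_vs PV_vs linear_map_comp[OF bilinear_left[OF coaction_product_bilinear[OF K_alg P_vs V_vs]
            tens_closed[OF V_vs K_vs v oneK]] Gl] linear_map_comp[OF g(1) tens_linear_left[OF P_vs V_vs v]] _ x])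
    fix a b assume ab: "a \<in> carrier P" "b \<in> carrier K"
    show "?G (coaction_product K P V (tens P K a b) (tens V K v \<one>\<^bsub>K\<^esub>)) = tens P V (g (tens P K a b)) v"
      unfolding coaction_product_tens[OF K_alg P_vs V_vs ab v oneK] alg_r_one[OF K_alg ab(2)]
      by (rule Gt[OF ab(1) v ab(2)])
  qed
  note el = tensor_map_linear[OF P_vs V_vs S_vs V_vs e linear_map_id(2)]
    and et = tensor_map_tens[OF P_vs V_vs S_vs V_vs e linear_map_id(2)]
  \<comment> \<open>On pure tensors this is the definition of \<open>e\<close>. For the given
    \<open>z\<close> the bracket vanishes by its coinvariance under \<open>K\<close>.\<close>
  have "incl (tensor_map S V e id z) = z \<ominus>\<^bsub>tensor P V\<^esub> (?G (?co z) \<ominus>\<^bsub>tensor P V\<^esub> ?G (tens (tensor P V) K z \<one>\<^bsub>K\<^esub>))"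
  proof (rule tensor_linear_eq[OF P_vs V_vs PV_vs linear_map_comp[OF el incl_linear]
        linear_map_minus_maps[OF PV_vs linear_map_id(1) linear_map_minus_maps[OF PV_vs linear_map_comp[OF col Gl]
          linear_map_comp[OF tens_linear_left[OF PV_vs K_vs oneK] Gl]]] _ z(1)])
    fix p v assume p: "p \<in> carrier P" and v: "v \<in> carrier V"
    note lv = tens_linear_left[OF P_vs V_vs v]
    have c: "\<rho>K p \<in> carrier (tensor P K)" "?u p \<in> carrier (tensor P K)"
      by (rule alg_hom_closed[OF \<rho>K p]) (rule linear_map_closed[OF unit_linear p])
    have "incl (tensor_map S V e id (tens P V p v)) = tens P V (p \<ominus>\<^bsub>P\<^esub> (g (\<rho>K p) \<ominus>\<^bsub>P\<^esub> g (?u p))) v"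
      using p v e_S[OF p] linear_map_minus[OF PK_vs P_vs g(1) c]
      by (simp add: et incl_tens) (simp add: e_def defect_def)
    also have "\<dots> = tens P V p v \<ominus>\<^bsub>tensor P V\<^esub> (tens P V (g (\<rho>K p)) v \<ominus>\<^bsub>tensor P V\<^esub> tens P V (g (?u p)) v)"
      using p linear_map_closed[OF g(1) c(1)] linear_map_closed[OF g(1) c(2)] vs_minus_closed[OF P_vs]
      by (simp add: linear_map_minus[OF P_vs PV_vs lv])
    finally show "incl (tensor_map S V e id (tens P V p v)) = tens P V p v \<ominus>\<^bsub>tensor P V\<^esub>
        (?G (?co (tens P V p v)) \<ominus>\<^bsub>tensor P V\<^esub> ?G (tens (tensor P V) K (tens P V p v) \<one>\<^bsub>K\<^esub>))"
      unfolding cot[OF p v] Gco[OF c(1) v] Gt[OF p v oneK] .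
  qed
  also have "\<dots> = z"
  proof -
    have G: "?G (tens (tensor P V) K z \<one>\<^bsub>K\<^esub>) \<in> carrier (tensor P V)"
      by (rule linear_map_closed[OF Gl tens_closed[OF PV_vs K_vs z(1) oneK]])
    show ?thesis unfolding co_z
      using vs_minus_eq_zero_iff[OF PV_vs G G] vs_minus_eq[OF PV_vs z(1) vs_zero_closed[OF PV_vs]] z(1) PV_vs by simp
  qed
  finally show thesis by (rule that[OF linear_map_closed[OF el z(1)]])
qed

text \<open>\<open>S\<close> is closed under products, so left multiplication by \<open>m\<close>
  restricts to it and commutes with the inclusion.\<close>

lemma incl_action:
  assumes m: "m \<in> carrier S" and y: "y \<in> carrier (tensor S V)"
  shows "incl (tensor_lift (tensor S V) (\<lambda>s v. tens S V (m \<otimes>\<^bsub>S\<^esub> s) v) y) =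
    tensor_lift (tensor P V) (\<lambda>p v. tens P V (m \<otimes>\<^bsub>P\<^esub> p) v) (incl y)"
proof -
  have mP: "m \<in> carrier P" using m by (simp add: S_carrier)
  have SP: "x \<in> carrier S \<Longrightarrow> x \<in> carrier P" for x by (simp add: S_carrier)
  note ml = alg_mult_right_linear[OF P_alg mP]
  have mS: "linear_map S S (\<lambda>s. m \<otimes>\<^bsub>S\<^esub> s)"
    by (rule linear_mapI) (auto simp: S_simps S_mult_closed m SP linear_map_add[OF ml] linear_map_smult[OF ml])
  note bS = bilinear_comp[OF tens_bilinear[OF S_vs V_vs] mS linear_map_id(1)]
    and bP = bilinear_comp[OF tens_bilinear[OF P_vs V_vs] ml linear_map_id(1)]
  note S = tensor_lift_linear[OF S_vs V_vs SV_vs bS] tensor_lift_tens[OF S_vs V_vs SV_vs bS]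
    and P = tensor_lift_linear[OF P_vs V_vs PV_vs bP] tensor_lift_tens[OF P_vs V_vs PV_vs bP]
  show ?thesis
  proof (rule tensor_linear_eq[OF S_vs V_vs PV_vs linear_map_comp[OF S(1) incl_linear] linear_map_comp[OF incl_linear P(1)] _ y])
    fix s v assume s: "s \<in> carrier S" and v: "v \<in> carrier V"
    show "incl (tensor_lift (tensor S V) (\<lambda>s v. tens S V (m \<otimes>\<^bsub>S\<^esub> s) v) (tens S V s v)) =
        tensor_lift (tensor P V) (\<lambda>p v. tens P V (m \<otimes>\<^bsub>P\<^esub> p) v) (incl (tens S V s v))"
      unfolding S(2)[OF s v] incl_tens[OF s v] incl_tens[OF linear_map_closed[OF mS s] v] id_apply P(2)[OF SP[OF s] v]
      by (simp add: S_simps)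
  qed
qed

text \<open>The isomorphism is the map induced by the inclusion: split, hence injective; matching
  coinvariants by \<open>coinvariant_iff\<close>; and onto by
  \<open>coinvariant_in_incl\<close>.\<close>

theorem bundle_iso:
  "left_module_iso (subspace P (coinvariants H P \<rho>H)) (associated_bundle CU1 S S_coaction V \<rho>V) (associated_bundle H P \<rho>H V \<rho>W)"
  unfolding left_module_iso_def
proof (intro exI[of _ incl] conjI ballI)
  have inj: "inj_on incl (carrier (tensor S V))"
  proof -
    obtain r where "\<And>y. y \<in> carrier (tensor S V) \<Longrightarrow> r (incl y) = y" by (rule incl_left_inverse) blast
    thus ?thesis by (rule inj_on_inverseI)
  qed
  let ?E = "coinvariants CU1 (tensor S V) co_S" and ?F = "coinvariants H (tensor P V) co_P"
  have E: "y \<in> ?E \<longleftrightarrow> incl y \<in> ?F" if "y \<in> carrier (tensor S V)" for y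
    using that coinvariant_iff[OF that] linear_map_closed[OF incl_linear that] by (simp add: coinvariants_def)
  have sub: "?E \<subseteq> carrier (tensor S V)" by (auto simp: coinvariants_def)
  have "incl ` ?E = ?F"
  proof
    show "incl ` ?E \<subseteq> ?F" using E sub by blast
    show "?F \<subseteq> incl ` ?E"
    proof
      fix z assume z: "z \<in> ?F"
      hence "z \<in> carrier (tensor P V)" "co_P z = tens (tensor P V) H z \<one>\<^bsub>H\<^esub>" by (auto simp: coinvariants_def)
      then obtain y where "y \<in> carrier (tensor S V)" "incl y = z" by (rule coinvariant_in_incl)
      thus "z \<in> incl ` ?E" using E z by blast
    qed
  qed
  thus "bij_betw incl (carrier (associated_bundle CU1 S S_coaction V \<rho>V)) (carrier (associated_bundle H P \<rho>H V \<rho>W))"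
    using inj_on_subset[OF inj sub] by (simp add: bij_betw_def associated_bundle_def Let_def)
  fix x assume "x \<in> carrier (associated_bundle CU1 S S_coaction V \<rho>V)"
  hence x: "x \<in> carrier (tensor S V)" using sub by (auto simp: associated_bundle_def Let_def)
  show "incl (x \<oplus>\<^bsub>associated_bundle CU1 S S_coaction V \<rho>V\<^esub> y) = incl x \<oplus>\<^bsub>associated_bundle H P \<rho>H V \<rho>W\<^esub> incl y"
    if "y \<in> carrier (associated_bundle CU1 S S_coaction V \<rho>V)" for y
    using linear_map_add[OF incl_linear x, of y] that sub by (auto simp: associated_bundle_def Let_def)
  fix m assume "m \<in> carrier (subspace P (coinvariants H P \<rho>H))"
  hence "m \<in> carrier S" by (intro base_subset) (simp add: subspace_def)
  from incl_action[OF this x]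
  show "incl (m \<odot>\<^bsub>associated_bundle CU1 S S_coaction V \<rho>V\<^esub> x) = m \<odot>\<^bsub>associated_bundle H P \<rho>H V \<rho>W\<^esub> incl x"
    by (simp add: associated_bundle_def Let_def)
qed

end

end

lemma sphere_reduction:
  assumes q: "q > 0" and n: "n \<ge> 1"
  shows "circle_reduction (SU_algebra q (Suc n)) (CqU q n) (CqSU q n)
    (coaction_via q (Suc n) (CqU q n) (alpha q (Suc n))) (coaction_via q (Suc n) (CqSU q n) (beta q (Suc n)))
    (coaction_via q (Suc n) CU1 (gamma q (Suc n))) (det_map q n) (pi_map q n) (torus_map q n)"
proof
  let ?P = "SU_algebra q (Suc n)"
  note A = SU_algebra_alg[of q "Suc n"] and H = CqU_alg[of q n] and K = CqSU_alg[of q n]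
  note V = complex_alg_vs[OF A] complex_alg_vs[OF H] complex_alg_vs[OF K]
  note ah = alpha_hom(1)[OF q n] and ph = pi_hom(1)[OF q n] and th = torus_hom(1)[OF q n]
  note al = alg_hom_linear[OF ah] and pl = alg_hom_linear[OF ph] and dl = det_map_linear
  show "complex_alg ?P" "complex_alg (CqU q n)" "complex_alg (CqSU q n)" by (rule A H K)+
  show "linear_map ?P (tensor ?P (CqU q n)) (coaction_via q (Suc n) (CqU q n) (alpha q (Suc n)))"
    by (rule alg_hom_linear[OF coaction_via_hom[OF q n H ah]])
  show "alg_hom ?P (tensor ?P (CqSU q n)) (coaction_via q (Suc n) (CqSU q n) (beta q (Suc n)))"
    by (rule coaction_via_hom[OF q n K beta_hom[OF q n]])
  show "linear_map ?P (tensor ?P CU1) (coaction_via q (Suc n) CU1 (gamma q (Suc n)))"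
    by (rule alg_hom_linear[OF coaction_via_hom[OF q n CU1_alg gamma_hom[OF q n]]])
  show "alg_hom CU1 (CqU q n) (det_map q n)" by (rule det_map_hom)
  show "alg_hom (CqU q n) (CqSU q n) (pi_map q n)" "alg_hom (CqU q n) CU1 (torus_map q n)" by (rule ph th)+
  show "torus_map q n (det_map q n f) = f" for f
  proof (rule free_space_linear_eq[OF CU1_free CU1_vs linear_map_comp[OF dl alg_hom_linear[OF th]] linear_map_id(1)])
    show "torus_map q n (det_map q n (Poly_Mapping.single k 1)) = Poly_Mapping.single k 1" for k
      unfolding tpow_def[symmetric] by (simp add: det_map_tpow torus_det_pow[OF q n])
  qed simp
  show "pi_map q n (det_map q n (tpow k)) = \<one>\<^bsub>CqSU q n\<^esub>" for k
    by (simp add: det_map_tpow pi_det_pow[OF q n])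
  fix x assume x: "x \<in> carrier ?P"
  note c = comult_SU_hom(1)[OF q, of "Suc n"]
  \<comment> \<open>\<beta> is \<open>pi_map\<close> after \<alpha>, applied in the second
    leg.\<close>
  have comp: "tensor_map ?P (CqSU q n) id (beta q (Suc n)) w = tensor_map ?P (CqSU q n) id (pi_map q n) (tensor_map ?P (CqU q n) id (alpha q (Suc n)) w)"
    if w: "w \<in> carrier (tensor ?P ?P)" for w
  proof (rule tensor_linear_eq[OF V(1) V(1) tensor_vs[OF V(1,3)]
        tensor_map_linear[OF V(1) V(1) V(1) V(3) linear_map_id(2) alg_hom_linear[OF beta_hom[OF q n]]]
        linear_map_comp[OF tensor_map_linear[OF V(1) V(1) V(1) V(2) linear_map_id(2) al]
          tensor_map_linear[OF V(1) V(2) V(1) V(3) linear_map_id(2) pl]] _ w])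
    fix a b assume ab: "a \<in> carrier ?P" "b \<in> carrier ?P"
    show "tensor_map ?P (CqSU q n) id (beta q (Suc n)) (tens ?P ?P a b) =
        tensor_map ?P (CqSU q n) id (pi_map q n) (tensor_map ?P (CqU q n) id (alpha q (Suc n)) (tens ?P ?P a b))"
      using ab alg_hom_closed[OF ah ab(2)]
      by (simp add: tensor_map_tens[OF V(1) V(1) V(1) V(3) linear_map_id(2) alg_hom_linear[OF beta_hom[OF q n]]]
          tensor_map_tens[OF V(1) V(1) V(1) V(2) linear_map_id(2) al] tensor_map_tens[OF V(1) V(2) V(1) V(3) linear_map_id(2) pl]
          beta_conv[OF q n])
  qed
  show "coaction_via q (Suc n) (CqSU q n) (beta q (Suc n)) x =
      tensor_map ?P (CqSU q n) id (pi_map q n) (coaction_via q (Suc n) (CqU q n) (alpha q (Suc n)) x)"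
    unfolding coaction_via_def by (rule comp[OF alg_hom_closed[OF c x]]) simp
  assume s: "coaction_via q (Suc n) (CqSU q n) (beta q (Suc n)) x = tens ?P (CqSU q n) x \<one>\<^bsub>CqSU q n\<^esub>"
  show "coaction_via q (Suc n) (CqU q n) (alpha q (Suc n)) x = tensor_map ?P (CqU q n) id (det_map q n) (coaction_via q (Suc n) CU1 (gamma q (Suc n)) x)"
    by (rule alpha_coaction_sphere[OF q n x s])
  show "coaction_via q (Suc n) (CqSU q n) (beta q (Suc n)) (coord ?P k (coaction_via q (Suc n) CU1 (gamma q (Suc n)) x)) =
      tens ?P (CqSU q n) (coord ?P k (coaction_via q (Suc n) CU1 (gamma q (Suc n)) x)) \<one>\<^bsub>CqSU q n\<^esub>" for k
    by (rule sphere_components[OF q n x s])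
qed

theorem proposition8p3:
  fixes N :: nat and q :: real
    and V :: "(complex, 'v) module" and \<rho>V :: "'v \<Rightarrow> ('v, laurent) tensor"
  assumes "N \<ge> 2" and "0 < q" and "q \<le> 1"
    and "right_comodule CU1 V \<rho>V"
  shows "\<exists>(W :: (complex, 'v) module) (\<rho>W :: 'v \<Rightarrow> ('v, qgen free set) tensor).
    right_comodule (CqU q (N - 1)) W \<rho>W \<and>
    left_module_iso (CqCP q N)
      (associated_bundle CU1 (CqS q N) (sphere_coaction q N) V \<rho>V)
      (associated_bundle (CqU q (N - 1)) (SU_algebra q N)
         (coaction_via q N (CqU q (N - 1)) (alpha q N)) W \<rho>W)"
proof -
  \<comment> \<open>Writing \<open>N\<close> as \<open>Suc n\<close> removes the truncated
    subtraction, and N \<ge> 2 becomes n \<ge> 1.\<close>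
  define n where "n = N - 1"
  have N: "N = Suc n" and n: "n \<ge> 1" using assms(1) by (simp_all add: n_def)
  interpret circle_reduction "SU_algebra q (Suc n)" "CqU q n" "CqSU q n"
    "coaction_via q (Suc n) (CqU q n) (alpha q (Suc n))" "coaction_via q (Suc n) (CqSU q n) (beta q (Suc n))"
    "coaction_via q (Suc n) CU1 (gamma q (Suc n))" "det_map q n" "pi_map q n" "torus_map q n"
    by (rule sphere_reduction[OF assms(2) n])
  have S: "CqS q N = S" "sphere_coaction q N = S_coaction"
    by (auto simp: N CqS_def S_def sphere_coaction_def S_coaction_def)
  have B: "CqCP q N = subspace (SU_algebra q (Suc n))
      (coinvariants (CqU q n) (SU_algebra q (Suc n)) (coaction_via q (Suc n) (CqU q n) (alpha q (Suc n))))"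
    by (simp add: N CqCP_def)
  show ?thesis
    unfolding S B
    \<comment> \<open>The witness \<open>W\<close> is the space \<open>V\<close> itself, with its
      coaction pushed forward along \<open>det_map\<close>.\<close>
    using det_comodule[OF assms(2) n assms(4)] bundle_iso[OF assms(4)] by (auto simp: N)
qed

end
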